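(* Let $A$ be a commutative Noetherian ring whose underlying abelian group is torsion-free, and let $I_2=(2,\ a^2-a\text{ for all }a\in A)\subseteq A$. Then we have isomorphisms of $A$-modules \[ H^s_{fl}(\mathcal{M}^{2\text{-}buds}_{fmA}; \mathcal{O}) \cong \begin{cases} A & \text{if } s=0 \\ 0 & \text{if } s\neq 0, \end{cases} \qquad H^s_{fl}(\mathcal{M}^{2\text{-}buds}_{fmA}; \omega) \cong \begin{cases} A/I_2 & \text{if } s=1 \\ 0 & \text{if } s\neq 1, \end{cases} \] \[ H^s_{fl}(\mathcal{M}^{2\text{-}buds}_{fmA}; \omega^{\otimes 2}) \cong \begin{cases} \delta(I_2) & \text{if } s=0 \\ A/I_2^2 & \text{if } s=1 \\ A/I_2 & \text{if } s=2 \\ 0 & \text{otherwise}, \end{cases} \] where $\delta(I_2)$ is the delta-invariant of the ideal $I_2$ of $A$, i.e., $\delta(I_2)$ is isomorphic to the André–Quillen homology group $H_2(A, A/I_2; A/I_2)$, and $A/I_2^2$ is the quotient of $A$ by the square of the ideal $I_2$.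
   Context: The delta-invariant $\delta(I)$ of a finitely generated ideal $I$ of $A$ is the kernel of the multiplication map $\mathrm{Sym}^2_A(I)\to I^2$; it is known to agree with the André–Quillen homology group $H_2(A,A/I;A/I)$ of the $A$-algebra $A/I$ with coefficients in $A/I$. Formal $A$-module 2-buds: for a commutative ring $A$ and commutative $A$-algebra $R$, a formal $A$-module $2$-bud over $R$ is an element $F\in R[[X,Y]]/(X,Y)^3$ satisfying the commutative formal group law axioms modulo $(X,Y)^3$, with a ring homomorphism $\rho:A\to\mathrm{End}(F)\subseteq R[[X]]/(X^3)$ (addition $F(f,g)$, multiplication composition) with $\rho(a)\equiv aX \bmod X^2$. Strict isomorphisms are isomorphisms $f\equiv X \bmod X^2$. The groupoid of these is corepresented by the graded Hopf algebroid $(L^A_{2\text{-}buds},L^A_{2\text{-}buds}B)$ described as follows. Let $\mathrm{Dr}^A$ be the $A$-module generated by symbols $\gamma$ and $c_a$ ($a\in A$), in degree $2$, subject to $(a^2-a)\gamma=2c_a$, $c_{a+b}-c_a-c_b=ab\gamma$, $ac_b+b^2c_a=c_{ab}$ for all $a,b\in A$. Then $L^A_{2\text{-}buds}=\mathrm{Sym}_A(\mathrm{Dr}^A)$, $L^A_{2\text{-}buds}B=L^A_{2\text{-}buds}[t]$ with $|t|=2$, $\eta_L(x)=x$, $\eta_R(\gamma)=\gamma+2t$, $\eta_R(c_a)=c_a+(a^2-a)t$, $\Delta(t)=t\otimes1+1\otimes t$, $\epsilon(t)=0$. $\mathcal{M}_{fmA}^{2\text{-}buds}$ is the Artin stack obtained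 by stackifying the groupoid scheme $(\mathrm{Spec}\,L^A_{2\text{-}buds},\mathrm{Spec}\,L^A_{2\text{-}buds}B)$, $\omega$ is its line bundle of invariant differentials (corresponding to the graded comodule $\Sigma^2L^A_{2\text{-}buds}$), $\mathcal{O}=\omega^{\otimes 0}$ is the structure sheaf, and its flat cohomology is $H^s_{fl}(\mathcal{M}_{fmA}^{2\text{-}buds};\omega^{\otimes n})=\mathrm{Cotor}^{s,2n}_{L^A_{2\text{-}buds}B}(L^A_{2\text{-}buds},L^A_{2\text{-}buds})$, the cohomology of the cobar complex in cohomological degree $s$ and internal degree $2n$. *)

theory Defs
  imports
    "HOL-Algebra.UnivPoly"
    "HOL-Algebra.QuotRing"
    "HOL-Algebra.Ideal_Product"
    "HOL-Algebra.Ring_Divisibility"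
    "HOL-Library.Multiset"
begin

section \<open>Modules and algebras by generators and relations\<close>

definition torsion_free_ring :: "('a, 'm) ring_scheme \<Rightarrow> bool" where
  "torsion_free_ring A \<longleftrightarrow>
     (\<forall>x \<in> carrier A. \<forall>n::nat. n > 0 \<longrightarrow> add_pow A n x = \<zero>\<^bsub>A\<^esub> \<longrightarrow> x = \<zero>\<^bsub>A\<^esub>)"

definition algebra_via :: "('a \<Rightarrow> 'b) \<Rightarrow> ('b, 'n) ring_scheme \<Rightarrow> ('a, 'b) module" where
  "algebra_via \<phi> S =
     \<lparr>carrier = carrier S, monoid.mult = monoid.mult S, one = one S, zero = zero S, add = add S,
      smult = (\<lambda>a x. \<phi> a \<otimes>\<^bsub>S\<^esub> x)\<rparr>"

abbreviation regular_module :: "('a, 'm) ring_scheme \<Rightarrow> ('a, 'a) module" where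
  "regular_module A \<equiv> algebra_via (\<lambda>a. a) A"

text \<open>The library type of modules extends the type of rings. Where a module carries no
  multiplication (free modules, quotients of modules, cohomology), the fields \<open>mult\<close> and
  \<open>one\<close> are meaningless and never used.\<close>

definition free_module :: "('a, 'm) ring_scheme \<Rightarrow> 's set \<Rightarrow> ('a, 's \<Rightarrow> 'a) module" where
  "free_module A S =
     \<lparr>carrier = {p. range p \<subseteq> carrier A \<and> {x. p x \<noteq> \<zero>\<^bsub>A\<^esub>} \<subseteq> S \<and> finite {x. p x \<noteq> \<zero>\<^bsub>A\<^esub>}},
      monoid.mult = undefined, one = undefined,
      zero = (\<lambda>_. \<zero>\<^bsub>A\<^esub>), add = (\<lambda>p q x. p x \<oplus>\<^bsub>A\<^esub> q x),
      smult = (\<lambda>a p x. a \<otimes>\<^bsub>A\<^esub> p x)\<rparr>"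

definition basis :: "('a, 'm) ring_scheme \<Rightarrow> 's \<Rightarrow> 's \<Rightarrow> 'a" where
  "basis A x = (\<lambda>y. if y = x then \<one>\<^bsub>A\<^esub> else \<zero>\<^bsub>A\<^esub>)"

definition monoid_algebra ::
    "('a, 'm) ring_scheme \<Rightarrow> ('s, 'k) monoid_scheme \<Rightarrow> ('a, 's \<Rightarrow> 'a) module" where
  "monoid_algebra A G = (free_module A (carrier G))
     \<lparr>monoid.mult := (\<lambda>p q z. finsum A (\<lambda>(x, y). p x \<otimes>\<^bsub>A\<^esub> q y)
                {(x, y). p x \<noteq> \<zero>\<^bsub>A\<^esub> \<and> q y \<noteq> \<zero>\<^bsub>A\<^esub> \<and> x \<otimes>\<^bsub>G\<^esub> y = z}),
      one := basis A \<one>\<^bsub>G\<^esub>\<rparr>"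

definition span ::
    "('a, 'm) ring_scheme \<Rightarrow> ('a, 'b, 'n) module_scheme \<Rightarrow> 'b set \<Rightarrow> 'b set" where
  "span A M X = \<Inter>{N. submodule N A M \<and> X \<subseteq> N}"

text \<open>For \<open>N\<close> an ideal of an algebra this is the quotient algebra, for \<open>N\<close> a submodule
  the quotient module.\<close>

definition quotient_module :: "('a, 'b, 'n) module_scheme \<Rightarrow> 'b set \<Rightarrow> ('a, 'b set) module" where
  "quotient_module M N = ring.extend (M Quot N)
     (module.fields (\<lambda>a X. \<Union>x\<in>X. N +>\<^bsub>M\<^esub> (a \<odot>\<^bsub>M\<^esub> x)))"

text \<open>The \<open>A\<close>-linear map out of a quotient of a free module that sends the class of each basis
  element \<open>x\<close> to \<open>f x\<close>; meaningful when \<open>f\<close> respects the relations.\<close>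

definition linear_lift ::
    "('a, 'm) ring_scheme \<Rightarrow> ('a, 'b, 'n) module_scheme \<Rightarrow> ('s \<Rightarrow> 'b) \<Rightarrow> ('s \<Rightarrow> 'a) set \<Rightarrow> 'b" where
  "linear_lift A N f X =
     the_elem ((\<lambda>p. \<Oplus>\<^bsub>N\<^esub>x \<in> {x. p x \<noteq> \<zero>\<^bsub>A\<^esub>}. p x \<odot>\<^bsub>N\<^esub> f x) ` X)"

definition module_iso ::
    "('a, 'm) ring_scheme \<Rightarrow> ('a, 'b, 'n) module_scheme \<Rightarrow> ('a, 'c, 'k) module_scheme \<Rightarrow> bool" where
  "module_iso A M N \<longleftrightarrow> module A M \<and> module A N \<and>
     (\<exists>f. bij_betw f (carrier M) (carrier N) \<and>
          (\<forall>x \<in> carrier M. \<forall>y \<in> carrier M. f (x \<oplus>\<^bsub>M\<^esub> y) = f x \<oplus>\<^bsub>N\<^esub> f y) \<and>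
          (\<forall>a \<in> carrier A. \<forall>x \<in> carrier M. f (a \<odot>\<^bsub>M\<^esub> x) = a \<odot>\<^bsub>N\<^esub> f x))"

definition zero_module :: "('a, 'm) ring_scheme \<Rightarrow> ('a, 'b, 'n) module_scheme \<Rightarrow> bool" where
  "zero_module A M \<longleftrightarrow> module A M \<and> carrier M = {\<zero>\<^bsub>M\<^esub>}"


section \<open>Symmetric algebras and the delta-invariant\<close>

definition free_comm_monoid :: "'s set \<Rightarrow> 's multiset monoid" where
  "free_comm_monoid S = \<lparr>carrier = {u. set_mset u \<subseteq> S}, monoid.mult = (+), one = {#}\<rparr>"

text \<open>\<open>Sym\<^sub>A(M)\<close> is the polynomial algebra on variables \<open>x\<^sub>m\<close>, \<open>m \<in> M\<close>, modulo the linear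
  relations that make \<open>m \<mapsto> x\<^sub>m\<close> an \<open>A\<close>-linear map.\<close>

abbreviation poly_algebra ::
    "('a, 'm) ring_scheme \<Rightarrow> ('a, 'b, 'n) module_scheme \<Rightarrow> ('a, 'b multiset \<Rightarrow> 'a) module" where
  "poly_algebra A M \<equiv> monoid_algebra A (free_comm_monoid (carrier M))"

definition sym_ideal ::
    "('a, 'm) ring_scheme \<Rightarrow> ('a, 'b, 'n) module_scheme \<Rightarrow> ('b multiset \<Rightarrow> 'a) set" where
  "sym_ideal A M =
    (let P = poly_algebra A M; v = (\<lambda>m. basis A {#m#}) in
     Idl\<^bsub>P\<^esub> ({v (x \<oplus>\<^bsub>M\<^esub> y) \<ominus>\<^bsub>P\<^esub> (v x \<oplus>\<^bsub>P\<^esub> v y) | x y. x \<in> carrier M \<and> y \<in> carrier M}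
         \<union> {v (a \<odot>\<^bsub>M\<^esub> x) \<ominus>\<^bsub>P\<^esub> a \<odot>\<^bsub>P\<^esub> v x | a x. a \<in> carrier A \<and> x \<in> carrier M}))"

definition sym_algebra ::
    "('a, 'm) ring_scheme \<Rightarrow> ('a, 'b, 'n) module_scheme \<Rightarrow> ('a, ('b multiset \<Rightarrow> 'a) set) module" where
  "sym_algebra A M = quotient_module (poly_algebra A M) (sym_ideal A M)"

definition sym_incl ::
    "('a, 'm) ring_scheme \<Rightarrow> ('a, 'b, 'n) module_scheme \<Rightarrow> 'b \<Rightarrow> ('b multiset \<Rightarrow> 'a) set" where
  "sym_incl A M x = sym_ideal A M +>\<^bsub>poly_algebra A M\<^esub> basis A {#x#}"

definition sym_power ::
    "('a, 'm) ring_scheme \<Rightarrow> ('a, 'b, 'n) module_scheme \<Rightarrow> nat \<Rightarrow> ('b multiset \<Rightarrow> 'a) set set" where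
  "sym_power A M k =
     {sym_ideal A M +>\<^bsub>poly_algebra A M\<^esub> p | p.
        p \<in> carrier (poly_algebra A M) \<and> (\<forall>u. p u \<noteq> \<zero>\<^bsub>A\<^esub> \<longrightarrow> size u = k)}"

text \<open>The \<open>A\<close>-algebra map \<open>Sym\<^sub>A(M) \<rightarrow> S\<close> extending an \<open>A\<close>-linear map \<open>g : M \<rightarrow> S\<close>.\<close>

definition sym_lift ::
    "('a, 'm) ring_scheme \<Rightarrow> ('a, 'c, 'k) module_scheme \<Rightarrow> ('b \<Rightarrow> 'c) \<Rightarrow> ('b multiset \<Rightarrow> 'a) set \<Rightarrow> 'c" where
  "sym_lift A S g =
     linear_lift A S (\<lambda>u. \<Otimes>\<^bsub>S\<^esub>x \<in> set_mset u. g x [^]\<^bsub>S\<^esub> count u x)"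

text \<open>The kernel of the multiplication map \<open>Sym\<^sup>2\<^sub>A(I) \<rightarrow> I\<^sup>2 \<subseteq> A\<close>, as an \<open>A\<close>-module.\<close>

definition delta_invariant ::
    "('a, 'm) ring_scheme \<Rightarrow> 'a set \<Rightarrow> ('a, ('a multiset \<Rightarrow> 'a) set) module" where
  "delta_invariant A I =
    (let M = (regular_module A)\<lparr>carrier := I\<rparr> in
     (sym_algebra A M)\<lparr>carrier :=
        {X \<in> sym_power A M 2. sym_lift A (regular_module A) (\<lambda>x. x) X = \<zero>\<^bsub>A\<^esub>}\<rparr>)"

definition I2 :: "('a, 'm) ring_scheme \<Rightarrow> 'a set" where
  "I2 A = Idl\<^bsub>A\<^esub> (insert (\<one>\<^bsub>A\<^esub> \<oplus>\<^bsub>A\<^esub> \<one>\<^bsub>A\<^esub>) {a \<otimes>\<^bsub>A\<^esub> a \<ominus>\<^bsub>A\<^esub> a | a. a \<in> carrier A})"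


section \<open>The Hopf algebroid of formal module 2-buds\<close>

datatype 'a dr_gen = Gam | Cgen 'a

definition dr_free :: "('a, 'm) ring_scheme \<Rightarrow> ('a, 'a dr_gen \<Rightarrow> 'a) module" where
  "dr_free A = free_module A (insert Gam (Cgen ` carrier A))"

definition dr_relations :: "('a, 'm) ring_scheme \<Rightarrow> ('a dr_gen \<Rightarrow> 'a) set" where
  "dr_relations A =
    (let F = dr_free A; \<gamma> = basis A Gam; c = (\<lambda>a. basis A (Cgen a)) in
      {(a \<otimes>\<^bsub>A\<^esub> a \<ominus>\<^bsub>A\<^esub> a) \<odot>\<^bsub>F\<^esub> \<gamma> \<ominus>\<^bsub>F\<^esub> (c a \<oplus>\<^bsub>F\<^esub> c a) | a. a \<in> carrier A}
    \<union> {(c (a \<oplus>\<^bsub>A\<^esub> b) \<ominus>\<^bsub>F\<^esub> c a \<ominus>\<^bsub>F\<^esub> c b) \<ominus>\<^bsub>F\<^esub> (a \<otimes>\<^bsub>A\<^esub> b) \<odot>\<^bsub>F\<^esub> \<gamma> | a b.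
         a \<in> carrier A \<and> b \<in> carrier A}
    \<union> {(a \<odot>\<^bsub>F\<^esub> c b \<oplus>\<^bsub>F\<^esub> (b \<otimes>\<^bsub>A\<^esub> b) \<odot>\<^bsub>F\<^esub> c a) \<ominus>\<^bsub>F\<^esub> c (a \<otimes>\<^bsub>A\<^esub> b) | a b.
         a \<in> carrier A \<and> b \<in> carrier A})"

type_synonym 'a dr = "('a dr_gen \<Rightarrow> 'a) set"

definition Dr :: "('a, 'm) ring_scheme \<Rightarrow> ('a, 'a dr) module" where
  "Dr A = quotient_module (dr_free A) (span A (dr_free A) (dr_relations A))"

definition dr_class :: "('a, 'm) ring_scheme \<Rightarrow> 'a dr_gen \<Rightarrow> 'a dr" where
  "dr_class A x = span A (dr_free A) (dr_relations A) +>\<^bsub>dr_free A\<^esub> basis A x"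

type_synonym 'a bud = "('a dr multiset \<Rightarrow> 'a) set"

definition LA :: "('a, 'm) ring_scheme \<Rightarrow> ('a, 'a bud) module" where
  "LA A = sym_algebra A (Dr A)"

text \<open>\<open>LA A\<close> is the ring \<open>L\<close>, and \<open>LB A\<close> the polynomial ring \<open>L[t]\<close>, regarded as an \<open>A\<close>-algebra.\<close>

definition eta_L :: "('a, 'm) ring_scheme \<Rightarrow> 'a bud \<Rightarrow> nat \<Rightarrow> 'a bud" where
  "eta_L A x = up_ring.monom (UP (LA A)) x 0"

definition LB :: "('a, 'm) ring_scheme \<Rightarrow> ('a, nat \<Rightarrow> 'a bud) module" where
  "LB A = algebra_via (\<lambda>a. eta_L A (a \<odot>\<^bsub>LA A\<^esub> \<one>\<^bsub>LA A\<^esub>)) (UP (LA A))"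

definition LB_t :: "('a, 'm) ring_scheme \<Rightarrow> nat \<Rightarrow> 'a bud" where
  "LB_t A = up_ring.monom (UP (LA A)) \<one>\<^bsub>LA A\<^esub> 1"

text \<open>The \<open>A\<close>-algebra map with \<open>\<eta>\<^sub>R(\<gamma>) = \<gamma> + 2t\<close> and \<open>\<eta>\<^sub>R(c\<^sub>a) = c\<^sub>a + (a\<^sup>2 - a)t\<close>.\<close>

definition eta_R_gen :: "('a, 'm) ring_scheme \<Rightarrow> 'a dr_gen \<Rightarrow> nat \<Rightarrow> 'a bud" where
  "eta_R_gen A x = eta_L A (sym_incl A (Dr A) (dr_class A x)) \<oplus>\<^bsub>LB A\<^esub>
     (case x of Gam \<Rightarrow> LB_t A \<oplus>\<^bsub>LB A\<^esub> LB_t A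
              | Cgen a \<Rightarrow> (a \<otimes>\<^bsub>A\<^esub> a \<ominus>\<^bsub>A\<^esub> a) \<odot>\<^bsub>LB A\<^esub> LB_t A)"

definition eta_R :: "('a, 'm) ring_scheme \<Rightarrow> 'a bud \<Rightarrow> nat \<Rightarrow> 'a bud" where
  "eta_R A = sym_lift A (LB A) (linear_lift A (LB A) (eta_R_gen A))"

text \<open>Internal degrees, with \<open>\<gamma>\<close>, \<open>c\<^sub>a\<close> and \<open>t\<close> all in degree 2.\<close>

definition L_deg :: "('a, 'm) ring_scheme \<Rightarrow> nat \<Rightarrow> 'a bud set" where
  "L_deg A d = (if even d then sym_power A (Dr A) (d div 2) else {\<zero>\<^bsub>LA A\<^esub>})"

definition LB_deg :: "('a, 'm) ring_scheme \<Rightarrow> nat \<Rightarrow> (nat \<Rightarrow> 'a bud) set" where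
  "LB_deg A d = {p \<in> carrier (LB A). \<forall>j. up_ring.coeff (UP (LA A)) p j \<noteq> \<zero>\<^bsub>LA A\<^esub> \<longrightarrow>
     2 * j \<le> d \<and> up_ring.coeff (UP (LA A)) p j \<in> L_deg A (d - 2 * j)}"


section \<open>The cobar complex\<close>

text \<open>\<open>tensor A s\<close> is \<open>L \<otimes>\<^sub>L LB \<otimes>\<^sub>L \<dots> \<otimes>\<^sub>L LB\<close> with \<open>s\<close> factors \<open>LB\<close>, where each \<open>LB\<close> is a left
  \<open>L\<close>-module through \<open>\<eta>\<^sub>L\<close> and a right one through \<open>\<eta>\<^sub>R\<close>. The leading \<open>L\<close> (the comodule of
  coefficients) makes the case \<open>s = 0\<close> uniform: \<open>tensor A 0 \<cong> L\<close> and
  \<open>tensor A s \<cong> LB \<otimes>\<^sub>L \<dots> \<otimes>\<^sub>L LB\<close>.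
  A generator \<open>(l, [g\<^sub>1, \<dots>, g\<^sub>s])\<close> stands for \<open>l \<otimes> g\<^sub>1 \<otimes> \<dots> \<otimes> g\<^sub>s\<close>; the ring structure is the
  factorwise one.\<close>

type_synonym 'a word = "'a bud \<times> (nat \<Rightarrow> 'a bud) list"

definition word_monoid :: "('a, 'm) ring_scheme \<Rightarrow> nat \<Rightarrow> 'a word monoid" where
  "word_monoid A s =
     \<lparr>carrier = {(l, gs). l \<in> carrier (LA A) \<and> length gs = s \<and> set gs \<subseteq> carrier (LB A)},
      monoid.mult = (\<lambda>(l, gs) (m, hs). (l \<otimes>\<^bsub>LA A\<^esub> m, map2 (monoid.mult (LB A)) gs hs)),
      one = (\<one>\<^bsub>LA A\<^esub>, replicate s \<one>\<^bsub>LB A\<^esub>)\<rparr>"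

definition tensor_ideal :: "('a, 'm) ring_scheme \<Rightarrow> nat \<Rightarrow> ('a word \<Rightarrow> 'a) set" where
  "tensor_ideal A s =
    (let P = monoid_algebra A (word_monoid A s); W = carrier (word_monoid A s);
         w = (\<lambda>l gs. basis A (l, gs)) in
     Idl\<^bsub>P\<^esub>
      ( {w (l \<oplus>\<^bsub>LA A\<^esub> m) gs \<ominus>\<^bsub>P\<^esub> (w l gs \<oplus>\<^bsub>P\<^esub> w m gs) | l m gs.
          (l, gs) \<in> W \<and> (m, gs) \<in> W}
      \<union> {w (a \<odot>\<^bsub>LA A\<^esub> l) gs \<ominus>\<^bsub>P\<^esub> a \<odot>\<^bsub>P\<^esub> w l gs | a l gs.
          a \<in> carrier A \<and> (l, gs) \<in> W}
      \<union> {w l (gs[i := g \<oplus>\<^bsub>LB A\<^esub> h]) \<ominus>\<^bsub>P\<^esub> (w l (gs[i := g]) \<oplus>\<^bsub>P\<^esub> w l (gs[i := h])) | l gs i g h.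
          (l, gs) \<in> W \<and> i < s \<and> g \<in> carrier (LB A) \<and> h \<in> carrier (LB A)}
      \<union> {w (l \<otimes>\<^bsub>LA A\<^esub> r) gs \<ominus>\<^bsub>P\<^esub> w l (gs[0 := eta_L A r \<otimes>\<^bsub>LB A\<^esub> gs ! 0]) | l r gs.
          (l, gs) \<in> W \<and> r \<in> carrier (LA A) \<and> 0 < s}
      \<union> {w l (gs[i := gs ! i \<otimes>\<^bsub>LB A\<^esub> eta_R A r]) \<ominus>\<^bsub>P\<^esub>
           w l (gs[Suc i := eta_L A r \<otimes>\<^bsub>LB A\<^esub> gs ! Suc i]) | l r gs i.
          (l, gs) \<in> W \<and> r \<in> carrier (LA A) \<and> Suc i < s} ))"

type_synonym 'a tens = "('a word \<Rightarrow> 'a) set"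

definition tensor :: "('a, 'm) ring_scheme \<Rightarrow> nat \<Rightarrow> ('a, 'a tens) module" where
  "tensor A s = quotient_module (monoid_algebra A (word_monoid A s)) (tensor_ideal A s)"

definition pure_tensor :: "('a, 'm) ring_scheme \<Rightarrow> 'a bud \<Rightarrow> (nat \<Rightarrow> 'a bud) list \<Rightarrow> 'a tens" where
  "pure_tensor A l gs = tensor_ideal A (length gs)
     +>\<^bsub>monoid_algebra A (word_monoid A (length gs))\<^esub> basis A (l, gs)"

text \<open>The ring map \<open>\<Delta> : LB \<rightarrow> LB \<otimes>\<^sub>L LB\<close> with \<open>\<Delta> \<circ> \<eta>\<^sub>L = \<eta>\<^sub>L \<otimes> 1\<close> and \<open>\<Delta>(t) = t \<otimes> 1 + 1 \<otimes> t\<close>: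
  the evaluation homomorphism of \<open>L[t]\<close> at \<open>t \<otimes> 1 + 1 \<otimes> t\<close>.\<close>

definition comult :: "('a, 'm) ring_scheme \<Rightarrow> (nat \<Rightarrow> 'a bud) \<Rightarrow> 'a tens" where
  "comult A = UnivPoly.eval (LA A) (tensor A 2) (\<lambda>l. pure_tensor A l [\<one>\<^bsub>LB A\<^esub>, \<one>\<^bsub>LB A\<^esub>])
     (pure_tensor A \<one>\<^bsub>LA A\<^esub> [LB_t A, \<one>\<^bsub>LB A\<^esub>] \<oplus>\<^bsub>tensor A 2\<^esub> pure_tensor A \<one>\<^bsub>LA A\<^esub> [\<one>\<^bsub>LB A\<^esub>, LB_t A])"

text \<open>The cofaces on \<open>l \<otimes> g\<^sub>1 \<otimes> \<dots> \<otimes> g\<^sub>s\<close>: the coaction \<open>l \<mapsto> 1 \<otimes> \<eta>\<^sub>R(l)\<close> for \<open>i = 0\<close>, the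
  comultiplication applied to \<open>g\<^sub>i\<close> for \<open>1 \<le> i \<le> s\<close>, and \<open>- \<otimes> 1\<close> for \<open>i = s + 1\<close>. A term
  \<open>m \<otimes> h\<^sub>1 \<otimes> h\<^sub>2\<close> of \<open>\<Delta>(g\<^sub>i)\<close> is the element \<open>\<eta>\<^sub>L(m)h\<^sub>1 \<otimes> h\<^sub>2\<close> of \<open>LB \<otimes>\<^sub>L LB\<close>.\<close>

definition coface :: "('a, 'm) ring_scheme \<Rightarrow> nat \<Rightarrow> nat \<Rightarrow> 'a word \<Rightarrow> 'a tens" where
  "coface A s i = (\<lambda>(l, gs).
     if i = 0 then pure_tensor A \<one>\<^bsub>LA A\<^esub> (eta_R A l # gs)
     else if i \<le> s then
       linear_lift A (tensor A (Suc s))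
         (\<lambda>(m, hs). pure_tensor A l
            (take (i - 1) gs @ [eta_L A m \<otimes>\<^bsub>LB A\<^esub> hs ! 0, hs ! 1] @ drop i gs))
         (comult A (gs ! (i - 1)))
     else pure_tensor A l (gs @ [\<one>\<^bsub>LB A\<^esub>]))"

definition cobar_diff :: "('a, 'm) ring_scheme \<Rightarrow> nat \<Rightarrow> 'a tens \<Rightarrow> 'a tens" where
  "cobar_diff A s = linear_lift A (tensor A (Suc s))
     (\<lambda>x. \<Oplus>\<^bsub>tensor A (Suc s)\<^esub>i \<in> {..Suc s}.
        if even i then coface A s i x else \<ominus>\<^bsub>tensor A (Suc s)\<^esub> coface A s i x)"

definition tensor_deg :: "('a, 'm) ring_scheme \<Rightarrow> nat \<Rightarrow> nat \<Rightarrow> 'a tens set" where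
  "tensor_deg A s d = span A (tensor A s)
     {pure_tensor A l gs | l gs e es. length gs = s \<and> l \<in> L_deg A e \<and>
        list_all2 (\<lambda>g k. g \<in> LB_deg A k) gs es \<and> e + sum_list es = d}"

definition cocycles :: "('a, 'm) ring_scheme \<Rightarrow> nat \<Rightarrow> nat \<Rightarrow> 'a tens set" where
  "cocycles A s d = {X \<in> tensor_deg A s d. cobar_diff A s X = \<zero>\<^bsub>tensor A (Suc s)\<^esub>}"

definition coboundaries :: "('a, 'm) ring_scheme \<Rightarrow> nat \<Rightarrow> nat \<Rightarrow> 'a tens set" where
  "coboundaries A s d = (case s of 0 \<Rightarrow> {\<zero>\<^bsub>tensor A 0\<^esub>}
     | Suc r \<Rightarrow> cobar_diff A r ` tensor_deg A r d)"

text \<open>\<open>Cotor\<^sup>s\<^sup>,\<^sup>d(L, L)\<close> over \<open>(L, LB)\<close>, in internal degree \<open>d\<close>.\<close>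

definition cotor :: "('a, 'm) ring_scheme \<Rightarrow> nat \<Rightarrow> nat \<Rightarrow> ('a, 'a tens set) module" where
  "cotor A s d = quotient_module ((tensor A s)\<lparr>carrier := cocycles A s d\<rparr>) (coboundaries A s d)"

text \<open>\<open>H\<^sup>s\<^sub>f\<^sub>l(M; \<omega>\<^sup>n)\<close> for \<open>M\<close> the stack of formal \<open>A\<close>-module 2-buds, i.e. the stackification of the
  groupoid scheme \<open>(Spec L, Spec LB)\<close>, and \<open>\<omega>\<close> its line bundle of invariant differentials:
  by definition \<open>Cotor\<^sup>s\<^sup>,\<^sup>2\<^sup>n\<close>.\<close>

definition flat_cohomology :: "('a, 'm) ring_scheme \<Rightarrow> nat \<Rightarrow> nat \<Rightarrow> ('a, 'a tens set) module" where
  "flat_cohomology A s n = cotor A s (2 * n)"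

end

theory Submission
  imports Defs
begin

text \<open>The map \<open>phi : Dr \<rightarrow> A\<close> with \<open>\<gamma> \<mapsto> 2\<close> and \<open>c\<^sub>a \<mapsto> a\<^sup>2 - a\<close> is an isomorphism onto \<open>I\<^sub>2\<close>: the relations
  force \<open>c\<^bsub>phi x\<^esub> = (phi x - 1)x\<close> for all \<open>x\<close>, so \<open>phi x = 0\<close> implies \<open>x = 0\<close>. On generators
  \<open>\<eta>\<^sub>R(x) = x + phi(x)t\<close>, and the \<open>s\<close>-th term of the cobar complex is the polynomial ring
  \<open>L[t\<^sub>0, \<dots>, t\<^bsub>s-1\<^esub>]\<close>, where \<open>t\<^sub>i\<close> is \<open>t\<close> in the \<open>i\<close>-th tensor factor and the cofaces omit or double a point
  among the partial sums \<open>t\<^sub>0 + \<dots> + t\<^bsub>i-1\<^esub>\<close>. Setting the last variable to zero is an extra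
  codegeneracy, so every cocycle is cohomologous to a multiple of the last variable, and multiplication
  by the last variable shifts the complex by one. Thus internal degree 2 reduces to degree 0 and degree 4
  to degree 2 and the differential of \<open>t\<^sub>i\<^sup>2\<close>. In degree 4, \<open>\<eta>\<^sub>R(z) - z = mu(z)(\<gamma>t + t\<^sup>2)\<close>, where
  \<open>mu\<close> corresponds to the multiplication \<open>Sym\<^sup>2(I\<^sub>2) \<rightarrow> A\<close>; its kernel and image
  are \<open>\<delta>(I\<^sub>2)\<close> and \<open>I\<^sub>2\<^sup>2\<close>.\<close>

section \<open>Linear maps and quotients of modules\<close>

text \<open>The identity behind the injectivity of \<open>phi\<close> can be guessed: if an element
  x of \<open>Dr\<close> is to be determined by b = phi(x), then c_b has the value b^2 - b = (b -
  1)b, so c_b can only be (b - 1)x, and such an equation can be tested on generators. The obstacle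
  is well-definedness. Tensor powers, cofaces and the differential are linear lifts from
  presentations, and the differential is only linear, so checking generators of the relation ideal
  does not suffice for it. Coordinates therefore come first: once they are injective, a lift is well
  defined as soon as its coordinates are. A factor is described by two end points and not by an
  increment, because a right unit then evaluates at the end point of its factor, which is where the
  left unit of the next factor evaluates; the relations across tensor signs thus hold for every
  choice of points. The class gamma t + t^2 comes from expanding (x + phi(x)t)(y + phi(y)t): by
  phi(x)y = phi(y)x and phi(x)gamma = 2x the cross terms add up to phi(x)phi(y) gamma t. The case
  split in internal degree 4 comes from the differential of a squared variable, which depends on the
  parity of its index.\<close>

definition linear_maps ::
    "('a, 'm) ring_scheme \<Rightarrow> ('a, 'b, 'n) module_scheme \<Rightarrow> ('a, 'c, 'k) module_scheme \<Rightarrow> ('b \<Rightarrow> 'c) set" where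
  "linear_maps R M N = {f. f \<in> carrier M \<rightarrow> carrier N
     \<and> (\<forall>x \<in> carrier M. \<forall>y \<in> carrier M. f (x \<oplus>\<^bsub>M\<^esub> y) = f x \<oplus>\<^bsub>N\<^esub> f y)
     \<and> (\<forall>a \<in> carrier R. \<forall>x \<in> carrier M. f (a \<odot>\<^bsub>M\<^esub> x) = a \<odot>\<^bsub>N\<^esub> f x)}"

definition algebra_maps ::
    "('a, 'm) ring_scheme \<Rightarrow> ('a, 'b, 'n) module_scheme \<Rightarrow> ('a, 'c, 'k) module_scheme \<Rightarrow> ('b \<Rightarrow> 'c) set" where
  "algebra_maps R M N = {f \<in> linear_maps R M N. f \<one>\<^bsub>M\<^esub> = \<one>\<^bsub>N\<^esub>
     \<and> (\<forall>x \<in> carrier M. \<forall>y \<in> carrier M. f (x \<otimes>\<^bsub>M\<^esub> y) = f x \<otimes>\<^bsub>N\<^esub> f y)}"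

lemma linear_mapsI:
  assumes "\<And>x. x \<in> carrier M \<Longrightarrow> f x \<in> carrier N"
    and "\<And>x y. x \<in> carrier M \<Longrightarrow> y \<in> carrier M \<Longrightarrow> f (x \<oplus>\<^bsub>M\<^esub> y) = f x \<oplus>\<^bsub>N\<^esub> f y"
    and "\<And>a x. a \<in> carrier R \<Longrightarrow> x \<in> carrier M \<Longrightarrow> f (a \<odot>\<^bsub>M\<^esub> x) = a \<odot>\<^bsub>N\<^esub> f x"
  shows "f \<in> linear_maps R M N"
  using assms by (auto simp: linear_maps_def)

lemma algebra_mapsI:
  assumes "f \<in> linear_maps R M N" "f \<one>\<^bsub>M\<^esub> = \<one>\<^bsub>N\<^esub>"
    and "\<And>x y. x \<in> carrier M \<Longrightarrow> y \<in> carrier M \<Longrightarrow> f (x \<otimes>\<^bsub>M\<^esub> y) = f x \<otimes>\<^bsub>N\<^esub> f y"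
  shows "f \<in> algebra_maps R M N"
  using assms by (auto simp: algebra_maps_def)

lemma linear_mapsD:
  assumes "f \<in> linear_maps R M N"
  shows "x \<in> carrier M \<Longrightarrow> f x \<in> carrier N"
    and "x \<in> carrier M \<Longrightarrow> y \<in> carrier M \<Longrightarrow> f (x \<oplus>\<^bsub>M\<^esub> y) = f x \<oplus>\<^bsub>N\<^esub> f y"
    and "a \<in> carrier R \<Longrightarrow> x \<in> carrier M \<Longrightarrow> f (a \<odot>\<^bsub>M\<^esub> x) = a \<odot>\<^bsub>N\<^esub> f x"
  using assms by (auto simp: linear_maps_def)

lemma algebra_mapsD:
  assumes "f \<in> algebra_maps R M N"
  shows "f \<in> linear_maps R M N"
    and "x \<in> carrier M \<Longrightarrow> f x \<in> carrier N"
    and "x \<in> carrier M \<Longrightarrow> y \<in> carrier M \<Longrightarrow> f (x \<oplus>\<^bsub>M\<^esub> y) = f x \<oplus>\<^bsub>N\<^esub> f y"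
    and "a \<in> carrier R \<Longrightarrow> x \<in> carrier M \<Longrightarrow> f (a \<odot>\<^bsub>M\<^esub> x) = a \<odot>\<^bsub>N\<^esub> f x"
    and "f \<one>\<^bsub>M\<^esub> = \<one>\<^bsub>N\<^esub>"
    and "x \<in> carrier M \<Longrightarrow> y \<in> carrier M \<Longrightarrow> f (x \<otimes>\<^bsub>M\<^esub> y) = f x \<otimes>\<^bsub>N\<^esub> f y"
  using assms by (auto simp: linear_maps_def algebra_maps_def)

lemma algebra_maps_ring_hom: "f \<in> algebra_maps R M N \<Longrightarrow> f \<in> ring_hom M N"
  by (rule ring_hom_memI) (auto dest: algebra_mapsD)

lemma linear_maps_comp:
  "f \<in> linear_maps R M N \<Longrightarrow> g \<in> linear_maps R N K \<Longrightarrow> (\<lambda>x. g (f x)) \<in> linear_maps R M K"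
  by (auto simp: linear_maps_def Pi_def)

lemma algebra_maps_comp:
  "f \<in> algebra_maps R M N \<Longrightarrow> g \<in> algebra_maps R N K \<Longrightarrow> (\<lambda>x. g (f x)) \<in> algebra_maps R M K"
  by (auto simp: algebra_maps_def linear_maps_def Pi_def)

lemma linear_map_abelian_group_hom:
  assumes "module R M" "module R N" "f \<in> linear_maps R M N"
  shows "abelian_group_hom M N f"
proof -
  interpret M: module R M by fact
  interpret N: module R N by fact
  show ?thesis
    using assms(3) M.abelian_group_axioms N.abelian_group_axioms
    by (auto intro!: abelian_group_homI group_hom.intro group_hom_axioms.intro M.a_group N.a_group
        simp: hom_def linear_maps_def)
qed

lemma linear_map_zero:
  assumes "module R M" "module R N" "f \<in> linear_maps R M N"
  shows "f \<zero>\<^bsub>M\<^esub> = \<zero>\<^bsub>N\<^esub>"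
  using abelian_group_hom.hom_zero[OF linear_map_abelian_group_hom[OF assms]] .

lemma linear_map_uminus:
  assumes "module R M" "module R N" "f \<in> linear_maps R M N" "x \<in> carrier M"
  shows "f (\<ominus>\<^bsub>M\<^esub> x) = \<ominus>\<^bsub>N\<^esub> f x"
  using abelian_group_hom.hom_a_inv[OF linear_map_abelian_group_hom[OF assms(1-3)] assms(4)] .

lemma linear_map_minus:
  assumes "module R M" "module R N" "f \<in> linear_maps R M N" "x \<in> carrier M" "y \<in> carrier M"
  shows "f (x \<ominus>\<^bsub>M\<^esub> y) = f x \<ominus>\<^bsub>N\<^esub> f y"
proof -
  interpret M: module R M by fact
  show ?thesis
    using assms linear_map_uminus[OF assms(1-3)] by (simp add: a_minus_def linear_mapsD)
qed

lemma linear_map_finsum: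
  assumes "module R M" "module R N" "f \<in> linear_maps R M N" "g \<in> X \<rightarrow> carrier M"
  shows "f (finsum M g X) = (\<Oplus>\<^bsub>N\<^esub>i\<in>X. f (g i))"
proof -
  interpret M: module R M by fact
  interpret N: module R N by fact
  show ?thesis
    using assms(4)
    by (induction X rule: infinite_finite_induct)
      (auto simp: linear_map_zero[OF assms(1-3)] linear_mapsD[OF assms(3)] Pi_def)
qed

lemma (in abelian_group) minus_eq_zero_iff:
  assumes "x \<in> carrier G" "y \<in> carrier G" shows "x \<ominus> y = \<zero> \<longleftrightarrow> x = y"
  using assms by (metis a_minus_def add.inv_closed add.inv_solve_right l_zero r_neg zero_closed)

lemma (in abelian_group) minus_eq_minus_iff:
  assumes "x \<in> carrier G" "y \<in> carrier G" "z \<in> carrier G" "w \<in> carrier G"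
  shows "x \<ominus> y = z \<ominus> w \<longleftrightarrow> x \<oplus> w = z \<oplus> y"
proof
  assume "x \<oplus> w = z \<oplus> y"
  have "x \<ominus> y = (x \<oplus> w) \<oplus> (\<ominus> w \<oplus> \<ominus> y)"
    using assms by (simp add: a_minus_def a_assoc r_neg2)
  also have "\<dots> = (z \<oplus> y) \<oplus> (\<ominus> y \<oplus> \<ominus> w)"
    using assms \<open>x \<oplus> w = z \<oplus> y\<close> by (simp add: a_comm)
  also have "\<dots> = z \<ominus> w"
    using assms by (simp add: a_minus_def a_assoc r_neg2)
  finally show "x \<ominus> y = z \<ominus> w" .
next
  assume "x \<ominus> y = z \<ominus> w"
  have "x \<oplus> w = (x \<ominus> y) \<oplus> (y \<oplus> w)"
    using assms by (simp add: a_minus_def a_assoc r_neg1)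
  also have "\<dots> = (z \<ominus> w) \<oplus> (w \<oplus> y)"
    using assms \<open>x \<ominus> y = z \<ominus> w\<close> by (simp add: a_comm)
  also have "\<dots> = z \<oplus> y"
    using assms by (simp add: a_minus_def a_assoc r_neg1)
  finally show "x \<oplus> w = z \<oplus> y" .
qed

section \<open>Submodules, cosets and quotient modules\<close>

lemma (in module) submodule_abelian_subgroup:
  assumes "submodule N R M" shows "abelian_subgroup N M"
  by (rule abelian_subgroupI3)
    (auto intro: additive_subgroup.intro submodule.axioms(1)[OF assms] M.abelian_group_axioms)

lemma (in module) finsum_mem_submodule:
  assumes N: "submodule N R M" and "\<And>i. i \<in> X \<Longrightarrow> g i \<in> N"
  shows "finsum M g X \<in> N"
proof -
  have "N \<subseteq> carrier M" "\<zero>\<^bsub>M\<^esub> \<in> N"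
    using submoduleE(1)[OF N] additive_subgroup.zero_closed[OF additive_subgroup.intro]
      submodule.axioms(1)[OF N] by auto
  then show ?thesis
    using assms(2)
  proof (induction X rule: infinite_finite_induct)
    case (insert x F)
    then have "finsum M g (insert x F) = g x \<oplus>\<^bsub>M\<^esub> finsum M g F"
      by (intro finsum_insert) auto
    with insert submoduleE(5)[OF N] show ?case by auto
  qed auto
qed

lemma quotient_module_sel:
  "carrier (quotient_module M N) = a_rcosets\<^bsub>M\<^esub> N"
  "monoid.mult (quotient_module M N) = rcoset_mult M N"
  "one (quotient_module M N) = N +>\<^bsub>M\<^esub> \<one>\<^bsub>M\<^esub>"
  "zero (quotient_module M N) = N"
  "add (quotient_module M N) = set_add M"
  "smult (quotient_module M N) = (\<lambda>a X. \<Union>x\<in>X. N +>\<^bsub>M\<^esub> (a \<odot>\<^bsub>M\<^esub> x))"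
  by (simp_all add: quotient_module_def ring.extend_def module.fields_def FactRing_def)

lemma quotient_carrierE:
  assumes "X \<in> carrier (quotient_module M N)"
  obtains x where "x \<in> carrier M" "X = N +>\<^bsub>M\<^esub> x"
  using assms by (auto simp: A_RCOSETS_def' a_r_coset_def' quotient_module_sel)

lemma UN_singleton_const: "x \<in> X \<Longrightarrow> (\<And>y. y \<in> X \<Longrightarrow> f y = c) \<Longrightarrow> (\<Union>y\<in>X. f y) = c"
  by auto

context module
begin

context
  fixes N assumes N: "submodule N R M"
begin

interpretation N: abelian_subgroup N M
  by (rule submodule_abelian_subgroup[OF N])

lemma coset_carrier [simp]: "x \<in> carrier M \<Longrightarrow> N +>\<^bsub>M\<^esub> x \<in> carrier (quotient_module M N)"
  by (simp add: a_rcosetsI N.a_subset quotient_module_sel)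

lemma coset_add:
  "x \<in> carrier M \<Longrightarrow> y \<in> carrier M \<Longrightarrow>
    (N +>\<^bsub>M\<^esub> x) \<oplus>\<^bsub>quotient_module M N\<^esub> (N +>\<^bsub>M\<^esub> y) = N +>\<^bsub>M\<^esub> (x \<oplus>\<^bsub>M\<^esub> y)"
  by (simp add: N.a_rcos_sum quotient_module_sel)

lemma mem_coset_iff:
  "x \<in> carrier M \<Longrightarrow> y \<in> carrier M \<Longrightarrow> x \<in> N +>\<^bsub>M\<^esub> y \<longleftrightarrow> x \<ominus>\<^bsub>M\<^esub> y \<in> N"
  by (simp add: N.a_rcos_module a_minus_def)

lemma coset_eq_iff:
  assumes "x \<in> carrier M" "y \<in> carrier M"
  shows "N +>\<^bsub>M\<^esub> x = N +>\<^bsub>M\<^esub> y \<longleftrightarrow> x \<ominus>\<^bsub>M\<^esub> y \<in> N"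
proof
  assume "N +>\<^bsub>M\<^esub> x = N +>\<^bsub>M\<^esub> y"
  then have "x \<in> N +>\<^bsub>M\<^esub> y" using N.a_rcos_self[OF assms(1)] by simp
  then show "x \<ominus>\<^bsub>M\<^esub> y \<in> N" using mem_coset_iff[OF assms] by simp
next
  assume "x \<ominus>\<^bsub>M\<^esub> y \<in> N"
  then have "x \<in> N +>\<^bsub>M\<^esub> y" using mem_coset_iff[OF assms] by simp
  then show "N +>\<^bsub>M\<^esub> x = N +>\<^bsub>M\<^esub> y" using N.a_repr_independence'[OF _ assms(2)] by simp
qed

lemma coset_eq_zero_iff:
  assumes "x \<in> carrier M"
  shows "N +>\<^bsub>M\<^esub> x = N \<longleftrightarrow> x \<in> N"
proof -
  have "x \<ominus>\<^bsub>M\<^esub> \<zero>\<^bsub>M\<^esub> = x"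
    using assms by (metis M.add.inv_one M.r_zero M.add.inv_closed M.zero_closed a_minus_def M.add.m_comm M.l_neg)
  then show ?thesis
    using coset_eq_iff[OF assms M.zero_closed] assms by (simp add: N.a_subset)
qed

text \<open>Scalar multiplication in the quotient is a union over all representatives of a coset. It
  collapses to one coset because any two representatives differ by an element of \<open>N\<close>,
  and \<open>N\<close> is closed under scalars.\<close>

lemma coset_smult:
  assumes a: "a \<in> carrier R" and x: "x \<in> carrier M"
  shows "a \<odot>\<^bsub>quotient_module M N\<^esub> (N +>\<^bsub>M\<^esub> x) = N +>\<^bsub>M\<^esub> (a \<odot>\<^bsub>M\<^esub> x)"
proof -
  have const: "N +>\<^bsub>M\<^esub> (a \<odot>\<^bsub>M\<^esub> y) = N +>\<^bsub>M\<^esub> (a \<odot>\<^bsub>M\<^esub> x)" if "y \<in> N +>\<^bsub>M\<^esub> x" for y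
  proof -
    have y: "y \<in> carrier M" using that x N.a_elemrcos_carrier by blast
    then have "y \<ominus>\<^bsub>M\<^esub> x \<in> N" using mem_coset_iff[OF y x] that by simp
    then have "a \<odot>\<^bsub>M\<^esub> (y \<ominus>\<^bsub>M\<^esub> x) \<in> N" using submoduleE(4)[OF N] a by blast
    then have "a \<odot>\<^bsub>M\<^esub> y \<ominus>\<^bsub>M\<^esub> a \<odot>\<^bsub>M\<^esub> x \<in> N"
      using a x y by (simp add: a_minus_def smult_r_distr smult_r_minus)
    then show ?thesis using a x y by (simp add: coset_eq_iff)
  qed
  have "(\<Union>y\<in>N +>\<^bsub>M\<^esub> x. N +>\<^bsub>M\<^esub> (a \<odot>\<^bsub>M\<^esub> y)) = N +>\<^bsub>M\<^esub> (a \<odot>\<^bsub>M\<^esub> x)"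
    by (rule UN_singleton_const[OF N.a_rcos_self[OF x] const])
  then show ?thesis by (simp add: quotient_module_sel)
qed

lemma quotient_module_module: "module R (quotient_module M N)"
proof (rule moduleI)
  have zero: "\<zero>\<^bsub>quotient_module M N\<^esub> = N +>\<^bsub>M\<^esub> \<zero>\<^bsub>M\<^esub>"
    by (simp add: N.a_subset quotient_module_sel)
  note q = coset_add coset_carrier
  show "abelian_group (quotient_module M N)"
  proof (rule abelian_groupI)
    show "\<zero>\<^bsub>quotient_module M N\<^esub> \<in> carrier (quotient_module M N)"
      unfolding zero by (rule coset_carrier) simp
  next
    fix X assume "X \<in> carrier (quotient_module M N)"
    then obtain x where x: "x \<in> carrier M" "X = N +>\<^bsub>M\<^esub> x" by (rule quotient_carrierE)
    then have "(N +>\<^bsub>M\<^esub> (\<ominus>\<^bsub>M\<^esub> x)) \<oplus>\<^bsub>quotient_module M N\<^esub> X = \<zero>\<^bsub>quotient_module M N\<^esub>"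
      unfolding zero by (simp add: q M.l_neg)
    with x show "\<exists>Y\<in>carrier (quotient_module M N). Y \<oplus>\<^bsub>quotient_module M N\<^esub> X = \<zero>\<^bsub>quotient_module M N\<^esub>"
      by (intro bexI[of _ "N +>\<^bsub>M\<^esub> (\<ominus>\<^bsub>M\<^esub> x)"]) (simp_all add: q)
  next
    fix X assume "X \<in> carrier (quotient_module M N)"
    then show "\<zero>\<^bsub>quotient_module M N\<^esub> \<oplus>\<^bsub>quotient_module M N\<^esub> X = X"
      unfolding zero by (elim quotient_carrierE) (simp add: q)
  qed (elim quotient_carrierE; simp add: q M.a_ac)+
qed (auto elim!: quotient_carrierE
    simp: coset_add coset_smult smult_l_distr smult_r_distr smult_assoc1
    R.cring_axioms)

lemma coset_linear: "(\<lambda>x. N +>\<^bsub>M\<^esub> x) \<in> linear_maps R M (quotient_module M N)"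
  by (rule linear_mapsI) (simp_all only: coset_carrier coset_add coset_smult)

end

lemma kernel_submodule:
  assumes "module R K" "f \<in> linear_maps R M K"
  shows "submodule {x \<in> carrier M. f x = \<zero>\<^bsub>K\<^esub>} R M"
proof -
  interpret K: module R K by fact
  note lin = linear_mapsD[OF assms(2)]
  show ?thesis
    by (rule submoduleI)
      (auto simp: lin linear_map_zero[OF module_axioms assms] linear_map_uminus[OF module_axioms assms])
qed

end

lemma (in algebra) ideal_submodule:
  assumes "ideal N M" shows "submodule N R M"
proof -
  interpret N: ideal N M by fact
  have "a \<odot>\<^bsub>M\<^esub> x \<in> N" if "a \<in> carrier R" "x \<in> N" for a x
  proof -
    have "a \<odot>\<^bsub>M\<^esub> x = (a \<odot>\<^bsub>M\<^esub> \<one>\<^bsub>M\<^esub>) \<otimes>\<^bsub>M\<^esub> x" using that by (simp add: smult_assoc2)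
    then show ?thesis using that by (simp add: N.I_l_closed)
  qed
  then show ?thesis by (intro submoduleI) auto
qed

text \<open>\<open>quotient_module\<close> extends the record \<open>M Quot N\<close>, so the ring
  axioms are inherited from the quotient ring by an ideal, and only the scalar action needs an
  argument.\<close>

lemma (in algebra) quotient_algebra:
  assumes "ideal N M"
  shows "algebra R (quotient_module M N)"
    and "(\<lambda>x. N +>\<^bsub>M\<^esub> x) \<in> algebra_maps R M (quotient_module M N)"
proof -
  interpret N: ideal N M by fact
  note N = ideal_submodule[OF assms]
  interpret q: module R "quotient_module M N" by (rule quotient_module_module[OF N])
  interpret c: cring "M Quot N" by (rule N.quotient_is_cring[OF M_cring])
  have c: "cring (quotient_module M N)"
    by (rule cringI)
      (use c.l_one c.m_assoc c.m_comm c.l_distr c.m_closed c.one_closed q.abelian_group_axioms in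
        \<open>auto simp: FactRing_def quotient_module_sel intro!: comm_monoidI\<close>)
  have mult: "(N +>\<^bsub>M\<^esub> x) \<otimes>\<^bsub>quotient_module M N\<^esub> (N +>\<^bsub>M\<^esub> y) = N +>\<^bsub>M\<^esub> (x \<otimes>\<^bsub>M\<^esub> y)"
    if "x \<in> carrier M" "y \<in> carrier M" for x y
    using N.rcoset_mult_add that by (simp add: quotient_module_sel)
  show "algebra R (quotient_module M N)"
    by (rule algebraI)
      (auto elim!: quotient_carrierE
        simp: coset_add[OF N] coset_smult[OF N] mult c coset_carrier[OF N]
        smult_l_distr smult_r_distr smult_assoc1 smult_assoc2 R.cring_axioms)
  show "(\<lambda>x. N +>\<^bsub>M\<^esub> x) \<in> algebra_maps R M (quotient_module M N)"
    by (rule algebra_mapsI[OF coset_linear[OF N]]) (simp_all only: mult, simp add: quotient_module_sel)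
qed

lemma (in algebra) kernel_ideal:
  assumes "algebra R K" "f \<in> algebra_maps R M K"
  shows "ideal {x \<in> carrier M. f x = \<zero>\<^bsub>K\<^esub>} M"
proof -
  note K_cring = algebra.M_cring[OF assms(1)]
  interpret h: ring_hom_ring M K f
    by (rule ring_hom_ringI2[OF cring.axioms(1)[OF M_cring] cring.axioms(1)[OF K_cring]
        algebra_maps_ring_hom[OF assms(2)]])
  show ?thesis using h.kernel_is_ideal unfolding a_kernel_def' .
qed

lemma (in module) span_submodule:
  assumes "X \<subseteq> carrier M" shows "submodule (span R M X) R M"
proof -
  have "carrier M \<in> {N. submodule N R M \<and> X \<subseteq> N}"
    using assms carrier_is_submodule by auto
  moreover have "\<zero>\<^bsub>M\<^esub> \<in> N" if "submodule N R M" for N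
    using additive_subgroup.zero_closed[OF additive_subgroup.intro] submodule.axioms(1)[OF that] by auto
  ultimately show ?thesis
    unfolding span_def by (intro submoduleI) (auto simp: submoduleE(3-5))
qed

lemma span_superset: "X \<subseteq> span R M X"
  unfolding span_def by (rule Inter_greatest) simp

lemma span_minimal: "submodule N R M \<Longrightarrow> X \<subseteq> N \<Longrightarrow> span R M X \<subseteq> N"
  unfolding span_def by (rule Inter_lower) simp

text \<open>The inverse of the desired map cannot be chosen naturally, so the map goes out of the
  quotient: on a coset \<open>f\<close> has one value, which \<open>the_elem\<close> extracts. The
  kernel enters through an equation for \<open>K\<close>, so that later uses can supply their own
  description of it.\<close>

theorem first_isomorphism:
  assumes M: "module R M" and N: "module R N" and f: "f \<in> linear_maps R M N"
    and surj: "f ` carrier M = carrier N" and K: "K = {x \<in> carrier M. f x = \<zero>\<^bsub>N\<^esub>}"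
  shows "module_iso R (quotient_module M K) N"
proof -
  interpret M: module R M by fact
  interpret N: module R N by fact
  note sub = M.kernel_submodule[OF N f, folded K]
  note lin = linear_mapsD[OF f]
  define g where "g X = the_elem (f ` X)" for X
  have eq: "x \<ominus>\<^bsub>M\<^esub> y \<in> K \<longleftrightarrow> f x = f y" if "x \<in> carrier M" "y \<in> carrier M" for x y
    using that by (simp add: K linear_map_minus[OF M N f] lin N.minus_eq_zero_iff)
  have g: "g (K +>\<^bsub>M\<^esub> x) = f x" if x: "x \<in> carrier M" for x
  proof -
    interpret K: abelian_subgroup K M by (rule M.submodule_abelian_subgroup[OF sub])
    have "f y = f x" if "y \<in> K +>\<^bsub>M\<^esub> x" for y
    proof -
      have y: "y \<in> carrier M" using that x K.a_elemrcos_carrier by blast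
      then show ?thesis
        using M.mem_coset_iff[OF sub y x] that eq[OF y x] by simp
    qed
    then have "f ` (K +>\<^bsub>M\<^esub> x) = {f x}" using K.a_rcos_self[OF x] by blast
    then show ?thesis by (simp add: g_def)
  qed
  have "bij_betw g (carrier (quotient_module M K)) (carrier N)"
  proof (rule bij_betwI')
    fix X Y assume "X \<in> carrier (quotient_module M K)" "Y \<in> carrier (quotient_module M K)"
    then obtain x y where "x \<in> carrier M" "y \<in> carrier M" "X = K +>\<^bsub>M\<^esub> x" "Y = K +>\<^bsub>M\<^esub> y"
      by (metis quotient_carrierE)
    then show "(g X = g Y) = (X = Y)" by (simp add: g M.coset_eq_iff[OF sub] eq)
  next
    fix X assume "X \<in> carrier (quotient_module M K)"
    then show "g X \<in> carrier N" by (metis quotient_carrierE g lin(1))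
  next
    fix y assume "y \<in> carrier N"
    then have "y \<in> f ` carrier M" using surj by simp
    then obtain x where "x \<in> carrier M" "f x = y" by (rule imageE) simp
    then show "\<exists>X\<in>carrier (quotient_module M K). y = g X"
      using g[OF \<open>x \<in> carrier M\<close>] M.coset_carrier[OF sub \<open>x \<in> carrier M\<close>]
      by (intro bexI[of _ "K +>\<^bsub>M\<^esub> x"]) simp_all
  qed
  moreover have "g (X \<oplus>\<^bsub>quotient_module M K\<^esub> Y) = g X \<oplus>\<^bsub>N\<^esub> g Y"
    if "X \<in> carrier (quotient_module M K)" "Y \<in> carrier (quotient_module M K)" for X Y
    using that by (elim quotient_carrierE) (simp only: M.coset_add[OF sub] g M.a_closed lin)
  moreover have "g (a \<odot>\<^bsub>quotient_module M K\<^esub> X) = a \<odot>\<^bsub>N\<^esub> g X"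
    if "X \<in> carrier (quotient_module M K)" "a \<in> carrier R" for X a
    using that by (elim quotient_carrierE) (simp only: M.coset_smult[OF sub] g M.smult_closed lin)
  ultimately show ?thesis
    unfolding module_iso_def using M.quotient_module_module[OF sub] N by (intro conjI exI[of _ g]) auto
qed

lemma module_iso_sym:
  assumes "module_iso R M N" shows "module_iso R N M"
proof -
  obtain f where f: "bij_betw f (carrier M) (carrier N)"
    and fl: "\<forall>x \<in> carrier M. \<forall>y \<in> carrier M. f (x \<oplus>\<^bsub>M\<^esub> y) = f x \<oplus>\<^bsub>N\<^esub> f y"
      "\<forall>a \<in> carrier R. \<forall>x \<in> carrier M. f (a \<odot>\<^bsub>M\<^esub> x) = a \<odot>\<^bsub>N\<^esub> f x"
    and M: "module R M" and N: "module R N"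
    using assms unfolding module_iso_def by blast
  interpret M: module R M by fact
  interpret N: module R N by fact
  let ?g = "inv_into (carrier M) f"
  have g: "bij_betw ?g (carrier N) (carrier M)" by (rule bij_betw_inv_into[OF f])
  have gc: "?g y \<in> carrier M" and fg: "f (?g y) = y" if "y \<in> carrier N" for y
    using that g f by (auto simp: bij_betw_def f_inv_into_f inv_into_into)
  have gf: "?g (f x) = x" if "x \<in> carrier M" for x
    using that f by (simp add: bij_betw_def)
  have "?g (x \<oplus>\<^bsub>N\<^esub> y) = ?g x \<oplus>\<^bsub>M\<^esub> ?g y" if "x \<in> carrier N" "y \<in> carrier N" for x y
    using gf[of "?g x \<oplus>\<^bsub>M\<^esub> ?g y"] that by (simp add: fl gc fg)
  moreover have "?g (a \<odot>\<^bsub>N\<^esub> x) = a \<odot>\<^bsub>M\<^esub> ?g x" if "x \<in> carrier N" "a \<in> carrier R" for x a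
    using gf[of "a \<odot>\<^bsub>M\<^esub> ?g x"] that by (simp add: fl gc fg)
  ultimately show ?thesis unfolding module_iso_def using M N g by (intro conjI exI[of _ ?g]) auto
qed

lemma linear_image_submodule:
  assumes M: "module R M" and N: "module R N" and f: "f \<in> linear_maps R M N"
  shows "submodule (f ` carrier M) R N"
proof -
  interpret M: module R M by fact
  interpret N: module R N by fact
  note l = linear_mapsD[OF f]
  show ?thesis
  proof (rule N.submoduleI)
    show "\<zero>\<^bsub>N\<^esub> \<in> f ` carrier M"
      by (rule image_eqI[of _ _ "\<zero>\<^bsub>M\<^esub>"]) (simp_all add: linear_map_zero[OF M N f])
  next
    fix x assume "x \<in> f ` carrier M"
    then obtain a where a: "a \<in> carrier M" "x = f a" by (rule imageE) simp
    then show "\<ominus>\<^bsub>N\<^esub> x \<in> f ` carrier M"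
      by (intro image_eqI[of _ _ "\<ominus>\<^bsub>M\<^esub> a"]) (simp_all add: linear_map_uminus[OF M N f])
    fix y assume "y \<in> f ` carrier M"
    then obtain b where "b \<in> carrier M" "y = f b" by (rule imageE) simp
    with a show "x \<oplus>\<^bsub>N\<^esub> y \<in> f ` carrier M"
      by (intro image_eqI[of _ _ "a \<oplus>\<^bsub>M\<^esub> b"]) (simp_all add: l)
  next
    fix c x assume c: "c \<in> carrier R" and "x \<in> f ` carrier M"
    then obtain a where "a \<in> carrier M" "x = f a" by (elim imageE) simp
    with c show "c \<odot>\<^bsub>N\<^esub> x \<in> f ` carrier M"
      by (intro image_eqI[of _ _ "c \<odot>\<^bsub>M\<^esub> a"]) (simp_all add: l)
  qed (auto simp: l)
qed

lemma module_iso_trans: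
  assumes MN: "module_iso R M N" and NK: "module_iso R N K" shows "module_iso R M K"
proof -
  obtain f where f: "bij_betw f (carrier M) (carrier N)"
    and fl: "\<forall>x \<in> carrier M. \<forall>y \<in> carrier M. f (x \<oplus>\<^bsub>M\<^esub> y) = f x \<oplus>\<^bsub>N\<^esub> f y"
      "\<forall>a \<in> carrier R. \<forall>x \<in> carrier M. f (a \<odot>\<^bsub>M\<^esub> x) = a \<odot>\<^bsub>N\<^esub> f x" and M: "module R M"
    using MN unfolding module_iso_def by blast
  obtain g where g: "bij_betw g (carrier N) (carrier K)"
    and gl: "\<forall>x \<in> carrier N. \<forall>y \<in> carrier N. g (x \<oplus>\<^bsub>N\<^esub> y) = g x \<oplus>\<^bsub>K\<^esub> g y"
      "\<forall>a \<in> carrier R. \<forall>x \<in> carrier N. g (a \<odot>\<^bsub>N\<^esub> x) = a \<odot>\<^bsub>K\<^esub> g x" and K: "module R K"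
    using NK unfolding module_iso_def by blast
  have fc: "f x \<in> carrier N" if "x \<in> carrier M" for x using f that by (auto simp: bij_betw_def)
  have "bij_betw (g \<circ> f) (carrier M) (carrier K)" by (rule bij_betw_trans[OF f g])
  then show ?thesis
    unfolding module_iso_def using M K by (intro conjI exI[of _ "g \<circ> f"]) (simp_all add: fl gl fc)
qed

lemma module_iso_quotient_zero:
  assumes M: "module R M" shows "module_iso R (quotient_module M {\<zero>\<^bsub>M\<^esub>}) M"
proof (rule first_isomorphism[OF M M])
  interpret module R M by fact
  show "(\<lambda>x. x) \<in> linear_maps R M M" by (rule linear_mapsI) simp_all
qed (use module.axioms(2)[OF M] abelian_group.axioms(1) abelian_monoid.zero_closed in auto)

lemma submodule_zero: "submodule N R M \<Longrightarrow> \<zero>\<^bsub>M\<^esub> \<in> N"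
  by (rule additive_subgroup.zero_closed[OF additive_subgroup.intro[OF submodule.axioms(1)]])

section \<open>Free modules and monoid algebras\<close>

text \<open>This is the map that \<open>linear_lift\<close> applies to every representative of a
  coset. The lift is meaningful when this extension is constant on cosets.\<close>

definition linear_ext ::
    "('a, 'm) ring_scheme \<Rightarrow> ('a, 'b, 'n) module_scheme \<Rightarrow> ('s \<Rightarrow> 'b) \<Rightarrow> ('s \<Rightarrow> 'a) \<Rightarrow> 'b" where
  "linear_ext R N f p = (\<Oplus>\<^bsub>N\<^esub>x \<in> {x. p x \<noteq> \<zero>\<^bsub>R\<^esub>}. p x \<odot>\<^bsub>N\<^esub> f x)"

text \<open>The fields \<open>mult\<close> and \<open>one\<close> do not enter the module axioms. A
  free module and the monoid algebra built on it differ only in these two.\<close>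

lemma module_cong:
  assumes "module R M" and eq: "carrier N = carrier M" "zero N = zero M" "add N = add M" "smult N = smult M"
  shows "module R N"
proof -
  interpret M: module R M by fact
  have "\<exists>y\<in>carrier M. y \<oplus>\<^bsub>M\<^esub> x = \<zero>\<^bsub>M\<^esub>" if "x \<in> carrier M" for x
    using that M.l_neg by blast
  then have "abelian_group N"
    by (intro abelian_groupI) (simp_all add: eq M.a_ac)
  then show ?thesis
    by (intro moduleI) (simp_all add: eq M.smult_l_distr M.smult_r_distr M.smult_assoc1 M.R.is_cring)
qed

lemma cring_cong:
  assumes "cring M" and eq: "carrier N = carrier M" "zero N = zero M" "add N = add M"
    "one N = one M" "monoid.mult N = monoid.mult M"
  shows "cring N"
proof -
  interpret M: cring M by fact
  have "\<exists>y\<in>carrier M. y \<oplus>\<^bsub>M\<^esub> x = \<zero>\<^bsub>M\<^esub>" if "x \<in> carrier M" for x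
    using that M.l_neg by blast
  then have "abelian_group N"
    by (intro abelian_groupI) (simp_all add: eq M.a_ac)
  then show ?thesis
    by (intro cringI comm_monoidI) (simp_all add: eq M.m_ac M.l_distr M.r_distr)
qed

context cring
begin

lemma free_module_sel:
  "p \<in> carrier (free_module R S) \<longleftrightarrow>
    range p \<subseteq> carrier R \<and> {x. p x \<noteq> \<zero>} \<subseteq> S \<and> finite {x. p x \<noteq> \<zero>}"
  "zero (free_module R S) = (\<lambda>_. \<zero>)"
  "add (free_module R S) p q = (\<lambda>x. p x \<oplus> q x)"
  "smult (free_module R S) a p = (\<lambda>x. a \<otimes> p x)"
  by (simp_all add: free_module_def)

lemma free_module_closed:
  assumes "p \<in> carrier (free_module R S)"
  shows "p x \<in> carrier R" "p x \<noteq> \<zero> \<Longrightarrow> x \<in> S" "finite {x. p x \<noteq> \<zero>}" "{x. p x \<noteq> \<zero>} \<subseteq> S"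
  using assms by (auto simp: free_module_sel(1))

lemma free_module_module: "module R (free_module R S)"
proof (rule moduleI)
  have add: "p \<oplus>\<^bsub>free_module R S\<^esub> q \<in> carrier (free_module R S)"
    if p: "p \<in> carrier (free_module R S)" and q: "q \<in> carrier (free_module R S)" for p q
  proof -
    note cl = free_module_closed[OF p] free_module_closed[OF q]
    have "{x. p x \<oplus> q x \<noteq> \<zero>} \<subseteq> {x. p x \<noteq> \<zero>} \<union> {x. q x \<noteq> \<zero>}" by auto
    moreover have "\<dots> \<subseteq> S" "finite \<dots>" using cl by auto
    ultimately have "{x. p x \<oplus> q x \<noteq> \<zero>} \<subseteq> S" "finite {x. p x \<oplus> q x \<noteq> \<zero>}"
      by (auto intro: finite_subset)
    then show ?thesis using cl(1,5) by (auto simp: free_module_sel)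
  qed
  show smult: "a \<odot>\<^bsub>free_module R S\<^esub> p \<in> carrier (free_module R S)"
    if a: "a \<in> carrier R" and p: "p \<in> carrier (free_module R S)" for a p
  proof -
    note cl = free_module_closed[OF p]
    have "{x. a \<otimes> p x \<noteq> \<zero>} \<subseteq> {x. p x \<noteq> \<zero>}" using a by auto
    with cl(3,4) have "{x. a \<otimes> p x \<noteq> \<zero>} \<subseteq> S" "finite {x. a \<otimes> p x \<noteq> \<zero>}"
      by (auto intro: finite_subset)
    then show ?thesis using cl(1) a by (auto simp: free_module_sel)
  qed
  show "abelian_group (free_module R S)"
  proof (rule abelian_groupI)
    fix p assume p: "p \<in> carrier (free_module R S)"
    have "(\<ominus> \<one>) \<odot>\<^bsub>free_module R S\<^esub> p \<in> carrier (free_module R S)"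
      by (rule smult[OF _ p]) simp
    moreover have "((\<ominus> \<one>) \<odot>\<^bsub>free_module R S\<^esub> p) \<oplus>\<^bsub>free_module R S\<^esub> p = \<zero>\<^bsub>free_module R S\<^esub>"
      using free_module_closed(1)[OF p] by (simp add: free_module_sel l_minus l_neg)
    ultimately show "\<exists>q\<in>carrier (free_module R S). q \<oplus>\<^bsub>free_module R S\<^esub> p = \<zero>\<^bsub>free_module R S\<^esub>"
      by blast
  qed (use add in \<open>simp_all add: free_module_sel fun_eq_iff image_subset_iff a_ac\<close>)
qed (auto simp: free_module_sel is_cring image_subset_iff l_distr r_distr m_assoc)

lemma basis_closed [intro]: "x \<in> S \<Longrightarrow> basis R x \<in> carrier (free_module R S)"
  by (auto simp: free_module_sel basis_def intro: finite_subset[of _ "{x}"])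

lemma basis_supp: "{y. basis R x y \<noteq> \<zero>} \<subseteq> {x}"
  by (auto simp: basis_def)

lemma finsum_free_module_apply:
  assumes "g \<in> X \<rightarrow> carrier (free_module R S)"
  shows "(\<Oplus>\<^bsub>free_module R S\<^esub>i\<in>X. g i) z = (\<Oplus>i\<in>X. g i z)"
proof -
  interpret F: module R "free_module R S" by (rule free_module_module)
  show ?thesis using assms
  proof (induction X rule: infinite_finite_induct)
    case (insert x X)
    then have "g i z \<in> carrier R" if "i \<in> insert x X" for i
      using that insert.prems free_module_closed(1)[of "g i" S z] by auto
    with insert show ?case by (simp add: Pi_def free_module_sel)
  qed (simp_all add: free_module_sel)
qed

lemma free_module_repr:
  assumes p: "p \<in> carrier (free_module R S)"
  shows "p = (\<Oplus>\<^bsub>free_module R S\<^esub>x\<in>{x. p x \<noteq> \<zero>}. p x \<odot>\<^bsub>free_module R S\<^esub> basis R x)"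
proof (rule ext)
  fix z
  interpret F: module R "free_module R S" by (rule free_module_module)
  note cl = free_module_closed[OF p]
  have "(\<Oplus>\<^bsub>free_module R S\<^esub>x\<in>{x. p x \<noteq> \<zero>}. p x \<odot>\<^bsub>free_module R S\<^esub> basis R x) z
      = (\<Oplus>x\<in>{x. p x \<noteq> \<zero>}. (p x \<odot>\<^bsub>free_module R S\<^esub> basis R x) z)"
    by (rule finsum_free_module_apply) (use cl in \<open>auto intro!: F.smult_closed basis_closed\<close>)
  also have "\<dots> = (\<Oplus>x\<in>{x. p x \<noteq> \<zero>}. if z = x then p x else \<zero>)"
    by (rule finsum_cong') (use cl in \<open>auto simp: basis_def free_module_sel\<close>)
  also have "\<dots> = p z"
  proof (cases "p z = \<zero>")
    case True
    then have "(\<Oplus>x\<in>{x. p x \<noteq> \<zero>}. if z = x then p x else \<zero>) = (\<Oplus>x\<in>{x. p x \<noteq> \<zero>}. \<zero>)"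
      by (intro finsum_cong') auto
    with True show ?thesis by simp
  next
    case False
    then show ?thesis using finsum_singleton[of z "{x. p x \<noteq> \<zero>}" p] cl by auto
  qed
  finally show "p z = (\<Oplus>\<^bsub>free_module R S\<^esub>x\<in>{x. p x \<noteq> \<zero>}. p x \<odot>\<^bsub>free_module R S\<^esub> basis R x) z" by simp
qed

lemma free_module_induct [consumes 1, case_names zero basis smult add]:
  assumes p: "p \<in> carrier (free_module R S)"
    and zero: "P \<zero>\<^bsub>free_module R S\<^esub>"
    and basis: "\<And>x. x \<in> S \<Longrightarrow> P (basis R x)"
    and smult: "\<And>a p. a \<in> carrier R \<Longrightarrow> p \<in> carrier (free_module R S) \<Longrightarrow> P p \<Longrightarrow>
      P (a \<odot>\<^bsub>free_module R S\<^esub> p)"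
    and add: "\<And>p q. p \<in> carrier (free_module R S) \<Longrightarrow> q \<in> carrier (free_module R S) \<Longrightarrow> P p \<Longrightarrow> P q \<Longrightarrow>
      P (p \<oplus>\<^bsub>free_module R S\<^esub> q)"
  shows "P p"
proof -
  interpret F: module R "free_module R S" by (rule free_module_module)
  note cl = free_module_closed[OF p]
  have "P (\<Oplus>\<^bsub>free_module R S\<^esub>x\<in>X. p x \<odot>\<^bsub>free_module R S\<^esub> basis R x)"
    if "finite X" "X \<subseteq> S" for X
    using that
  proof (induction X rule: finite_induct)
    case (insert x X)
    have c: "p y \<odot>\<^bsub>free_module R S\<^esub> basis R y \<in> carrier (free_module R S)" if "y \<in> S" for y
      using that cl(1) by (intro F.smult_closed basis_closed)
    have "finsum (free_module R S) (\<lambda>x. p x \<odot>\<^bsub>free_module R S\<^esub> basis R x) (insert x X)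
        = p x \<odot>\<^bsub>free_module R S\<^esub> basis R x \<oplus>\<^bsub>free_module R S\<^esub>
          finsum (free_module R S) (\<lambda>x. p x \<odot>\<^bsub>free_module R S\<^esub> basis R x) X"
      using insert by (intro F.finsum_insert) (auto intro!: c)
    moreover have "P \<dots>"
    proof (rule add[OF c _ smult])
      show "finsum (free_module R S) (\<lambda>x. p x \<odot>\<^bsub>free_module R S\<^esub> basis R x) X \<in> carrier (free_module R S)"
        using insert.prems by (intro F.finsum_closed) (auto intro!: c)
    qed (use insert cl(1) basis in auto)
    ultimately show ?case by metis
  qed (use zero in simp)
  from this[OF cl(3,4)] show ?thesis using free_module_repr[OF p] by metis
qed

context
  fixes N :: "('a, 'c, 'n) module_scheme" (structure) and S :: "'s set" and f :: "'s \<Rightarrow> 'c"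
  assumes N: "module R N" and f: "f \<in> S \<rightarrow> carrier N"
begin

interpretation N: module R N by (rule N)

text \<open>Sums attached to different elements run over different supports. A common finite
  superset makes them comparable, the extra terms being zero.\<close>

lemma linear_ext_superset:
  assumes "p \<in> carrier (free_module R S)" "finite X" "{x. p x \<noteq> \<zero>\<^bsub>R\<^esub>} \<subseteq> X" "X \<subseteq> S"
  shows "linear_ext R N f p = (\<Oplus>\<^bsub>N\<^esub>x\<in>X. p x \<odot>\<^bsub>N\<^esub> f x)"
  unfolding linear_ext_def
  by (rule N.add.finprod_mono_neutral_cong_left)
    (use assms f free_module_closed[OF assms(1)] in \<open>auto simp: Pi_def\<close>)

lemma linear_ext_basis: "x \<in> S \<Longrightarrow> linear_ext R N f (basis R x) = f x"
  using f linear_ext_superset[of "basis R x" "{x}"] basis_supp[of x]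
  by (simp add: basis_closed Pi_def) (simp add: basis_def)

lemma linear_ext_linear: "linear_ext R N f \<in> linear_maps R (free_module R S) N"
proof (rule linear_mapsI)
  interpret F: module R "free_module R S" by (rule free_module_module)
  show cl: "linear_ext R N f p \<in> carrier N" if "p \<in> carrier (free_module R S)" for p
    unfolding linear_ext_def using free_module_closed[OF that] f by (auto intro!: N.finsum_closed N.smult_closed simp: Pi_def)
  fix p assume p: "p \<in> carrier (free_module R S)"
  note cp = free_module_closed[OF p]
  show "linear_ext R N f (p \<oplus>\<^bsub>free_module R S\<^esub> q) = linear_ext R N f p \<oplus>\<^bsub>N\<^esub> linear_ext R N f q"
    if q: "q \<in> carrier (free_module R S)" for q
  proof -
    note cq = free_module_closed[OF q]
    let ?X = "{x. p x \<noteq> \<zero>\<^bsub>R\<^esub>} \<union> {x. q x \<noteq> \<zero>\<^bsub>R\<^esub>}"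
    have X: "finite ?X" "?X \<subseteq> S" using cp cq by auto
    have "linear_ext R N f (p \<oplus>\<^bsub>free_module R S\<^esub> q)
        = (\<Oplus>\<^bsub>N\<^esub>x\<in>?X. (p \<oplus>\<^bsub>free_module R S\<^esub> q) x \<odot>\<^bsub>N\<^esub> f x)"
      by (rule linear_ext_superset[OF F.a_closed[OF p q] X(1) _ X(2)]) (auto simp: free_module_sel)
    also have "\<dots> = (\<Oplus>\<^bsub>N\<^esub>x\<in>?X. p x \<odot>\<^bsub>N\<^esub> f x \<oplus>\<^bsub>N\<^esub> q x \<odot>\<^bsub>N\<^esub> f x)"
      by (rule N.finsum_cong') (use X f cp cq in \<open>auto simp: Pi_def subset_iff free_module_sel N.smult_l_distr\<close>)
    also have "\<dots> = (\<Oplus>\<^bsub>N\<^esub>x\<in>?X. p x \<odot>\<^bsub>N\<^esub> f x) \<oplus>\<^bsub>N\<^esub> (\<Oplus>\<^bsub>N\<^esub>x\<in>?X. q x \<odot>\<^bsub>N\<^esub> f x)"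
      using X f cp(1) cq(1) by (intro N.finsum_addf) (auto simp: Pi_def subset_iff)
    also have "\<dots> = linear_ext R N f p \<oplus>\<^bsub>N\<^esub> linear_ext R N f q"
      using linear_ext_superset[OF p X(1) _ X(2)] linear_ext_superset[OF q X(1) _ X(2)] by simp
    finally show ?thesis .
  qed
  show "linear_ext R N f (a \<odot>\<^bsub>free_module R S\<^esub> p) = a \<odot>\<^bsub>N\<^esub> linear_ext R N f p" if a: "a \<in> carrier R" for a
  proof -
    have "linear_ext R N f (a \<odot>\<^bsub>free_module R S\<^esub> p)
        = (\<Oplus>\<^bsub>N\<^esub>x\<in>{x. p x \<noteq> \<zero>\<^bsub>R\<^esub>}. (a \<odot>\<^bsub>free_module R S\<^esub> p) x \<odot>\<^bsub>N\<^esub> f x)"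
      by (rule linear_ext_superset[OF F.smult_closed[OF a p] cp(3) _ cp(4)]) (use a in \<open>auto simp: free_module_sel\<close>)
    also have "\<dots> = (\<Oplus>\<^bsub>N\<^esub>x\<in>{x. p x \<noteq> \<zero>\<^bsub>R\<^esub>}. a \<odot>\<^bsub>N\<^esub> (p x \<odot>\<^bsub>N\<^esub> f x))"
      by (rule N.finsum_cong') (use a f cp in \<open>auto simp: Pi_def free_module_sel N.smult_assoc1\<close>)
    also have "\<dots> = a \<odot>\<^bsub>N\<^esub> linear_ext R N f p"
      unfolding linear_ext_def
      by (rule N.finsum_smult_ldistr[symmetric]) (use a f cp in \<open>auto simp: Pi_def\<close>)
    finally show ?thesis .
  qed
qed

lemma linear_ext_mem:
  assumes "p \<in> carrier (free_module R S)" "submodule K R N"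
    and "\<And>x. p x \<noteq> \<zero>\<^bsub>R\<^esub> \<Longrightarrow> p x \<odot>\<^bsub>N\<^esub> f x \<in> K"
  shows "linear_ext R N f p \<in> K"
  unfolding linear_ext_def by (rule N.finsum_mem_submodule[OF assms(2)]) (use assms(3) in auto)

end

lemma free_module_maps_eq:
  assumes "module R N" "f \<in> linear_maps R (free_module R S) N" "g \<in> linear_maps R (free_module R S) N"
    and "\<And>x. x \<in> S \<Longrightarrow> f (basis R x) = g (basis R x)" and p: "p \<in> carrier (free_module R S)"
  shows "f p = g p"
proof -
  interpret F: module R "free_module R S" by (rule free_module_module)
  note z = linear_map_zero[OF F.module_axioms assms(1)]
  show ?thesis using p
    by (induction rule: free_module_induct)
      (simp_all only: assms(4) z[OF assms(2)] z[OF assms(3)] linear_mapsD[OF assms(2)] linear_mapsD[OF assms(3)])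
qed

text \<open>Well-definedness of lifts: an extension that kills \<open>K\<close> is constant on
  cosets, so the image inside \<open>linear_lift\<close> is a singleton and \<open>the_elem\<close>
  returns its element. Every lift out of a presentation below is reduced to this.\<close>

lemma linear_lift_coset:
  assumes N: "module R N" and f: "f \<in> S \<rightarrow> carrier N"
    and K: "submodule K R (free_module R S)" "\<And>p. p \<in> K \<Longrightarrow> linear_ext R N f p = \<zero>\<^bsub>N\<^esub>"
    and p: "p \<in> carrier (free_module R S)"
  shows "linear_lift R N f (K +>\<^bsub>free_module R S\<^esub> p) = linear_ext R N f p"
proof -
  interpret F: module R "free_module R S" by (rule free_module_module)
  interpret N: module R N by fact
  interpret K: abelian_subgroup K "free_module R S" by (rule F.submodule_abelian_subgroup[OF K(1)])
  note lin = linear_ext_linear[OF N f]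
  have "linear_ext R N f q = linear_ext R N f p" if "q \<in> K +>\<^bsub>free_module R S\<^esub> p" for q
  proof -
    have q: "q \<in> carrier (free_module R S)" using that p K.a_elemrcos_carrier by blast
    then have "linear_ext R N f (q \<ominus>\<^bsub>free_module R S\<^esub> p) = \<zero>\<^bsub>N\<^esub>"
      using F.mem_coset_iff[OF K(1) q p] that K(2) by simp
    then show ?thesis
      using linear_map_minus[OF F.module_axioms N lin q p] linear_mapsD(1)[OF lin] p q
        N.minus_eq_zero_iff by metis
  qed
  moreover have "p \<in> K +>\<^bsub>free_module R S\<^esub> p" using K.a_rcos_self[OF p] .
  ultimately have "linear_ext R N f ` (K +>\<^bsub>free_module R S\<^esub> p) = {linear_ext R N f p}" by blast
  then show ?thesis
    unfolding linear_lift_def linear_ext_def[abs_def] by simp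
qed

section \<open>Monoid algebras over a commutative ring\<close>

lemma monoid_algebra_sel:
  "carrier (monoid_algebra R G) = carrier (free_module R (carrier G))"
  "zero (monoid_algebra R G) = zero (free_module R (carrier G))"
  "add (monoid_algebra R G) = add (free_module R (carrier G))"
  "smult (monoid_algebra R G) = smult (free_module R (carrier G))"
  "one (monoid_algebra R G) = basis R \<one>\<^bsub>G\<^esub>"
  by (simp_all add: monoid_algebra_def free_module_def)

lemma linear_maps_monoid_algebra:
  "linear_maps R (monoid_algebra R G) N = linear_maps R (free_module R (carrier G)) N"
  by (simp add: linear_maps_def monoid_algebra_sel)

lemma monoid_algebra_module: "module R (monoid_algebra R G)"
  by (rule module_cong[OF free_module_module]) (simp_all add: monoid_algebra_sel)

context
  fixes G :: "('s, 'k) monoid_scheme" (structure)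
  assumes G: "comm_monoid G"
begin

interpretation G: comm_monoid G by (rule G)

abbreviation (input) "P \<equiv> monoid_algebra R G"

interpretation P: module R P by (rule monoid_algebra_module)

lemma monoid_algebra_mult_superset:
  assumes p: "p \<in> carrier P" and q: "q \<in> carrier P"
    and X: "finite X" "{x. p x \<noteq> \<zero>\<^bsub>R\<^esub>} \<subseteq> X" and Y: "finite Y" "{x. q x \<noteq> \<zero>\<^bsub>R\<^esub>} \<subseteq> Y"
  shows "(p \<otimes>\<^bsub>P\<^esub> q) z = (finsum R (\<lambda>(x, y). p x \<otimes>\<^bsub>R\<^esub> q y)
      ({(x, y). x \<in> X \<and> y \<in> Y \<and> x \<otimes>\<^bsub>G\<^esub> y = z}))"
proof -
  have cl: "p x \<in> carrier R" "q x \<in> carrier R" for x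
    using p q free_module_closed(1) by (auto simp: monoid_algebra_sel)
  have fin: "finite {(x, y). x \<in> X \<and> y \<in> Y \<and> x \<otimes>\<^bsub>G\<^esub> y = z}"
    by (rule finite_subset[of _ "X \<times> Y"]) (use X Y in auto)
  have "(p \<otimes>\<^bsub>P\<^esub> q) z = (finsum R (\<lambda>(x, y). p x \<otimes>\<^bsub>R\<^esub> q y)
      ({(x, y). p x \<noteq> \<zero>\<^bsub>R\<^esub> \<and> q y \<noteq> \<zero>\<^bsub>R\<^esub> \<and> x \<otimes>\<^bsub>G\<^esub> y = z}))"
    by (simp add: monoid_algebra_def)
  also have "\<dots> = (finsum R (\<lambda>(x, y). p x \<otimes>\<^bsub>R\<^esub> q y)
      ({(x, y). x \<in> X \<and> y \<in> Y \<and> x \<otimes>\<^bsub>G\<^esub> y = z}))"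
    by (rule add.finprod_mono_neutral_cong_left[OF fin]) (use X Y cl in auto)
  finally show ?thesis .
qed

lemma monoid_algebra_mult_closed:
  assumes p: "p \<in> carrier P" and q: "q \<in> carrier P"
  shows "p \<otimes>\<^bsub>P\<^esub> q \<in> carrier P"
proof -
  note cp = free_module_closed[OF p[unfolded monoid_algebra_sel]]
  note cq = free_module_closed[OF q[unfolded monoid_algebra_sel]]
  let ?Z = "(\<lambda>(x, y). x \<otimes>\<^bsub>G\<^esub> y) ` ({x. p x \<noteq> \<zero>\<^bsub>R\<^esub>} \<times> {x. q x \<noteq> \<zero>\<^bsub>R\<^esub>})"
  note eq = monoid_algebra_mult_superset[OF p q cp(3) order_refl cq(3) order_refl]
  have "(p \<otimes>\<^bsub>P\<^esub> q) z \<in> carrier R" for z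
    unfolding eq by (rule finsum_closed) (use cp(1) cq(1) in auto)
  moreover have "(p \<otimes>\<^bsub>P\<^esub> q) z = \<zero>\<^bsub>R\<^esub>" if "z \<notin> ?Z" for z
  proof -
    have "{(x, y). x \<in> {x. p x \<noteq> \<zero>\<^bsub>R\<^esub>} \<and> y \<in> {x. q x \<noteq> \<zero>\<^bsub>R\<^esub>} \<and> x \<otimes>\<^bsub>G\<^esub> y = z} = {}"
      using that by (auto simp: image_iff)
    then show ?thesis unfolding eq by (simp only: finsum_empty)
  qed
  then have "{z. (p \<otimes>\<^bsub>P\<^esub> q) z \<noteq> \<zero>\<^bsub>R\<^esub>} \<subseteq> ?Z" by blast
  moreover have "finite ?Z" "?Z \<subseteq> carrier G" using cp cq by auto
  ultimately show ?thesis
    unfolding monoid_algebra_sel free_module_sel using finite_subset by blast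
qed

lemma monoid_algebra_comm:
  assumes p: "p \<in> carrier P" and q: "q \<in> carrier P"
  shows "p \<otimes>\<^bsub>P\<^esub> q = q \<otimes>\<^bsub>P\<^esub> p"
proof (rule ext)
  fix z
  note cp = free_module_closed[OF p[unfolded monoid_algebra_sel]]
  note cq = free_module_closed[OF q[unfolded monoid_algebra_sel]]
  let ?T = "{(x, y). p x \<noteq> \<zero>\<^bsub>R\<^esub> \<and> q y \<noteq> \<zero>\<^bsub>R\<^esub> \<and> x \<otimes>\<^bsub>G\<^esub> y = z}"
  have T: "{(x, y). q x \<noteq> \<zero>\<^bsub>R\<^esub> \<and> p y \<noteq> \<zero>\<^bsub>R\<^esub> \<and> x \<otimes>\<^bsub>G\<^esub> y = z} = prod.swap ` ?T"
    using cp(2) cq(2) by (auto simp: G.m_comm image_iff)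
  have "(q \<otimes>\<^bsub>P\<^esub> p) z = finsum R (\<lambda>(x, y). q x \<otimes>\<^bsub>R\<^esub> p y) (prod.swap ` ?T)"
    unfolding T[symmetric] by (simp add: monoid_algebra_def)
  also have "\<dots> = (\<Oplus>\<^bsub>R\<^esub>t \<in> ?T. (case prod.swap t of (x, y) \<Rightarrow> q x \<otimes>\<^bsub>R\<^esub> p y))"
    by (rule finsum_reindex) (use cp(1) cq(1) in auto)
  also have "\<dots> = (finsum R (\<lambda>(x, y). p x \<otimes>\<^bsub>R\<^esub> q y)
      (?T))"
    by (rule finsum_cong') (use cp(1) cq(1) in \<open>auto simp: m_comm\<close>)
  also have "\<dots> = (p \<otimes>\<^bsub>P\<^esub> q) z" by (simp add: monoid_algebra_def)
  finally show "(p \<otimes>\<^bsub>P\<^esub> q) z = (q \<otimes>\<^bsub>P\<^esub> p) z" by simp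
qed

lemma monoid_algebra_l_distr:
  assumes p: "p \<in> carrier P" and p': "p' \<in> carrier P" and q: "q \<in> carrier P"
  shows "(p \<oplus>\<^bsub>P\<^esub> p') \<otimes>\<^bsub>P\<^esub> q = p \<otimes>\<^bsub>P\<^esub> q \<oplus>\<^bsub>P\<^esub> p' \<otimes>\<^bsub>P\<^esub> q"
proof (rule ext)
  fix z
  note cp = free_module_closed[OF p[unfolded monoid_algebra_sel]]
  note cp' = free_module_closed[OF p'[unfolded monoid_algebra_sel]]
  note cq = free_module_closed[OF q[unfolded monoid_algebra_sel]]
  let ?X = "{x. p x \<noteq> \<zero>\<^bsub>R\<^esub>} \<union> {x. p' x \<noteq> \<zero>\<^bsub>R\<^esub>}" and ?Y = "{x. q x \<noteq> \<zero>\<^bsub>R\<^esub>}"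
  let ?T = "{(x, y). x \<in> ?X \<and> y \<in> ?Y \<and> x \<otimes>\<^bsub>G\<^esub> y = z}"
  have X: "finite ?X" "finite ?Y" using cp cp' cq by auto
  have "((p \<oplus>\<^bsub>P\<^esub> p') \<otimes>\<^bsub>P\<^esub> q) z = (finsum R (\<lambda>(x, y). (p \<oplus>\<^bsub>P\<^esub> p') x \<otimes>\<^bsub>R\<^esub> q y)
      (?T))"
    by (rule monoid_algebra_mult_superset[OF P.a_closed[OF p p'] q X(1) _ X(2)])
      (auto simp: monoid_algebra_sel free_module_sel)
  also have "\<dots> = (\<Oplus>\<^bsub>R\<^esub>t \<in> ?T. (case t of (x, y) \<Rightarrow> p x \<otimes>\<^bsub>R\<^esub> q y) \<oplus>\<^bsub>R\<^esub> (case t of (x, y) \<Rightarrow> p' x \<otimes>\<^bsub>R\<^esub> q y))"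
    by (rule finsum_cong')
      (use cp(1) cp'(1) cq(1) in \<open>auto simp: monoid_algebra_sel free_module_sel l_distr\<close>)
  also have "\<dots> = (finsum R (\<lambda>(x, y). p x \<otimes>\<^bsub>R\<^esub> q y)
      (?T)) \<oplus>\<^bsub>R\<^esub> (finsum R (\<lambda>(x, y). p' x \<otimes>\<^bsub>R\<^esub> q y)
      (?T))"
    by (rule finsum_addf) (use cp(1) cp'(1) cq(1) in auto)
  also have "\<dots> = (p \<otimes>\<^bsub>P\<^esub> q) z \<oplus>\<^bsub>R\<^esub> (p' \<otimes>\<^bsub>P\<^esub> q) z"
    using monoid_algebra_mult_superset[OF p q X(1) _ X(2)] monoid_algebra_mult_superset[OF p' q X(1) _ X(2)]
    by simp
  finally show "((p \<oplus>\<^bsub>P\<^esub> p') \<otimes>\<^bsub>P\<^esub> q) z = (p \<otimes>\<^bsub>P\<^esub> q \<oplus>\<^bsub>P\<^esub> p' \<otimes>\<^bsub>P\<^esub> q) z"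
    by (simp add: monoid_algebra_sel free_module_sel)
qed

lemma monoid_algebra_smult_assoc:
  assumes a: "a \<in> carrier R" and p: "p \<in> carrier P" and q: "q \<in> carrier P"
  shows "(a \<odot>\<^bsub>P\<^esub> p) \<otimes>\<^bsub>P\<^esub> q = a \<odot>\<^bsub>P\<^esub> (p \<otimes>\<^bsub>P\<^esub> q)"
proof (rule ext)
  fix z
  note cp = free_module_closed[OF p[unfolded monoid_algebra_sel]]
  note cq = free_module_closed[OF q[unfolded monoid_algebra_sel]]
  let ?X = "{x. p x \<noteq> \<zero>\<^bsub>R\<^esub>}" and ?Y = "{x. q x \<noteq> \<zero>\<^bsub>R\<^esub>}"
  let ?T = "{(x, y). x \<in> ?X \<and> y \<in> ?Y \<and> x \<otimes>\<^bsub>G\<^esub> y = z}"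
  have fin: "finite ?T"
    by (rule finite_subset[of _ "?X \<times> ?Y"]) (use cp(3) cq(3) in auto)
  have "((a \<odot>\<^bsub>P\<^esub> p) \<otimes>\<^bsub>P\<^esub> q) z = (finsum R (\<lambda>(x, y). (a \<odot>\<^bsub>P\<^esub> p) x \<otimes>\<^bsub>R\<^esub> q y)
      (?T))"
    by (rule monoid_algebra_mult_superset[OF P.smult_closed[OF a p] q cp(3) _ cq(3)])
      (use a in \<open>auto simp: monoid_algebra_sel free_module_sel\<close>)
  also have "\<dots> = (\<Oplus>\<^bsub>R\<^esub>t \<in> ?T. a \<otimes>\<^bsub>R\<^esub> (case t of (x, y) \<Rightarrow> p x \<otimes>\<^bsub>R\<^esub> q y))"
    by (rule finsum_cong')
      (use a cp(1) cq(1) in \<open>auto simp: monoid_algebra_sel free_module_sel m_assoc\<close>)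
  also have "\<dots> = a \<otimes>\<^bsub>R\<^esub> (finsum R (\<lambda>(x, y). p x \<otimes>\<^bsub>R\<^esub> q y)
      (?T))"
    by (rule finsum_rdistr[symmetric]) (use fin a cp(1) cq(1) in auto)
  also have "\<dots> = a \<otimes>\<^bsub>R\<^esub> (p \<otimes>\<^bsub>P\<^esub> q) z"
    using monoid_algebra_mult_superset[OF p q cp(3) _ cq(3)] by simp
  finally show "((a \<odot>\<^bsub>P\<^esub> p) \<otimes>\<^bsub>P\<^esub> q) z = (a \<odot>\<^bsub>P\<^esub> (p \<otimes>\<^bsub>P\<^esub> q)) z"
    by (simp add: monoid_algebra_sel free_module_sel)
qed

lemma monoid_algebra_basis_closed: "x \<in> carrier G \<Longrightarrow> basis R x \<in> carrier P"
  unfolding monoid_algebra_sel by (rule basis_closed)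

lemma monoid_algebra_mult_basis:
  assumes x: "x \<in> carrier G" and y: "y \<in> carrier G"
  shows "basis R x \<otimes>\<^bsub>P\<^esub> basis R y = basis R (x \<otimes>\<^bsub>G\<^esub> y)"
proof (rule ext)
  fix z
  have "(basis R x \<otimes>\<^bsub>P\<^esub> basis R y) z = (finsum R (\<lambda>(u, v). basis R x u \<otimes>\<^bsub>R\<^esub> basis R y v)
      ({(u, v). u \<in> {x} \<and> v \<in> {y} \<and> u \<otimes>\<^bsub>G\<^esub> v = z}))"
    by (rule monoid_algebra_mult_superset[OF monoid_algebra_basis_closed[OF x] monoid_algebra_basis_closed[OF y]])
      (simp_all add: basis_supp)
  also have "{(u, v). u \<in> {x} \<and> v \<in> {y} \<and> u \<otimes>\<^bsub>G\<^esub> v = z} = (if z = x \<otimes>\<^bsub>G\<^esub> y then {(x, y)} else {})"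
    by auto
  also have "(finsum R (\<lambda>(u, v). basis R x u \<otimes>\<^bsub>R\<^esub> basis R y v)
      ((if z = x \<otimes>\<^bsub>G\<^esub> y then {(x, y)} else {})))
      = basis R (x \<otimes>\<^bsub>G\<^esub> y) z"
    by (simp add: basis_def)
  finally show "(basis R x \<otimes>\<^bsub>P\<^esub> basis R y) z = basis R (x \<otimes>\<^bsub>G\<^esub> y) z" .
qed

lemmas monoid_algebra_induct [consumes 1, case_names zero basis smult add] =
  free_module_induct[of _ "carrier G", folded monoid_algebra_sel(1-4)[of G]]

lemma monoid_algebra_r_distr:
  "p \<in> carrier P \<Longrightarrow> q \<in> carrier P \<Longrightarrow> q' \<in> carrier P \<Longrightarrow>
    p \<otimes>\<^bsub>P\<^esub> (q \<oplus>\<^bsub>P\<^esub> q') = p \<otimes>\<^bsub>P\<^esub> q \<oplus>\<^bsub>P\<^esub> p \<otimes>\<^bsub>P\<^esub> q'"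
  using monoid_algebra_comm monoid_algebra_l_distr P.a_closed by metis

lemma monoid_algebra_smult_assoc2:
  "a \<in> carrier R \<Longrightarrow> p \<in> carrier P \<Longrightarrow> q \<in> carrier P \<Longrightarrow> p \<otimes>\<^bsub>P\<^esub> (a \<odot>\<^bsub>P\<^esub> q) = a \<odot>\<^bsub>P\<^esub> (p \<otimes>\<^bsub>P\<^esub> q)"
  using monoid_algebra_comm monoid_algebra_smult_assoc P.smult_closed by metis

lemma monoid_algebra_zero_mult: "p \<in> carrier P \<Longrightarrow> \<zero>\<^bsub>P\<^esub> \<otimes>\<^bsub>P\<^esub> p = \<zero>\<^bsub>P\<^esub>"
  using monoid_algebra_smult_assoc[of "\<zero>\<^bsub>R\<^esub>" "\<zero>\<^bsub>P\<^esub>" p] P.smult_l_null monoid_algebra_mult_closed P.zero_closed zero_closed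
  by metis

lemma monoid_algebra_mult_zero: "p \<in> carrier P \<Longrightarrow> p \<otimes>\<^bsub>P\<^esub> \<zero>\<^bsub>P\<^esub> = \<zero>\<^bsub>P\<^esub>"
  using monoid_algebra_comm monoid_algebra_zero_mult P.zero_closed by metis

text \<open>Both sides are additive and homogeneous in each argument, so the three arguments are
  reduced to basis elements one at a time, where associativity is that of the monoid. No triple
  convolution sum is ever written down.\<close>

lemma monoid_algebra_assoc:
  assumes p: "p \<in> carrier P" and q: "q \<in> carrier P" and r: "r \<in> carrier P"
  shows "p \<otimes>\<^bsub>P\<^esub> q \<otimes>\<^bsub>P\<^esub> r = p \<otimes>\<^bsub>P\<^esub> (q \<otimes>\<^bsub>P\<^esub> r)"
proof -
  note rules = monoid_algebra_zero_mult monoid_algebra_mult_zero monoid_algebra_l_distr monoid_algebra_r_distr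
    monoid_algebra_smult_assoc monoid_algebra_smult_assoc2 monoid_algebra_mult_closed
    monoid_algebra_basis_closed P.a_closed P.smult_closed P.zero_closed
  have 1: "p \<otimes>\<^bsub>P\<^esub> basis R y \<otimes>\<^bsub>P\<^esub> basis R z = p \<otimes>\<^bsub>P\<^esub> (basis R y \<otimes>\<^bsub>P\<^esub> basis R z)"
    if "y \<in> carrier G" "z \<in> carrier G" for y z
    using p that
    by (induction rule: monoid_algebra_induct)
      (simp_all add: rules monoid_algebra_mult_basis G.m_assoc)
  have 2: "p \<otimes>\<^bsub>P\<^esub> q \<otimes>\<^bsub>P\<^esub> basis R z = p \<otimes>\<^bsub>P\<^esub> (q \<otimes>\<^bsub>P\<^esub> basis R z)" if "z \<in> carrier G" for z
    using q that
    by (induction rule: monoid_algebra_induct) (simp_all add: rules 1 p)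
  show ?thesis using r by (induction rule: monoid_algebra_induct) (simp_all add: rules 2 p q)
qed

lemma monoid_algebra_algebra: "algebra R P"
proof (rule algebraI)
  have one: "\<one>\<^bsub>P\<^esub> \<otimes>\<^bsub>P\<^esub> p = p" if "p \<in> carrier P" for p
    using that
    by (induction rule: monoid_algebra_induct)
      (simp_all add: monoid_algebra_sel(5) monoid_algebra_mult_zero monoid_algebra_r_distr monoid_algebra_smult_assoc2
        monoid_algebra_mult_basis monoid_algebra_basis_closed)
  have oneC: "\<one>\<^bsub>P\<^esub> \<in> carrier P" by (simp add: monoid_algebra_sel(5) monoid_algebra_basis_closed)
  show "cring P"
    by (rule cringI[OF P.abelian_group_axioms comm_monoidI[OF monoid_algebra_mult_closed oneC
          monoid_algebra_assoc one monoid_algebra_comm] monoid_algebra_l_distr])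
qed (simp_all add: is_cring P.smult_l_distr P.smult_r_distr P.smult_assoc1 monoid_algebra_smult_assoc)

lemma linear_ext_algebra_map:
  assumes N: "algebra R N" and f: "f \<in> carrier G \<rightarrow> carrier N" "f \<one>\<^bsub>G\<^esub> = \<one>\<^bsub>N\<^esub>"
    "\<And>x y. x \<in> carrier G \<Longrightarrow> y \<in> carrier G \<Longrightarrow> f (x \<otimes>\<^bsub>G\<^esub> y) = f x \<otimes>\<^bsub>N\<^esub> f y"
  shows "linear_ext R N f \<in> algebra_maps R P N"
proof (rule algebra_mapsI)
  interpret N: algebra R N by fact
  let ?h = "linear_ext R N f"
  show lin: "?h \<in> linear_maps R P N"
    unfolding linear_maps_monoid_algebra by (rule linear_ext_linear[OF N.module f(1)])
  have h: "?h (basis R x) = f x" if "x \<in> carrier G" for x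
    by (rule linear_ext_basis[OF N.module f(1) that])
  note z = linear_map_zero[OF P.module_axioms N.module lin]
  note l = linear_mapsD[OF lin]
  have s2: "x \<otimes>\<^bsub>N\<^esub> (a \<odot>\<^bsub>N\<^esub> y) = a \<odot>\<^bsub>N\<^esub> (x \<otimes>\<^bsub>N\<^esub> y)"
    if "a \<in> carrier R" "x \<in> carrier N" "y \<in> carrier N" for a x y
    using that N.smult_assoc2 N.m_comm N.smult_closed by metis
  show "?h \<one>\<^bsub>P\<^esub> = \<one>\<^bsub>N\<^esub>" by (simp add: monoid_algebra_sel h f)
  note rules = monoid_algebra_zero_mult monoid_algebra_mult_zero monoid_algebra_l_distr monoid_algebra_r_distr
    monoid_algebra_smult_assoc monoid_algebra_smult_assoc2 monoid_algebra_mult_closed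
    monoid_algebra_basis_closed z l N.l_distr N.r_distr N.smult_assoc2 s2
  fix p q assume p: "p \<in> carrier P" and q: "q \<in> carrier P"
  have 1: "?h (p \<otimes>\<^bsub>P\<^esub> basis R y) = ?h p \<otimes>\<^bsub>N\<^esub> f y" if "y \<in> carrier G" for y
    using p that f(1)
    by (induction rule: monoid_algebra_induct) (simp_all add: rules h f monoid_algebra_mult_basis Pi_def)
  show "?h (p \<otimes>\<^bsub>P\<^esub> q) = ?h p \<otimes>\<^bsub>N\<^esub> ?h q"
    using q p by (induction rule: monoid_algebra_induct) (simp_all add: rules h 1)
qed

end

end

lemma free_comm_monoid_comm_monoid: "comm_monoid (free_comm_monoid S)"
  by (rule comm_monoidI) (auto simp: free_comm_monoid_def)

text \<open>Multiplication by a variable shifts coefficients along \<open>add_mset s\<close>. This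
  yields cancellation of variables and the splitting of a polynomial by divisibility by its last
  variable.\<close>

lemma (in cring) variable_mult_apply:
  fixes s :: 's
  assumes q: "q \<in> carrier (monoid_algebra R (free_comm_monoid UNIV))"
  shows "(basis R {#s#} \<otimes>\<^bsub>monoid_algebra R (free_comm_monoid UNIV)\<^esub> q) u
    = (if s \<in># u then q (u - {#s#}) else \<zero>)"
proof -
  let ?P = "monoid_algebra R (free_comm_monoid (UNIV :: 's set))"
  note G = free_comm_monoid_comm_monoid[of "UNIV :: 's set"]
  note cq = free_module_closed[OF q[unfolded monoid_algebra_sel]]
  have b: "basis R {#s#} \<in> carrier ?P"
    by (rule monoid_algebra_basis_closed[OF G]) (simp add: free_comm_monoid_def)
  \<comment> \<open>The index \<open>u - {#s#}\<close> is inserted into the support so that the set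
    of contributing pairs has one element whenever \<open>s\<close> occurs in \<open>u\<close>, even
    if the coefficient there is zero.\<close>
  have "(basis R {#s#} \<otimes>\<^bsub>?P\<^esub> q) u = (finsum R (\<lambda>(x, y). basis R {#s#} x \<otimes> q y)
      ({(x, y). x \<in> {{#s#}} \<and> y \<in> insert (u - {#s#}) {x. q x \<noteq> \<zero>}
      \<and> x \<otimes>\<^bsub>free_comm_monoid UNIV\<^esub> y = u}))"
    by (rule monoid_algebra_mult_superset[OF G b q]) (use cq(3) basis_supp[of "{#s#}"] in auto)
  also have "{(x, y). x \<in> {{#s#}} \<and> y \<in> insert (u - {#s#}) {x. q x \<noteq> \<zero>} \<and> x \<otimes>\<^bsub>free_comm_monoid UNIV\<^esub> y = u}
      = (if s \<in># u then {({#s#}, u - {#s#})} else {})"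
    by (auto simp: free_comm_monoid_def)
  finally show ?thesis using cq(1) by (auto simp: basis_def)
qed

section \<open>Algebras given by a ring homomorphism\<close>

lemma algebra_via_sel [simp]:
  "carrier (algebra_via h S) = carrier S" "monoid.mult (algebra_via h S) = monoid.mult S"
  "one (algebra_via h S) = one S" "zero (algebra_via h S) = zero S" "add (algebra_via h S) = add S"
  "smult (algebra_via h S) = (\<lambda>a x. h a \<otimes>\<^bsub>S\<^esub> x)"
  by (simp_all add: algebra_via_def)

lemma algebra_via_algebra:
  assumes R: "cring R" and S: "cring S" and h: "h \<in> ring_hom R S"
  shows "algebra R (algebra_via h S)"
proof -
  interpret R: cring R by fact
  interpret S: cring S by fact
  show ?thesis
    by (rule algebraI[OF R cring_cong[OF S]])
      (simp_all add: ring_hom_closed[OF h] ring_hom_add[OF h] ring_hom_mult[OF h] ring_hom_one[OF h]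
        S.l_distr S.r_distr S.m_assoc)
qed

lemma regular_module_algebra: "cring R \<Longrightarrow> algebra R (regular_module R)"
  by (rule algebra_via_algebra) (auto simp: ring_hom_def)

lemma (in algebra) unit_hom: "(\<lambda>a. a \<odot>\<^bsub>M\<^esub> \<one>\<^bsub>M\<^esub>) \<in> ring_hom R M"
  by (rule ring_hom_memI) (simp_all add: smult_l_distr smult_assoc1 smult_assoc2)

lemma (in algebra) unit_hom_smult: "a \<in> carrier R \<Longrightarrow> x \<in> carrier M \<Longrightarrow> (a \<odot>\<^bsub>M\<^esub> \<one>\<^bsub>M\<^esub>) \<otimes>\<^bsub>M\<^esub> x = a \<odot>\<^bsub>M\<^esub> x"
  by (simp add: smult_assoc2)

lemma (in algebra) smult_mult_right:
  "a \<in> carrier R \<Longrightarrow> x \<in> carrier M \<Longrightarrow> y \<in> carrier M \<Longrightarrow> x \<otimes>\<^bsub>M\<^esub> (a \<odot>\<^bsub>M\<^esub> y) = a \<odot>\<^bsub>M\<^esub> (x \<otimes>\<^bsub>M\<^esub> y)"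
  by (metis smult_assoc2 m_comm smult_closed)

text \<open>Restriction of scalars along the unit map from \<open>R\<close> to \<open>M\<close>.
  Both \<open>LB\<close> and the coordinate ring \<open>Q\<close> receive their structure over the
  ground ring through \<open>LA\<close> in this way.\<close>

lemma (in algebra) via_unit_algebra:
  assumes S: "cring S" and h: "h \<in> ring_hom M S"
  shows "algebra R (algebra_via (\<lambda>a. h (a \<odot>\<^bsub>M\<^esub> \<one>\<^bsub>M\<^esub>)) S)"
    and "h \<in> algebra_maps R M (algebra_via (\<lambda>a. h (a \<odot>\<^bsub>M\<^esub> \<one>\<^bsub>M\<^esub>)) S)"
proof -
  have "(\<lambda>a. h (a \<odot>\<^bsub>M\<^esub> \<one>\<^bsub>M\<^esub>)) \<in> ring_hom R S"
    using ring_hom_trans[OF unit_hom h] by (simp add: comp_def)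
  then show "algebra R (algebra_via (\<lambda>a. h (a \<odot>\<^bsub>M\<^esub> \<one>\<^bsub>M\<^esub>)) S)"
    by (rule algebra_via_algebra[OF R.is_cring S])
  show "h \<in> algebra_maps R M (algebra_via (\<lambda>a. h (a \<odot>\<^bsub>M\<^esub> \<one>\<^bsub>M\<^esub>)) S)"
  proof (intro algebra_mapsI linear_mapsI)
    fix a x assume "a \<in> carrier R" "x \<in> carrier M"
    then show "h (a \<odot>\<^bsub>M\<^esub> x) = a \<odot>\<^bsub>algebra_via (\<lambda>a. h (a \<odot>\<^bsub>M\<^esub> \<one>\<^bsub>M\<^esub>)) S\<^esub> h x"
      using ring_hom_mult[OF h, of "a \<odot>\<^bsub>M\<^esub> \<one>\<^bsub>M\<^esub>" x] by (simp add: unit_hom_smult)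
  qed (simp_all add: ring_hom_closed[OF h] ring_hom_add[OF h] ring_hom_one[OF h] ring_hom_mult[OF h])
qed

text \<open>The body agrees with the function lifted inside \<open>sym_lift\<close>, so that an
  algebra map out of a symmetric algebra becomes a \<open>linear_lift\<close> of a monoid
  homomorphism from multisets. Evaluation of polynomials uses the same function.\<close>

definition monomial :: "('b, 'n) monoid_scheme \<Rightarrow> ('s \<Rightarrow> 'b) \<Rightarrow> 's multiset \<Rightarrow> 'b" where
  "monomial N g u = (\<Otimes>\<^bsub>N\<^esub>x \<in> set_mset u. g x [^]\<^bsub>N\<^esub> count u x)"

lemma free_comm_monoid_sel [simp]:
  "u \<in> carrier (free_comm_monoid S) \<longleftrightarrow> set_mset u \<subseteq> S" "\<one>\<^bsub>free_comm_monoid S\<^esub> = {#}"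
  "u \<otimes>\<^bsub>free_comm_monoid S\<^esub> v = u + v"
  by (simp_all add: free_comm_monoid_def)

context comm_monoid
begin

lemma monomial_single: "g x \<in> carrier G \<Longrightarrow> monomial G g {#x#} = g x"
  by (simp add: monomial_def)

context
  fixes g :: "'s \<Rightarrow> 'a" and S :: "'s set"
  assumes g: "g \<in> S \<rightarrow> carrier G"
begin

lemma monomial_superset:
  assumes "finite X" "set_mset u \<subseteq> X" "X \<subseteq> S"
  shows "monomial G g u = (\<Otimes>x \<in> X. g x [^] count u x)"
  unfolding monomial_def
  by (rule finprod_mono_neutral_cong_left) (use assms g in \<open>auto simp: not_in_iff\<close>)

lemma monomial_hom:
  "monomial G g \<in> carrier (free_comm_monoid S) \<rightarrow> carrier G"
  "monomial G g \<one>\<^bsub>free_comm_monoid S\<^esub> = \<one>"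
  "u \<in> carrier (free_comm_monoid S) \<Longrightarrow> v \<in> carrier (free_comm_monoid S) \<Longrightarrow>
    monomial G g (u \<otimes>\<^bsub>free_comm_monoid S\<^esub> v) = monomial G g u \<otimes> monomial G g v"
proof -
  have gc: "x \<in> S \<Longrightarrow> g x \<in> carrier G" for x using g by blast
  show "monomial G g \<in> carrier (free_comm_monoid S) \<rightarrow> carrier G"
    by (auto simp: monomial_def intro!: finprod_closed nat_pow_closed gc)
  show "monomial G g \<one>\<^bsub>free_comm_monoid S\<^esub> = \<one>" by (simp add: monomial_def)
  assume u: "u \<in> carrier (free_comm_monoid S)" and v: "v \<in> carrier (free_comm_monoid S)"
  let ?X = "set_mset u \<union> set_mset v"
  have X: "finite ?X" "?X \<subseteq> S" using u v by auto
  have "monomial G g (u + v) = (\<Otimes>x \<in> ?X. g x [^] count (u + v) x)"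
    by (rule monomial_superset) (use X in auto)
  also have "\<dots> = (\<Otimes>x \<in> ?X. g x [^] count u x \<otimes> g x [^] count v x)"
    by (rule finprod_cong') (use X gc in \<open>auto simp: nat_pow_mult subset_iff\<close>)
  also have "\<dots> = (\<Otimes>x \<in> ?X. g x [^] count u x) \<otimes> (\<Otimes>x \<in> ?X. g x [^] count v x)"
    by (rule finprod_multf) (use X gc in \<open>auto simp: subset_iff\<close>)
  also have "\<dots> = monomial G g u \<otimes> monomial G g v"
    using monomial_superset[of ?X] X by simp
  finally show "monomial G g (u \<otimes>\<^bsub>free_comm_monoid S\<^esub> v) = monomial G g u \<otimes> monomial G g v" by simp
qed

end

end

context cring
begin

context
  fixes G :: "('s, 'k) monoid_scheme" and gens :: "('s \<Rightarrow> 'a) set"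
  assumes G: "comm_monoid G" and gens: "gens \<subseteq> carrier (monoid_algebra R G)"
begin

interpretation P: algebra R "monoid_algebra R G" by (rule monoid_algebra_algebra[OF G])

abbreviation (input) "K \<equiv> Idl\<^bsub>monoid_algebra R G\<^esub> gens"

lemma genideal_monoid_algebra: "ideal K (monoid_algebra R G)"
  by (rule P.genideal_ideal[OF gens])

text \<open>Here \<open>f\<close> need not be multiplicative, at the price that vanishing is
  required on the whole ideal. This is the form needed for cofaces and for the cobar
  differential.\<close>

lemma linear_lift_monoid_algebra:
  assumes N: "module R N" and f: "f \<in> carrier G \<rightarrow> carrier N"
    and K: "\<And>p. p \<in> K \<Longrightarrow> linear_ext R N f p = \<zero>\<^bsub>N\<^esub>"
    and p: "p \<in> carrier (monoid_algebra R G)"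
  shows "linear_lift R N f (K +>\<^bsub>monoid_algebra R G\<^esub> p) = linear_ext R N f p"
proof -
  have "submodule K R (monoid_algebra R G)" by (rule P.ideal_submodule[OF genideal_monoid_algebra])
  then have sub: "submodule K R (free_module R (carrier G))"
    by (simp add: submodule_def submodule_axioms_def monoid_algebra_sel)
  have "K +>\<^bsub>monoid_algebra R G\<^esub> p = K +>\<^bsub>free_module R (carrier G)\<^esub> p"
    by (simp add: a_r_coset_def' monoid_algebra_sel)
  then show ?thesis
    using linear_lift_coset[OF N f sub K] p by (simp add: monoid_algebra_sel)
qed

text \<open>For multiplicative \<open>f\<close> the kernel of the extension is an ideal, so
  vanishing on the generators of the relation ideal is enough.\<close>

lemma monoid_algebra_quotient_lift:
  assumes N: "algebra R N" and f: "f \<in> carrier G \<rightarrow> carrier N" "f \<one>\<^bsub>G\<^esub> = \<one>\<^bsub>N\<^esub>"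
    "\<And>x y. x \<in> carrier G \<Longrightarrow> y \<in> carrier G \<Longrightarrow> f (x \<otimes>\<^bsub>G\<^esub> y) = f x \<otimes>\<^bsub>N\<^esub> f y"
    and gen0: "\<And>p. p \<in> gens \<Longrightarrow> linear_ext R N f p = \<zero>\<^bsub>N\<^esub>"
  shows "p \<in> carrier (monoid_algebra R G) \<Longrightarrow>
      linear_lift R N f (K +>\<^bsub>monoid_algebra R G\<^esub> p) = linear_ext R N f p"
    and "linear_lift R N f \<in> algebra_maps R (quotient_module (monoid_algebra R G) K) N"
proof -
  interpret N: algebra R N by fact
  let ?h = "linear_ext R N f"
  note h = linear_ext_algebra_map[OF G N f]
  have "K \<subseteq> {p \<in> carrier (monoid_algebra R G). ?h p = \<zero>\<^bsub>N\<^esub>}"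
    by (rule P.genideal_minimal[OF P.kernel_ideal[OF N h]]) (use gens gen0 in auto)
  then have K: "?h p = \<zero>\<^bsub>N\<^esub>" if "p \<in> K" for p using that by auto
  show eq: "linear_lift R N f (K +>\<^bsub>monoid_algebra R G\<^esub> p) = ?h p"
    if "p \<in> carrier (monoid_algebra R G)" for p
    by (rule linear_lift_monoid_algebra[OF N.module f(1) K that])
  let ?Q = "quotient_module (monoid_algebra R G) K"
  note q = P.quotient_algebra(2)[OF genideal_monoid_algebra]
  note q' = algebra_mapsD(3-6)[OF q, symmetric] and h' = algebra_mapsD[OF h]
  show "linear_lift R N f \<in> algebra_maps R ?Q N"
  proof (intro algebra_mapsI linear_mapsI)
    show "linear_lift R N f \<one>\<^bsub>?Q\<^esub> = \<one>\<^bsub>N\<^esub>" by (simp only: q'(3) eq[OF P.one_closed] h')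
  qed (auto elim!: quotient_carrierE simp: q' eq h')
qed

end

section \<open>Symmetric algebras\<close>

context
  fixes M :: "('a, 'c, 'n) module_scheme"
  assumes M: "module R M"
begin

interpretation M: module R M by (rule M)

abbreviation (input) "PM \<equiv> poly_algebra R M"

interpretation P: algebra R PM by (rule monoid_algebra_algebra[OF free_comm_monoid_comm_monoid])

definition "sym_rel =
  {basis R {#x \<oplus>\<^bsub>M\<^esub> y#} \<ominus>\<^bsub>PM\<^esub> (basis R {#x#} \<oplus>\<^bsub>PM\<^esub> basis R {#y#}) | x y. x \<in> carrier M \<and> y \<in> carrier M}
  \<union> {basis R {#a \<odot>\<^bsub>M\<^esub> x#} \<ominus>\<^bsub>PM\<^esub> a \<odot>\<^bsub>PM\<^esub> basis R {#x#} | a x. a \<in> carrier R \<and> x \<in> carrier M}"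

lemma basis_PM: "set_mset u \<subseteq> carrier M \<Longrightarrow> basis R u \<in> carrier PM"
  by (rule monoid_algebra_basis_closed[OF free_comm_monoid_comm_monoid]) simp

lemma sym_rel_closed: "sym_rel \<subseteq> carrier PM"
  by (auto simp: sym_rel_def basis_PM)

lemma sym_ideal_eq: "sym_ideal R M = Idl\<^bsub>PM\<^esub> sym_rel"
  by (simp add: sym_ideal_def sym_rel_def Let_def)

lemma sym_ideal_ideal: "ideal (sym_ideal R M) PM"
  unfolding sym_ideal_eq by (rule genideal_monoid_algebra[OF free_comm_monoid_comm_monoid sym_rel_closed])

lemma sym_algebra_algebra: "algebra R (sym_algebra R M)"
  unfolding sym_algebra_def by (rule P.quotient_algebra(1)[OF sym_ideal_ideal])

lemma sym_coset_map: "(\<lambda>p. sym_ideal R M +>\<^bsub>PM\<^esub> p) \<in> algebra_maps R PM (sym_algebra R M)"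
  unfolding sym_algebra_def by (rule P.quotient_algebra(2)[OF sym_ideal_ideal])

lemma sym_carrierE:
  assumes "X \<in> carrier (sym_algebra R M)"
  obtains p where "p \<in> carrier PM" "X = sym_ideal R M +>\<^bsub>PM\<^esub> p"
  using assms unfolding sym_algebra_def by (rule quotient_carrierE)

lemma sym_incl_linear: "sym_incl R M \<in> linear_maps R M (sym_algebra R M)"
proof (rule linear_mapsI)
  note sub = P.ideal_submodule[OF sym_ideal_ideal]
  have rel: "p \<in> sym_ideal R M" if "p \<in> sym_rel" for p
    unfolding sym_ideal_eq using P.genideal_self[OF sym_rel_closed] that by blast
  note c = algebra_mapsD[OF sym_coset_map]
  show "sym_incl R M x \<in> carrier (sym_algebra R M)" if "x \<in> carrier M" for x
    unfolding sym_incl_def by (rule c(2)) (use that in \<open>simp add: basis_PM\<close>)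
  show "sym_incl R M (x \<oplus>\<^bsub>M\<^esub> y) = sym_incl R M x \<oplus>\<^bsub>sym_algebra R M\<^esub> sym_incl R M y"
    if "x \<in> carrier M" "y \<in> carrier M" for x y
  proof -
    have "basis R {#x \<oplus>\<^bsub>M\<^esub> y#} \<ominus>\<^bsub>PM\<^esub> (basis R {#x#} \<oplus>\<^bsub>PM\<^esub> basis R {#y#}) \<in> sym_ideal R M"
      by (rule rel) (use that in \<open>auto simp: sym_rel_def\<close>)
    then have "sym_incl R M (x \<oplus>\<^bsub>M\<^esub> y) = sym_ideal R M +>\<^bsub>PM\<^esub> (basis R {#x#} \<oplus>\<^bsub>PM\<^esub> basis R {#y#})"
      unfolding sym_incl_def using that by (simp add: P.coset_eq_iff[OF sub] basis_PM)
    then show ?thesis using that by (simp add: sym_incl_def c(3) basis_PM)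
  qed
  show "sym_incl R M (a \<odot>\<^bsub>M\<^esub> x) = a \<odot>\<^bsub>sym_algebra R M\<^esub> sym_incl R M x"
    if "a \<in> carrier R" "x \<in> carrier M" for a x
  proof -
    have "basis R {#a \<odot>\<^bsub>M\<^esub> x#} \<ominus>\<^bsub>PM\<^esub> a \<odot>\<^bsub>PM\<^esub> basis R {#x#} \<in> sym_ideal R M"
      by (rule rel) (use that in \<open>auto simp: sym_rel_def\<close>)
    then have "sym_incl R M (a \<odot>\<^bsub>M\<^esub> x) = sym_ideal R M +>\<^bsub>PM\<^esub> (a \<odot>\<^bsub>PM\<^esub> basis R {#x#})"
      unfolding sym_incl_def using that by (simp add: P.coset_eq_iff[OF sub] basis_PM)
    then show ?thesis using that by (simp add: sym_incl_def c(4) basis_PM)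
  qed
qed

lemma sym_basis_add_mset:
  assumes "x \<in> carrier M" "set_mset u \<subseteq> carrier M"
  shows "sym_ideal R M +>\<^bsub>PM\<^esub> basis R (add_mset x u)
    = sym_incl R M x \<otimes>\<^bsub>sym_algebra R M\<^esub> (sym_ideal R M +>\<^bsub>PM\<^esub> basis R u)"
proof -
  have "basis R (add_mset x u) = basis R {#x#} \<otimes>\<^bsub>PM\<^esub> basis R u"
    using monoid_algebra_mult_basis[OF free_comm_monoid_comm_monoid, of "{#x#}" "carrier M" u] assms by simp
  then show ?thesis
    using assms by (simp add: algebra_mapsD[OF sym_coset_map] basis_PM sym_incl_def)
qed

lemma sym_basis_empty: "sym_ideal R M +>\<^bsub>PM\<^esub> basis R {#} = \<one>\<^bsub>sym_algebra R M\<^esub>"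
  using algebra_mapsD(5)[OF sym_coset_map] by (simp add: monoid_algebra_sel)

lemma sym_induct [consumes 1, case_names one incl smult add mult]:
  assumes X: "X \<in> carrier (sym_algebra R M)"
    and one: "Q \<one>\<^bsub>sym_algebra R M\<^esub>"
    and incl: "\<And>x. x \<in> carrier M \<Longrightarrow> Q (sym_incl R M x)"
    and smult: "\<And>a X. a \<in> carrier R \<Longrightarrow> X \<in> carrier (sym_algebra R M) \<Longrightarrow> Q X \<Longrightarrow> Q (a \<odot>\<^bsub>sym_algebra R M\<^esub> X)"
    and add: "\<And>X Y. X \<in> carrier (sym_algebra R M) \<Longrightarrow> Y \<in> carrier (sym_algebra R M) \<Longrightarrow> Q X \<Longrightarrow> Q Y \<Longrightarrow>
      Q (X \<oplus>\<^bsub>sym_algebra R M\<^esub> Y)"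
    and mult: "\<And>X Y. X \<in> carrier (sym_algebra R M) \<Longrightarrow> Y \<in> carrier (sym_algebra R M) \<Longrightarrow> Q X \<Longrightarrow> Q Y \<Longrightarrow>
      Q (X \<otimes>\<^bsub>sym_algebra R M\<^esub> Y)"
  shows "Q X"
proof -
  interpret L: algebra R "sym_algebra R M" by (rule sym_algebra_algebra)
  note c = algebra_mapsD[OF sym_coset_map]
  note i = linear_mapsD[OF sym_incl_linear]
  have zero: "Q \<zero>\<^bsub>sym_algebra R M\<^esub>"
    using smult[OF zero_closed L.one_closed one] by simp
  have basis: "Q (sym_ideal R M +>\<^bsub>PM\<^esub> basis R u)" if "set_mset u \<subseteq> carrier M" for u
    using that
  proof (induction u)
    case (add x u)
    then show ?case
      by (simp add: sym_basis_add_mset mult incl i(1) c(2) basis_PM)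
  qed (simp add: sym_basis_empty one)
  obtain p where p: "p \<in> carrier PM" "X = sym_ideal R M +>\<^bsub>PM\<^esub> p" using X by (rule sym_carrierE)
  have "Q (sym_ideal R M +>\<^bsub>PM\<^esub> p)"
    using p(1)
  proof (induction rule: monoid_algebra_induct[OF free_comm_monoid_comm_monoid, consumes 1, case_names zero basis smult add])
    case zero
    then show ?case
      using \<open>Q \<zero>\<^bsub>sym_algebra R M\<^esub>\<close> linear_map_zero[OF P.module L.module c(1)] by simp
  qed (simp_all add: c basis smult add)
  with p show ?thesis by simp
qed

lemma sym_maps_eq:
  assumes N: "algebra R N" and f: "f \<in> algebra_maps R (sym_algebra R M) N"
    and g: "g \<in> algebra_maps R (sym_algebra R M) N"
    and "\<And>x. x \<in> carrier M \<Longrightarrow> f (sym_incl R M x) = g (sym_incl R M x)"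
    and X: "X \<in> carrier (sym_algebra R M)"
  shows "f X = g X"
  using X by (induction rule: sym_induct) (simp_all add: algebra_mapsD[OF f] algebra_mapsD[OF g] assms(4))

context
  fixes N :: "('a, 'd, 'k) module_scheme" and g :: "'c \<Rightarrow> 'd"
  assumes N: "algebra R N" and g: "g \<in> linear_maps R M N"
begin

interpretation N: algebra R N by (rule N)

abbreviation (input) "sym_monom \<equiv> monomial N g"

lemmas sym_monom_hom =
  comm_monoid.monomial_hom[OF N.comm_monoid_axioms, of g "carrier M", OF funcsetI[OF linear_mapsD(1)[OF g]]]

lemma sym_monom_single: "x \<in> carrier M \<Longrightarrow> sym_monom {#x#} = g x"
  by (rule comm_monoid.monomial_single[OF N.comm_monoid_axioms]) (rule linear_mapsD(1)[OF g])

lemma sym_lift_eq: "sym_lift R N g = linear_lift R N sym_monom"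
  by (simp add: sym_lift_def monomial_def[abs_def])

lemma sym_rel_kernel:
  assumes "p \<in> sym_rel" shows "linear_ext R N sym_monom p = \<zero>\<^bsub>N\<^esub>"
proof -
  note gl = linear_mapsD[OF g]
  note h = linear_ext_algebra_map[OF free_comm_monoid_comm_monoid N sym_monom_hom]
  note h' = algebra_mapsD[OF h]
  have b: "linear_ext R N sym_monom (basis R {#x#}) = g x" if "x \<in> carrier M" for x
    using linear_ext_basis[OF N.module sym_monom_hom(1), of "{#x#}"] that by (simp add: sym_monom_single)
  note minus = linear_map_minus[OF P.module N.module h'(1)]
  from assms consider x y where "x \<in> carrier M" "y \<in> carrier M"
      "p = basis R {#x \<oplus>\<^bsub>M\<^esub> y#} \<ominus>\<^bsub>PM\<^esub> (basis R {#x#} \<oplus>\<^bsub>PM\<^esub> basis R {#y#})"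
    | a x where "a \<in> carrier R" "x \<in> carrier M" "p = basis R {#a \<odot>\<^bsub>M\<^esub> x#} \<ominus>\<^bsub>PM\<^esub> a \<odot>\<^bsub>PM\<^esub> basis R {#x#}"
    unfolding sym_rel_def by blast
  then show ?thesis
  proof cases
    case 1
    then have "linear_ext R N sym_monom p = linear_ext R N sym_monom (basis R {#x \<oplus>\<^bsub>M\<^esub> y#})
        \<ominus>\<^bsub>N\<^esub> linear_ext R N sym_monom (basis R {#x#} \<oplus>\<^bsub>PM\<^esub> basis R {#y#})"
      by (simp only: minus basis_PM P.a_closed M.a_closed set_mset_single empty_subsetI insert_subset)
    also have "linear_ext R N sym_monom (basis R {#x#} \<oplus>\<^bsub>PM\<^esub> basis R {#y#}) = g x \<oplus>\<^bsub>N\<^esub> g y"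
      using h'(3)[of "basis R {#x#}" "basis R {#y#}"] 1 by (simp only: b basis_PM set_mset_single empty_subsetI insert_subset)
    finally show ?thesis using 1 by (simp add: b gl N.minus_eq_zero_iff)
  next
    case 2
    then have "linear_ext R N sym_monom p = linear_ext R N sym_monom (basis R {#a \<odot>\<^bsub>M\<^esub> x#})
        \<ominus>\<^bsub>N\<^esub> linear_ext R N sym_monom (a \<odot>\<^bsub>PM\<^esub> basis R {#x#})"
      by (simp only: minus basis_PM P.smult_closed M.smult_closed set_mset_single empty_subsetI insert_subset)
    also have "linear_ext R N sym_monom (a \<odot>\<^bsub>PM\<^esub> basis R {#x#}) = a \<odot>\<^bsub>N\<^esub> g x"
      using h'(4)[of a "basis R {#x#}"] 2 by (simp only: b basis_PM set_mset_single empty_subsetI insert_subset)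
    finally show ?thesis using 2 by (simp add: b gl N.minus_eq_zero_iff)
  qed
qed

lemma sym_lift_coset:
  "p \<in> carrier PM \<Longrightarrow> sym_lift R N g (sym_ideal R M +>\<^bsub>PM\<^esub> p) = linear_ext R N sym_monom p"
  unfolding sym_lift_eq sym_ideal_eq
  by (rule monoid_algebra_quotient_lift(1)[OF free_comm_monoid_comm_monoid sym_rel_closed N sym_monom_hom sym_rel_kernel])

lemma sym_lift_map: "sym_lift R N g \<in> algebra_maps R (sym_algebra R M) N"
  unfolding sym_lift_eq sym_ideal_eq sym_algebra_def
  by (rule monoid_algebra_quotient_lift(2)[OF free_comm_monoid_comm_monoid sym_rel_closed N sym_monom_hom sym_rel_kernel])

lemma sym_lift_incl: "x \<in> carrier M \<Longrightarrow> sym_lift R N g (sym_incl R M x) = g x"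
  unfolding sym_incl_def
  using linear_ext_basis[OF N.module sym_monom_hom(1), of "{#x#}"]
  by (simp add: sym_lift_coset basis_PM sym_monom_single)

end

end

section \<open>The module of 2-bud parameters\<close>

lemma gen_carrier [simp]: "Gam \<in> insert Gam (Cgen ` carrier R)" "Cgen a \<in> insert Gam (Cgen ` carrier R) \<longleftrightarrow> a \<in> carrier R"
  by auto

abbreviation "gens \<equiv> insert Gam (Cgen ` carrier R)"

lemma dr_free_module: "module R (dr_free R)"
  unfolding dr_free_def by (rule free_module_module)

lemma dr_basis_closed [simp]: "x \<in> gens \<Longrightarrow> basis R x \<in> carrier (dr_free R)"
  unfolding dr_free_def by (rule basis_closed)

lemma dr_relations_closed: "dr_relations R \<subseteq> carrier (dr_free R)"
proof -
  interpret F: module R "dr_free R" by (rule dr_free_module)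
  show ?thesis by (auto simp: dr_relations_def Let_def)
qed

abbreviation "dr_span \<equiv> span R (dr_free R) (dr_relations R)"

lemma dr_span_submodule: "submodule dr_span R (dr_free R)"
  by (rule module.span_submodule[OF dr_free_module dr_relations_closed])

lemma Dr_module: "module R (Dr R)"
  unfolding Dr_def by (rule module.quotient_module_module[OF dr_free_module dr_span_submodule])

lemma dr_coset_linear: "(\<lambda>p. dr_span +>\<^bsub>dr_free R\<^esub> p) \<in> linear_maps R (dr_free R) (Dr R)"
  unfolding Dr_def by (rule module.coset_linear[OF dr_free_module dr_span_submodule])

lemma dr_class_closed [simp]: "x \<in> gens \<Longrightarrow> dr_class R x \<in> carrier (Dr R)"
  unfolding dr_class_def by (rule linear_mapsD(1)[OF dr_coset_linear]) simp

lemma dr_induct [consumes 1, case_names zero gen smult add]: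
  assumes X: "X \<in> carrier (Dr R)"
    and zero: "Q \<zero>\<^bsub>Dr R\<^esub>"
    and gen: "\<And>x. x \<in> gens \<Longrightarrow> Q (dr_class R x)"
    and smult: "\<And>a X. a \<in> carrier R \<Longrightarrow> X \<in> carrier (Dr R) \<Longrightarrow> Q X \<Longrightarrow> Q (a \<odot>\<^bsub>Dr R\<^esub> X)"
    and add: "\<And>X Y. X \<in> carrier (Dr R) \<Longrightarrow> Y \<in> carrier (Dr R) \<Longrightarrow> Q X \<Longrightarrow> Q Y \<Longrightarrow> Q (X \<oplus>\<^bsub>Dr R\<^esub> Y)"
  shows "Q X"
proof -
  note c = linear_mapsD[OF dr_coset_linear]
  obtain p where p: "p \<in> carrier (dr_free R)" "X = dr_span +>\<^bsub>dr_free R\<^esub> p"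
    using X unfolding Dr_def by (rule quotient_carrierE)
  have "Q (dr_span +>\<^bsub>dr_free R\<^esub> p)"
    using p(1)[unfolded dr_free_def]
  proof (induction rule: free_module_induct)
    case zero
    then show ?case
      using \<open>Q \<zero>\<^bsub>Dr R\<^esub>\<close> linear_map_zero[OF dr_free_module Dr_module dr_coset_linear]
      by (simp add: dr_free_def)
  next
    case (basis x) then show ?case using gen[of x] by (simp add: dr_class_def)
  next
    case (smult a p) then show ?case using assms(4)[of a "dr_span +>\<^bsub>dr_free R\<^esub> p"] c
      by (simp add: dr_free_def)
  next
    case (add p q)
    then show ?case using assms(5)[of "dr_span +>\<^bsub>dr_free R\<^esub> p" "dr_span +>\<^bsub>dr_free R\<^esub> q"] c
      by (simp add: dr_free_def)
  qed
  with p show ?thesis by simp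
qed

lemma dr_maps_eq:
  assumes N: "module R N" and f: "f \<in> linear_maps R (Dr R) N" and g: "g \<in> linear_maps R (Dr R) N"
    and "\<And>x. x \<in> gens \<Longrightarrow> f (dr_class R x) = g (dr_class R x)" and X: "X \<in> carrier (Dr R)"
  shows "f X = g X"
  using X
  by (induction rule: dr_induct)
    (simp_all only: assms(4) linear_mapsD[OF f] linear_mapsD[OF g] linear_map_zero[OF Dr_module N f] linear_map_zero[OF Dr_module N g])

text \<open>The universal property of \<open>Dr\<close>. The kernel of the linear extension is a
  submodule, so it contains the span of the relations as soon as it contains the three
  families.\<close>

lemma dr_lift:
  assumes N: "module R N" and f: "f \<in> gens \<rightarrow> carrier N"
    and 1: "\<And>a. a \<in> carrier R \<Longrightarrow> (a \<otimes> a \<ominus> a) \<odot>\<^bsub>N\<^esub> f Gam = f (Cgen a) \<oplus>\<^bsub>N\<^esub> f (Cgen a)"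
    and 2: "\<And>a b. a \<in> carrier R \<Longrightarrow> b \<in> carrier R \<Longrightarrow>
      f (Cgen (a \<oplus> b)) = f (Cgen a) \<oplus>\<^bsub>N\<^esub> f (Cgen b) \<oplus>\<^bsub>N\<^esub> (a \<otimes> b) \<odot>\<^bsub>N\<^esub> f Gam"
    and 3: "\<And>a b. a \<in> carrier R \<Longrightarrow> b \<in> carrier R \<Longrightarrow>
      a \<odot>\<^bsub>N\<^esub> f (Cgen b) \<oplus>\<^bsub>N\<^esub> (b \<otimes> b) \<odot>\<^bsub>N\<^esub> f (Cgen a) = f (Cgen (a \<otimes> b))"
  shows "linear_lift R N f \<in> linear_maps R (Dr R) N"
    and "x \<in> gens \<Longrightarrow> linear_lift R N f (dr_class R x) = f x"
proof -
  interpret F: module R "dr_free R" by (rule dr_free_module)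
  interpret N: module R N by fact
  let ?h = "linear_ext R N f"
  have h: "?h \<in> linear_maps R (dr_free R) N"
    unfolding dr_free_def by (rule linear_ext_linear[OF N f])
  note l = linear_mapsD[OF h]
  note minus = linear_map_minus[OF F.module_axioms N h]
  have b: "?h (basis R x) = f x" if "x \<in> gens" for x by (rule linear_ext_basis[OF N f that])
  have fc: "f x \<in> carrier N" if "x \<in> gens" for x using f that by blast
  have gen0: "?h p = \<zero>\<^bsub>N\<^esub>" if p: "p \<in> dr_relations R" for p
  proof -
    have swap: "x \<ominus>\<^bsub>N\<^esub> y \<ominus>\<^bsub>N\<^esub> z = x \<ominus>\<^bsub>N\<^esub> (y \<oplus>\<^bsub>N\<^esub> z)"
      if "x \<in> carrier N" "y \<in> carrier N" "z \<in> carrier N" for x y z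
      using that by (simp add: a_minus_def N.minus_add N.a_assoc)
    from p consider a where "a \<in> carrier R"
        "p = (a \<otimes> a \<ominus> a) \<odot>\<^bsub>dr_free R\<^esub> basis R Gam \<ominus>\<^bsub>dr_free R\<^esub> (basis R (Cgen a) \<oplus>\<^bsub>dr_free R\<^esub> basis R (Cgen a))"
      | a b where "a \<in> carrier R" "b \<in> carrier R"
        "p = basis R (Cgen (a \<oplus> b)) \<ominus>\<^bsub>dr_free R\<^esub> basis R (Cgen a) \<ominus>\<^bsub>dr_free R\<^esub> basis R (Cgen b)
          \<ominus>\<^bsub>dr_free R\<^esub> (a \<otimes> b) \<odot>\<^bsub>dr_free R\<^esub> basis R Gam"
      | a b where "a \<in> carrier R" "b \<in> carrier R"
        "p = a \<odot>\<^bsub>dr_free R\<^esub> basis R (Cgen b) \<oplus>\<^bsub>dr_free R\<^esub> (b \<otimes> b) \<odot>\<^bsub>dr_free R\<^esub> basis R (Cgen a)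
          \<ominus>\<^bsub>dr_free R\<^esub> basis R (Cgen (a \<otimes> b))"
      unfolding dr_relations_def Let_def by blast
    then show ?thesis
    proof cases
      case 1 with assms(3) show ?thesis by (simp add: minus l b fc N.minus_eq_zero_iff)
    next
      case 2 with assms(4) show ?thesis by (simp add: minus l b fc swap N.minus_eq_zero_iff N.minus_closed)
    next
      case 3 with assms(5) show ?thesis by (simp add: minus l b fc N.minus_eq_zero_iff)
    qed
  qed
  have "dr_span \<subseteq> {p \<in> carrier (dr_free R). ?h p = \<zero>\<^bsub>N\<^esub>}"
    by (rule span_minimal[OF F.kernel_submodule[OF N h]]) (use gen0 dr_relations_closed in auto)
  then have K: "?h p = \<zero>\<^bsub>N\<^esub>" if "p \<in> dr_span" for p using that by auto
  have eq: "linear_lift R N f (dr_span +>\<^bsub>dr_free R\<^esub> p) = ?h p" if "p \<in> carrier (dr_free R)" for p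
    using linear_lift_coset[OF N f dr_span_submodule[unfolded dr_free_def]] K that by (simp add: dr_free_def)
  show "linear_lift R N f (dr_class R x) = f x" if "x \<in> gens"
    unfolding dr_class_def using that by (simp add: eq b)
  note c = linear_mapsD(2,3)[OF dr_coset_linear, symmetric]
  show "linear_lift R N f \<in> linear_maps R (Dr R) N"
  proof (rule linear_mapsI)
    fix X assume "X \<in> carrier (Dr R)"
    then show "linear_lift R N f X \<in> carrier N"
      unfolding Dr_def by (elim quotient_carrierE) (simp add: eq l)
  next
    fix X Y assume "X \<in> carrier (Dr R)" "Y \<in> carrier (Dr R)"
    then obtain x y where "x \<in> carrier (dr_free R)" "X = dr_span +>\<^bsub>dr_free R\<^esub> x"
        "y \<in> carrier (dr_free R)" "Y = dr_span +>\<^bsub>dr_free R\<^esub> y"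
      unfolding Dr_def by (metis quotient_carrierE)
    then show "linear_lift R N f (X \<oplus>\<^bsub>Dr R\<^esub> Y) = linear_lift R N f X \<oplus>\<^bsub>N\<^esub> linear_lift R N f Y"
      by (simp add: c eq l)
  next
    fix a X assume "a \<in> carrier R" "X \<in> carrier (Dr R)"
    then obtain x where "a \<in> carrier R" "x \<in> carrier (dr_free R)" "X = dr_span +>\<^bsub>dr_free R\<^esub> x"
      unfolding Dr_def by (metis quotient_carrierE)
    then show "linear_lift R N f (a \<odot>\<^bsub>Dr R\<^esub> X) = a \<odot>\<^bsub>N\<^esub> linear_lift R N f X"
      by (simp add: c eq l)
  qed
qed

section \<open>Identities in \<open>Dr\<close> and the injectivity of \<open>phi\<close>\<close>

interpretation D: module R "Dr R" by (rule Dr_module)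

abbreviation "gam \<equiv> dr_class R Gam"
abbreviation "cc a \<equiv> dr_class R (Cgen a)"

lemma dr_relation:
  assumes "p \<in> carrier (dr_free R)" "q \<in> carrier (dr_free R)" "p \<ominus>\<^bsub>dr_free R\<^esub> q \<in> dr_relations R"
  shows "dr_span +>\<^bsub>dr_free R\<^esub> p = dr_span +>\<^bsub>dr_free R\<^esub> q"
  using module.coset_eq_iff[OF dr_free_module dr_span_submodule assms(1,2)] assms(3) span_superset[of "dr_relations R"] by blast

lemma dr_rel_double:
  assumes a: "a \<in> carrier R" shows "(a \<otimes> a \<ominus> a) \<odot>\<^bsub>Dr R\<^esub> gam = cc a \<oplus>\<^bsub>Dr R\<^esub> cc a"
proof -
  interpret F: module R "dr_free R" by (rule dr_free_module)
  note c = linear_mapsD(2,3)[OF dr_coset_linear]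
  have "dr_span +>\<^bsub>dr_free R\<^esub> ((a \<otimes> a \<ominus> a) \<odot>\<^bsub>dr_free R\<^esub> basis R Gam)
      = dr_span +>\<^bsub>dr_free R\<^esub> (basis R (Cgen a) \<oplus>\<^bsub>dr_free R\<^esub> basis R (Cgen a))"
    by (rule dr_relation) (use a in \<open>auto simp: dr_relations_def Let_def\<close>)
  with a show ?thesis by (simp add: c dr_class_def)
qed

lemma dr_rel_add:
  assumes a: "a \<in> carrier R" and b: "b \<in> carrier R"
  shows "cc (a \<oplus> b) = cc a \<oplus>\<^bsub>Dr R\<^esub> cc b \<oplus>\<^bsub>Dr R\<^esub> (a \<otimes> b) \<odot>\<^bsub>Dr R\<^esub> gam"
proof -
  interpret F: module R "dr_free R" by (rule dr_free_module)
  note c = linear_mapsD(2,3)[OF dr_coset_linear]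
  note m = linear_map_minus[OF dr_free_module Dr_module dr_coset_linear]
  have "dr_span +>\<^bsub>dr_free R\<^esub> (basis R (Cgen (a \<oplus> b)) \<ominus>\<^bsub>dr_free R\<^esub> basis R (Cgen a) \<ominus>\<^bsub>dr_free R\<^esub> basis R (Cgen b))
      = dr_span +>\<^bsub>dr_free R\<^esub> ((a \<otimes> b) \<odot>\<^bsub>dr_free R\<^esub> basis R Gam)"
    by (rule dr_relation) (use a b in \<open>auto simp: dr_relations_def Let_def\<close>)
  with a b have "cc (a \<oplus> b) \<ominus>\<^bsub>Dr R\<^esub> cc a \<ominus>\<^bsub>Dr R\<^esub> cc b = (a \<otimes> b) \<odot>\<^bsub>Dr R\<^esub> gam"
    by (simp add: c m dr_class_def F.minus_closed)
  moreover have comb: "y \<oplus>\<^bsub>Dr R\<^esub> z \<oplus>\<^bsub>Dr R\<^esub> (x \<ominus>\<^bsub>Dr R\<^esub> y \<ominus>\<^bsub>Dr R\<^esub> z) = x"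
    if "x \<in> carrier (Dr R)" "y \<in> carrier (Dr R)" "z \<in> carrier (Dr R)" for x y z
  proof -
    have "y \<oplus>\<^bsub>Dr R\<^esub> z \<oplus>\<^bsub>Dr R\<^esub> (x \<ominus>\<^bsub>Dr R\<^esub> y \<ominus>\<^bsub>Dr R\<^esub> z)
        = x \<oplus>\<^bsub>Dr R\<^esub> ((y \<oplus>\<^bsub>Dr R\<^esub> \<ominus>\<^bsub>Dr R\<^esub> y) \<oplus>\<^bsub>Dr R\<^esub> (z \<oplus>\<^bsub>Dr R\<^esub> \<ominus>\<^bsub>Dr R\<^esub> z))"
      using that unfolding a_minus_def by (simp only: D.a_ac D.a_closed D.a_inv_closed)
    then show ?thesis using that by (simp add: D.r_neg)
  qed
  ultimately show ?thesis
    using a b comb[of "cc (a \<oplus> b)" "cc a" "cc b"] by simp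
qed

lemma dr_rel_mult:
  assumes a: "a \<in> carrier R" and b: "b \<in> carrier R"
  shows "cc (a \<otimes> b) = a \<odot>\<^bsub>Dr R\<^esub> cc b \<oplus>\<^bsub>Dr R\<^esub> (b \<otimes> b) \<odot>\<^bsub>Dr R\<^esub> cc a"
proof -
  interpret F: module R "dr_free R" by (rule dr_free_module)
  note c = linear_mapsD(2,3)[OF dr_coset_linear]
  have "dr_span +>\<^bsub>dr_free R\<^esub> (a \<odot>\<^bsub>dr_free R\<^esub> basis R (Cgen b) \<oplus>\<^bsub>dr_free R\<^esub> (b \<otimes> b) \<odot>\<^bsub>dr_free R\<^esub> basis R (Cgen a))
      = dr_span +>\<^bsub>dr_free R\<^esub> basis R (Cgen (a \<otimes> b))"
    by (rule dr_relation) (use a b in \<open>auto simp: dr_relations_def Let_def\<close>)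
  with a b show ?thesis by (simp add: c dr_class_def)
qed

definition "phi_gen = (\<lambda>x. case x of Gam \<Rightarrow> \<one> \<oplus> \<one> | Cgen a \<Rightarrow> a \<otimes> a \<ominus> a)"

definition "phi = linear_lift R (regular_module R) phi_gen"

lemma regular_module: "module R (regular_module R)"
  by (rule algebra.module[OF regular_module_algebra[OF is_cring]])

lemma phi_linear: "phi \<in> linear_maps R (Dr R) (regular_module R)"
  and phi_gen: "x \<in> gens \<Longrightarrow> phi (dr_class R x) = phi_gen x"
proof -
  have 0: "phi_gen \<in> gens \<rightarrow> carrier (regular_module R)" by (auto simp: phi_gen_def)
  have 1: "(a \<otimes> a \<ominus> a) \<otimes> phi_gen Gam = phi_gen (Cgen a) \<oplus> phi_gen (Cgen a)" if "a \<in> carrier R" for a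
    using that unfolding phi_gen_def dr_gen.case by algebra
  have 2: "phi_gen (Cgen (a \<oplus> b)) = phi_gen (Cgen a) \<oplus> phi_gen (Cgen b) \<oplus> (a \<otimes> b) \<otimes> phi_gen Gam"
    if "a \<in> carrier R" "b \<in> carrier R" for a b
    using that unfolding phi_gen_def dr_gen.case by algebra
  have 3: "a \<otimes> phi_gen (Cgen b) \<oplus> (b \<otimes> b) \<otimes> phi_gen (Cgen a) = phi_gen (Cgen (a \<otimes> b))"
    if "a \<in> carrier R" "b \<in> carrier R" for a b
    using that unfolding phi_gen_def dr_gen.case by algebra
  note d = dr_lift[OF regular_module 0, simplified, OF 1 2 3]
  show "phi \<in> linear_maps R (Dr R) (regular_module R)" unfolding phi_def by (rule d(1))
  show "phi (dr_class R x) = phi_gen x" if "x \<in> gens" unfolding phi_def using d(2) that by auto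
qed

lemma phi [simp]:
  "x \<in> carrier (Dr R) \<Longrightarrow> phi x \<in> carrier R"
  "x \<in> carrier (Dr R) \<Longrightarrow> y \<in> carrier (Dr R) \<Longrightarrow> phi (x \<oplus>\<^bsub>Dr R\<^esub> y) = phi x \<oplus> phi y"
  "a \<in> carrier R \<Longrightarrow> x \<in> carrier (Dr R) \<Longrightarrow> phi (a \<odot>\<^bsub>Dr R\<^esub> x) = a \<otimes> phi x"
  "phi gam = \<one> \<oplus> \<one>"
  "a \<in> carrier R \<Longrightarrow> phi (cc a) = a \<otimes> a \<ominus> a"
  "phi \<zero>\<^bsub>Dr R\<^esub> = \<zero>"
  using linear_mapsD[OF phi_linear] phi_gen[of Gam] phi_gen[of "Cgen a"]
    linear_map_zero[OF Dr_module regular_module phi_linear]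
  by (auto simp: phi_gen_def)

lemma smult_minus_left:
  assumes "a \<in> carrier R" "b \<in> carrier R" "x \<in> carrier (Dr R)"
  shows "(a \<ominus> b) \<odot>\<^bsub>Dr R\<^esub> x = a \<odot>\<^bsub>Dr R\<^esub> x \<ominus>\<^bsub>Dr R\<^esub> b \<odot>\<^bsub>Dr R\<^esub> x"
  using assms by (simp add: a_minus_def D.smult_l_distr D.smult_l_minus)

lemma two_smult: "x \<in> carrier (Dr R) \<Longrightarrow> (\<one> \<oplus> \<one>) \<odot>\<^bsub>Dr R\<^esub> x = x \<oplus>\<^bsub>Dr R\<^esub> x"
  by (simp add: D.smult_l_distr)

lemma smult_comm:
  "a \<in> carrier R \<Longrightarrow> b \<in> carrier R \<Longrightarrow> x \<in> carrier (Dr R) \<Longrightarrow>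
    a \<odot>\<^bsub>Dr R\<^esub> (b \<odot>\<^bsub>Dr R\<^esub> x) = b \<odot>\<^bsub>Dr R\<^esub> (a \<odot>\<^bsub>Dr R\<^esub> x)"
  by (metis D.smult_assoc1 m_comm)

text \<open>For two generators \<open>cc a\<close> and \<open>cc b\<close> this compares the
  expansions of \<open>cc (a \<otimes> b)\<close> and \<open>cc (b \<otimes> a)\<close>; against
  \<open>gam\<close> it is the doubling relation. Both sides are linear in each variable, so
  induction in one variable after the other suffices. In particular phi(x) \<open>gam\<close> =
  2x.\<close>

lemma phi_swap:
  assumes "x \<in> carrier (Dr R)" "y \<in> carrier (Dr R)"
  shows "phi x \<odot>\<^bsub>Dr R\<^esub> y = phi y \<odot>\<^bsub>Dr R\<^esub> x"
proof -
  have cc: "(a \<otimes> a \<ominus> a) \<odot>\<^bsub>Dr R\<^esub> cc b = (b \<otimes> b \<ominus> b) \<odot>\<^bsub>Dr R\<^esub> cc a"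
    if "a \<in> carrier R" "b \<in> carrier R" for a b
  proof -
    have "a \<odot>\<^bsub>Dr R\<^esub> cc b \<oplus>\<^bsub>Dr R\<^esub> (b \<otimes> b) \<odot>\<^bsub>Dr R\<^esub> cc a = b \<odot>\<^bsub>Dr R\<^esub> cc a \<oplus>\<^bsub>Dr R\<^esub> (a \<otimes> a) \<odot>\<^bsub>Dr R\<^esub> cc b"
      using dr_rel_mult[of a b] dr_rel_mult[of b a] that m_comm by metis
    then show ?thesis
      using that by (simp add: smult_minus_left D.minus_eq_minus_iff D.a_comm)
  qed
  have gen: "phi (dr_class R u) \<odot>\<^bsub>Dr R\<^esub> dr_class R v = phi (dr_class R v) \<odot>\<^bsub>Dr R\<^esub> dr_class R u"
    if "u \<in> gens" "v \<in> gens" for u v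
    using that by (auto simp: dr_rel_double two_smult cc)
  have 1: "phi x \<odot>\<^bsub>Dr R\<^esub> dr_class R v = phi (dr_class R v) \<odot>\<^bsub>Dr R\<^esub> x" if "v \<in> gens" for v
    using assms(1)
  proof (induction rule: dr_induct)
    case (smult a X)
    with that show ?case by (simp add: D.smult_assoc1 smult_comm[of a])
  qed (use that in \<open>simp_all add: gen D.smult_l_distr D.smult_r_distr\<close>)
  show ?thesis using assms(2)
  proof (induction rule: dr_induct)
    case (smult a X)
    with assms(1) show ?case by (simp add: D.smult_assoc1 smult_comm[of "phi x"])
  qed (use assms(1) in \<open>simp_all add: 1 D.smult_l_distr D.smult_r_distr\<close>)
qed

lemma cc_zero: "cc \<zero> = \<zero>\<^bsub>Dr R\<^esub>" and cc_one: "cc \<one> = \<zero>\<^bsub>Dr R\<^esub>"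
proof -
  have "cc \<zero> = cc \<zero> \<oplus>\<^bsub>Dr R\<^esub> cc \<zero>" using dr_rel_add[of \<zero> \<zero>] by simp
  then show "cc \<zero> = \<zero>\<^bsub>Dr R\<^esub>" by (metis D.add.l_cancel_one' dr_class_closed gen_carrier(2) zero_closed)
  have "cc \<one> = cc \<one> \<oplus>\<^bsub>Dr R\<^esub> cc \<one>" using dr_rel_mult[of \<one> \<one>] by simp
  then show "cc \<one> = \<zero>\<^bsub>Dr R\<^esub>" by (metis D.add.l_cancel_one' dr_class_closed gen_carrier(2) one_closed)
qed

text \<open>This identity on generators propagates to all of \<open>Dr\<close> by \<open>phi_swap\<close>; at \<open>phi x = 0\<close> it says \<open>0 = - x\<close>.\<close>

lemma cc_phi:
  assumes "x \<in> carrier (Dr R)"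
  shows "cc (phi x) = (phi x \<ominus> \<one>) \<odot>\<^bsub>Dr R\<^esub> x"
  using assms
proof (induction rule: dr_induct)
  case zero
  then show ?case by (simp add: cc_zero minus_closed)
next
  case (gen u)
  show ?case
  proof (cases u)
    case Gam
    have "cc (\<one> \<oplus> \<one>) = gam" using dr_rel_add[of \<one> \<one>] by (simp add: cc_one)
    moreover have "\<one> \<oplus> \<one> \<ominus> \<one> = \<one>" by algebra
    ultimately show ?thesis using Gam by simp
  next
    case (Cgen a)
    with gen have a: "a \<in> carrier R" by auto
    \<comment> \<open>With b = a - 1 the argument a^2 - a is the product ab, so the multiplication
      rule applies and gives a c_b + b^2 c_a. The addition rule for a = b + 1, with c_1 = 0,
      expresses a c_b through c_a, and the coefficient of c_a becomes ab - 1.\<close>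
    define b where "b = a \<ominus> \<one>"
    have b: "b \<in> carrier R" using a by (simp add: b_def minus_closed)
    have ab: "a = b \<oplus> \<one>" "a \<otimes> a \<ominus> a = a \<otimes> b" using a unfolding b_def by algebra+
    have ca: "cc a = cc b \<oplus>\<^bsub>Dr R\<^esub> b \<odot>\<^bsub>Dr R\<^esub> gam"
      using dr_rel_add[of b \<one>] b ab(1) by (simp add: cc_one)
    have "a \<odot>\<^bsub>Dr R\<^esub> cc a = a \<odot>\<^bsub>Dr R\<^esub> cc b \<oplus>\<^bsub>Dr R\<^esub> (a \<otimes> a \<ominus> a) \<odot>\<^bsub>Dr R\<^esub> gam"
      using a b by (subst ca) (simp add: D.smult_r_distr D.smult_assoc1 ab(2))
    also have "(a \<otimes> a \<ominus> a) \<odot>\<^bsub>Dr R\<^esub> gam = (\<one> \<oplus> \<one>) \<odot>\<^bsub>Dr R\<^esub> cc a"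
      using a by (simp add: dr_rel_double two_smult)
    finally have "a \<odot>\<^bsub>Dr R\<^esub> cc b = a \<odot>\<^bsub>Dr R\<^esub> cc a \<ominus>\<^bsub>Dr R\<^esub> (\<one> \<oplus> \<one>) \<odot>\<^bsub>Dr R\<^esub> cc a"
      using a b by (simp add: a_minus_def D.a_assoc D.r_neg)
    then have "cc (a \<otimes> b) = (a \<ominus> (\<one> \<oplus> \<one>) \<oplus> b \<otimes> b) \<odot>\<^bsub>Dr R\<^esub> cc a"
      using a b by (simp add: dr_rel_mult smult_minus_left D.smult_l_distr minus_closed)
    moreover have "a \<ominus> (\<one> \<oplus> \<one>) \<oplus> b \<otimes> b = a \<otimes> b \<ominus> \<one>" using a unfolding b_def by algebra
    ultimately show ?thesis using a Cgen by (simp add: ab(2))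
  qed
next
  case (smult a X)
  \<comment> \<open>The multiplication rule leaves a multiple of \<open>cc a\<close>;
    \<open>phi_swap\<close> converts phi(X) c_a into (a^2 - a)X, after which both terms are
    multiples of X.\<close>
  have "cc (a \<otimes> phi X) = a \<odot>\<^bsub>Dr R\<^esub> ((phi X \<ominus> \<one>) \<odot>\<^bsub>Dr R\<^esub> X) \<oplus>\<^bsub>Dr R\<^esub> phi X \<odot>\<^bsub>Dr R\<^esub> (phi X \<odot>\<^bsub>Dr R\<^esub> cc a)"
    using smult by (simp add: dr_rel_mult D.smult_assoc1)
  also have "phi X \<odot>\<^bsub>Dr R\<^esub> cc a = (a \<otimes> a \<ominus> a) \<odot>\<^bsub>Dr R\<^esub> X"
    using phi_swap[of X "cc a"] smult by simp
  also have "a \<odot>\<^bsub>Dr R\<^esub> ((phi X \<ominus> \<one>) \<odot>\<^bsub>Dr R\<^esub> X) \<oplus>\<^bsub>Dr R\<^esub> phi X \<odot>\<^bsub>Dr R\<^esub> ((a \<otimes> a \<ominus> a) \<odot>\<^bsub>Dr R\<^esub> X)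
      = (a \<otimes> (phi X \<ominus> \<one>) \<oplus> phi X \<otimes> (a \<otimes> a \<ominus> a)) \<odot>\<^bsub>Dr R\<^esub> X"
    using smult by (simp add: D.smult_assoc1 D.smult_l_distr minus_closed)
  also have "a \<otimes> (phi X \<ominus> \<one>) \<oplus> phi X \<otimes> (a \<otimes> a \<ominus> a) = (a \<otimes> phi X \<ominus> \<one>) \<otimes> a"
    using smult(1) phi(1)[OF smult(2)] by algebra
  finally show ?case using smult by (simp add: D.smult_assoc1 minus_closed)
next
  case (add X Y)
  \<comment> \<open>The \<open>gam\<close> term of the addition rule must supply the mixed terms of
    (phi X + phi Y - 1)(X + Y). It does, because phi(Y) \<open>gam\<close> = 2Y and phi(X)Y =
    phi(Y)X.\<close>
  have 1: "(phi X \<otimes> phi Y) \<odot>\<^bsub>Dr R\<^esub> gam = phi X \<odot>\<^bsub>Dr R\<^esub> Y \<oplus>\<^bsub>Dr R\<^esub> phi Y \<odot>\<^bsub>Dr R\<^esub> X"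
  proof -
    have "phi Y \<odot>\<^bsub>Dr R\<^esub> gam = Y \<oplus>\<^bsub>Dr R\<^esub> Y"
      using phi_swap[of Y gam] add by (simp add: two_smult)
    then show ?thesis
      using add phi_swap[of X Y] by (simp add: D.smult_assoc1 D.smult_r_distr)
  qed
  have 2: "(phi X \<oplus> phi Y \<ominus> \<one>) \<odot>\<^bsub>Dr R\<^esub> X = (phi X \<ominus> \<one>) \<odot>\<^bsub>Dr R\<^esub> X \<oplus>\<^bsub>Dr R\<^esub> phi Y \<odot>\<^bsub>Dr R\<^esub> X"
    "(phi X \<oplus> phi Y \<ominus> \<one>) \<odot>\<^bsub>Dr R\<^esub> Y = (phi Y \<ominus> \<one>) \<odot>\<^bsub>Dr R\<^esub> Y \<oplus>\<^bsub>Dr R\<^esub> phi X \<odot>\<^bsub>Dr R\<^esub> Y"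
    using add by (simp_all add: a_minus_def D.smult_l_distr[symmetric] a_ac)
  show ?case
    using add by (simp add: dr_rel_add 1 2 D.smult_r_distr minus_closed D.a_ac)
qed

lemma phi_injective:
  assumes "x \<in> carrier (Dr R)" "phi x = \<zero>" shows "x = \<zero>\<^bsub>Dr R\<^esub>"
proof -
  have "\<zero>\<^bsub>Dr R\<^esub> = (\<ominus> \<one>) \<odot>\<^bsub>Dr R\<^esub> x"
    using cc_phi[OF assms(1)] assms by (simp add: cc_zero a_minus_def)
  then have "\<zero>\<^bsub>Dr R\<^esub> = \<ominus>\<^bsub>Dr R\<^esub> x" using assms by (simp add: D.smult_l_minus)
  then show ?thesis using assms(1) by (metis D.add.inv_eq_1_iff)
qed

lemma phi_eqD:
  assumes "x \<in> carrier (Dr R)" "y \<in> carrier (Dr R)" "phi x = phi y" shows "x = y"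
proof -
  have "phi (x \<ominus>\<^bsub>Dr R\<^esub> y) = \<zero>"
    using linear_map_minus[OF Dr_module regular_module phi_linear assms(1,2)] assms
      abelian_group.minus_eq_zero_iff[OF module.axioms(2)[OF regular_module]] by simp
  then show ?thesis using phi_injective[of "x \<ominus>\<^bsub>Dr R\<^esub> y"] assms D.minus_eq_zero_iff D.minus_closed by blast
qed

lemma I2_ideal: "ideal (I2 R) R"
  unfolding I2_def by (rule genideal_ideal) auto

lemma phi_image: "phi ` carrier (Dr R) = I2 R"
proof
  let ?S = "insert (\<one> \<oplus> \<one>) {a \<otimes> a \<ominus> a | a. a \<in> carrier R}"
  have S: "?S \<subseteq> carrier R" by auto
  interpret I: ideal "I2 R" R by (rule I2_ideal)
  have "?S \<subseteq> I2 R" unfolding I2_def by (rule genideal_self[OF S])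
  then have "\<one> \<oplus> \<one> \<in> I2 R" "a \<in> carrier R \<Longrightarrow> a \<otimes> a \<ominus> a \<in> I2 R" for a by blast+
  then have gen: "phi (dr_class R u) \<in> I2 R" if "u \<in> gens" for u
    using that by (elim insertE imageE) simp_all
  have "phi x \<in> I2 R" if "x \<in> carrier (Dr R)" for x
    using that by (induction rule: dr_induct) (simp_all add: gen I.I_l_closed)
  then show "phi ` carrier (Dr R) \<subseteq> I2 R" by blast
  have "ideal (phi ` carrier (Dr R)) R"
  proof (rule idealI[OF ring_axioms])
    show "subgroup (phi ` carrier (Dr R)) (add_monoid R)"
    proof (rule add.subgroupI)
      show "phi ` carrier (Dr R) \<noteq> {}" using D.zero_closed by blast
      fix a assume "a \<in> phi ` carrier (Dr R)"
      then obtain x where x: "x \<in> carrier (Dr R)" "a = phi x" by blast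
      then have "\<ominus> a = phi ((\<ominus> \<one>) \<odot>\<^bsub>Dr R\<^esub> x)" by (simp add: l_minus del: D.smult_one)
      with x show "\<ominus> a \<in> phi ` carrier (Dr R)"
        by (intro image_eqI[of _ _ "(\<ominus> \<one>) \<odot>\<^bsub>Dr R\<^esub> x"]) simp_all
    next
      fix a b assume "a \<in> phi ` carrier (Dr R)" "b \<in> phi ` carrier (Dr R)"
      then obtain x y where x: "x \<in> carrier (Dr R)" "a = phi x" and y: "y \<in> carrier (Dr R)" "b = phi y" by blast
      then show "a \<oplus> b \<in> phi ` carrier (Dr R)"
        by (intro image_eqI[of _ _ "x \<oplus>\<^bsub>Dr R\<^esub> y"]) simp_all
    qed auto
  next
    fix a r assume "a \<in> phi ` carrier (Dr R)" and r: "r \<in> carrier R"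
    then obtain x where x: "x \<in> carrier (Dr R)" "a = phi x" by blast
    with r show "r \<otimes> a \<in> phi ` carrier (Dr R)"
      by (intro image_eqI[of _ _ "r \<odot>\<^bsub>Dr R\<^esub> x"]) simp_all
    with x r show "a \<otimes> r \<in> phi ` carrier (Dr R)" by (simp add: m_comm)
  qed
  moreover have "?S \<subseteq> phi ` carrier (Dr R)"
  proof -
    have "phi gam \<in> phi ` carrier (Dr R)" "a \<in> carrier R \<Longrightarrow> phi (cc a) \<in> phi ` carrier (Dr R)" for a
      by (rule imageI; simp)+
    then show ?thesis by auto
  qed
  ultimately show "I2 R \<subseteq> phi ` carrier (Dr R)"
    unfolding I2_def by (rule genideal_minimal)
qed

section \<open>The rings of the Hopf algebroid\<close>

lemma LA_algebra: "algebra R (LA R)"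
  unfolding LA_def by (rule sym_algebra_algebra[OF Dr_module])

interpretation L: algebra R "LA R" by (rule LA_algebra)

abbreviation "iota \<equiv> sym_incl R (Dr R)"

lemma iota_linear: "iota \<in> linear_maps R (Dr R) (LA R)"
  unfolding LA_def by (rule sym_incl_linear[OF Dr_module])

lemma iota_closed [simp]: "x \<in> carrier (Dr R) \<Longrightarrow> iota x \<in> carrier (LA R)"
  by (rule linear_mapsD(1)[OF iota_linear])

lemmas LA_maps_eq = sym_maps_eq[OF Dr_module, folded LA_def]
lemmas LA_lift_map = sym_lift_map[OF Dr_module, folded LA_def]
lemmas LA_lift_incl = sym_lift_incl[OF Dr_module]

text \<open>If the values on generators come from a linear map that already exists, the relations
  hold for free and the lift is that map. This recognises \<open>eta_R\<close> on generators without
  checking relations in \<open>LB\<close>.\<close>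

lemma dr_lift_eq:
  assumes N: "module R N" and h: "h \<in> linear_maps R (Dr R) N"
    and f: "\<And>u. u \<in> gens \<Longrightarrow> f u = h (dr_class R u)"
  shows "linear_lift R N f \<in> linear_maps R (Dr R) N"
    and "x \<in> carrier (Dr R) \<Longrightarrow> linear_lift R N f x = h x"
proof -
  interpret N: module R N by fact
  note l = linear_mapsD[OF h]
  have fc: "f \<in> gens \<rightarrow> carrier N" by (auto simp: f l(1) simp del: insert_iff)
  have 1: "(a \<otimes> a \<ominus> a) \<odot>\<^bsub>N\<^esub> f Gam = f (Cgen a) \<oplus>\<^bsub>N\<^esub> f (Cgen a)" if "a \<in> carrier R" for a
    using that l(2)[of "cc a" "cc a"] l(3)[of "a \<otimes> a \<ominus> a" gam] by (simp add: f dr_rel_double minus_closed)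
  have 2: "f (Cgen (a \<oplus> b)) = f (Cgen a) \<oplus>\<^bsub>N\<^esub> f (Cgen b) \<oplus>\<^bsub>N\<^esub> (a \<otimes> b) \<odot>\<^bsub>N\<^esub> f Gam"
    if "a \<in> carrier R" "b \<in> carrier R" for a b
    using that by (simp add: f dr_rel_add l)
  have 3: "a \<odot>\<^bsub>N\<^esub> f (Cgen b) \<oplus>\<^bsub>N\<^esub> (b \<otimes> b) \<odot>\<^bsub>N\<^esub> f (Cgen a) = f (Cgen (a \<otimes> b))"
    if "a \<in> carrier R" "b \<in> carrier R" for a b
    using that by (simp add: f dr_rel_mult l)
  note d = dr_lift[OF N fc 1 2 3]
  show d1: "linear_lift R N f \<in> linear_maps R (Dr R) N" by (rule d(1))
  show "linear_lift R N f x = h x" if "x \<in> carrier (Dr R)"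
    by (rule dr_maps_eq[OF N d1 h _ that]) (simp only: d(2) f)
qed

text \<open>The common pattern x + phi(x)w of all right units. For \<open>N\<close> =
  \<open>LB R\<close>, \<open>h\<close> = \<open>eta_L R\<close> and \<open>w\<close> =
  \<open>LB_t R\<close> it gives the values of \<open>eta_R\<close> on the generators of
  \<open>LA\<close>; leaving \<open>N\<close> and \<open>w\<close> free allows such maps to be
  evaluated at arbitrary points of the coordinate ring.\<close>

definition twist_lin :: "('a, 'c, 'k) module_scheme \<Rightarrow> ('a bud \<Rightarrow> 'c) \<Rightarrow> 'c \<Rightarrow> 'a dr \<Rightarrow> 'c" where
  "twist_lin N h w x = h (iota x) \<oplus>\<^bsub>N\<^esub> phi x \<odot>\<^bsub>N\<^esub> w"

definition twist :: "('a, 'c, 'k) module_scheme \<Rightarrow> ('a bud \<Rightarrow> 'c) \<Rightarrow> 'c \<Rightarrow> 'a bud \<Rightarrow> 'c" where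
  "twist N h w = sym_lift R N (twist_lin N h w)"

lemma twist_lin_linear:
  assumes N: "algebra R N" and h: "h \<in> linear_maps R (LA R) N" and w: "w \<in> carrier N"
  shows "twist_lin N h w \<in> linear_maps R (Dr R) N"
proof -
  interpret N: algebra R N by fact
  note l = linear_mapsD[OF h]
  have sw: "a \<oplus>\<^bsub>N\<^esub> b \<oplus>\<^bsub>N\<^esub> (c \<oplus>\<^bsub>N\<^esub> d) = a \<oplus>\<^bsub>N\<^esub> c \<oplus>\<^bsub>N\<^esub> (b \<oplus>\<^bsub>N\<^esub> d)"
    if "a \<in> carrier N" "b \<in> carrier N" "c \<in> carrier N" "d \<in> carrier N" for a b c d
    using that by (simp add: N.a_ac)
  show ?thesis
    by (rule linear_mapsI)
      (simp_all add: twist_lin_def w l linear_mapsD[OF iota_linear] N.smult_l_distr N.smult_r_distr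
        N.smult_assoc1 sw)
qed

lemma twist_map:
  assumes "algebra R N" "h \<in> linear_maps R (LA R) N" "w \<in> carrier N"
  shows "twist N h w \<in> algebra_maps R (LA R) N"
  unfolding twist_def by (rule LA_lift_map[OF assms(1) twist_lin_linear[OF assms]])

lemma twist_iota:
  assumes "algebra R N" "h \<in> linear_maps R (LA R) N" "w \<in> carrier N" "x \<in> carrier (Dr R)"
  shows "twist N h w (iota x) = h (iota x) \<oplus>\<^bsub>N\<^esub> phi x \<odot>\<^bsub>N\<^esub> w"
  unfolding twist_def LA_lift_incl[OF assms(1) twist_lin_linear[OF assms(1-3)] assms(4)]
  by (simp add: twist_lin_def)

lemma eta_L_hom: "eta_L R \<in> ring_hom (LA R) (UP (LA R))"
proof -
  interpret U: UP_cring "LA R" "UP (LA R)" by (simp_all add: UP_cring_def L.M_cring)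
  show ?thesis using U.const_ring_hom by (simp add: eta_L_def[abs_def])
qed

lemma LB_algebra: "algebra R (LB R)"
  unfolding LB_def by (rule L.via_unit_algebra(1)[OF _ eta_L_hom]) (simp add: UP_cring.UP_cring UP_cring.intro L.M_cring)

interpretation B: algebra R "LB R" by (rule LB_algebra)

lemma LB_sel:
  "carrier (LB R) = carrier (UP (LA R))" "monoid.mult (LB R) = monoid.mult (UP (LA R))"
  "one (LB R) = one (UP (LA R))" "zero (LB R) = zero (UP (LA R))" "add (LB R) = add (UP (LA R))"
  by (simp_all add: LB_def)

lemma eta_L_map: "eta_L R \<in> algebra_maps R (LA R) (LB R)"
  unfolding LB_def by (rule L.via_unit_algebra(2)[OF _ eta_L_hom]) (simp add: UP_cring.UP_cring UP_cring.intro L.M_cring)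

lemma LB_t_closed [simp]: "LB_t R \<in> carrier (LB R)"
proof -
  interpret U: UP_cring "LA R" "UP (LA R)" by (simp_all add: UP_cring_def L.M_cring)
  show ?thesis by (simp add: LB_t_def LB_sel)
qed

lemma eta_R_twist_lin:
  shows "linear_lift R (LB R) (eta_R_gen R) \<in> linear_maps R (Dr R) (LB R)"
    and "x \<in> carrier (Dr R) \<Longrightarrow> linear_lift R (LB R) (eta_R_gen R) x = twist_lin (LB R) (eta_L R) (LB_t R) x"
proof -
  note lin = twist_lin_linear[OF LB_algebra algebra_mapsD(1)[OF eta_L_map] LB_t_closed]
  have "eta_R_gen R u = twist_lin (LB R) (eta_L R) (LB_t R) (dr_class R u)" if "u \<in> gens" for u
    using that by (auto simp: eta_R_gen_def twist_lin_def B.smult_l_distr)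
  note d = dr_lift_eq[OF B.module lin this]
  show "linear_lift R (LB R) (eta_R_gen R) \<in> linear_maps R (Dr R) (LB R)" by (rule d(1))
  show "linear_lift R (LB R) (eta_R_gen R) x = twist_lin (LB R) (eta_L R) (LB_t R) x" if "x \<in> carrier (Dr R)"
    by (rule d(2)[OF _ that])
qed

lemma eta_R_map: "eta_R R \<in> algebra_maps R (LA R) (LB R)"
  unfolding eta_R_def by (rule LA_lift_map[OF LB_algebra eta_R_twist_lin(1)])

lemma eta_R_iota:
  "x \<in> carrier (Dr R) \<Longrightarrow> eta_R R (iota x) = eta_L R (iota x) \<oplus>\<^bsub>LB R\<^esub> phi x \<odot>\<^bsub>LB R\<^esub> LB_t R"
  unfolding eta_R_def by (simp add: LA_lift_incl[OF LB_algebra eta_R_twist_lin(1)] eta_R_twist_lin(2) twist_lin_def)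

abbreviation "LB_eval N h u \<equiv> UnivPoly.eval (LA R) N h u"

context
  fixes N :: "('d, 'n) ring_scheme" and h
  assumes N: "cring N" and h: "h \<in> ring_hom (LA R) N"
begin

lemma LB_UP: "UP_pre_univ_prop (LA R) N h"
  by (intro UP_pre_univ_prop.intro ring_hom_cringI UP_cring.intro L.M_cring N h)

lemma LB_eval_hom: "u \<in> carrier N \<Longrightarrow> LB_eval N h u \<in> ring_hom (LB R) N"
  using UP_pre_univ_prop.eval_ring_hom[OF LB_UP] by (simp add: ring_hom_def LB_sel)

lemma LB_eval_eta_L: "u \<in> carrier N \<Longrightarrow> l \<in> carrier (LA R) \<Longrightarrow> LB_eval N h u (eta_L R l) = h l"
  unfolding eta_L_def by (rule UP_pre_univ_prop.eval_const[OF LB_UP])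

lemma LB_eval_t: "u \<in> carrier N \<Longrightarrow> LB_eval N h u (LB_t R) = u"
  unfolding LB_t_def by (rule UP_pre_univ_prop.eval_monom1[OF LB_UP])

text \<open>Uniqueness in the universal property of a polynomial ring in one variable: agreement on
  constants and on the variable suffices.\<close>

lemma LB_hom_eq:
  assumes f: "f \<in> ring_hom (LB R) N" and g: "g \<in> ring_hom (LB R) N"
    and "\<And>l. l \<in> carrier (LA R) \<Longrightarrow> f (eta_L R l) = h l" "\<And>l. l \<in> carrier (LA R) \<Longrightarrow> g (eta_L R l) = h l"
    and "f (LB_t R) = g (LB_t R)" and p: "p \<in> carrier (LB R)"
  shows "f p = g p"
proof -
  interpret U: UP_cring "LA R" "UP (LA R)" by (simp_all add: UP_cring_def L.M_cring)
  have hom: "ring_hom_cring (UP (LA R)) N k" if "k \<in> ring_hom (LB R) N" for k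
    using that by (intro ring_hom_cringI U.UP_cring N) (simp add: ring_hom_def LB_sel)
  have t: "f (LB_t R) \<in> carrier N" using ring_hom_closed[OF f LB_t_closed] .
  show ?thesis
    by (rule UP_pre_univ_prop.UP_hom_unique[OF LB_UP hom[OF f] _ _ hom[OF g], where s = "f (LB_t R)"])
      (use assms t in \<open>simp_all add: LB_t_def eta_L_def LB_sel\<close>)
qed

end

section \<open>The polynomial ring in the coordinates of the cobar complex\<close>

text \<open>\<open>Q\<close> is \<open>L[t\<^sub>0, t\<^sub>1, \<dots>]\<close> as an \<open>A\<close>-algebra: its elements send a multiset of variable indices (a monomial) to
  its coefficient in \<open>L\<close>. The constant \<open>l\<close> is \<open>qc l\<close>, and \<open>t\<^sub>i\<close> is \<open>qt i\<close>.\<close>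

abbreviation "FN \<equiv> free_comm_monoid (UNIV :: nat set)"

definition "QM = monoid_algebra (LA R) FN"
definition "qc l = l \<odot>\<^bsub>QM\<^esub> \<one>\<^bsub>QM\<^esub>"
definition "Q = algebra_via (\<lambda>a. qc (a \<odot>\<^bsub>LA R\<^esub> \<one>\<^bsub>LA R\<^esub>)) QM"
definition qt :: "nat \<Rightarrow> nat multiset \<Rightarrow> 'a bud" where "qt i = basis (LA R) {#i#}"

lemma QM_algebra: "algebra (LA R) QM"
  unfolding QM_def by (rule cring.monoid_algebra_algebra[OF L.M_cring free_comm_monoid_comm_monoid])

interpretation QM: algebra "LA R" QM by (rule QM_algebra)

lemma qc_hom: "qc \<in> ring_hom (LA R) QM"
  using QM.unit_hom by (simp add: qc_def[abs_def])

lemma Q_algebra: "algebra R Q" and qc_map: "qc \<in> algebra_maps R (LA R) Q"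
  unfolding Q_def by (rule L.via_unit_algebra[OF QM.M_cring qc_hom])+

interpretation Q: algebra R Q by (rule Q_algebra)

lemma Q_sel:
  "carrier Q = carrier QM" "monoid.mult Q = monoid.mult QM" "one Q = one QM" "zero Q = zero QM" "add Q = add QM"
  by (simp_all add: Q_def)

lemma qc_closed [simp]: "l \<in> carrier (LA R) \<Longrightarrow> qc l \<in> carrier Q"
  by (rule algebra_mapsD(2)[OF qc_map])

lemma QM_smult: "l \<in> carrier (LA R) \<Longrightarrow> p \<in> carrier Q \<Longrightarrow> l \<odot>\<^bsub>QM\<^esub> p = qc l \<otimes>\<^bsub>Q\<^esub> p"
  by (simp add: qc_def Q_sel QM.unit_hom_smult)

lemma qt_closed [simp]: "qt i \<in> carrier Q"
  unfolding Q_sel QM_def qt_def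
  by (rule cring.monoid_algebra_basis_closed[OF L.M_cring free_comm_monoid_comm_monoid]) simp

text \<open>The polynomials in the variables with index in \<open>J\<close>, written as the free
  module on the monomials supported in \<open>J\<close> so that induction over free modules applies
  to them.\<close>

definition "Qpart J = carrier (free_module (LA R) {u :: nat multiset. set_mset u \<subseteq> J})"

lemma Qpart_iff: "q \<in> Qpart J \<longleftrightarrow> q \<in> carrier Q \<and> (\<forall>u. q u \<noteq> \<zero>\<^bsub>LA R\<^esub> \<longrightarrow> set_mset u \<subseteq> J)"
  by (auto simp: Qpart_def Q_sel QM_def cring.monoid_algebra_sel[OF L.M_cring] cring.free_module_sel[OF L.M_cring])

lemma Qpart_closed: "q \<in> Qpart J \<Longrightarrow> q \<in> carrier Q"
  by (simp add: Qpart_iff)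

lemma Qpart_UNIV: "Qpart UNIV = carrier Q"
  by (auto simp: Qpart_iff)

lemma Q_sel_free: "zero Q = zero (free_module (LA R) S)" "add Q = add (free_module (LA R) S)"
  "smult QM = smult (free_module (LA R) S)"
  by (simp_all add: Q_sel QM_def monoid_algebra_def free_module_def)

lemma basis_add_mset: "basis (LA R) (add_mset i u) = qt i \<otimes>\<^bsub>Q\<^esub> basis (LA R) u"
  using cring.monoid_algebra_mult_basis[OF L.M_cring free_comm_monoid_comm_monoid, of "{#i#}" UNIV u]
  by (simp add: Q_sel QM_def qt_def)

lemma basis_empty: "basis (LA R) {#} = \<one>\<^bsub>Q\<^esub>"
  by (simp add: Q_sel QM_def cring.monoid_algebra_sel[OF L.M_cring])

lemma basis_Q: "basis (LA R) u \<in> carrier Q"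
  unfolding Q_sel QM_def
  by (rule cring.monoid_algebra_basis_closed[OF L.M_cring free_comm_monoid_comm_monoid]) simp

lemma Qpart_induct [consumes 1, case_names const var add mult]:
  assumes q: "q \<in> Qpart J"
    and const: "\<And>l. l \<in> carrier (LA R) \<Longrightarrow> T (qc l)"
    and var: "\<And>i. i \<in> J \<Longrightarrow> T (qt i)"
    and add: "\<And>p q. p \<in> carrier Q \<Longrightarrow> q \<in> carrier Q \<Longrightarrow> T p \<Longrightarrow> T q \<Longrightarrow> T (p \<oplus>\<^bsub>Q\<^esub> q)"
    and mult: "\<And>p q. p \<in> carrier Q \<Longrightarrow> q \<in> carrier Q \<Longrightarrow> T p \<Longrightarrow> T q \<Longrightarrow> T (p \<otimes>\<^bsub>Q\<^esub> q)"
  shows "T q"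
proof -
  let ?S = "{u :: nat multiset. set_mset u \<subseteq> J}"
  note lin = algebra_mapsD[OF qc_map]
  have sub: "p \<in> carrier (free_module (LA R) ?S) \<Longrightarrow> p \<in> carrier Q" for p
    using Qpart_closed by (simp add: Qpart_def)
  have zero: "T \<zero>\<^bsub>Q\<^esub>"
    using const[OF L.zero_closed] linear_map_zero[OF L.module Q.module lin(1)] by simp
  have one: "T \<one>\<^bsub>Q\<^esub>" using const[OF L.one_closed] lin(5) by simp
  have basis: "T (basis (LA R) u)" if "set_mset u \<subseteq> J" for u
    using that
    by (induction u) (simp_all add: basis_empty one basis_add_mset mult var basis_Q)
  show ?thesis using q unfolding Qpart_def
  proof (induction rule: cring.free_module_induct[OF L.M_cring, consumes 1, case_names zero basis smult add])
    case zero then show ?case using \<open>T \<zero>\<^bsub>Q\<^esub>\<close> by (simp add: Q_sel_free[symmetric])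
  next
    case (basis x) then show ?case using \<open>\<And>u. set_mset u \<subseteq> J \<Longrightarrow> T (basis (LA R) u)\<close> by simp
  next
    case (smult a p)
    then show ?case using mult[of "qc a" p] const sub[of p] QM_smult[of a p]
      by (simp add: Q_sel_free[symmetric])
  next
    case (add p q)
    then show ?case using assms(4)[of p q] sub by (simp add: Q_sel_free[symmetric])
  qed
qed

lemma Qpart_maps_eq:
  assumes f: "f \<in> ring_hom Q N" and g: "g \<in> ring_hom Q N"
    and "\<And>l. l \<in> carrier (LA R) \<Longrightarrow> f (qc l) = g (qc l)" "\<And>i. i \<in> J \<Longrightarrow> f (qt i) = g (qt i)"
    and q: "q \<in> Qpart J"
  shows "f q = g q"
  using q
  by (induction rule: Qpart_induct)
    (simp_all add: assms(3,4) ring_hom_add[OF f] ring_hom_add[OF g] ring_hom_mult[OF f] ring_hom_mult[OF g])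

text \<open>Evaluation of polynomials with \<open>h\<close> on coefficients and \<open>u i\<close>
  for the variables. Making \<open>N\<close> an algebra over \<open>LA\<close> through
  \<open>h\<close> turns evaluation into a linear extension from the basis of monomials.\<close>

definition Qlift :: "('a, 'c, 'k) module_scheme \<Rightarrow> ('a bud \<Rightarrow> 'c) \<Rightarrow> (nat \<Rightarrow> 'c) \<Rightarrow> (nat multiset \<Rightarrow> 'a bud) \<Rightarrow> 'c" where
  "Qlift N h u = linear_ext (LA R) (algebra_via h N) (monomial N u)"

lemma Qlift:
  assumes N: "algebra R N" and h: "h \<in> algebra_maps R (LA R) N" and u: "\<And>i. u i \<in> carrier N"
  shows "Qlift N h u \<in> algebra_maps R Q N"
    and "l \<in> carrier (LA R) \<Longrightarrow> Qlift N h u (qc l) = h l"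
    and "Qlift N h u (qt i) = u i"
proof -
  interpret N: algebra R N by fact
  let ?N = "algebra_via h N"
  note h' = algebra_mapsD[OF h]
  have N': "algebra (LA R) ?N"
    by (rule algebra_via_algebra[OF L.M_cring N.M_cring algebra_maps_ring_hom[OF h]])
  have u': "u \<in> UNIV \<rightarrow> carrier N" using u by auto
  note mon = N.monomial_hom[OF u']
  have "Qlift N h u \<in> algebra_maps (LA R) QM ?N"
    unfolding Qlift_def QM_def
    by (rule cring.linear_ext_algebra_map[OF L.M_cring free_comm_monoid_comm_monoid N'])
      (use mon in \<open>simp_all add: algebra_via_sel\<close>)
  note k = algebra_mapsD[OF this]
  have c: "Qlift N h u (qc l) = h l" if "l \<in> carrier (LA R)" for l
    using that k(4)[of l "\<one>\<^bsub>QM\<^esub>"] k(5) by (simp add: qc_def h')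
  then show "l \<in> carrier (LA R) \<Longrightarrow> Qlift N h u (qc l) = h l" .
  show "Qlift N h u (qt i) = u i"
    unfolding Qlift_def qt_def
    using cring.linear_ext_basis[OF L.M_cring algebra.module[OF N'], of "monomial N u" "carrier FN" "{#i#}"] mon(1)
    by (simp add: N.monomial_single u)
  have "Qlift N h u (a \<odot>\<^bsub>Q\<^esub> x) = a \<odot>\<^bsub>N\<^esub> Qlift N h u x" if "a \<in> carrier R" "x \<in> carrier Q" for a x
  proof -
    have "Qlift N h u (a \<odot>\<^bsub>Q\<^esub> x) = Qlift N h u (qc (a \<odot>\<^bsub>LA R\<^esub> \<one>\<^bsub>LA R\<^esub>) \<otimes>\<^bsub>QM\<^esub> x)"
      by (simp add: Q_def)
    also have "\<dots> = h (a \<odot>\<^bsub>LA R\<^esub> \<one>\<^bsub>LA R\<^esub>) \<otimes>\<^bsub>N\<^esub> Qlift N h u x"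
      using that k(6)[of "qc (a \<odot>\<^bsub>LA R\<^esub> \<one>\<^bsub>LA R\<^esub>)" x] qc_closed by (simp add: c Q_sel)
    also have "\<dots> = a \<odot>\<^bsub>N\<^esub> Qlift N h u x"
      using that k(2)[of x] by (simp add: h' N.unit_hom_smult Q_sel)
    finally show ?thesis .
  qed
  then show "Qlift N h u \<in> algebra_maps R Q N"
    by (intro algebra_mapsI linear_mapsI) (use k in \<open>simp_all add: Q_sel\<close>)
qed

section \<open>Coordinates on the tensor powers\<close>

text \<open>\<open>tau w\<close> is \<open>\<eta>\<^sub>R\<close> with \<open>w\<close> in place of \<open>t\<close>. For points \<open>w\<^sub>0, w\<^sub>1, \<dots>\<close> of \<open>Q\<close>, the map \<open>psi w\<close> below is
  \<open>tau w\<^sub>0\<close> on the leading \<open>L\<close> and sends \<open>t\<close> in the \<open>i\<close>-th factor to \<open>w\<^bsub>i+1\<^esub> - w\<^sub>i\<close>.\<close>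

definition "tau = twist Q qc"
definition "lam v w = LB_eval Q (tau v) (w \<ominus>\<^bsub>Q\<^esub> v)"

lemma tau_map: "w \<in> carrier Q \<Longrightarrow> tau w \<in> algebra_maps R (LA R) Q"
  unfolding tau_def by (rule twist_map[OF Q_algebra algebra_mapsD(1)[OF qc_map]])

lemma tau_iota:
  "w \<in> carrier Q \<Longrightarrow> x \<in> carrier (Dr R) \<Longrightarrow> tau w (iota x) = qc (iota x) \<oplus>\<^bsub>Q\<^esub> phi x \<odot>\<^bsub>Q\<^esub> w"
  unfolding tau_def by (rule twist_iota[OF Q_algebra algebra_mapsD(1)[OF qc_map]])

lemma tau_zero: "l \<in> carrier (LA R) \<Longrightarrow> tau \<zero>\<^bsub>Q\<^esub> l = qc l"
  by (rule LA_maps_eq[OF Q_algebra tau_map qc_map]) (simp_all add: tau_iota)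

lemma lam_eta_L: "v \<in> carrier Q \<Longrightarrow> w \<in> carrier Q \<Longrightarrow> l \<in> carrier (LA R) \<Longrightarrow> lam v w (eta_L R l) = tau v l"
  unfolding lam_def
  by (rule LB_eval_eta_L[OF Q.M_cring algebra_maps_ring_hom[OF tau_map]]) (simp_all add: Q.minus_closed)

lemma lam_t: "v \<in> carrier Q \<Longrightarrow> w \<in> carrier Q \<Longrightarrow> lam v w (LB_t R) = w \<ominus>\<^bsub>Q\<^esub> v"
  unfolding lam_def
  by (rule LB_eval_t[OF Q.M_cring algebra_maps_ring_hom[OF tau_map]]) (simp_all add: Q.minus_closed)

lemma LB_smult: "a \<in> carrier R \<Longrightarrow> g \<in> carrier (LB R) \<Longrightarrow> a \<odot>\<^bsub>LB R\<^esub> g = eta_L R (a \<odot>\<^bsub>LA R\<^esub> \<one>\<^bsub>LA R\<^esub>) \<otimes>\<^bsub>LB R\<^esub> g"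
  by (simp add: LB_def)

lemma lam_map:
  assumes v: "v \<in> carrier Q" and w: "w \<in> carrier Q" shows "lam v w \<in> algebra_maps R (LB R) Q"
proof -
  note t = algebra_mapsD[OF tau_map[OF v]]
  have h: "lam v w \<in> ring_hom (LB R) Q"
    unfolding lam_def
    by (rule LB_eval_hom[OF Q.M_cring algebra_maps_ring_hom[OF tau_map]]) (simp_all add: v w Q.minus_closed)
  have e: "eta_L R l \<in> carrier (LB R)" if "l \<in> carrier (LA R)" for l
    by (rule algebra_mapsD(2)[OF eta_L_map that])
  have "lam v w (a \<odot>\<^bsub>LB R\<^esub> g) = a \<odot>\<^bsub>Q\<^esub> lam v w g" if "a \<in> carrier R" "g \<in> carrier (LB R)" for a g
    using that by (simp add: LB_smult ring_hom_mult[OF h] e lam_eta_L[OF v w] t Q.unit_hom_smult ring_hom_closed[OF h])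
  then show ?thesis
    by (intro algebra_mapsI linear_mapsI)
      (simp_all add: ring_hom_closed[OF h] ring_hom_add[OF h] ring_hom_mult[OF h] ring_hom_one[OF h])
qed

text \<open>On a generator the right unit adds phi(x)(w - v) to x + phi(x)v, which moves the point
  from \<open>v\<close> to \<open>w\<close>. Since \<open>lam_eta_L\<close> evaluates at the first
  point, adjacent factors agree at the point they share.\<close>

lemma lam_eta_R:
  assumes v: "v \<in> carrier Q" and w: "w \<in> carrier Q" and l: "l \<in> carrier (LA R)"
  shows "lam v w (eta_R R l) = tau w l"
proof (rule LA_maps_eq[OF Q_algebra algebra_maps_comp[OF eta_R_map lam_map[OF v w]] tau_map[OF w] _ l])
  fix x assume x: "x \<in> carrier (Dr R)"
  note k = algebra_mapsD[OF lam_map[OF v w]]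
  have "lam v w (eta_R R (iota x)) = qc (iota x) \<oplus>\<^bsub>Q\<^esub> phi x \<odot>\<^bsub>Q\<^esub> v \<oplus>\<^bsub>Q\<^esub> phi x \<odot>\<^bsub>Q\<^esub> (w \<ominus>\<^bsub>Q\<^esub> v)"
    using x v w by (simp add: eta_R_iota k algebra_mapsD(2)[OF eta_L_map] lam_eta_L lam_t tau_iota)
  also have "\<dots> = qc (iota x) \<oplus>\<^bsub>Q\<^esub> phi x \<odot>\<^bsub>Q\<^esub> (v \<oplus>\<^bsub>Q\<^esub> (w \<ominus>\<^bsub>Q\<^esub> v))"
    using x v w by (simp add: Q.smult_r_distr Q.a_assoc Q.minus_closed)
  also have "v \<oplus>\<^bsub>Q\<^esub> (w \<ominus>\<^bsub>Q\<^esub> v) = w"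
    using v w by (simp add: a_minus_def Q.r_neg2 Q.a_comm[of w])
  finally show "lam v w (eta_R R (iota x)) = tau w (iota x)" using x w by (simp add: tau_iota)
qed

text \<open>The i-th factor of the word is read between the points \<open>w i\<close> and
  \<open>w (Suc i)\<close>. A word with n factors therefore depends only on the points with index 0
  to n.\<close>

primrec lamprod :: "(nat \<Rightarrow> 'a bud) list \<Rightarrow> (nat \<Rightarrow> nat multiset \<Rightarrow> 'a bud) \<Rightarrow> nat multiset \<Rightarrow> 'a bud" where
  "lamprod [] w = \<one>\<^bsub>Q\<^esub>"
| "lamprod (g # gs) w = lam (w 0) (w (Suc 0)) g \<otimes>\<^bsub>Q\<^esub> lamprod gs (\<lambda>k. w (Suc k))"

definition "psi_word w = (\<lambda>(l, gs). tau (w 0) l \<otimes>\<^bsub>Q\<^esub> lamprod gs w)"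

context
  fixes w :: "nat \<Rightarrow> nat multiset \<Rightarrow> 'a bud"
  assumes w: "\<And>k. w k \<in> carrier Q"
begin

lemma lam_closed [simp]: "g \<in> carrier (LB R) \<Longrightarrow> lam (w i) (w j) g \<in> carrier Q"
  by (rule algebra_mapsD(2)[OF lam_map[OF w w]])

end

lemma lamprod_closed: "set gs \<subseteq> carrier (LB R) \<Longrightarrow> (\<And>k. w k \<in> carrier Q) \<Longrightarrow> lamprod gs w \<in> carrier Q"
  by (induction gs arbitrary: w) (simp_all add: lam_closed)

lemma lamprod_append:
  "set xs \<subseteq> carrier (LB R) \<Longrightarrow> set ys \<subseteq> carrier (LB R) \<Longrightarrow> (\<And>k. w k \<in> carrier Q) \<Longrightarrow>
    lamprod (xs @ ys) w = lamprod xs w \<otimes>\<^bsub>Q\<^esub> lamprod ys (\<lambda>k. w (length xs + k))"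
  by (induction xs arbitrary: w) (simp_all add: lam_closed lamprod_closed Q.m_assoc)

lemma lamprod_mult:
  "length gs = length hs \<Longrightarrow> set gs \<subseteq> carrier (LB R) \<Longrightarrow> set hs \<subseteq> carrier (LB R) \<Longrightarrow> (\<And>k. w k \<in> carrier Q) \<Longrightarrow>
    lamprod (map2 (monoid.mult (LB R)) gs hs) w = lamprod gs w \<otimes>\<^bsub>Q\<^esub> lamprod hs w"
proof (induction gs hs arbitrary: w rule: list_induct2)
  case (Cons g gs h hs)
  have sw: "a \<otimes>\<^bsub>Q\<^esub> b \<otimes>\<^bsub>Q\<^esub> (c \<otimes>\<^bsub>Q\<^esub> d) = a \<otimes>\<^bsub>Q\<^esub> c \<otimes>\<^bsub>Q\<^esub> (b \<otimes>\<^bsub>Q\<^esub> d)"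
    if "a \<in> carrier Q" "b \<in> carrier Q" "c \<in> carrier Q" "d \<in> carrier Q" for a b c d
    using that by (simp add: Q.m_ac)
  show ?case
    using Cons.prems Cons.IH[of "\<lambda>k. w (Suc k)"]
    by (simp add: algebra_mapsD(6)[OF lam_map] lam_closed lamprod_closed sw)
qed simp

lemma lamprod_one: "(\<And>k. w k \<in> carrier Q) \<Longrightarrow> lamprod (replicate s \<one>\<^bsub>LB R\<^esub>) w = \<one>\<^bsub>Q\<^esub>"
  by (induction s arbitrary: w) (simp_all add: algebra_mapsD(5)[OF lam_map])

lemma lamprod_split:
  assumes "i < length gs" "set gs \<subseteq> carrier (LB R)" "\<And>k. w k \<in> carrier Q"
  shows "lamprod gs w = lamprod (take i gs) w \<otimes>\<^bsub>Q\<^esub> (lam (w i) (w (Suc i)) (gs ! i)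
    \<otimes>\<^bsub>Q\<^esub> lamprod (drop (Suc i) gs) (\<lambda>k. w (Suc i + k)))"
proof -
  have sub: "set (take i gs) \<subseteq> carrier (LB R)" "set (drop i gs) \<subseteq> carrier (LB R)"
    using assms(2) by (auto dest: in_set_takeD in_set_dropD)
  have "lamprod gs w = lamprod (take i gs @ drop i gs) w" by simp
  also have "\<dots> = lamprod (take i gs) w \<otimes>\<^bsub>Q\<^esub> lamprod (drop i gs) (\<lambda>k. w (i + k))"
    using assms(1) by (subst lamprod_append[OF sub assms(3)]) simp
  also have "drop i gs = gs ! i # drop (Suc i) gs" using assms(1) by (rule Cons_nth_drop_Suc[symmetric])
  finally show ?thesis by simp
qed

lemma eta_closed [simp]: "l \<in> carrier (LA R) \<Longrightarrow> eta_L R l \<in> carrier (LB R)"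
  "l \<in> carrier (LA R) \<Longrightarrow> eta_R R l \<in> carrier (LB R)"
  by (rule algebra_mapsD(2)[OF eta_L_map] algebra_mapsD(2)[OF eta_R_map]; assumption)+

section \<open>Words and relations among pure tensors\<close>

definition word :: "nat \<Rightarrow> 'a bud \<Rightarrow> (nat \<Rightarrow> 'a bud) list \<Rightarrow> bool" where
  "word s l gs \<longleftrightarrow> l \<in> carrier (LA R) \<and> length gs = s \<and> set gs \<subseteq> carrier (LB R)"

lemma word_carrier: "(l, gs) \<in> carrier (word_monoid R s) \<longleftrightarrow> word s l gs"
  by (simp add: word_monoid_def word_def)

lemma word_update: "word s l gs \<Longrightarrow> g \<in> carrier (LB R) \<Longrightarrow> word s l (gs[i := g])"
  by (auto simp: word_def dest: set_update_subset_insert[THEN subsetD])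

lemma word_length: "word s l gs \<Longrightarrow> length gs = s"
  and word_left: "word s l gs \<Longrightarrow> l \<in> carrier (LA R)"
  and word_change: "word s l gs \<Longrightarrow> m \<in> carrier (LA R) \<Longrightarrow> word s m gs"
  by (auto simp: word_def)

lemma word_nth: "word s l gs \<Longrightarrow> i < s \<Longrightarrow> gs ! i \<in> carrier (LB R)"
  by (auto simp: word_def)

lemma word_replicate [simp]: "l \<in> carrier (LA R) \<Longrightarrow> word s l (replicate s \<one>\<^bsub>LB R\<^esub>)"
  by (auto simp: word_def)

lemma word_map2:
  assumes "word s l gs" "word s m hs" shows "word s (l \<otimes>\<^bsub>LA R\<^esub> m) (map2 (monoid.mult (LB R)) gs hs)"
  using assms by (auto simp: word_def set_zip intro!: B.m_closed)

lemma word_comm_monoid: "comm_monoid (word_monoid R s)"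
proof (rule comm_monoidI)
  fix x y assume x: "x \<in> carrier (word_monoid R s)" and y: "y \<in> carrier (word_monoid R s)"
  obtain l gs m hs where xy: "x = (l, gs)" "y = (m, hs)" by (metis prod.exhaust)
  note c = x[unfolded xy word_carrier] y[unfolded xy word_carrier]
  show "x \<otimes>\<^bsub>word_monoid R s\<^esub> y \<in> carrier (word_monoid R s)"
    using word_map2[OF c] by (simp add: xy word_monoid_def word_def)
  show "x \<otimes>\<^bsub>word_monoid R s\<^esub> y = y \<otimes>\<^bsub>word_monoid R s\<^esub> x"
    using c by (auto simp: xy word_monoid_def word_def L.m_comm subset_iff intro!: nth_equalityI B.m_comm)
  show "\<one>\<^bsub>word_monoid R s\<^esub> \<otimes>\<^bsub>word_monoid R s\<^esub> x = x"
    using c by (auto simp: xy word_monoid_def word_def subset_iff intro!: nth_equalityI B.l_one)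
  show "x \<otimes>\<^bsub>word_monoid R s\<^esub> y \<otimes>\<^bsub>word_monoid R s\<^esub> z = x \<otimes>\<^bsub>word_monoid R s\<^esub> (y \<otimes>\<^bsub>word_monoid R s\<^esub> z)"
    if z: "z \<in> carrier (word_monoid R s)" for z
  proof -
    obtain n ks where z': "z = (n, ks)" by (metis prod.exhaust)
    show ?thesis
      using c z[unfolded z' word_carrier]
      by (auto simp: xy z' word_monoid_def word_def L.m_assoc subset_iff intro!: nth_equalityI B.m_assoc)
  qed
qed (auto simp: word_monoid_def)

abbreviation (input) "WA s \<equiv> monoid_algebra R (word_monoid R s)"

lemma WA_algebra: "algebra R (WA s)"
  by (rule monoid_algebra_algebra[OF word_comm_monoid])

lemma WA_basis: "word s l gs \<Longrightarrow> basis R (l, gs) \<in> carrier (WA s)"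
  by (rule monoid_algebra_basis_closed[OF word_comm_monoid]) (simp add: word_carrier)

text \<open>The generating set of \<open>tensor_ideal\<close>, split off because multiplicative maps
  out of the tensor power need to be tested only on it.\<close>

definition "tensor_rel s =
    (let P = monoid_algebra R (word_monoid R s); W = carrier (word_monoid R s);
         w = (\<lambda>l gs. basis R (l, gs)) in
      ( {w (l \<oplus>\<^bsub>LA R\<^esub> m) gs \<ominus>\<^bsub>P\<^esub> (w l gs \<oplus>\<^bsub>P\<^esub> w m gs) | l m gs.
          (l, gs) \<in> W \<and> (m, gs) \<in> W}
      \<union> {w (a \<odot>\<^bsub>LA R\<^esub> l) gs \<ominus>\<^bsub>P\<^esub> a \<odot>\<^bsub>P\<^esub> w l gs | a l gs.
          a \<in> carrier R \<and> (l, gs) \<in> W}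
      \<union> {w l (gs[i := g \<oplus>\<^bsub>LB R\<^esub> h]) \<ominus>\<^bsub>P\<^esub> (w l (gs[i := g]) \<oplus>\<^bsub>P\<^esub> w l (gs[i := h])) | l gs i g h.
          (l, gs) \<in> W \<and> i < s \<and> g \<in> carrier (LB R) \<and> h \<in> carrier (LB R)}
      \<union> {w (l \<otimes>\<^bsub>LA R\<^esub> r) gs \<ominus>\<^bsub>P\<^esub> w l (gs[0 := eta_L R r \<otimes>\<^bsub>LB R\<^esub> gs ! 0]) | l r gs.
          (l, gs) \<in> W \<and> r \<in> carrier (LA R) \<and> 0 < s}
      \<union> {w l (gs[i := gs ! i \<otimes>\<^bsub>LB R\<^esub> eta_R R r]) \<ominus>\<^bsub>P\<^esub>
           w l (gs[Suc i := eta_L R r \<otimes>\<^bsub>LB R\<^esub> gs ! Suc i]) | l r gs i.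
          (l, gs) \<in> W \<and> r \<in> carrier (LA R) \<and> Suc i < s} ))"

lemma tensor_ideal_eq: "tensor_ideal R s = Idl\<^bsub>WA s\<^esub> (tensor_rel s)"
  by (simp add: tensor_ideal_def tensor_rel_def Let_def)

lemma tensor_rel_cases:
  assumes "p \<in> tensor_rel s"
  obtains (add) l m gs where "word s l gs" "word s m gs"
      "p = basis R (l \<oplus>\<^bsub>LA R\<^esub> m, gs) \<ominus>\<^bsub>WA s\<^esub> (basis R (l, gs) \<oplus>\<^bsub>WA s\<^esub> basis R (m, gs))"
    | (smult) a l gs where "a \<in> carrier R" "word s l gs"
      "p = basis R (a \<odot>\<^bsub>LA R\<^esub> l, gs) \<ominus>\<^bsub>WA s\<^esub> a \<odot>\<^bsub>WA s\<^esub> basis R (l, gs)"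
    | (add_slot) l gs i g h where "word s l gs" "i < s" "g \<in> carrier (LB R)" "h \<in> carrier (LB R)"
      "p = basis R (l, gs[i := g \<oplus>\<^bsub>LB R\<^esub> h]) \<ominus>\<^bsub>WA s\<^esub> (basis R (l, gs[i := g]) \<oplus>\<^bsub>WA s\<^esub> basis R (l, gs[i := h]))"
    | (slide0) l r gs where "word s l gs" "r \<in> carrier (LA R)" "0 < s"
      "p = basis R (l \<otimes>\<^bsub>LA R\<^esub> r, gs) \<ominus>\<^bsub>WA s\<^esub> basis R (l, gs[0 := eta_L R r \<otimes>\<^bsub>LB R\<^esub> gs ! 0])"
    | (slide) l r gs i where "word s l gs" "r \<in> carrier (LA R)" "Suc i < s"
      "p = basis R (l, gs[i := gs ! i \<otimes>\<^bsub>LB R\<^esub> eta_R R r]) \<ominus>\<^bsub>WA s\<^esub>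
        basis R (l, gs[Suc i := eta_L R r \<otimes>\<^bsub>LB R\<^esub> gs ! Suc i])"
  by (insert assms[unfolded tensor_rel_def Let_def word_carrier], elim UnE CollectE exE conjE)
    (rule that; assumption)+

lemma tensor_rel_closed: "tensor_rel s \<subseteq> carrier (WA s)"
proof
  interpret P: algebra R "WA s" by (rule WA_algebra)
  note closed = WA_basis P.minus_closed P.a_closed P.smult_closed word_update
  fix p assume "p \<in> tensor_rel s"
  then show "p \<in> carrier (WA s)"
  proof (cases rule: tensor_rel_cases)
    case (add l m gs)
    then have "word s (l \<oplus>\<^bsub>LA R\<^esub> m) gs" by (simp add: word_def)
    with add show ?thesis by (simp add: closed)
  next
    case (smult r l gs)
    then have "word s (r \<odot>\<^bsub>LA R\<^esub> l) gs" by (simp add: word_def)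
    with smult show ?thesis by (simp add: closed)
  next
    case (slide0 l r gs)
    then have "word s (l \<otimes>\<^bsub>LA R\<^esub> r) gs" by (simp add: word_def)
    with slide0 show ?thesis using word_nth[OF slide0(1), of 0] by (simp add: closed)
  next
    case (slide l r gs i) then show ?thesis
      using word_nth[OF slide(1), of i] word_nth[OF slide(1), of "Suc i"] by (simp add: closed)
  qed (simp add: closed)
qed

lemma tensor_ideal_ideal: "ideal (tensor_ideal R s) (WA s)"
  unfolding tensor_ideal_eq by (rule genideal_monoid_algebra[OF word_comm_monoid tensor_rel_closed])

lemma tensor_algebra: "algebra R (tensor R s)"
  unfolding tensor_def by (rule algebra.quotient_algebra(1)[OF WA_algebra tensor_ideal_ideal])

lemma tensor_coset_map: "(\<lambda>p. tensor_ideal R s +>\<^bsub>WA s\<^esub> p) \<in> algebra_maps R (WA s) (tensor R s)"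
  unfolding tensor_def by (rule algebra.quotient_algebra(2)[OF WA_algebra tensor_ideal_ideal])

lemma tensor_carrierE:
  assumes "X \<in> carrier (tensor R s)"
  obtains p where "p \<in> carrier (WA s)" "X = tensor_ideal R s +>\<^bsub>WA s\<^esub> p"
  using assms unfolding tensor_def by (rule quotient_carrierE)

lemma pure_eq: "length gs = s \<Longrightarrow> pure_tensor R l gs = tensor_ideal R s +>\<^bsub>WA s\<^esub> basis R (l, gs)"
  by (simp add: pure_tensor_def)

lemma pure_closed [simp]: "word s l gs \<Longrightarrow> pure_tensor R l gs \<in> carrier (tensor R s)"
  using algebra_mapsD(2)[OF tensor_coset_map WA_basis] by (simp add: pure_eq[OF word_length])

lemma pure_mult:
  assumes "word s l gs" "word s m hs"
  shows "pure_tensor R l gs \<otimes>\<^bsub>tensor R s\<^esub> pure_tensor R m hs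
    = pure_tensor R (l \<otimes>\<^bsub>LA R\<^esub> m) (map2 (monoid.mult (LB R)) gs hs)"
proof -
  have len: "length gs = s" "length hs = s" using assms by (auto simp: word_def)
  have "basis R (l, gs) \<otimes>\<^bsub>WA s\<^esub> basis R (m, hs) = basis R ((l, gs) \<otimes>\<^bsub>word_monoid R s\<^esub> (m, hs))"
    by (rule monoid_algebra_mult_basis[OF word_comm_monoid]) (simp_all add: word_carrier assms)
  also have "(l, gs) \<otimes>\<^bsub>word_monoid R s\<^esub> (m, hs) = (l \<otimes>\<^bsub>LA R\<^esub> m, map2 (monoid.mult (LB R)) gs hs)"
    by (simp add: word_monoid_def)
  finally show ?thesis
    using algebra_mapsD(6)[OF tensor_coset_map WA_basis[OF assms(1)] WA_basis[OF assms(2)]] len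
    by (simp add: pure_eq)
qed

lemma pure_one: "pure_tensor R \<one>\<^bsub>LA R\<^esub> (replicate s \<one>\<^bsub>LB R\<^esub>) = \<one>\<^bsub>tensor R s\<^esub>"
  using algebra_mapsD(5)[OF tensor_coset_map] by (simp add: pure_eq monoid_algebra_sel word_monoid_def)

lemma pure_rel:
  assumes x: "x \<in> carrier (WA s)" and y: "y \<in> carrier (WA s)" and "x \<ominus>\<^bsub>WA s\<^esub> y \<in> tensor_rel s"
  shows "tensor_ideal R s +>\<^bsub>WA s\<^esub> x = tensor_ideal R s +>\<^bsub>WA s\<^esub> y"
proof -
  interpret P: algebra R "WA s" by (rule WA_algebra)
  have "x \<ominus>\<^bsub>WA s\<^esub> y \<in> tensor_ideal R s"
    unfolding tensor_ideal_eq using P.genideal_self[OF tensor_rel_closed] assms(3) by blast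
  then show ?thesis using P.coset_eq_iff[OF P.ideal_submodule[OF tensor_ideal_ideal] x y] by blast
qed

lemma pure_add:
  assumes "word s l gs" "m \<in> carrier (LA R)"
  shows "pure_tensor R (l \<oplus>\<^bsub>LA R\<^esub> m) gs = pure_tensor R l gs \<oplus>\<^bsub>tensor R s\<^esub> pure_tensor R m gs"
proof -
  interpret P: algebra R "WA s" by (rule WA_algebra)
  have w: "word s m gs" "word s (l \<oplus>\<^bsub>LA R\<^esub> m) gs" "length gs = s" using assms by (auto simp: word_def)
  have "tensor_ideal R s +>\<^bsub>WA s\<^esub> basis R (l \<oplus>\<^bsub>LA R\<^esub> m, gs)
      = tensor_ideal R s +>\<^bsub>WA s\<^esub> (basis R (l, gs) \<oplus>\<^bsub>WA s\<^esub> basis R (m, gs))"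
  proof (rule pure_rel)
    show "basis R (l \<oplus>\<^bsub>LA R\<^esub> m, gs) \<ominus>\<^bsub>WA s\<^esub> (basis R (l, gs) \<oplus>\<^bsub>WA s\<^esub> basis R (m, gs)) \<in> tensor_rel s"
      using assms(1) w(1) unfolding tensor_rel_def Let_def word_carrier by blast
  qed (intro WA_basis P.a_closed assms w)+
  then show ?thesis
    using algebra_mapsD(3)[OF tensor_coset_map WA_basis[OF assms(1)] WA_basis[OF w(1)]] w by (simp add: pure_eq)
qed

lemma pure_smult:
  assumes "word s l gs" "a \<in> carrier R"
  shows "pure_tensor R (a \<odot>\<^bsub>LA R\<^esub> l) gs = a \<odot>\<^bsub>tensor R s\<^esub> pure_tensor R l gs"
proof -
  interpret P: algebra R "WA s" by (rule WA_algebra)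
  have w: "word s (a \<odot>\<^bsub>LA R\<^esub> l) gs" "length gs = s" using assms by (auto simp: word_def)
  have "tensor_ideal R s +>\<^bsub>WA s\<^esub> basis R (a \<odot>\<^bsub>LA R\<^esub> l, gs)
      = tensor_ideal R s +>\<^bsub>WA s\<^esub> (a \<odot>\<^bsub>WA s\<^esub> basis R (l, gs))"
  proof (rule pure_rel)
    show "basis R (a \<odot>\<^bsub>LA R\<^esub> l, gs) \<ominus>\<^bsub>WA s\<^esub> a \<odot>\<^bsub>WA s\<^esub> basis R (l, gs) \<in> tensor_rel s"
      using assms unfolding tensor_rel_def Let_def word_carrier by blast
  qed (intro WA_basis P.smult_closed assms w)+
  then show ?thesis
    using algebra_mapsD(4)[OF tensor_coset_map assms(2) WA_basis[OF assms(1)]] w by (simp add: pure_eq)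
qed

lemma pure_add_slot:
  assumes "word s l gs" "i < s" "g \<in> carrier (LB R)" "h \<in> carrier (LB R)"
  shows "pure_tensor R l (gs[i := g \<oplus>\<^bsub>LB R\<^esub> h])
    = pure_tensor R l (gs[i := g]) \<oplus>\<^bsub>tensor R s\<^esub> pure_tensor R l (gs[i := h])"
proof -
  interpret P: algebra R "WA s" by (rule WA_algebra)
  have w: "word s l (gs[i := g])" "word s l (gs[i := h])" "word s l (gs[i := g \<oplus>\<^bsub>LB R\<^esub> h])" "length gs = s"
    using assms by (auto intro: word_update word_length)
  have "tensor_ideal R s +>\<^bsub>WA s\<^esub> basis R (l, gs[i := g \<oplus>\<^bsub>LB R\<^esub> h])
      = tensor_ideal R s +>\<^bsub>WA s\<^esub> (basis R (l, gs[i := g]) \<oplus>\<^bsub>WA s\<^esub> basis R (l, gs[i := h]))"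
  proof (rule pure_rel)
    show "basis R (l, gs[i := g \<oplus>\<^bsub>LB R\<^esub> h]) \<ominus>\<^bsub>WA s\<^esub> (basis R (l, gs[i := g]) \<oplus>\<^bsub>WA s\<^esub> basis R (l, gs[i := h]))
        \<in> tensor_rel s"
      using assms unfolding tensor_rel_def Let_def word_carrier by blast
  qed (intro WA_basis P.a_closed w)+
  then show ?thesis
    using algebra_mapsD(3)[OF tensor_coset_map WA_basis[OF w(1)] WA_basis[OF w(2)]] w by (simp add: pure_eq)
qed

lemma pure_slide0:
  assumes "word s l gs" "r \<in> carrier (LA R)" "0 < s"
  shows "pure_tensor R (l \<otimes>\<^bsub>LA R\<^esub> r) gs = pure_tensor R l (gs[0 := eta_L R r \<otimes>\<^bsub>LB R\<^esub> gs ! 0])"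
proof -
  have w: "word s (l \<otimes>\<^bsub>LA R\<^esub> r) gs" "word s l (gs[0 := eta_L R r \<otimes>\<^bsub>LB R\<^esub> gs ! 0])" "length gs = s"
    using assms word_nth[OF assms(1,3)]
    by (simp_all add: word_update word_length word_left word_change[OF assms(1)])
  have "tensor_ideal R s +>\<^bsub>WA s\<^esub> basis R (l \<otimes>\<^bsub>LA R\<^esub> r, gs)
      = tensor_ideal R s +>\<^bsub>WA s\<^esub> basis R (l, gs[0 := eta_L R r \<otimes>\<^bsub>LB R\<^esub> gs ! 0])"
  proof (rule pure_rel)
    show "basis R (l \<otimes>\<^bsub>LA R\<^esub> r, gs) \<ominus>\<^bsub>WA s\<^esub> basis R (l, gs[0 := eta_L R r \<otimes>\<^bsub>LB R\<^esub> gs ! 0]) \<in> tensor_rel s"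
      using assms unfolding tensor_rel_def Let_def word_carrier by blast
  qed (intro WA_basis w)+
  then show ?thesis using w by (simp add: pure_eq)
qed

lemma pure_slide:
  assumes "word s l gs" "r \<in> carrier (LA R)" "Suc i < s"
  shows "pure_tensor R l (gs[i := gs ! i \<otimes>\<^bsub>LB R\<^esub> eta_R R r])
    = pure_tensor R l (gs[Suc i := eta_L R r \<otimes>\<^bsub>LB R\<^esub> gs ! Suc i])"
proof -
  have w: "word s l (gs[i := gs ! i \<otimes>\<^bsub>LB R\<^esub> eta_R R r])" "word s l (gs[Suc i := eta_L R r \<otimes>\<^bsub>LB R\<^esub> gs ! Suc i])" "length gs = s"
    using assms word_nth[OF assms(1)] by (simp_all add: word_update word_length)
  have "tensor_ideal R s +>\<^bsub>WA s\<^esub> basis R (l, gs[i := gs ! i \<otimes>\<^bsub>LB R\<^esub> eta_R R r])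
      = tensor_ideal R s +>\<^bsub>WA s\<^esub> basis R (l, gs[Suc i := eta_L R r \<otimes>\<^bsub>LB R\<^esub> gs ! Suc i])"
  proof (rule pure_rel)
    show "basis R (l, gs[i := gs ! i \<otimes>\<^bsub>LB R\<^esub> eta_R R r]) \<ominus>\<^bsub>WA s\<^esub> basis R (l, gs[Suc i := eta_L R r \<otimes>\<^bsub>LB R\<^esub> gs ! Suc i])
        \<in> tensor_rel s"
      using assms unfolding tensor_rel_def Let_def word_carrier by blast
  qed (intro WA_basis w)+
  then show ?thesis using w by (simp add: pure_eq)
qed

lemma tensor_maps_eq:
  assumes N: "module R N" and f: "f \<in> linear_maps R (tensor R s) N" and g: "g \<in> linear_maps R (tensor R s) N"
    and eq: "\<And>l gs. word s l gs \<Longrightarrow> f (pure_tensor R l gs) = g (pure_tensor R l gs)"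
    and X: "X \<in> carrier (tensor R s)"
  shows "f X = g X"
proof -
  obtain p where p: "p \<in> carrier (WA s)" "X = tensor_ideal R s +>\<^bsub>WA s\<^esub> p" using X by (rule tensor_carrierE)
  have c: "(\<lambda>p. h (tensor_ideal R s +>\<^bsub>WA s\<^esub> p)) \<in> linear_maps R (free_module R (carrier (word_monoid R s))) N"
    if "h \<in> linear_maps R (tensor R s) N" for h
    using linear_maps_comp[OF algebra_mapsD(1)[OF tensor_coset_map] that] by (simp add: linear_maps_monoid_algebra)
  have b: "f (tensor_ideal R s +>\<^bsub>WA s\<^esub> basis R x) = g (tensor_ideal R s +>\<^bsub>WA s\<^esub> basis R x)"
    if "x \<in> carrier (word_monoid R s)" for x
  proof -
    obtain l gs where x: "x = (l, gs)" by (metis prod.exhaust)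
    with that have w: "word s l gs" by (simp add: word_carrier)
    then show ?thesis using eq[OF w] by (simp add: x pure_eq[OF word_length[OF w]])
  qed
  show ?thesis
    using free_module_maps_eq[OF N c[OF f] c[OF g] b p(1)[unfolded monoid_algebra_sel]] p(2) by simp
qed

definition "psi w = linear_lift R Q (psi_word w)"

context
  fixes w :: "nat \<Rightarrow> nat multiset \<Rightarrow> 'a bud"
  assumes w: "\<And>k. w k \<in> carrier Q"
begin

lemma psi_word_apply: "psi_word w (l, gs) = tau (w 0) l \<otimes>\<^bsub>Q\<^esub> lamprod gs w"
  by (simp add: psi_word_def)

lemma psi_word_closed: "word s l gs \<Longrightarrow> psi_word w (l, gs) \<in> carrier Q"
  by (simp add: psi_word_def word_def lamprod_closed w algebra_mapsD(2)[OF tau_map])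

lemma psi_word_hom:
  "psi_word w \<in> carrier (word_monoid R s) \<rightarrow> carrier Q"
  "psi_word w \<one>\<^bsub>word_monoid R s\<^esub> = \<one>\<^bsub>Q\<^esub>"
  "x \<in> carrier (word_monoid R s) \<Longrightarrow> y \<in> carrier (word_monoid R s) \<Longrightarrow>
    psi_word w (x \<otimes>\<^bsub>word_monoid R s\<^esub> y) = psi_word w x \<otimes>\<^bsub>Q\<^esub> psi_word w y"
proof -
  note t = algebra_mapsD[OF tau_map[OF w]]
  show "psi_word w \<in> carrier (word_monoid R s) \<rightarrow> carrier Q"
    using psi_word_closed by (auto simp: word_carrier)
  show "psi_word w \<one>\<^bsub>word_monoid R s\<^esub> = \<one>\<^bsub>Q\<^esub>"
    by (simp add: word_monoid_def psi_word_def lamprod_one w t)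
  assume x: "x \<in> carrier (word_monoid R s)" and y: "y \<in> carrier (word_monoid R s)"
  obtain l gs m hs where xy: "x = (l, gs)" "y = (m, hs)" by (metis prod.exhaust)
  note c = x[unfolded xy word_carrier word_def] y[unfolded xy word_carrier word_def]
  have sw: "a \<otimes>\<^bsub>Q\<^esub> b \<otimes>\<^bsub>Q\<^esub> (c \<otimes>\<^bsub>Q\<^esub> d) = a \<otimes>\<^bsub>Q\<^esub> c \<otimes>\<^bsub>Q\<^esub> (b \<otimes>\<^bsub>Q\<^esub> d)"
    if "a \<in> carrier Q" "b \<in> carrier Q" "c \<in> carrier Q" "d \<in> carrier Q" for a b c d
    using that by (simp add: Q.m_ac)
  show "psi_word w (x \<otimes>\<^bsub>word_monoid R s\<^esub> y) = psi_word w x \<otimes>\<^bsub>Q\<^esub> psi_word w y"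
    using c by (simp add: xy word_monoid_def psi_word_def lamprod_mult w t lamprod_closed sw)
qed

lemma psi_word_update:
  assumes "word s l gs" "i < s" "g \<in> carrier (LB R)"
  shows "psi_word w (l, gs[i := g]) = (tau (w 0) l \<otimes>\<^bsub>Q\<^esub> lamprod (take i gs) w
    \<otimes>\<^bsub>Q\<^esub> lamprod (drop (Suc i) gs) (\<lambda>k. w (Suc i + k))) \<otimes>\<^bsub>Q\<^esub> lam (w i) (w (Suc i)) g"
proof -
  have c: "set (take i gs) \<subseteq> carrier (LB R)" "set (drop (Suc i) gs) \<subseteq> carrier (LB R)" "l \<in> carrier (LA R)" "length gs = s"
    using assms(1) by (auto simp: word_def dest: in_set_takeD in_set_dropD)
  have "lamprod (gs[i := g]) w = lamprod (take i gs) w \<otimes>\<^bsub>Q\<^esub> (lam (w i) (w (Suc i)) g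
      \<otimes>\<^bsub>Q\<^esub> lamprod (drop (Suc i) gs) (\<lambda>k. w (Suc i + k)))"
    using lamprod_split[of i "gs[i := g]" w] word_update[OF assms(1,3), of i] assms(2) c(4)
    by (simp add: word_def w)
  then show ?thesis
    using c assms by (simp add: psi_word_def lamprod_closed w lam_closed algebra_mapsD(2)[OF tau_map] Q.m_ac)
qed

lemma psi_word_update2:
  assumes "word s l gs" "Suc i < s" "g \<in> carrier (LB R)" "h \<in> carrier (LB R)"
  shows "psi_word w (l, gs[i := g, Suc i := h]) = (tau (w 0) l \<otimes>\<^bsub>Q\<^esub> lamprod (take i gs) w
    \<otimes>\<^bsub>Q\<^esub> lamprod (drop (Suc (Suc i)) gs) (\<lambda>k. w (Suc (Suc i) + k)))
    \<otimes>\<^bsub>Q\<^esub> (lam (w i) (w (Suc i)) g \<otimes>\<^bsub>Q\<^esub> lam (w (Suc i)) (w (Suc (Suc i))) h)"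
proof -
  have c: "set (take i gs) \<subseteq> carrier (LB R)" "set (drop (Suc (Suc i)) gs) \<subseteq> carrier (LB R)" "l \<in> carrier (LA R)" "length gs = s"
    using assms(1) by (auto simp: word_def dest: in_set_takeD in_set_dropD)
  have d: "drop (Suc i) (gs[i := g, Suc i := h]) = h # drop (Suc (Suc i)) gs"
    using assms(2) c(4) by (subst Cons_nth_drop_Suc[symmetric]) simp_all
  have "lamprod (gs[i := g, Suc i := h]) w = lamprod (take i gs) w \<otimes>\<^bsub>Q\<^esub> (lam (w i) (w (Suc i)) g
      \<otimes>\<^bsub>Q\<^esub> (lam (w (Suc i)) (w (Suc (Suc i))) h \<otimes>\<^bsub>Q\<^esub> lamprod (drop (Suc (Suc i)) gs) (\<lambda>k. w (Suc (Suc i) + k))))"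
    using lamprod_split[of i "gs[i := g, Suc i := h]" w]
      word_update[OF word_update[OF assms(1,3), of i] assms(4), of "Suc i"] assms(2) c(4)
    by (simp add: word_def w d)
  then show ?thesis
    using c assms by (simp add: psi_word_def lamprod_closed w lam_closed algebra_mapsD(2)[OF tau_map] Q.m_ac)
qed

lemma psi_word_ext: "linear_ext R Q (psi_word w) \<in> algebra_maps R (WA s) Q"
  by (rule linear_ext_algebra_map[OF word_comm_monoid Q_algebra psi_word_hom])

text \<open>The two sliding relations hold because \<open>r\<close> is evaluated at the same point
  on either side: at \<open>w 0\<close> between the leading ring and the first factor, at
  \<open>w (Suc i)\<close> between factors i and i + 1. The remaining relations express linearity in
  one slot.\<close>

lemma psi_word_kernel:
  assumes "p \<in> tensor_rel s" shows "linear_ext R Q (psi_word w) p = \<zero>\<^bsub>Q\<^esub>"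
proof -
  interpret P: algebra R "WA s" by (rule WA_algebra)
  let ?h = "linear_ext R Q (psi_word w)"
  note h = algebra_mapsD[OF psi_word_ext[of s]]
  have b: "?h (basis R (l, gs)) = psi_word w (l, gs)" if "word s l gs" for l gs
    by (rule linear_ext_basis[OF Q.module psi_word_hom(1), of _ s]) (simp add: word_carrier that)
  note t = algebra_mapsD[OF tau_map[OF w]]
  have zero: "?h (x \<ominus>\<^bsub>WA s\<^esub> y) = \<zero>\<^bsub>Q\<^esub>" if "x \<in> carrier (WA s)" "y \<in> carrier (WA s)" "?h x = ?h y" for x y
    using that linear_map_minus[OF P.module Q.module h(1) that(1,2)] h(2) Q.minus_eq_zero_iff by metis
  have lc: "lamprod gs w \<in> carrier Q" if "word s l gs" for l gs
    using that by (simp add: word_def lamprod_closed w)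
  from assms show ?thesis
  proof (cases rule: tensor_rel_cases)
    case (add l m gs)
    then have w': "word s m gs" "word s (l \<oplus>\<^bsub>LA R\<^esub> m) gs" "l \<in> carrier (LA R)" "m \<in> carrier (LA R)"
      by (auto simp: word_def)
    have "?h (basis R (l, gs) \<oplus>\<^bsub>WA s\<^esub> basis R (m, gs)) = ?h (basis R (l \<oplus>\<^bsub>LA R\<^esub> m, gs))"
      using h(3)[OF WA_basis[OF add(1)] WA_basis[OF w'(1)]] add w' lc[OF add(1)]
      by (simp add: b psi_word_apply t Q.l_distr)
    then show ?thesis unfolding add(3)
      by (intro zero WA_basis P.a_closed add w') simp
  next
    case (smult a l gs)
    then have w': "word s (a \<odot>\<^bsub>LA R\<^esub> l) gs" "l \<in> carrier (LA R)" by (auto simp: word_def)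
    have "?h (a \<odot>\<^bsub>WA s\<^esub> basis R (l, gs)) = ?h (basis R (a \<odot>\<^bsub>LA R\<^esub> l, gs))"
      using h(4)[OF smult(1) WA_basis[OF smult(2)]] smult w' lc[OF smult(2)]
      by (simp add: b psi_word_apply t Q.smult_assoc2)
    then show ?thesis unfolding smult(3)
      by (intro zero WA_basis P.smult_closed smult w') simp
  next
    case (add_slot l gs i g k)
    then have w': "word s l (gs[i := g])" "word s l (gs[i := k])" "word s l (gs[i := g \<oplus>\<^bsub>LB R\<^esub> k])"
      "set (take i gs) \<subseteq> carrier (LB R)" "set (drop (Suc i) gs) \<subseteq> carrier (LB R)" "l \<in> carrier (LA R)"
      using in_set_takeD in_set_dropD by (fastforce simp: word_def intro: word_update)+
    have "?h (basis R (l, gs[i := g]) \<oplus>\<^bsub>WA s\<^esub> basis R (l, gs[i := k])) = ?h (basis R (l, gs[i := g \<oplus>\<^bsub>LB R\<^esub> k]))"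
      using h(3)[OF WA_basis[OF w'(1)] WA_basis[OF w'(2)]] add_slot w'
      by (simp add: b psi_word_update[OF add_slot(1,2)] algebra_mapsD(3)[OF lam_map] w Q.r_distr lamprod_closed lam_closed t)
    then show ?thesis unfolding add_slot(5)
      by (intro zero WA_basis P.a_closed w') simp
  next
    case (slide0 l r gs)
    let ?g = "eta_L R r \<otimes>\<^bsub>LB R\<^esub> gs ! 0"
    have g0: "gs ! 0 \<in> carrier (LB R)" by (rule word_nth[OF slide0(1,3)])
    have w': "word s (l \<otimes>\<^bsub>LA R\<^esub> r) gs" "l \<in> carrier (LA R)" "word s l (gs[0 := ?g])"
      using slide0 g0 by (simp_all add: word_update word_left word_change[OF slide0(1)])
    have c: "set (drop (Suc 0) gs) \<subseteq> carrier (LB R)"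
      using slide0(1) by (auto simp: word_def dest: in_set_dropD)
    have "psi_word w (l \<otimes>\<^bsub>LA R\<^esub> r, gs[0 := gs ! 0]) = psi_word w (l, gs[0 := ?g])"
      using psi_word_update[OF w'(1) slide0(3) g0] psi_word_update[OF slide0(1,3), of ?g] g0 w' c slide0(2)
      by (simp add: t algebra_mapsD(6)[OF lam_map] w lam_eta_L lam_closed lamprod_closed Q.m_ac)
    then show ?thesis unfolding slide0(4)
      by (intro zero WA_basis w') (use w' in \<open>simp add: b\<close>)
  next
    case (slide l r gs i)
    let ?g = "gs ! i \<otimes>\<^bsub>LB R\<^esub> eta_R R r" and ?k = "eta_L R r \<otimes>\<^bsub>LB R\<^esub> gs ! Suc i"
    have g: "gs ! i \<in> carrier (LB R)" "gs ! Suc i \<in> carrier (LB R)"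
      using slide word_nth by auto
    have w': "word s l (gs[i := ?g])" "word s l (gs[Suc i := ?k])"
      using slide g by (simp_all add: word_update)
    have c: "set (take i gs) \<subseteq> carrier (LB R)" "set (drop (Suc (Suc i)) gs) \<subseteq> carrier (LB R)" "l \<in> carrier (LA R)" "length gs = s"
      using slide(1) by (auto simp: word_def dest: in_set_takeD in_set_dropD)
    have "lam (w i) (w (Suc i)) ?g \<otimes>\<^bsub>Q\<^esub> lam (w (Suc i)) (w (Suc (Suc i))) (gs ! Suc i)
        = lam (w i) (w (Suc i)) (gs ! i) \<otimes>\<^bsub>Q\<^esub> lam (w (Suc i)) (w (Suc (Suc i))) ?k"
      using g slide(2) by (simp add: algebra_mapsD(6)[OF lam_map] w lam_eta_L lam_eta_R lam_closed t Q.m_assoc)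
    \<comment> \<open>The two sides of the relation alter different slots, so both are written as
      updates of the same pair of slots; the unchanged slot is updated by its own entry.\<close>
    then have "psi_word w (l, gs[i := ?g, Suc i := gs ! Suc i]) = psi_word w (l, gs[i := gs ! i, Suc i := ?k])"
      using g slide(2) by (simp only: psi_word_update2[OF slide(1,3)] B.m_closed eta_closed)
    moreover have "gs[i := ?g, Suc i := gs ! Suc i] = gs[i := ?g]" "gs[i := gs ! i] = gs"
      by (simp_all add: list_update_swap[of i "Suc i"])
    ultimately show ?thesis unfolding slide(4)
      by (intro zero WA_basis w') (use w' in \<open>simp add: b\<close>)
  qed
qed

lemma psi_map: "psi w \<in> algebra_maps R (tensor R s) Q"
  unfolding psi_def tensor_def tensor_ideal_eq
  by (rule monoid_algebra_quotient_lift(2)[OF word_comm_monoid tensor_rel_closed Q_algebra psi_word_hom psi_word_kernel])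

lemma psi_coset:
  "p \<in> carrier (WA s) \<Longrightarrow> psi w (tensor_ideal R s +>\<^bsub>WA s\<^esub> p) = linear_ext R Q (psi_word w) p"
  unfolding psi_def tensor_ideal_eq
  by (rule monoid_algebra_quotient_lift(1)[OF word_comm_monoid tensor_rel_closed Q_algebra psi_word_hom psi_word_kernel])

lemma psi_pure:
  assumes "word s l gs" shows "psi w (pure_tensor R l gs) = tau (w 0) l \<otimes>\<^bsub>Q\<^esub> lamprod gs w"
proof -
  have "psi w (pure_tensor R l gs) = linear_ext R Q (psi_word w) (basis R (l, gs))"
    using assms psi_coset[OF WA_basis[OF assms]] by (simp add: pure_eq[OF word_length[OF assms]])
  also have "\<dots> = psi_word w (l, gs)"
    by (rule linear_ext_basis[OF Q.module psi_word_hom(1), of _ s]) (simp add: word_carrier assms)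
  finally show ?thesis by (simp add: psi_word_def)
qed

end

text \<open>The standard points: their successive differences are the variables themselves, so
  \<open>psi tsum\<close> reads off coordinates, and they start at zero, so the leading ring is
  embedded by constants.\<close>

primrec tsum :: "nat \<Rightarrow> nat multiset \<Rightarrow> 'a bud" where
  "tsum 0 = \<zero>\<^bsub>Q\<^esub>"
| "tsum (Suc j) = tsum j \<oplus>\<^bsub>Q\<^esub> qt j"

lemma tsum_closed [simp]: "tsum j \<in> carrier Q"
  by (induction j) simp_all

lemma tsum_diff: "tsum (Suc j) \<ominus>\<^bsub>Q\<^esub> tsum j = qt j"
  by (simp add: a_minus_def Q.a_ac Q.r_neg Q.r_neg1 Q.a_assoc[symmetric])

section \<open>The inverse of the coordinate map\<close>

definition "ones s = replicate s \<one>\<^bsub>LB R\<^esub>"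
definition "cst s l = pure_tensor R l (ones s)"
definition "ins s i g = pure_tensor R \<one>\<^bsub>LA R\<^esub> ((ones s)[i := g])"
text \<open>A polynomial ring in all variables maps to a tensor power with \<open>s\<close> factors;
  the variables with index at least \<open>s\<close> have no factor to go to and are sent to zero as
  a filler. On polynomials in the first \<open>s\<close> variables this inverts
  \<open>psi tsum\<close>.\<close>

definition "Theta s = Qlift (tensor R s) (cst s) (\<lambda>i. if i < s then ins s i (LB_t R) else \<zero>\<^bsub>tensor R s\<^esub>)"

lemma word_ones [simp]: "l \<in> carrier (LA R) \<Longrightarrow> word s l (ones s)"
  by (simp add: ones_def)

lemma length_ones [simp]: "length (ones s) = s"
  by (simp add: ones_def)

lemma nth_ones [simp]: "i < s \<Longrightarrow> ones s ! i = \<one>\<^bsub>LB R\<^esub>"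
  by (simp add: ones_def)

lemma map2_ones: "set gs \<subseteq> carrier (LB R) \<Longrightarrow> length gs = s \<Longrightarrow> map2 (monoid.mult (LB R)) gs (ones s) = gs"
  by (rule nth_equalityI) (auto simp: subset_iff)

lemma cst_map: "cst s \<in> algebra_maps R (LA R) (tensor R s)"
proof (intro algebra_mapsI linear_mapsI)
  have o: "map2 (monoid.mult (LB R)) (ones s) (ones s) = ones s"
    by (rule map2_ones) (auto simp: ones_def)
  fix x y assume "x \<in> carrier (LA R)" "y \<in> carrier (LA R)"
  then show "cst s (x \<otimes>\<^bsub>LA R\<^esub> y) = cst s x \<otimes>\<^bsub>tensor R s\<^esub> cst s y"
    by (simp add: cst_def pure_mult[of s] o)
qed (simp_all add: cst_def pure_add[of s] pure_smult[of s] pure_one[folded ones_def])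

lemma ins_hom:
  assumes i: "i < s" shows "ins s i \<in> ring_hom (LB R) (tensor R s)"
proof (rule ring_hom_memI)
  have w: "word s \<one>\<^bsub>LA R\<^esub> ((ones s)[i := g])" if "g \<in> carrier (LB R)" for g
    by (rule word_update[OF word_ones that]) simp
  fix g h assume g: "g \<in> carrier (LB R)" and h: "h \<in> carrier (LB R)"
  show "ins s i g \<in> carrier (tensor R s)" unfolding ins_def by (rule pure_closed[OF w[OF g]])
  show "ins s i (g \<oplus>\<^bsub>LB R\<^esub> h) = ins s i g \<oplus>\<^bsub>tensor R s\<^esub> ins s i h"
    unfolding ins_def by (rule pure_add_slot[OF word_ones i g h]) simp
  have "map2 (monoid.mult (LB R)) ((ones s)[i := g]) ((ones s)[i := h]) = (ones s)[i := g \<otimes>\<^bsub>LB R\<^esub> h]"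
    by (rule nth_equalityI) (auto simp: nth_list_update g h i)
  then show "ins s i (g \<otimes>\<^bsub>LB R\<^esub> h) = ins s i g \<otimes>\<^bsub>tensor R s\<^esub> ins s i h"
    unfolding ins_def using pure_mult[OF w[OF g] w[OF h]] by simp
next
  have "(ones s)[i := \<one>\<^bsub>LB R\<^esub>] = ones s" using i list_update_id[of "ones s" i] by simp
  then show "ins s i \<one>\<^bsub>LB R\<^esub> = \<one>\<^bsub>tensor R s\<^esub>" by (simp add: ins_def pure_one[folded ones_def])
qed

lemma Theta:
  shows Theta_map: "Theta s \<in> algebra_maps R Q (tensor R s)"
    and Theta_qc: "l \<in> carrier (LA R) \<Longrightarrow> Theta s (qc l) = cst s l"
    and Theta_qt: "i < s \<Longrightarrow> Theta s (qt i) = ins s i (LB_t R)"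
proof -
  interpret T: algebra R "tensor R s" by (rule tensor_algebra)
  have u: "(if i < s then ins s i (LB_t R) else \<zero>\<^bsub>tensor R s\<^esub>) \<in> carrier (tensor R s)" for i
    using ring_hom_closed[OF ins_hom LB_t_closed] by simp
  note q = Qlift[OF tensor_algebra cst_map u]
  show "Theta s \<in> algebra_maps R Q (tensor R s)" unfolding Theta_def by (rule q(1))
  show "l \<in> carrier (LA R) \<Longrightarrow> Theta s (qc l) = cst s l" unfolding Theta_def by (rule q(2))
  show "i < s \<Longrightarrow> Theta s (qt i) = ins s i (LB_t R)" unfolding Theta_def q(3) by simp
qed

text \<open>Maps out of \<open>LB\<close> are compared on constants and on the variable. For
  constants, \<open>tau (tsum i) l\<close> must go to \<open>eta_L R l\<close> in factor i. In
  factor 0 this is sliding from the leading ring. For factor i + 1, sliding turns the left unit into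
  the right unit in factor i, where the induction hypothesis applies and \<open>lam_eta_R\<close>
  moves on to the next point.\<close>

lemma Theta_lam:
  "i < s \<Longrightarrow> g \<in> carrier (LB R) \<Longrightarrow> Theta s (lam (tsum i) (tsum (Suc i)) g) = ins s i g"
proof (induction i arbitrary: g)
  interpret T: algebra R "tensor R s" by (rule tensor_algebra)
  have step: "Theta s (lam (tsum i) (tsum (Suc i)) g) = ins s i g"
    if i: "i < s" and g: "g \<in> carrier (LB R)"
      and l: "\<And>l. l \<in> carrier (LA R) \<Longrightarrow> Theta s (tau (tsum i) l) = ins s i (eta_L R l)" for i g
  proof (rule LB_hom_eq[OF T.M_cring _ _ ins_hom[OF i], where h = "\<lambda>l. Theta s (tau (tsum i) l)"])
    show "(\<lambda>l. Theta s (tau (tsum i) l)) \<in> ring_hom (LA R) (tensor R s)"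
      by (rule algebra_maps_ring_hom[OF algebra_maps_comp[OF tau_map Theta_map]]) simp
    show "(\<lambda>g. Theta s (lam (tsum i) (tsum (Suc i)) g)) \<in> ring_hom (LB R) (tensor R s)"
      by (rule algebra_maps_ring_hom[OF algebra_maps_comp[OF lam_map Theta_map]]) simp_all
    show "Theta s (lam (tsum i) (tsum (Suc i)) (LB_t R)) = ins s i (LB_t R)"
      by (simp only: lam_t tsum_closed tsum_diff Theta_qt[OF i])
    fix l assume "l \<in> carrier (LA R)"
    then show "Theta s (lam (tsum i) (tsum (Suc i)) (eta_L R l)) = Theta s (tau (tsum i) l)"
      "ins s i (eta_L R l) = Theta s (tau (tsum i) l)"
      by (simp_all only: lam_eta_L tsum_closed l)
  qed (rule g)
  {
    case 0
    show ?case
    proof (rule step[OF 0])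
      fix l assume l: "l \<in> carrier (LA R)"
      have "pure_tensor R (\<one>\<^bsub>LA R\<^esub> \<otimes>\<^bsub>LA R\<^esub> l) (ones s)
          = pure_tensor R \<one>\<^bsub>LA R\<^esub> ((ones s)[0 := eta_L R l \<otimes>\<^bsub>LB R\<^esub> ones s ! 0])"
        by (rule pure_slide0[OF word_ones l 0(1)]) simp
      with l 0 show "Theta s (tau (tsum 0) l) = ins s 0 (eta_L R l)"
        by (simp add: tau_zero Theta_qc cst_def ins_def)
    qed
  next
    case (Suc i)
    show ?case
    proof (rule step[OF Suc.prems])
      fix l assume l: "l \<in> carrier (LA R)"
      have "pure_tensor R \<one>\<^bsub>LA R\<^esub> ((ones s)[i := ones s ! i \<otimes>\<^bsub>LB R\<^esub> eta_R R l])
          = pure_tensor R \<one>\<^bsub>LA R\<^esub> ((ones s)[Suc i := eta_L R l \<otimes>\<^bsub>LB R\<^esub> ones s ! Suc i])"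
        by (rule pure_slide[OF word_ones l Suc.prems(1)]) simp
      then have "ins s (Suc i) (eta_L R l) = ins s i (eta_R R l)"
        using l Suc.prems by (simp add: ins_def)
      also have "\<dots> = Theta s (lam (tsum i) (tsum (Suc i)) (eta_R R l))"
        using Suc.IH[of "eta_R R l"] Suc.prems l by simp
      also have "\<dots> = Theta s (tau (tsum (Suc i)) l)"
        by (simp only: lam_eta_R tsum_closed l)
      finally show "Theta s (tau (tsum (Suc i)) l) = ins s (Suc i) (eta_L R l)" by simp
    qed
  }
qed

text \<open>The factors of a pure tensor are multiplied in one at a time: the product of the first k
  coordinates corresponds to the pure tensor whose remaining slots are one. Consequently
  \<open>psi tsum\<close> is injective on each tensor power.\<close>

lemma Theta_psi:
  assumes X: "X \<in> carrier (tensor R s)" shows "Theta s (psi tsum X) = X"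
proof -
  interpret T: algebra R "tensor R s" by (rule tensor_algebra)
  note Th = algebra_mapsD[OF Theta_map[of s]]
  have pure: "Theta s (psi tsum (pure_tensor R l gs)) = pure_tensor R l gs" if w: "word s l gs" for l gs
  proof -
    note lw = word_left[OF w]
    have gs: "length gs = s" "set gs \<subseteq> carrier (LB R)" using w by (auto simp: word_def)
    have tk: "set (take k gs) \<subseteq> carrier (LB R)" for k using gs(2) by (auto dest: in_set_takeD)
    have wk: "word s l (take k gs @ ones (s - k))" if "k \<le> s" for k
      using gs tk[of k] lw that by (auto simp: word_def ones_def)
    have "Theta s (tau (tsum 0) l \<otimes>\<^bsub>Q\<^esub> lamprod (take k gs) tsum) = pure_tensor R l (take k gs @ ones (s - k))"
      if "k \<le> s" for k
      using that
    proof (induction k)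
      case 0
      then show ?case using lw by (simp add: tau_zero Theta_qc cst_def)
    next
      case (Suc k)
      let ?a = "tau (tsum 0) l" and ?b = "lamprod (take k gs) tsum" and ?c = "lam (tsum k) (tsum (Suc k)) (gs ! k)"
      have g: "gs ! k \<in> carrier (LB R)" using word_nth[OF w] Suc.prems by simp
      have cl: "?a \<in> carrier Q" "?b \<in> carrier Q" "?c \<in> carrier Q"
        using lw g by (simp_all add: lamprod_closed tk algebra_mapsD(2)[OF tau_map] algebra_mapsD(2)[OF lam_map] del: tsum.simps)
      have "lamprod (take (Suc k) gs) tsum = ?b \<otimes>\<^bsub>Q\<^esub> ?c"
        using Suc.prems gs(1) g tk[of k] cl
        by (simp add: take_Suc_conv_app_nth lamprod_append min_def del: tsum.simps)
      then have "Theta s (?a \<otimes>\<^bsub>Q\<^esub> lamprod (take (Suc k) gs) tsum) = Theta s ((?a \<otimes>\<^bsub>Q\<^esub> ?b) \<otimes>\<^bsub>Q\<^esub> ?c)"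
        using cl by (simp add: Q.m_assoc)
      also have "\<dots> = Theta s (?a \<otimes>\<^bsub>Q\<^esub> ?b) \<otimes>\<^bsub>tensor R s\<^esub> Theta s ?c"
        using cl by (intro Th(6) Q.m_closed)
      also have "\<dots> = pure_tensor R l (take k gs @ ones (s - k)) \<otimes>\<^bsub>tensor R s\<^esub> ins s k (gs ! k)"
        using Suc Theta_lam[of k s "gs ! k"] g by (simp del: tsum.simps)
      also have "\<dots> = pure_tensor R (l \<otimes>\<^bsub>LA R\<^esub> \<one>\<^bsub>LA R\<^esub>)
          (map2 (monoid.mult (LB R)) (take k gs @ ones (s - k)) ((ones s)[k := gs ! k]))"
        unfolding ins_def
        by (rule pure_mult[OF wk word_update[OF word_ones g]]) (use Suc.prems in simp_all)
      also have "map2 (monoid.mult (LB R)) (take k gs @ ones (s - k)) ((ones s)[k := gs ! k]) = take (Suc k) gs @ ones (s - Suc k)"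
      proof (rule nth_equalityI)
        fix i assume "i < length (map2 (monoid.mult (LB R)) (take k gs @ ones (s - k)) ((ones s)[k := gs ! k]))"
        then have i: "i < s" using gs(1) Suc.prems by simp
        then show "map2 (monoid.mult (LB R)) (take k gs @ ones (s - k)) ((ones s)[k := gs ! k]) ! i
            = (take (Suc k) gs @ ones (s - Suc k)) ! i"
          using gs Suc.prems word_nth[OF w i] g
          by (auto simp: nth_append nth_list_update min_def less_Suc_eq)
      qed (use gs Suc.prems in simp)
      finally show ?case using lw by simp
    qed
    from this[of s] show ?thesis using gs(1) psi_pure[OF tsum_closed w] by (simp add: ones_def)
  qed
  have id: "(\<lambda>X. X) \<in> linear_maps R (tensor R s) (tensor R s)" by (rule linear_mapsI) simp_all
  show ?thesis
    by (rule tensor_maps_eq[OF T.module _ id pure X])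
      (use algebra_maps_comp[OF psi_map[OF tsum_closed] Theta_map] in \<open>simp add: algebra_mapsD(1)\<close>)
qed

lemma psi_zeroD:
  assumes "X \<in> carrier (tensor R s)" "psi tsum X = \<zero>\<^bsub>Q\<^esub>" shows "X = \<zero>\<^bsub>tensor R s\<^esub>"
  using Theta_psi[OF assms(1)] assms(2)
    linear_map_zero[OF Q.module algebra.module[OF tensor_algebra] algebra_mapsD(1)[OF Theta_map]] by metis

text \<open>The substitution on polynomials that changes the standard points into the points
  \<open>w\<close>. It is what \<open>psi w\<close> becomes once its source is expressed in
  coordinates.\<close>

definition "Op w = Qlift Q (tau (w 0)) (\<lambda>i. w (Suc i) \<ominus>\<^bsub>Q\<^esub> w i)"

lemma Op:
  assumes w: "\<And>k. w k \<in> carrier Q"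
  shows Op_map: "Op w \<in> algebra_maps R Q Q"
    and Op_qc: "l \<in> carrier (LA R) \<Longrightarrow> Op w (qc l) = tau (w 0) l"
    and Op_qt: "Op w (qt i) = w (Suc i) \<ominus>\<^bsub>Q\<^esub> w i"
proof -
  have u: "w (Suc i) \<ominus>\<^bsub>Q\<^esub> w i \<in> carrier Q" for i using w by (simp add: Q.minus_closed)
  note q = Qlift[OF Q_algebra tau_map[OF w[of 0]] u]
  show "Op w \<in> algebra_maps R Q Q" "Op w (qt i) = w (Suc i) \<ominus>\<^bsub>Q\<^esub> w i"
    "l \<in> carrier (LA R) \<Longrightarrow> Op w (qc l) = tau (w 0) l"
    unfolding Op_def by (rule q(1) q(3) q(2); assumption?)+
qed

lemma psi_Theta:
  assumes w: "\<And>k. w k \<in> carrier Q" and q: "q \<in> Qpart {..<s}"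
  shows "psi w (Theta s q) = Op w q"
proof (rule Qpart_maps_eq[OF _ algebra_maps_ring_hom[OF Op_map[of w, OF w]] _ _ q])
  show "(\<lambda>q. psi w (Theta s q)) \<in> ring_hom Q Q"
    by (rule algebra_maps_ring_hom[OF algebra_maps_comp[OF Theta_map psi_map[OF w]]])
  have ones: "lamprod (ones s) v = \<one>\<^bsub>Q\<^esub>" if "\<And>k. v k \<in> carrier Q" for v s
    unfolding ones_def by (rule lamprod_one) (rule that)
  show "psi w (Theta s (qc l)) = Op w (qc l)" if "l \<in> carrier (LA R)" for l
    using that psi_pure[OF w word_ones[of l s, OF that]] Op_qc[of w, OF w that]
    by (simp add: Theta_qc cst_def ones w algebra_mapsD(2)[OF tau_map[OF w]])
  show "psi w (Theta s (qt i)) = Op w (qt i)" if "i \<in> {..<s}" for i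
  proof -
    have i: "i < s" using that by simp
    have t: "take i (ones s) = ones i" "drop (Suc i) (ones s) = ones (s - Suc i)"
      using i by (simp_all add: ones_def min_def)
    have "psi w (ins s i (LB_t R)) = psi_word w (\<one>\<^bsub>LA R\<^esub>, (ones s)[i := LB_t R])"
      unfolding ins_def psi_word_def by (simp add: psi_pure[OF w word_update[OF word_ones LB_t_closed]])
    also have "\<dots> = w (Suc i) \<ominus>\<^bsub>Q\<^esub> w i"
      by (subst psi_word_update[OF w word_ones i LB_t_closed])
        (simp_all add: t ones w lam_t algebra_mapsD(5)[OF tau_map[OF w]] Q.minus_closed)
    finally show ?thesis using Op_qt[of w, OF w] by (simp add: Theta_qt[OF i])
  qed
qed

lemma Op_tsum_id: "q \<in> Qpart {..<s} \<Longrightarrow> Op tsum q = q"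
  by (rule Qpart_maps_eq[OF algebra_maps_ring_hom[OF Op_map]])
    (auto simp: Op_qc Op_qt tsum_diff tau_zero ring_hom_def simp del: tsum.simps(2))

lemma psi_Theta_id: "q \<in> Qpart {..<s} \<Longrightarrow> psi tsum (Theta s q) = q"
  by (simp only: psi_Theta[OF tsum_closed] Op_tsum_id)

section \<open>The cobar differential in coordinates\<close>

text \<open>A linear lift out of a tensor power is well defined as soon as its composition with the injective
  coordinate map is induced by a linear map; multiplicativity is not needed.\<close>

lemma linear_lift_via_psi:
  assumes f: "\<And>l gs. word s l gs \<Longrightarrow> f (l, gs) \<in> carrier (tensor R r)"
    and G: "G \<in> linear_maps R (tensor R s) Q"
    and eq: "\<And>l gs. word s l gs \<Longrightarrow> psi tsum (f (l, gs)) = G (pure_tensor R l gs)"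
    and Y: "Y \<in> carrier (tensor R s)"
  shows "linear_lift R (tensor R r) f Y \<in> carrier (tensor R r)"
    and "psi tsum (linear_lift R (tensor R r) f Y) = G Y"
proof -
  interpret T: algebra R "tensor R r" by (rule tensor_algebra)
  interpret S: algebra R "tensor R s" by (rule tensor_algebra)
  interpret P: algebra R "WA s" by (rule WA_algebra)
  have fc: "f \<in> carrier (word_monoid R s) \<rightarrow> carrier (tensor R r)"
    using f by (auto simp: word_carrier)
  let ?h = "linear_ext R (tensor R r) f"
  have h: "?h \<in> linear_maps R (free_module R (carrier (word_monoid R s))) (tensor R r)"
    by (rule linear_ext_linear[OF T.module fc])
  have ph: "(\<lambda>p. psi tsum (?h p)) \<in> linear_maps R (free_module R (carrier (word_monoid R s))) Q"
    by (rule linear_maps_comp[OF h algebra_mapsD(1)[OF psi_map[OF tsum_closed]]])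
  have Gc: "(\<lambda>p. G (tensor_ideal R s +>\<^bsub>WA s\<^esub> p)) \<in> linear_maps R (free_module R (carrier (word_monoid R s))) Q"
    using linear_maps_comp[OF algebra_mapsD(1)[OF tensor_coset_map] G] by (simp add: linear_maps_monoid_algebra)
  have b: "psi tsum (?h (basis R x)) = G (tensor_ideal R s +>\<^bsub>WA s\<^esub> basis R x)"
    if "x \<in> carrier (word_monoid R s)" for x
  proof -
    obtain l gs where x: "x = (l, gs)" by (metis prod.exhaust)
    with that have w: "word s l gs" by (simp add: word_carrier)
    then show ?thesis
      using eq[OF w] linear_ext_basis[OF T.module fc that] by (simp add: x pure_eq[OF word_length[OF w]])
  qed
  have agree: "psi tsum (?h p) = G (tensor_ideal R s +>\<^bsub>WA s\<^esub> p)" if "p \<in> carrier (WA s)" for p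
    by (rule free_module_maps_eq[OF Q.module ph Gc b]) (use that in \<open>simp_all add: monoid_algebra_sel\<close>)
  have hc: "?h p \<in> carrier (tensor R r)" if "p \<in> carrier (WA s)" for p
    using linear_mapsD(1)[OF h] that by (simp add: monoid_algebra_sel)
  have kernel: "?h p = \<zero>\<^bsub>tensor R r\<^esub>" if p: "p \<in> tensor_ideal R s" for p
  proof -
    have pc: "p \<in> carrier (WA s)" by (rule ideal.Icarr[OF tensor_ideal_ideal p])
    have "tensor_ideal R s +>\<^bsub>WA s\<^esub> p = \<zero>\<^bsub>tensor R s\<^esub>"
      using P.coset_eq_zero_iff[OF P.ideal_submodule[OF tensor_ideal_ideal] pc] p
      by (simp add: tensor_def quotient_module_sel)
    then have "psi tsum (?h p) = \<zero>\<^bsub>Q\<^esub>"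
      using agree[OF pc] linear_map_zero[OF S.module Q.module G] by simp
    then show ?thesis by (rule psi_zeroD[OF hc[OF pc]])
  qed
  obtain p where p: "p \<in> carrier (WA s)" "Y = tensor_ideal R s +>\<^bsub>WA s\<^esub> p" using Y by (rule tensor_carrierE)
  have "linear_lift R (tensor R r) f Y = ?h p"
    unfolding p(2) tensor_ideal_eq
    by (rule linear_lift_monoid_algebra[OF word_comm_monoid tensor_rel_closed T.module fc _ p(1)])
      (rule kernel[unfolded tensor_ideal_eq])
  then show "linear_lift R (tensor R r) f Y \<in> carrier (tensor R r)"
    and "psi tsum (linear_lift R (tensor R r) f Y) = G Y"
    using hc[OF p(1)] agree[OF p(1)] p(2) by simp_all
qed

lemma ones_two: "ones 2 = [\<one>\<^bsub>LB R\<^esub>, \<one>\<^bsub>LB R\<^esub>]"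
  by (simp add: ones_def numeral_2_eq_2)

lemma comult_arg:
  "pure_tensor R \<one>\<^bsub>LA R\<^esub> [LB_t R, \<one>\<^bsub>LB R\<^esub>] \<oplus>\<^bsub>tensor R 2\<^esub> pure_tensor R \<one>\<^bsub>LA R\<^esub> [\<one>\<^bsub>LB R\<^esub>, LB_t R]
    \<in> carrier (tensor R 2)"
proof -
  interpret T: algebra R "tensor R 2" by (rule tensor_algebra)
  show ?thesis by (intro T.a_closed pure_closed) (simp_all add: word_def)
qed

lemma comult_eval: "comult R = LB_eval (tensor R 2) (cst 2)
    (pure_tensor R \<one>\<^bsub>LA R\<^esub> [LB_t R, \<one>\<^bsub>LB R\<^esub>] \<oplus>\<^bsub>tensor R 2\<^esub> pure_tensor R \<one>\<^bsub>LA R\<^esub> [\<one>\<^bsub>LB R\<^esub>, LB_t R])"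
  by (simp add: comult_def cst_def[abs_def] ones_two)

lemmas comult_props =
  LB_eval_hom[OF algebra.M_cring[OF tensor_algebra] algebra_maps_ring_hom[OF cst_map] comult_arg, folded comult_eval]
  LB_eval_eta_L[OF algebra.M_cring[OF tensor_algebra] algebra_maps_ring_hom[OF cst_map] comult_arg, folded comult_eval]
  LB_eval_t[OF algebra.M_cring[OF tensor_algebra] algebra_maps_ring_hom[OF cst_map] comult_arg, folded comult_eval]

text \<open>The variable goes to the sum of two consecutive increments, which is the increment from
  the first point to the third. So comultiplication followed by evaluation forgets the middle
  point.\<close>

lemma psi_comult:
  assumes w: "\<And>k. w k \<in> carrier Q" and g: "g \<in> carrier (LB R)"
  shows "psi w (comult R g) = lam (w 0) (w 2) g"
proof (rule LB_hom_eq[OF Q.M_cring _ _ algebra_maps_ring_hom[OF lam_map[OF w w]], where h = "tau (w 0)"])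
  show "tau (w 0) \<in> ring_hom (LA R) Q" by (rule algebra_maps_ring_hom[OF tau_map[OF w]])
  show "(\<lambda>g. psi w (comult R g)) \<in> ring_hom (LB R) Q"
    using ring_hom_trans[OF comult_props(1) algebra_maps_ring_hom[OF psi_map[OF w]]] by (simp add: comp_def)
  show "lam (w 0) (w 2) (eta_L R l) = tau (w 0) l" if "l \<in> carrier (LA R)" for l
    by (rule lam_eta_L[OF w w that])
  have word: "word 2 \<one>\<^bsub>LA R\<^esub> [LB_t R, \<one>\<^bsub>LB R\<^esub>]" "word 2 \<one>\<^bsub>LA R\<^esub> [\<one>\<^bsub>LB R\<^esub>, LB_t R]"
    by (simp_all add: word_def)
  note t = algebra_mapsD[OF tau_map[OF w]]
  show "psi w (comult R (eta_L R l)) = tau (w 0) l" if "l \<in> carrier (LA R)" for l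
    using that psi_pure[OF w word_ones[of l 2, OF that]] lamprod_one[of w 2, OF w]
    by (simp add: comult_props(2) cst_def t ones_def)
  have "psi w (comult R (LB_t R)) = (w (Suc 0) \<ominus>\<^bsub>Q\<^esub> w 0) \<oplus>\<^bsub>Q\<^esub> (w 2 \<ominus>\<^bsub>Q\<^esub> w (Suc 0))"
    using algebra_mapsD(3)[OF psi_map[OF w] pure_closed[OF word(1)] pure_closed[OF word(2)]]
    by (simp add: comult_props(3) psi_pure[OF w word(1)] psi_pure[OF w word(2)] t lam_t w
        algebra_mapsD(5)[OF lam_map] Q.minus_closed numeral_2_eq_2)
  also have "\<dots> = w 2 \<ominus>\<^bsub>Q\<^esub> w 0"
  proof -
    have "(w (Suc 0) \<ominus>\<^bsub>Q\<^esub> w 0) \<oplus>\<^bsub>Q\<^esub> (w 2 \<ominus>\<^bsub>Q\<^esub> w (Suc 0))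
        = (w 2 \<oplus>\<^bsub>Q\<^esub> \<ominus>\<^bsub>Q\<^esub> w 0) \<oplus>\<^bsub>Q\<^esub> (w (Suc 0) \<oplus>\<^bsub>Q\<^esub> \<ominus>\<^bsub>Q\<^esub> w (Suc 0))"
      unfolding a_minus_def by (simp only: Q.a_ac Q.a_closed Q.a_inv_closed w)
    then show ?thesis using w by (simp add: Q.r_neg a_minus_def)
  qed
  finally show "psi w (comult R (LB_t R)) = lam (w 0) (w 2) (LB_t R)"
    by (simp add: lam_t w)
qed (rule g)

text \<open>The simplicial coface: the increasing injection of the natural numbers that misses
  \<open>i\<close>.\<close>

definition "skip i j = (if j < i then j else Suc j)"

lemma lamprod_cong:
  "(\<And>k. k \<le> length gs \<Longrightarrow> v k = w k) \<Longrightarrow> lamprod gs v = lamprod gs w"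
proof (induction gs arbitrary: v w)
  case (Cons g gs)
  have "lamprod gs (\<lambda>k. v (Suc k)) = lamprod gs (\<lambda>k. w (Suc k))"
    by (rule Cons.IH) (rule Cons.prems, simp)
  moreover have "v 0 = w 0" "v (Suc 0) = w (Suc 0)" by (rule Cons.prems, simp)+
  ultimately show ?case by simp
qed simp

text \<open>Each coface omits one of the points. For \<open>i = 0\<close> the right unit makes the
  second point the new base point, in the middle \<open>psi_comult\<close> forgets the point between
  two factors, and at the end the factor one makes the last point irrelevant.\<close>

lemma coface_word:
  assumes w: "word s l gs" and i: "i \<le> Suc s"
  shows "coface R s i (l, gs) \<in> carrier (tensor R (Suc s))"
    and "psi tsum (coface R s i (l, gs)) = psi (\<lambda>j. tsum (skip i j)) (pure_tensor R l gs)"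
proof -
  let ?v = "\<lambda>j. tsum (skip i j)"
  have v: "?v k \<in> carrier Q" for k by simp
  have len: "length gs = s" and gs: "set gs \<subseteq> carrier (LB R)" and l: "l \<in> carrier (LA R)"
    using w by (auto simp: word_def)
  note t = algebra_mapsD[OF tau_map[OF tsum_closed]]
  consider "i = 0" | "0 < i" "i \<le> s" | "i = Suc s" using i by linarith
  then have "coface R s i (l, gs) \<in> carrier (tensor R (Suc s)) \<and>
      psi tsum (coface R s i (l, gs)) = tau (?v 0) l \<otimes>\<^bsub>Q\<^esub> lamprod gs ?v"
  proof cases
    case 1
    have word: "word (Suc s) \<one>\<^bsub>LA R\<^esub> (eta_R R l # gs)" using w by (simp add: word_def)
    have v1: "?v = (\<lambda>k. tsum (Suc k))" by (simp add: 1 skip_def)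
    show ?thesis
      using pure_closed[OF word] psi_pure[OF tsum_closed word] l lamprod_closed[OF gs, of "\<lambda>k. tsum (Suc k)"]
      by (simp add: coface_def 1 v1 t lam_eta_R skip_def del: tsum.simps)
  next
    case 3
    have word: "word (Suc s) l (gs @ [\<one>\<^bsub>LB R\<^esub>])" using w by (simp add: word_def)
    \<comment> \<open>A word with \<open>s\<close> factors uses only the points 0 to
      \<open>s\<close>, and these are fixed by \<open>skip (Suc s)\<close>.\<close>
    have "lamprod gs ?v = lamprod gs tsum" by (rule lamprod_cong) (simp add: 3 skip_def len)
    then show ?thesis
      using pure_closed[OF word] psi_pure[OF tsum_closed word] lamprod_closed[OF gs, of tsum] gs
      by (simp add: coface_def 3 skip_def lamprod_append algebra_mapsD(5)[OF lam_map] del: tsum.simps)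
  next
    case 2
    define j where "j = i - 1"
    have j: "i = Suc j" "j < s" using 2 by (auto simp: j_def)
    have tk: "set (take j gs) \<subseteq> carrier (LB R)" "set (drop (Suc j) gs) \<subseteq> carrier (LB R)" "length (take j gs) = j"
      using gs j len by (auto dest: in_set_takeD in_set_dropD)
    let ?f = "\<lambda>(m, hs). pure_tensor R l (take j gs @ [eta_L R m \<otimes>\<^bsub>LB R\<^esub> hs ! 0, hs ! 1] @ drop (Suc j) gs)"
    let ?u = "\<lambda>k. tsum (j + k)"
    \<comment> \<open>All factors outside slot j contribute a constant. In the variable tensor of
      degree two the coordinates of the coface are then multiplication by this constant after
      \<open>psi\<close> at the points from j on: linear, which is all that
      \<open>linear_lift_via_psi\<close> asks for, although not multiplicative.\<close>
    define c where "c = tau (tsum 0) l \<otimes>\<^bsub>Q\<^esub> lamprod (take j gs) tsum \<otimes>\<^bsub>Q\<^esub> lamprod (drop (Suc j) gs) (\<lambda>k. tsum (Suc (Suc j) + k))"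
    have cl: "tau (tsum 0) l \<in> carrier Q" "lamprod (take j gs) tsum \<in> carrier Q"
      "lamprod (drop (Suc j) gs) (\<lambda>k. tsum (Suc (Suc j) + k)) \<in> carrier Q"
      using tk l by (simp_all add: t lamprod_closed del: tsum.simps)
    then have c: "c \<in> carrier Q" by (simp add: c_def del: tsum.simps)
    have u: "?u k \<in> carrier Q" for k by simp
    let ?G = "\<lambda>Y. c \<otimes>\<^bsub>Q\<^esub> psi ?u Y"
    have G: "?G \<in> linear_maps R (tensor R 2) Q"
      using algebra_mapsD[OF psi_map[of ?u, OF u]] c
      by (intro linear_mapsI) (simp_all add: Q.r_distr Q.smult_mult_right del: tsum.simps)
    have wf: "word (Suc s) l (take j gs @ [eta_L R m \<otimes>\<^bsub>LB R\<^esub> hs ! 0, hs ! 1] @ drop (Suc j) gs)"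
      if "word 2 m hs" for m hs
      using l tk j len word_nth[OF that, of 0] word_nth[OF that, of 1] word_left[OF that]
      by (simp add: word_def)
    have fc: "?f (m, hs) \<in> carrier (tensor R (Suc s))" if "word 2 m hs" for m hs
      using pure_closed[OF wf[OF that]] by simp
    have eq: "psi tsum (?f (m, hs)) = ?G (pure_tensor R m hs)" if wd: "word 2 m hs" for m hs
    proof -
      obtain g h where hs: "hs = [g, h]" and gh: "g \<in> carrier (LB R)" "h \<in> carrier (LB R)"
        using wd by (auto simp: word_def numeral_2_eq_2 length_Suc_conv)
      have m: "m \<in> carrier (LA R)" by (rule word_left[OF wd])
      let ?l1 = "lam (tsum j) (tsum (Suc j))" and ?l2 = "lam (tsum (Suc j)) (tsum (Suc (Suc j)))"
      have lc: "?l1 g \<in> carrier Q" "?l2 h \<in> carrier Q" "tau (tsum j) m \<in> carrier Q" "?l1 (eta_L R m \<otimes>\<^bsub>LB R\<^esub> g) = tau (tsum j) m \<otimes>\<^bsub>Q\<^esub> ?l1 g"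
        using gh m by (simp_all add: algebra_mapsD[OF lam_map] t lam_eta_L del: tsum.simps)
      have "psi tsum (?f (m, hs)) = tau (tsum 0) l \<otimes>\<^bsub>Q\<^esub> (lamprod (take j gs) tsum
          \<otimes>\<^bsub>Q\<^esub> (?l1 (eta_L R m \<otimes>\<^bsub>LB R\<^esub> g) \<otimes>\<^bsub>Q\<^esub> (?l2 h \<otimes>\<^bsub>Q\<^esub> lamprod (drop (Suc j) gs) (\<lambda>k. tsum (Suc (Suc j) + k)))))"
        using psi_pure[OF tsum_closed wf[OF wd]] tk gh m
        by (simp add: hs lamprod_append del: tsum.simps)
      also have "\<dots> = c \<otimes>\<^bsub>Q\<^esub> (tau (tsum j) m \<otimes>\<^bsub>Q\<^esub> (?l1 g \<otimes>\<^bsub>Q\<^esub> ?l2 h))"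
        unfolding lc(4) c_def using cl lc(1-3) by (simp add: Q.m_ac del: tsum.simps)
      also have "tau (tsum j) m \<otimes>\<^bsub>Q\<^esub> (?l1 g \<otimes>\<^bsub>Q\<^esub> ?l2 h) = psi ?u (pure_tensor R m hs)"
        using psi_pure[of ?u, OF u wd] lc by (simp add: hs del: tsum.simps)
      finally show ?thesis .
    qed
    have gj: "gs ! j \<in> carrier (LB R)" by (rule word_nth[OF w j(2)])
    have cm: "comult R (gs ! j) \<in> carrier (tensor R 2)" by (rule ring_hom_closed[OF comult_props(1) gj])
    have cof: "coface R s i (l, gs) = linear_lift R (tensor R (Suc s)) ?f (comult R (gs ! j))"
      using 2 by (simp add: coface_def j_def)
    note lift = linear_lift_via_psi[where f = ?f and G = ?G, OF fc G eq cm]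
    have "psi tsum (coface R s i (l, gs)) = c \<otimes>\<^bsub>Q\<^esub> psi ?u (comult R (gs ! j))"
      unfolding cof by (rule lift(2))
    also have "\<dots> = c \<otimes>\<^bsub>Q\<^esub> lam (tsum j) (tsum (Suc (Suc j))) (gs ! j)"
      using psi_comult[of ?u, OF u gj] by (simp del: tsum.simps)
    also have "\<dots> = tau (?v 0) l \<otimes>\<^bsub>Q\<^esub> lamprod gs ?v"
    proof -
      have e: "lamprod (take j gs) ?v = lamprod (take j gs) tsum"
        by (rule lamprod_cong) (simp add: j skip_def tk del: take_eq_Nil)
      have d: "(\<lambda>k. ?v (Suc j + k)) = (\<lambda>k. tsum (Suc (Suc j) + k))"
        by (simp add: j skip_def)
      have "lamprod gs ?v = lamprod (take j gs) ?v \<otimes>\<^bsub>Q\<^esub> (lam (?v j) (?v (Suc j)) (gs ! j)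
          \<otimes>\<^bsub>Q\<^esub> lamprod (drop (Suc j) gs) (\<lambda>k. ?v (Suc j + k)))"
        by (rule lamprod_split) (use j len gs in simp_all)
      also have "?v j = tsum j" by (simp add: j skip_def)
      also have "?v (Suc j) = tsum (Suc (Suc j))" by (simp add: j skip_def)
      finally have "lamprod gs ?v = lamprod (take j gs) tsum \<otimes>\<^bsub>Q\<^esub> (lam (tsum j) (tsum (Suc (Suc j))) (gs ! j)
          \<otimes>\<^bsub>Q\<^esub> lamprod (drop (Suc j) gs) (\<lambda>k. tsum (Suc (Suc j) + k)))"
        unfolding e d .
      moreover have "?v 0 = tsum 0" by (simp add: j skip_def)
      moreover have "lam (tsum j) (tsum (Suc (Suc j))) (gs ! j) \<in> carrier Q"
        using gj by (simp add: algebra_mapsD[OF lam_map] del: tsum.simps)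
      ultimately show ?thesis using cl by (simp add: c_def Q.m_ac del: tsum.simps)
    qed
    finally show ?thesis using lift(1) unfolding cof[symmetric] by (rule conjI[rotated])
  qed
  then show "coface R s i (l, gs) \<in> carrier (tensor R (Suc s))"
    and "psi tsum (coface R s i (l, gs)) = psi ?v (pure_tensor R l gs)"
    using psi_pure[of ?v, OF v w] by simp_all
qed

definition "sgn_Q i q = (if even (i::nat) then q else \<ominus>\<^bsub>Q\<^esub> q)"

text \<open>In coordinates the alternating sum of cofaces of a word is an alternating sum of values
  of \<open>psi\<close> at the points with one omitted. The latter is defined and linear on the
  whole tensor power, which makes the lift well defined.\<close>

lemma cobar_diff_psi:
  assumes X: "X \<in> carrier (tensor R s)"
  shows "cobar_diff R s X \<in> carrier (tensor R (Suc s))"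
    and "psi tsum (cobar_diff R s X) = (\<Oplus>\<^bsub>Q\<^esub>i\<in>{..Suc s}. sgn_Q i (psi (\<lambda>j. tsum (skip i j)) X))"
proof -
  interpret T: algebra R "tensor R (Suc s)" by (rule tensor_algebra)
  interpret S: algebra R "tensor R s" by (rule tensor_algebra)
  let ?f = "\<lambda>x. \<Oplus>\<^bsub>tensor R (Suc s)\<^esub>i \<in> {..Suc s}.
        if even i then coface R s i x else \<ominus>\<^bsub>tensor R (Suc s)\<^esub> coface R s i x"
  let ?G = "\<lambda>X. \<Oplus>\<^bsub>Q\<^esub>i\<in>{..Suc s}. sgn_Q i (psi (\<lambda>j. tsum (skip i j)) X)"
  have v: "tsum (skip i k) \<in> carrier Q" for i k by simp
  have p: "psi (\<lambda>j. tsum (skip i j)) \<in> linear_maps R (tensor R s) Q" for i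
    by (rule algebra_mapsD(1)[OF psi_map]) (rule v)
  have sgn: "(\<lambda>X. sgn_Q i (psi (\<lambda>j. tsum (skip i j)) X)) \<in> linear_maps R (tensor R s) Q" for i
    by (rule linear_mapsI)
      (auto simp: sgn_Q_def linear_mapsD[OF p] Q.minus_add Q.smult_r_minus)
  have G: "?G \<in> linear_maps R (tensor R s) Q"
    by (rule linear_mapsI)
      (simp_all add: linear_mapsD[OF sgn] Q.finsum_addf Q.finsum_smult_ldistr Pi_def del: Q.finsum_Suc)
  have cof: "(if even i then coface R s i (l, gs) else \<ominus>\<^bsub>tensor R (Suc s)\<^esub> coface R s i (l, gs)) \<in> carrier (tensor R (Suc s))"
    if "word s l gs" "i \<in> {..Suc s}" for l gs i
    using coface_word(1)[OF that(1)] that(2) by simp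
  have fc: "?f (l, gs) \<in> carrier (tensor R (Suc s))" if "word s l gs" for l gs
    by (rule T.finsum_closed) (use cof[OF that] in auto)
  note ps = algebra_mapsD(1)[OF psi_map[where s = "Suc s", OF tsum_closed]]
  have eq: "psi tsum (?f (l, gs)) = ?G (pure_tensor R l gs)" if w: "word s l gs" for l gs
  proof -
    have "psi tsum (?f (l, gs)) = (\<Oplus>\<^bsub>Q\<^esub>i\<in>{..Suc s}. psi tsum
        (if even i then coface R s i (l, gs) else \<ominus>\<^bsub>tensor R (Suc s)\<^esub> coface R s i (l, gs)))"
      by (rule linear_map_finsum[OF T.module Q.module ps]) (use cof[OF w] in blast)
    also have "\<dots> = ?G (pure_tensor R l gs)"
    proof (rule Q.finsum_cong')
      fix i assume "i \<in> {..Suc s}"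
      then show "psi tsum (if even i then coface R s i (l, gs) else \<ominus>\<^bsub>tensor R (Suc s)\<^esub> coface R s i (l, gs))
          = sgn_Q i (psi (\<lambda>j. tsum (skip i j)) (pure_tensor R l gs))"
        using coface_word[OF w] linear_map_uminus[OF T.module Q.module ps] by (simp add: sgn_Q_def)
    qed (use linear_mapsD(1)[OF sgn] w in auto)
    finally show ?thesis .
  qed
  note lift = linear_lift_via_psi[where f = ?f and G = ?G, OF fc G eq X]
  show "cobar_diff R s X \<in> carrier (tensor R (Suc s))"
    unfolding cobar_diff_def by (rule lift(1))
  show "psi tsum (cobar_diff R s X) = ?G X"
    unfolding cobar_diff_def by (rule lift(2))
qed

section \<open>Internal degrees\<close>

context
  fixes M :: "('a, 'c, 'n) module_scheme"
  assumes M: "module R M"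
begin

interpretation M: module R M by (rule M)
interpretation PM: algebra R "poly_algebra R M" by (rule monoid_algebra_algebra[OF free_comm_monoid_comm_monoid])
interpretation S: algebra R "sym_algebra R M" by (rule sym_algebra_algebra[OF M])

lemma sym_powerE:
  assumes "X \<in> sym_power R M k"
  obtains p where "p \<in> carrier (poly_algebra R M)" "\<And>u. p u \<noteq> \<zero> \<Longrightarrow> size u = k"
    "X = sym_ideal R M +>\<^bsub>poly_algebra R M\<^esub> p"
  using assms unfolding sym_power_def by blast

lemma sym_powerI:
  "p \<in> carrier (poly_algebra R M) \<Longrightarrow> (\<And>u. p u \<noteq> \<zero> \<Longrightarrow> size u = k) \<Longrightarrow>
    sym_ideal R M +>\<^bsub>poly_algebra R M\<^esub> p \<in> sym_power R M k"
  unfolding sym_power_def by blast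

lemma PM_apply:
  assumes "p \<in> carrier (poly_algebra R M)" "q \<in> carrier (poly_algebra R M)" "a \<in> carrier R"
  shows "(p \<oplus>\<^bsub>poly_algebra R M\<^esub> q) u = p u \<oplus> q u" "(a \<odot>\<^bsub>poly_algebra R M\<^esub> p) u = a \<otimes> p u"
    "\<zero>\<^bsub>poly_algebra R M\<^esub> u = \<zero>" "p u \<in> carrier R"
  using assms by (auto simp: monoid_algebra_sel free_module_sel)

lemma sym_power_submodule: "submodule (sym_power R M k) R (sym_algebra R M)"
proof (rule S.submoduleI)
  note c = algebra_mapsD[OF sym_coset_map[OF M]]
  show sub: "sym_power R M k \<subseteq> carrier (sym_algebra R M)"
    by (auto elim!: sym_powerE intro: c(2))
  have "sym_ideal R M +>\<^bsub>poly_algebra R M\<^esub> \<zero>\<^bsub>poly_algebra R M\<^esub> \<in> sym_power R M k"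
    by (rule sym_powerI) (simp_all add: monoid_algebra_sel free_module_sel)
  then show "\<zero>\<^bsub>sym_algebra R M\<^esub> \<in> sym_power R M k"
    using linear_map_zero[OF PM.module S.module c(1)] by simp
  show add: "X \<oplus>\<^bsub>sym_algebra R M\<^esub> Y \<in> sym_power R M k" if "X \<in> sym_power R M k" "Y \<in> sym_power R M k" for X Y
  proof -
    obtain p where p: "p \<in> carrier (poly_algebra R M)" "\<And>u. p u \<noteq> \<zero> \<Longrightarrow> size u = k"
      "X = sym_ideal R M +>\<^bsub>poly_algebra R M\<^esub> p" using \<open>X \<in> _\<close> by (rule sym_powerE) blast
    obtain q where q: "q \<in> carrier (poly_algebra R M)" "\<And>u. q u \<noteq> \<zero> \<Longrightarrow> size u = k"
      "Y = sym_ideal R M +>\<^bsub>poly_algebra R M\<^esub> q" using \<open>Y \<in> _\<close> by (rule sym_powerE) blast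
    have h: "size u = k" if "(p \<oplus>\<^bsub>poly_algebra R M\<^esub> q) u \<noteq> \<zero>" for u
    proof (rule ccontr)
      assume "size u \<noteq> k"
      then have "p u = \<zero>" "q u = \<zero>" using p(2) q(2) by blast+
      with that show False using PM_apply(1)[OF p(1) q(1) zero_closed, of u] by simp
    qed
    show ?thesis unfolding p(3) q(3) c(3)[OF p(1) q(1), symmetric]
      by (rule sym_powerI[OF PM.a_closed[OF p(1) q(1)] h])
  qed
  show smult: "a \<odot>\<^bsub>sym_algebra R M\<^esub> X \<in> sym_power R M k" if "a \<in> carrier R" "X \<in> sym_power R M k" for a X
  proof -
    obtain p where p: "p \<in> carrier (poly_algebra R M)" "\<And>u. p u \<noteq> \<zero> \<Longrightarrow> size u = k"
      "X = sym_ideal R M +>\<^bsub>poly_algebra R M\<^esub> p" using \<open>X \<in> _\<close> by (rule sym_powerE) blast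
    have h: "size u = k" if "(a \<odot>\<^bsub>poly_algebra R M\<^esub> p) u \<noteq> \<zero>" for u
    proof (rule ccontr)
      assume "size u \<noteq> k"
      then have "p u = \<zero>" using p(2) by blast
      with that show False using PM_apply(2)[OF p(1) p(1) \<open>a \<in> carrier R\<close>, of u] \<open>a \<in> carrier R\<close> by simp
    qed
    show ?thesis unfolding p(3) c(4)[OF \<open>a \<in> carrier R\<close> p(1), symmetric]
      by (rule sym_powerI[OF PM.smult_closed[OF \<open>a \<in> carrier R\<close> p(1)] h])
  qed
  show "\<ominus>\<^bsub>sym_algebra R M\<^esub> X \<in> sym_power R M k" if "X \<in> sym_power R M k" for X
  proof -
    have "(\<ominus> \<one>) \<odot>\<^bsub>sym_algebra R M\<^esub> X = \<ominus>\<^bsub>sym_algebra R M\<^esub> X"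
      using that sub by (subst S.smult_l_minus) auto
    then show ?thesis using smult[OF a_inv_closed[OF one_closed] that] by simp
  qed
qed

lemma sym_power_mult:
  assumes "X \<in> sym_power R M k" "Y \<in> sym_power R M m"
  shows "X \<otimes>\<^bsub>sym_algebra R M\<^esub> Y \<in> sym_power R M (k + m)"
proof -
  note c = algebra_mapsD[OF sym_coset_map[OF M]]
  obtain p where p: "p \<in> carrier (poly_algebra R M)" "\<And>u. p u \<noteq> \<zero> \<Longrightarrow> size u = k"
    "X = sym_ideal R M +>\<^bsub>poly_algebra R M\<^esub> p" using assms(1) by (rule sym_powerE) blast
  obtain q where q: "q \<in> carrier (poly_algebra R M)" "\<And>u. q u \<noteq> \<zero> \<Longrightarrow> size u = m"
    "Y = sym_ideal R M +>\<^bsub>poly_algebra R M\<^esub> q" using assms(2) by (rule sym_powerE) blast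
  have h: "size u = k + m" if u: "(p \<otimes>\<^bsub>poly_algebra R M\<^esub> q) u \<noteq> \<zero>" for u
  proof (rule ccontr)
    assume "size u \<noteq> k + m"
    then have "{(x, y). p x \<noteq> \<zero> \<and> q y \<noteq> \<zero> \<and> x \<otimes>\<^bsub>free_comm_monoid (carrier M)\<^esub> y = u} = {}"
      using p(2) q(2) by force
    moreover have "(p \<otimes>\<^bsub>poly_algebra R M\<^esub> q) u = finsum R (\<lambda>(x, y). p x \<otimes> q y)
        {(x, y). p x \<noteq> \<zero> \<and> q y \<noteq> \<zero> \<and> x \<otimes>\<^bsub>free_comm_monoid (carrier M)\<^esub> y = u}"
      by (simp add: monoid_algebra_def)
    ultimately have "(p \<otimes>\<^bsub>poly_algebra R M\<^esub> q) u = \<zero>" by (simp only: finsum_empty)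
    with u show False by simp
  qed
  show ?thesis unfolding p(3) q(3) c(6)[OF p(1) q(1), symmetric]
    by (rule sym_powerI[OF PM.m_closed[OF p(1) q(1)] h])
qed

lemma sym_power_one: "\<one>\<^bsub>sym_algebra R M\<^esub> \<in> sym_power R M 0"
  unfolding sym_basis_empty[OF M, symmetric]
  by (rule sym_powerI[OF basis_PM[OF M]]) (use basis_supp[of "{#}"] in auto)

lemma sym_power_incl: "x \<in> carrier M \<Longrightarrow> sym_incl R M x \<in> sym_power R M 1"
  unfolding sym_incl_def
  by (rule sym_powerI[OF basis_PM[OF M]]) (use basis_supp[of "{#x#}"] in auto)

text \<open>\<open>F\<close> is only a multiplicative family of submodules; it need not be a grading
  and its members may overlap. This freedom serves both to transport degrees and, with an artificial
  family, to describe the low degrees of \<open>LA\<close>.\<close>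

lemma sym_power_lift_mem:
  assumes N: "algebra R N" and g: "g \<in> linear_maps R M N"
    and F: "\<And>k. submodule (F k) R N" "\<one>\<^bsub>N\<^esub> \<in> F 0" "\<And>x. x \<in> carrier M \<Longrightarrow> g x \<in> F (Suc 0)"
      "\<And>k m x y. x \<in> F k \<Longrightarrow> y \<in> F m \<Longrightarrow> x \<otimes>\<^bsub>N\<^esub> y \<in> F (k + m)"
    and X: "X \<in> sym_power R M k"
  shows "sym_lift R N g X \<in> F k"
proof -
  interpret N: algebra R N by fact
  obtain p where p: "p \<in> carrier (poly_algebra R M)" "\<And>u. p u \<noteq> \<zero> \<Longrightarrow> size u = k"
    "X = sym_ideal R M +>\<^bsub>poly_algebra R M\<^esub> p" using X by (rule sym_powerE) blast
  note mon = sym_monom_hom[OF M N g]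
  have m: "monomial N g u \<in> F (size u)" if "set_mset u \<subseteq> carrier M" for u
    using that
  proof (induction u)
    case empty then show ?case using mon(2) F(2) by simp
  next
    case (add x u)
    have "monomial N g (add_mset x u) = g x \<otimes>\<^bsub>N\<^esub> monomial N g u"
      using mon(3)[of "{#x#}" u] add.prems sym_monom_single[OF M N g, of x] by simp
    then show ?case using F(4)[OF F(3) add.IH, of x] add.prems by simp
  qed
  have "linear_ext R N (monomial N g) p \<in> F k"
  proof (rule linear_ext_mem[OF N.module mon(1) _ F(1)])
    show pf: "p \<in> carrier (free_module R (carrier (free_comm_monoid (carrier M))))"
      using p(1) by (simp add: monoid_algebra_sel)
    fix u assume u: "p u \<noteq> \<zero>"
    then have "set_mset u \<subseteq> carrier M" using free_module_closed(2)[OF pf u] by simp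
    then show "p u \<odot>\<^bsub>N\<^esub> monomial N g u \<in> F k"
      using m[of u] p(2)[OF u] free_module_closed(1)[OF pf, of u] N.submoduleE(4)[OF F(1)] by metis
  qed
  then show ?thesis using sym_lift_coset[OF M N g p(1)] p(3) by simp
qed

end

lemma L_deg_submodule: "submodule (L_deg R d) R (LA R)"
proof (cases "even d")
  case True
  then show ?thesis unfolding L_deg_def LA_def using sym_power_submodule[OF Dr_module] by simp
next
  case False
  then show ?thesis unfolding L_deg_def by (auto intro!: L.submoduleI simp: L.minus_zero)
qed

lemma L_deg_closed: "l \<in> L_deg R d \<Longrightarrow> l \<in> carrier (LA R)"
  using L.submoduleE(1)[OF L_deg_submodule] by blast

lemma L_deg_zero: "\<zero>\<^bsub>LA R\<^esub> \<in> L_deg R d"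
  using L.submoduleE(2,3,5)[OF L_deg_submodule] L_deg_closed L.r_neg by (metis all_not_in_conv)

lemma L_deg_mult:
  assumes "l \<in> L_deg R d" "m \<in> L_deg R e" shows "l \<otimes>\<^bsub>LA R\<^esub> m \<in> L_deg R (d + e)"
proof (cases "even d \<and> even e")
  case True
  then have "(d + e) div 2 = d div 2 + e div 2" by auto
  then show ?thesis
    using True assms sym_power_mult[OF Dr_module, of l "d div 2" m "e div 2"] by (simp add: L_deg_def LA_def)
next
  case False
  then have "l = \<zero>\<^bsub>LA R\<^esub> \<or> m = \<zero>\<^bsub>LA R\<^esub>" using assms by (auto simp: L_deg_def)
  then show ?thesis using assms[THEN L_deg_closed] L_deg_zero by auto
qed

lemma L_deg_one: "\<one>\<^bsub>LA R\<^esub> \<in> L_deg R 0"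
  using sym_power_one[OF Dr_module] by (simp add: L_deg_def LA_def)

lemma L_deg_iota: "x \<in> carrier (Dr R) \<Longrightarrow> iota x \<in> L_deg R 2"
  using sym_power_incl[OF Dr_module] by (simp add: L_deg_def)

text \<open>The homogeneous polynomials of internal degree \<open>d\<close> in the first
  \<open>s\<close> variables, each variable in degree 2. The explicit bound on the size of a
  monomial prevents the truncated subtraction from placing oversized monomials in degree
  zero.\<close>

definition "E d s = {q \<in> carrier Q. \<forall>u. q u \<noteq> \<zero>\<^bsub>LA R\<^esub> \<longrightarrow>
  set_mset u \<subseteq> {..<s} \<and> 2 * size u \<le> d \<and> q u \<in> L_deg R (d - 2 * size u)}"

lemma E_closed: "q \<in> E d s \<Longrightarrow> q \<in> carrier Q"
  by (simp add: E_def)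

lemma E_Qpart: "q \<in> E d s \<Longrightarrow> q \<in> Qpart {..<s}"
  by (simp add: E_def Qpart_iff)

lemma E_mono: "s \<le> s' \<Longrightarrow> q \<in> E d s \<Longrightarrow> q \<in> E d s'"
proof -
  assume "s \<le> s'" and q: "q \<in> E d s"
  then have "set_mset u \<subseteq> {..<s'}" if "set_mset u \<subseteq> {..<s}" for u using that by fastforce
  with q show ?thesis by (simp add: E_def)
qed

lemma E_coeff: "q \<in> E d s \<Longrightarrow> q u \<in> L_deg R (d - 2 * size u)"
  using L_deg_zero by (cases "q u = \<zero>\<^bsub>LA R\<^esub>") (simp_all add: E_def)

lemma E_supp: "q \<in> E d s \<Longrightarrow> q u \<noteq> \<zero>\<^bsub>LA R\<^esub> \<Longrightarrow> set_mset u \<subseteq> {..<s} \<and> 2 * size u \<le> d"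
  by (simp add: E_def)

lemma Q_apply_closed: "q \<in> carrier Q \<Longrightarrow> q u \<in> carrier (LA R)"
  by (simp add: Q_sel QM_def cring.monoid_algebra_sel[OF L.M_cring] cring.free_module_closed(1)[OF L.M_cring])

lemma Q_add_apply: "(p \<oplus>\<^bsub>Q\<^esub> q) u = p u \<oplus>\<^bsub>LA R\<^esub> q u"
  by (simp add: Q_sel QM_def cring.monoid_algebra_sel[OF L.M_cring] cring.free_module_sel[OF L.M_cring])

lemma Q_zero_apply: "\<zero>\<^bsub>Q\<^esub> u = \<zero>\<^bsub>LA R\<^esub>"
  by (simp add: Q_sel QM_def cring.monoid_algebra_sel[OF L.M_cring] cring.free_module_sel[OF L.M_cring])

lemma qc_mult_apply: "l \<in> carrier (LA R) \<Longrightarrow> q \<in> carrier Q \<Longrightarrow> (qc l \<otimes>\<^bsub>Q\<^esub> q) u = l \<otimes>\<^bsub>LA R\<^esub> q u"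
  by (simp add: QM_smult[symmetric])
    (simp add: QM_def cring.monoid_algebra_sel[OF L.M_cring] cring.free_module_sel[OF L.M_cring])

lemma Q_smult_apply: "a \<in> carrier R \<Longrightarrow> q \<in> carrier Q \<Longrightarrow> (a \<odot>\<^bsub>Q\<^esub> q) u = a \<odot>\<^bsub>LA R\<^esub> q u"
proof -
  assume a: "a \<in> carrier R" and q: "q \<in> carrier Q"
  have "a \<odot>\<^bsub>Q\<^esub> q = qc (a \<odot>\<^bsub>LA R\<^esub> \<one>\<^bsub>LA R\<^esub>) \<otimes>\<^bsub>Q\<^esub> q" by (simp add: Q_def)
  then show ?thesis using a q by (simp add: qc_mult_apply L.unit_hom_smult Q_apply_closed)
qed

lemma qc_apply: "l \<in> carrier (LA R) \<Longrightarrow> qc l u = (if u = {#} then l else \<zero>\<^bsub>LA R\<^esub>)"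
proof -
  have "\<one>\<^bsub>Q\<^esub> u = (if u = {#} then \<one>\<^bsub>LA R\<^esub> else \<zero>\<^bsub>LA R\<^esub>)"
    unfolding basis_empty[symmetric] by (simp add: basis_def)
  moreover assume "l \<in> carrier (LA R)"
  ultimately show ?thesis using qc_mult_apply[of l "\<one>\<^bsub>Q\<^esub>" u] by simp
qed

lemma E_submodule: "submodule (E d s) R Q"
proof (rule Q.submoduleI)
  note m = L.submoduleE[OF L_deg_submodule]
  show "E d s \<subseteq> carrier Q" by (auto simp: E_def)
  show "\<zero>\<^bsub>Q\<^esub> \<in> E d s" by (simp add: E_def Q_zero_apply)
  show add: "p \<oplus>\<^bsub>Q\<^esub> q \<in> E d s" if "p \<in> E d s" "q \<in> E d s" for p q
  proof -
    have "set_mset u \<subseteq> {..<s} \<and> 2 * size u \<le> d \<and> p u \<oplus>\<^bsub>LA R\<^esub> q u \<in> L_deg R (d - 2 * size u)"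
      if u: "p u \<oplus>\<^bsub>LA R\<^esub> q u \<noteq> \<zero>\<^bsub>LA R\<^esub>" for u
    proof -
      have "p u \<noteq> \<zero>\<^bsub>LA R\<^esub> \<or> q u \<noteq> \<zero>\<^bsub>LA R\<^esub>" using u by auto
      moreover have "p u \<in> L_deg R (d - 2 * size u)" "q u \<in> L_deg R (d - 2 * size u)"
        using \<open>p \<in> E d s\<close> \<open>q \<in> E d s\<close> E_coeff by blast+
      ultimately show ?thesis using \<open>p \<in> E d s\<close> \<open>q \<in> E d s\<close> m(5) E_supp by blast
    qed
    then show ?thesis using that by (simp add: E_def Q_add_apply)
  qed
  show smult: "a \<odot>\<^bsub>Q\<^esub> q \<in> E d s" if a: "a \<in> carrier R" and q: "q \<in> E d s" for a q
  proof -
    have "q u \<noteq> \<zero>\<^bsub>LA R\<^esub>" if "a \<odot>\<^bsub>LA R\<^esub> q u \<noteq> \<zero>\<^bsub>LA R\<^esub>" for u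
    proof
      assume "q u = \<zero>\<^bsub>LA R\<^esub>"
      with a that show False by simp
    qed
    then show ?thesis using a q m(4) by (simp add: E_def Q_smult_apply)
  qed
  show "\<ominus>\<^bsub>Q\<^esub> q \<in> E d s" if "q \<in> E d s" for q
  proof -
    have "(\<ominus> \<one>) \<odot>\<^bsub>Q\<^esub> q = \<ominus>\<^bsub>Q\<^esub> q" using that by (subst Q.smult_l_minus) (auto simp: E_closed)
    then show ?thesis using smult[OF a_inv_closed[OF one_closed] that] by simp
  qed
qed

lemmas E_rules = Q.submoduleE(3-5)[OF E_submodule]

lemma E_zero: "\<zero>\<^bsub>Q\<^esub> \<in> E d s"
  by (simp add: E_def Q_zero_apply)

lemma E_minus: "p \<in> E d s \<Longrightarrow> q \<in> E d s \<Longrightarrow> p \<ominus>\<^bsub>Q\<^esub> q \<in> E d s"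
  by (simp add: a_minus_def E_rules)

lemma E_qc: "l \<in> L_deg R d \<Longrightarrow> qc l \<in> E d s"
  by (auto simp: E_def qc_apply L_deg_closed)

lemma E_one: "\<one>\<^bsub>Q\<^esub> \<in> E 0 s"
  using E_qc[OF L_deg_one] algebra_mapsD(5)[OF qc_map] by simp

lemma E_qt: "i < s \<Longrightarrow> qt i \<in> E 2 s"
  using L_deg_one qt_closed[of i] unfolding E_def by (auto simp: qt_def basis_def)

lemma E_mult:
  assumes p: "p \<in> E d s" and q: "q \<in> E e s" shows "p \<otimes>\<^bsub>Q\<^esub> q \<in> E (d + e) s"
proof -
  have pq: "(p \<otimes>\<^bsub>Q\<^esub> q) u = finsum (LA R) (\<lambda>(x, y). p x \<otimes>\<^bsub>LA R\<^esub> q y)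
      {(x, y). p x \<noteq> \<zero>\<^bsub>LA R\<^esub> \<and> q y \<noteq> \<zero>\<^bsub>LA R\<^esub> \<and> x + y = u}" for u
    by (simp add: Q_sel QM_def) (simp add: monoid_algebra_def)
  have terms: "set_mset (x + y) \<subseteq> {..<s} \<and> 2 * size (x + y) \<le> d + e
      \<and> p x \<otimes>\<^bsub>LA R\<^esub> q y \<in> L_deg R (d + e - 2 * size (x + y))"
    if "p x \<noteq> \<zero>\<^bsub>LA R\<^esub>" "q y \<noteq> \<zero>\<^bsub>LA R\<^esub>" for x y
  proof -
    have x: "set_mset x \<subseteq> {..<s}" "2 * size x \<le> d" "p x \<in> L_deg R (d - 2 * size x)"
      using p that by (auto simp: E_def)
    have y: "set_mset y \<subseteq> {..<s}" "2 * size y \<le> e" "q y \<in> L_deg R (e - 2 * size y)"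
      using q that by (auto simp: E_def)
    have "d + e - 2 * size (x + y) = (d - 2 * size x) + (e - 2 * size y)" using x y by simp
    then show ?thesis using x y L_deg_mult[OF x(3) y(3)] by simp
  qed
  have "set_mset u \<subseteq> {..<s} \<and> 2 * size u \<le> d + e \<and> (p \<otimes>\<^bsub>Q\<^esub> q) u \<in> L_deg R (d + e - 2 * size u)"
    if "(p \<otimes>\<^bsub>Q\<^esub> q) u \<noteq> \<zero>\<^bsub>LA R\<^esub>" for u
  proof -
    let ?T = "{(x, y). p x \<noteq> \<zero>\<^bsub>LA R\<^esub> \<and> q y \<noteq> \<zero>\<^bsub>LA R\<^esub> \<and> x + y = u}"
    have "?T \<noteq> {}"
    proof
      assume "?T = {}"
      then have "(p \<otimes>\<^bsub>Q\<^esub> q) u = \<zero>\<^bsub>LA R\<^esub>" unfolding pq by (simp only: L.finsum_empty)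
      with that show False by simp
    qed
    then obtain x y where "p x \<noteq> \<zero>\<^bsub>LA R\<^esub>" "q y \<noteq> \<zero>\<^bsub>LA R\<^esub>" "x + y = u" by blast
    then have "set_mset u \<subseteq> {..<s} \<and> 2 * size u \<le> d + e" using terms by blast
    moreover have "(p \<otimes>\<^bsub>Q\<^esub> q) u \<in> L_deg R (d + e - 2 * size u)"
      unfolding pq
    proof (rule L.finsum_mem_submodule[OF L_deg_submodule])
      fix z assume "z \<in> ?T"
      then obtain x y where z: "z = (x, y)" "p x \<noteq> \<zero>\<^bsub>LA R\<^esub>" "q y \<noteq> \<zero>\<^bsub>LA R\<^esub>" "x + y = u" by blast
      then show "(case z of (x, y) \<Rightarrow> p x \<otimes>\<^bsub>LA R\<^esub> q y) \<in> L_deg R (d + e - 2 * size u)"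
        using terms[of x y] by simp
    qed
    ultimately show ?thesis by blast
  qed
  then show ?thesis using E_closed[OF p] E_closed[OF q] by (simp add: E_def)
qed

lemma E_pow: "p \<in> E d s \<Longrightarrow> p [^]\<^bsub>Q\<^esub> k \<in> E (d * k) s"
proof (induction k)
  case (Suc k)
  then show ?case using E_mult[OF Suc.IH, of p d] by (simp add: add.commute)
qed (simp add: E_one)

lemma E_tsum: "j \<le> s \<Longrightarrow> tsum j \<in> E 2 s"
  by (induction j) (simp_all add: E_zero E_rules E_qt)

lemma E_tau:
  assumes w: "w \<in> E 2 s" and l: "l \<in> L_deg R d" shows "tau w l \<in> E d s"
proof (cases "even d")
  case True
  have "tau w l \<in> E (2 * (d div 2)) s"
    unfolding tau_def twist_def
  proof (rule sym_power_lift_mem[OF Dr_module Q_algebra, where F = "\<lambda>k. E (2 * k) s"])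
    show lin: "twist_lin Q qc w \<in> linear_maps R (Dr R) Q"
      by (rule twist_lin_linear[OF Q_algebra algebra_mapsD(1)[OF qc_map] E_closed[OF w]])
    show "twist_lin Q qc w x \<in> E (2 * Suc 0) s" if "x \<in> carrier (Dr R)" for x
      using that E_qc[OF L_deg_iota[OF that]] w by (simp add: twist_lin_def E_rules)
    show "x \<otimes>\<^bsub>Q\<^esub> y \<in> E (2 * (k + m)) s" if "x \<in> E (2 * k) s" "y \<in> E (2 * m) s" for x y k m
      using E_mult[OF that] by (simp add: distrib_left)
    show "l \<in> sym_power R (Dr R) (d div 2)" using l True by (simp add: L_deg_def)
  qed (simp_all add: E_submodule E_one)
  with True show ?thesis by simp
next
  case False
  then have "l = \<zero>\<^bsub>LA R\<^esub>" using l by (simp add: L_deg_def)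
  then show ?thesis
    using linear_map_zero[OF L.module Q.module algebra_mapsD(1)[OF tau_map[OF E_closed[OF w]]]] by (simp add: E_zero)
qed

lemma E_lam:
  assumes v: "v \<in> E 2 s" and w: "w \<in> E 2 s" and g: "g \<in> LB_deg R d"
  shows "lam v w g \<in> E d s"
proof -
  interpret U: UP_cring "LA R" "UP (LA R)" by (simp_all add: UP_cring_def L.M_cring)
  have gc: "g \<in> carrier (UP (LA R))" using g by (simp add: LB_deg_def LB_sel)
  have "lam v w g = (\<Oplus>\<^bsub>Q\<^esub>i\<in>{..deg (LA R) g}. tau v (up_ring.coeff (UP (LA R)) g i) \<otimes>\<^bsub>Q\<^esub> (w \<ominus>\<^bsub>Q\<^esub> v) [^]\<^bsub>Q\<^esub> i)"
    unfolding lam_def by (rule U.eval_on_carrier[OF gc])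
  also have "\<dots> \<in> E d s"
  proof (rule Q.finsum_mem_submodule[OF E_submodule])
    fix i
    let ?c = "up_ring.coeff (UP (LA R)) g i"
    have pow: "(w \<ominus>\<^bsub>Q\<^esub> v) [^]\<^bsub>Q\<^esub> i \<in> E (2 * i) s" by (rule E_pow[OF E_minus[OF w v]])
    show "tau v ?c \<otimes>\<^bsub>Q\<^esub> (w \<ominus>\<^bsub>Q\<^esub> v) [^]\<^bsub>Q\<^esub> i \<in> E d s"
    proof (cases "?c = \<zero>\<^bsub>LA R\<^esub>")
      case True
      then show ?thesis
        using linear_map_zero[OF L.module Q.module algebra_mapsD(1)[OF tau_map[OF E_closed[OF v]]]] E_closed[OF pow]
        by (simp add: E_zero)
    next
      case False
      then have i: "2 * i \<le> d" "?c \<in> L_deg R (d - 2 * i)" using g by (auto simp: LB_deg_def)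
      have "d - 2 * i + 2 * i = d" using i by simp
      then show ?thesis using E_mult[OF E_tau[OF v i(2)] pow] by simp
    qed
  qed
  finally show ?thesis .
qed

lemma E_lamprod:
  "list_all2 (\<lambda>g k. g \<in> LB_deg R k) gs es \<Longrightarrow> (\<And>k. k \<le> length gs \<Longrightarrow> w k \<in> E 2 s) \<Longrightarrow>
    lamprod gs w \<in> E (sum_list es) s"
proof (induction gs es arbitrary: w rule: list_all2_induct)
  case (Cons g gs k es)
  have "lam (w 0) (w (Suc 0)) g \<in> E k s"
    by (rule E_lam[OF Cons.prems Cons.prems Cons.hyps(1)]) simp_all
  moreover have "lamprod gs (\<lambda>k. w (Suc k)) \<in> E (sum_list es) s"
    by (rule Cons.IH) (rule Cons.prems, simp)
  ultimately show ?case by (simp add: E_mult)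
qed (simp add: E_one)

lemma LB_deg_closed: "g \<in> LB_deg R k \<Longrightarrow> g \<in> carrier (LB R)"
  by (simp add: LB_deg_def)

definition "deg_gens s d = {pure_tensor R l gs | l gs e es. length gs = s \<and> l \<in> L_deg R e \<and>
        list_all2 (\<lambda>g k. g \<in> LB_deg R k) gs es \<and> e + sum_list es = d}"

lemma tensor_deg_eq: "tensor_deg R s d = span R (tensor R s) (deg_gens s d)"
  by (simp add: tensor_deg_def deg_gens_def)

lemma deg_word:
  assumes "length gs = s" "l \<in> L_deg R e" "list_all2 (\<lambda>g k. g \<in> LB_deg R k) gs es"
  shows "word s l gs"
proof -
  have "g \<in> carrier (LB R)" if "g \<in> set gs" for g
    using assms(3) that by (auto simp: in_set_conv_nth list_all2_conv_all_nth intro: LB_deg_closed)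
  then show ?thesis using assms L_deg_closed by (auto simp: word_def)
qed

lemma deg_gens_closed: "deg_gens s d \<subseteq> carrier (tensor R s)"
  by (auto simp: deg_gens_def intro!: pure_closed deg_word)

lemma tensor_deg_submodule: "submodule (tensor_deg R s d) R (tensor R s)"
  unfolding tensor_deg_eq by (rule module.span_submodule[OF algebra.module[OF tensor_algebra] deg_gens_closed])

lemma tensor_deg_closed: "X \<in> tensor_deg R s d \<Longrightarrow> X \<in> carrier (tensor R s)"
  using module.submoduleE(1)[OF algebra.module[OF tensor_algebra] tensor_deg_submodule] by blast

lemma preimage_submodule:
  assumes M: "module R M" and N: "module R N" and f: "f \<in> linear_maps R M N" and U: "submodule U R N"
  shows "submodule {x \<in> carrier M. f x \<in> U} R M"
proof -
  interpret M: module R M by fact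
  interpret N: module R N by fact
  note k = N.submoduleE[OF U]
  have "\<zero>\<^bsub>N\<^esub> \<in> U" using k(2,3,5) N.r_neg k(1) by (metis all_not_in_conv subsetD)
  then show ?thesis
    by (intro M.submoduleI)
      (auto simp: k linear_mapsD[OF f] linear_map_zero[OF M N f] linear_map_uminus[OF M N f])
qed

text \<open>The preimage of a graded piece is a submodule, so only generating pure tensors matter,
  and for these degrees add up over the factors. Only the points actually used, up to index
  \<open>s\<close>, must have degree 2.\<close>

lemma psi_deg:
  assumes w: "\<And>k. w k \<in> carrier Q" and wE: "\<And>k. k \<le> s \<Longrightarrow> w k \<in> E 2 s'" and X: "X \<in> tensor_deg R s d"
  shows "psi w X \<in> E d s'"
proof -
  interpret T: algebra R "tensor R s" by (rule tensor_algebra)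
  have "deg_gens s d \<subseteq> {X \<in> carrier (tensor R s). psi w X \<in> E d s'}"
  proof
    fix X assume "X \<in> deg_gens s d"
    then obtain l gs e es where X: "X = pure_tensor R l gs" "length gs = s" "l \<in> L_deg R e"
      "list_all2 (\<lambda>g k. g \<in> LB_deg R k) gs es" "e + sum_list es = d" by (auto simp: deg_gens_def)
    have wd: "word s l gs" by (rule deg_word[OF X(2-4)])
    have "tau (w 0) l \<otimes>\<^bsub>Q\<^esub> lamprod gs w \<in> E (e + sum_list es) s'"
      by (intro E_mult E_tau wE X E_lamprod) (simp_all add: X)
    then show "X \<in> {X \<in> carrier (tensor R s). psi w X \<in> E d s'}"
      using psi_pure[OF w wd] pure_closed[OF wd] X by simp
  qed
  then have "tensor_deg R s d \<subseteq> {X \<in> carrier (tensor R s). psi w X \<in> E d s'}"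
    unfolding tensor_deg_eq
    by (intro span_minimal preimage_submodule[OF T.module Q.module algebra_mapsD(1)[OF psi_map[OF w]] E_submodule])
  with X show ?thesis by blast
qed

lemma Q_repr:
  assumes q: "q \<in> carrier Q"
  shows "q = (\<Oplus>\<^bsub>Q\<^esub>u\<in>{u. q u \<noteq> \<zero>\<^bsub>LA R\<^esub>}. qc (q u) \<otimes>\<^bsub>Q\<^esub> basis (LA R) u)"
proof -
  let ?F = "free_module (LA R) (carrier FN)"
  have F: "carrier ?F = carrier Q" "add ?F = add Q" "zero ?F = zero Q" "smult ?F = smult QM"
    by (simp_all add: Q_sel QM_def cring.monoid_algebra_sel[OF L.M_cring])
  have fin: "finsum ?F f X = finsum Q f X" for f and X :: "nat multiset set"
    by (simp add: finsum_def finprod_def F)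
  have "q = (\<Oplus>\<^bsub>?F\<^esub>u\<in>{u. q u \<noteq> \<zero>\<^bsub>LA R\<^esub>}. q u \<odot>\<^bsub>?F\<^esub> basis (LA R) u)"
    by (rule cring.free_module_repr[OF L.M_cring]) (simp only: F(1) q)
  also have "\<dots> = (\<Oplus>\<^bsub>Q\<^esub>u\<in>{u. q u \<noteq> \<zero>\<^bsub>LA R\<^esub>}. qc (q u) \<otimes>\<^bsub>Q\<^esub> basis (LA R) u)"
    unfolding fin F(4)
    by (rule Q.finsum_cong') (simp_all add: QM_smult Q_apply_closed q basis_Q)
  finally show ?thesis .
qed

text \<open>The factors of the pure tensor that \<open>Theta s\<close> assigns to the monomial
  \<open>u\<close>.\<close>

definition "pvec s u = map (\<lambda>i. LB_t R [^]\<^bsub>LB R\<^esub> count u i) [0..<s]"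

lemma pvec_word: "word s l (pvec s u) \<longleftrightarrow> l \<in> carrier (LA R)"
  by (auto simp: word_def pvec_def)

lemma Theta_basis: "set_mset u \<subseteq> {..<s} \<Longrightarrow> Theta s (basis (LA R) u) = pure_tensor R \<one>\<^bsub>LA R\<^esub> (pvec s u)"
proof (induction u)
  case empty
  have "pvec s {#} = ones s" by (simp add: pvec_def ones_def map_replicate_const)
  then show ?case
    using algebra_mapsD(5)[OF Theta_map[of s]] by (simp add: basis_empty pure_one[folded ones_def])
next
  case (add i u)
  then have i: "i < s" by simp
  have "Theta s (basis (LA R) (add_mset i u)) = ins s i (LB_t R) \<otimes>\<^bsub>tensor R s\<^esub> pure_tensor R \<one>\<^bsub>LA R\<^esub> (pvec s u)"
    using add i by (simp add: basis_add_mset algebra_mapsD(6)[OF Theta_map] basis_Q Theta_qt)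
  also have "\<dots> = pure_tensor R (\<one>\<^bsub>LA R\<^esub> \<otimes>\<^bsub>LA R\<^esub> \<one>\<^bsub>LA R\<^esub>)
      (map2 (monoid.mult (LB R)) ((ones s)[i := LB_t R]) (pvec s u))"
    unfolding ins_def by (rule pure_mult[OF word_update[OF word_ones LB_t_closed]]) (simp_all add: pvec_word)
  also have "map2 (monoid.mult (LB R)) ((ones s)[i := LB_t R]) (pvec s u) = pvec s (add_mset i u)"
    by (rule nth_equalityI) (auto simp: pvec_def nth_list_update i B.m_comm)
  finally show ?case by simp
qed

lemma LB_t_pow_deg: "LB_t R [^]\<^bsub>LB R\<^esub> k \<in> LB_deg R (2 * k)"
proof -
  interpret U: UP_cring "LA R" "UP (LA R)" by (simp_all add: UP_cring_def L.M_cring)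
  have "x [^]\<^bsub>LB R\<^esub> k = x [^]\<^bsub>UP (LA R)\<^esub> k" for x by (simp add: nat_pow_def LB_sel)
  then have "LB_t R [^]\<^bsub>LB R\<^esub> k = up_ring.monom (UP (LA R)) \<one>\<^bsub>LA R\<^esub> k"
    using U.monom_pow[of "\<one>\<^bsub>LA R\<^esub>" 1 k] by (simp add: LB_t_def)
  then show ?thesis by (simp add: LB_deg_def LB_sel L_deg_one)
qed

lemma count_sum:
  assumes "set_mset u \<subseteq> {..<s}" shows "(\<Sum>i\<leftarrow>[0..<s]. 2 * count u i) = 2 * size u"
proof -
  have "size u = (\<Sum>i\<in>{..<s}. count u i)"
    unfolding size_multiset_overloaded_eq
    by (rule sum.mono_neutral_left) (use assms in \<open>auto simp: not_in_iff\<close>)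
  then show ?thesis
    by (simp add: interv_sum_list_conv_sum_set_nat atLeast0LessThan sum_distrib_left)
qed

text \<open>A term of \<open>q\<close> is a coefficient of degree d - 2k times a monomial of size k,
  and its image is one of the generating pure tensors. Together with \<open>psi_tsum_deg\<close>
  this matches the degree \<open>d\<close> part of a tensor power with \<open>E d s\<close>.\<close>

lemma Theta_deg:
  assumes q: "q \<in> E d s" shows "Theta s q \<in> tensor_deg R s d"
proof -
  interpret T: algebra R "tensor R s" by (rule tensor_algebra)
  note qQ = E_closed[OF q]
  have "Theta s q = Theta s (\<Oplus>\<^bsub>Q\<^esub>u\<in>{u. q u \<noteq> \<zero>\<^bsub>LA R\<^esub>}. qc (q u) \<otimes>\<^bsub>Q\<^esub> basis (LA R) u)"
    using Q_repr[OF qQ] by simp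
  also have "\<dots> = (\<Oplus>\<^bsub>tensor R s\<^esub>u\<in>{u. q u \<noteq> \<zero>\<^bsub>LA R\<^esub>}. Theta s (qc (q u) \<otimes>\<^bsub>Q\<^esub> basis (LA R) u))"
    by (rule linear_map_finsum[OF Q.module T.module algebra_mapsD(1)[OF Theta_map]])
      (simp add: Q_apply_closed qQ basis_Q)
  also have "\<dots> \<in> tensor_deg R s d"
  proof (rule T.finsum_mem_submodule[OF tensor_deg_submodule])
    fix u assume "u \<in> {u. q u \<noteq> \<zero>\<^bsub>LA R\<^esub>}"
    then have u: "set_mset u \<subseteq> {..<s}" "2 * size u \<le> d" using E_supp[OF q] by simp_all
    have l: "q u \<in> carrier (LA R)" by (rule Q_apply_closed[OF qQ])
    have "Theta s (qc (q u) \<otimes>\<^bsub>Q\<^esub> basis (LA R) u)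
        = cst s (q u) \<otimes>\<^bsub>tensor R s\<^esub> pure_tensor R \<one>\<^bsub>LA R\<^esub> (pvec s u)"
      using l by (simp add: algebra_mapsD(6)[OF Theta_map] basis_Q Theta_qc Theta_basis[OF u(1)])
    also have "\<dots> = pure_tensor R (q u \<otimes>\<^bsub>LA R\<^esub> \<one>\<^bsub>LA R\<^esub>) (map2 (monoid.mult (LB R)) (ones s) (pvec s u))"
      unfolding cst_def by (rule pure_mult) (simp_all add: l pvec_word)
    also have "map2 (monoid.mult (LB R)) (ones s) (pvec s u) = pvec s u"
      by (rule nth_equalityI) (auto simp: pvec_def)
    finally have "Theta s (qc (q u) \<otimes>\<^bsub>Q\<^esub> basis (LA R) u) = pure_tensor R (q u) (pvec s u)" using l by simp
    moreover have "pure_tensor R (q u) (pvec s u) \<in> deg_gens s d"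
      unfolding deg_gens_def
    proof (intro CollectI exI conjI)
      show "q u \<in> L_deg R (d - 2 * size u)" by (rule E_coeff[OF q])
      show "list_all2 (\<lambda>g k. g \<in> LB_deg R k) (pvec s u) (map (\<lambda>i. 2 * count u i) [0..<s])"
        by (simp add: pvec_def list_all2_conv_all_nth LB_t_pow_deg)
      show "d - 2 * size u + sum_list (map (\<lambda>i. 2 * count u i) [0..<s]) = d"
        using count_sum[OF u(1)] u(2) by simp
    qed (simp_all add: pvec_def)
    then have "pure_tensor R (q u) (pvec s u) \<in> tensor_deg R s d"
      unfolding tensor_deg_eq by (rule subsetD[OF span_superset])
    ultimately show "Theta s (qc (q u) \<otimes>\<^bsub>Q\<^esub> basis (LA R) u) \<in> tensor_deg R s d" by simp
  qed
  finally show ?thesis .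
qed

lemma psi_tsum_deg: "X \<in> tensor_deg R s d \<Longrightarrow> psi tsum X \<in> E d s"
  by (rule psi_deg) (simp_all add: E_tsum)

section \<open>The cofaces in coordinates\<close>

text \<open>A coface in coordinates is a single endomorphism of \<open>Q\<close>, with no reference
  to the number of factors. On polynomials in \<open>s\<close> variables it is the identity for
  every \<open>i\<close> beyond \<open>s\<close>.\<close>

definition "cf i = Op (\<lambda>j. tsum (skip i j))"

lemma cf_map: "cf i \<in> algebra_maps R Q Q"
  unfolding cf_def by (rule Op_map) simp

lemmas cf_simps = algebra_mapsD[OF cf_map]

lemma cf_hom: "cf i \<in> ring_hom Q Q"
  by (rule algebra_maps_ring_hom[OF cf_map])

lemma cf_closed [simp]: "q \<in> carrier Q \<Longrightarrow> cf i q \<in> carrier Q"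
  by (rule cf_simps(2))

lemma tau_closed [simp]: "w \<in> carrier Q \<Longrightarrow> l \<in> carrier (LA R) \<Longrightarrow> tau w l \<in> carrier Q"
  by (rule algebra_mapsD(2)[OF tau_map])

lemma cf_qc: "l \<in> carrier (LA R) \<Longrightarrow> cf i (qc l) = tau (tsum (skip i 0)) l"
  unfolding cf_def by (rule Op_qc) simp_all

lemma cf_qt_diff: "cf i (qt j) = tsum (skip i (Suc j)) \<ominus>\<^bsub>Q\<^esub> tsum (skip i j)"
  unfolding cf_def by (rule Op_qt) simp

lemma cf_qc_Suc: "l \<in> carrier (LA R) \<Longrightarrow> cf (Suc i) (qc l) = qc l"
  by (simp add: cf_qc skip_def tau_zero)

text \<open>The variable \<open>qt j\<close> is the increment from point j to point j + 1. Omitting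
  a point up to j shifts both ends, omitting point j + 1 merges two increments, and omitting a later
  point changes nothing.\<close>

lemma cf_qt:
  "i \<le> j \<Longrightarrow> cf i (qt j) = qt (Suc j)"
  "cf (Suc j) (qt j) = qt j \<oplus>\<^bsub>Q\<^esub> qt (Suc j)"
  "Suc j < i \<Longrightarrow> cf i (qt j) = qt j"
proof -
  show "i \<le> j \<Longrightarrow> cf i (qt j) = qt (Suc j)" "Suc j < i \<Longrightarrow> cf i (qt j) = qt j"
    using tsum_diff[of "Suc j"] tsum_diff[of j] by (simp_all add: cf_qt_diff skip_def)
  have "(a \<oplus>\<^bsub>Q\<^esub> b \<oplus>\<^bsub>Q\<^esub> c) \<ominus>\<^bsub>Q\<^esub> a = b \<oplus>\<^bsub>Q\<^esub> c"
    if "a \<in> carrier Q" "b \<in> carrier Q" "c \<in> carrier Q" for a b c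
    using that by (simp add: a_minus_def Q.a_assoc Q.a_comm[of a] Q.l_neg Q.r_neg)
  then show "cf (Suc j) (qt j) = qt j \<oplus>\<^bsub>Q\<^esub> qt (Suc j)"
    by (simp add: cf_qt_diff skip_def)
qed

lemma cf_id:
  assumes q: "q \<in> Qpart {..<s}" and i: "s < i" shows "cf i q = q"
proof (rule Qpart_maps_eq[OF cf_hom _ _ _ q])
  show "(\<lambda>q. q) \<in> ring_hom Q Q" by (rule ring_hom_memI) simp_all
  show "cf i (qc l) = qc l" if "l \<in> carrier (LA R)" for l
    using i that cf_qc_Suc[of l "i - 1"] by simp
  show "cf i (qt j) = qt j" if "j \<in> {..<s}" for j
    using that i by (simp add: cf_qt(3))
qed

text \<open>Partial sums are measured from the base point. The subtracted term is nonzero only for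
  \<open>i = 0\<close>, when the base point moves from zero to \<open>qt 0\<close>.\<close>

lemma cf_tsum: "cf i (tsum k) = tsum (skip i k) \<ominus>\<^bsub>Q\<^esub> tsum (skip i 0)"
proof (induction k)
  case 0
  then show ?case using linear_map_zero[OF Q.module Q.module cf_simps(1)] by (simp add: a_minus_def Q.r_neg)
next
  case (Suc k)
  have "(a \<ominus>\<^bsub>Q\<^esub> b) \<oplus>\<^bsub>Q\<^esub> (c \<ominus>\<^bsub>Q\<^esub> a) = c \<ominus>\<^bsub>Q\<^esub> b"
    if "a \<in> carrier Q" "b \<in> carrier Q" "c \<in> carrier Q" for a b c
  proof -
    have "(a \<ominus>\<^bsub>Q\<^esub> b) \<oplus>\<^bsub>Q\<^esub> (c \<ominus>\<^bsub>Q\<^esub> a) = (c \<oplus>\<^bsub>Q\<^esub> \<ominus>\<^bsub>Q\<^esub> b) \<oplus>\<^bsub>Q\<^esub> (a \<oplus>\<^bsub>Q\<^esub> \<ominus>\<^bsub>Q\<^esub> a)"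
      unfolding a_minus_def using that by (simp only: Q.a_ac Q.a_closed Q.a_inv_closed)
    then show ?thesis using that by (simp add: Q.r_neg a_minus_def)
  qed
  then show ?case using Suc by (simp add: cf_simps cf_qt_diff del: tsum.simps(1))
qed

text \<open>The coefficient of \<open>phi x\<close> is the point at which \<open>tau\<close>
  evaluates. It is transported by \<open>cf i\<close> and gets the displacement of the base point
  added, which comes from the action on constants.\<close>

lemma cf_tau:
  assumes v: "v \<in> carrier Q" and l: "l \<in> carrier (LA R)"
  shows "cf i (tau v l) = tau (tsum (skip i 0) \<oplus>\<^bsub>Q\<^esub> cf i v) l"
proof (rule LA_maps_eq[OF Q_algebra algebra_maps_comp[OF tau_map[OF v] cf_map] tau_map _ l])
  fix x assume x: "x \<in> carrier (Dr R)"
  then show "cf i (tau v (iota x)) = tau (tsum (skip i 0) \<oplus>\<^bsub>Q\<^esub> cf i v) (iota x)"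
    using v by (simp add: tau_iota cf_simps cf_qc Q.smult_r_distr Q.a_assoc)
qed (use v in simp)

text \<open>The cosimplicial identity. Both composites are determined by the points they end up
  with, so it reduces to the corresponding identity for \<open>skip\<close>.\<close>

lemma cf_cf:
  assumes ij: "i \<le> j" and q: "q \<in> carrier Q" shows "cf i (cf j q) = cf (Suc j) (cf i q)"
proof -
  have skip: "skip i (skip j k) = skip (Suc j) (skip i k)" for k using ij by (auto simp: skip_def)
  have hom: "(\<lambda>q. cf a (cf b q)) \<in> ring_hom Q Q" for a b
    by (rule algebra_maps_ring_hom[OF algebra_maps_comp[OF cf_map cf_map]])
  have cancel: "a \<oplus>\<^bsub>Q\<^esub> (b \<ominus>\<^bsub>Q\<^esub> a) = b" if "a \<in> carrier Q" "b \<in> carrier Q" for a b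
    using that by (simp add: a_minus_def Q.a_comm[of b] Q.r_neg2)
  have cq: "cf a (cf b (qc l)) = tau (tsum (skip a (skip b 0))) l" if "l \<in> carrier (LA R)" for a b l
    using that by (simp add: cf_qc cf_tau cf_tsum cancel)
  have ct: "cf a (cf b (qt k)) = tsum (skip a (skip b (Suc k))) \<ominus>\<^bsub>Q\<^esub> tsum (skip a (skip b k))" for a b k
  proof -
    have "(x \<ominus>\<^bsub>Q\<^esub> z) \<ominus>\<^bsub>Q\<^esub> (y \<ominus>\<^bsub>Q\<^esub> z) = x \<ominus>\<^bsub>Q\<^esub> y"
      if "x \<in> carrier Q" "y \<in> carrier Q" "z \<in> carrier Q" for x y z
      using that by (simp add: Q.minus_eq_minus_iff Q.minus_closed cancel Q.a_comm)
        (simp add: a_minus_def Q.a_ac)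
    then show ?thesis
      by (simp add: cf_qt_diff linear_map_minus[OF Q.module Q.module cf_simps(1)] cf_tsum)
  qed
  show ?thesis
    by (rule Qpart_maps_eq[OF hom hom, where J = UNIV]) (simp_all add: cq ct skip Qpart_UNIV q)
qed

section \<open>The differential on polynomials\<close>

definition "dQ s q = (\<Oplus>\<^bsub>Q\<^esub>i\<in>{..Suc s}. sgn_Q i (cf i q))"

lemma sgn_Q_closed [simp]: "q \<in> carrier Q \<Longrightarrow> sgn_Q i q \<in> carrier Q"
  by (simp add: sgn_Q_def)

lemma sgn_Q_zero [simp]: "sgn_Q i \<zero>\<^bsub>Q\<^esub> = \<zero>\<^bsub>Q\<^esub>"
  by (simp add: sgn_Q_def Q.minus_zero)

lemma sgn_Q_linear: "sgn_Q i \<in> linear_maps R Q Q"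
  by (rule linear_mapsI) (simp_all add: sgn_Q_def Q.minus_add Q.smult_r_minus)

lemma sgn_Q_mult: "x \<in> carrier Q \<Longrightarrow> y \<in> carrier Q \<Longrightarrow> sgn_Q i (x \<otimes>\<^bsub>Q\<^esub> y) = x \<otimes>\<^bsub>Q\<^esub> sgn_Q i y"
  by (simp add: sgn_Q_def Q.r_minus)

lemma sgn_Q_sgn_Q: "x \<in> carrier Q \<Longrightarrow> sgn_Q i (sgn_Q i x) = x"
  by (simp add: sgn_Q_def)

lemma sgn_Q_comm: "x \<in> carrier Q \<Longrightarrow> sgn_Q i (sgn_Q j x) = sgn_Q j (sgn_Q i x)"
  by (simp add: sgn_Q_def)

lemma sgn_Q_Suc: "x \<in> carrier Q \<Longrightarrow> sgn_Q (Suc i) x \<oplus>\<^bsub>Q\<^esub> sgn_Q i x = \<zero>\<^bsub>Q\<^esub>"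
  by (simp add: sgn_Q_def Q.l_neg Q.r_neg)

lemma sgn_cf_linear: "(\<lambda>q. sgn_Q i (cf i q)) \<in> linear_maps R Q Q"
  by (rule linear_maps_comp[OF cf_simps(1) sgn_Q_linear])

lemma dQ_linear: "dQ s \<in> linear_maps R Q Q"
  unfolding dQ_def
  by (rule linear_mapsI)
    (simp_all add: linear_mapsD[OF sgn_cf_linear] Q.finsum_addf Q.finsum_smult_ldistr Pi_def del: Q.finsum_Suc)

lemmas dQ_simps = linear_mapsD[OF dQ_linear]

lemma dQ_zero: "dQ s \<zero>\<^bsub>Q\<^esub> = \<zero>\<^bsub>Q\<^esub>"
  by (rule linear_map_zero[OF Q.module Q.module dQ_linear])

lemma dQ_sgn: "q \<in> carrier Q \<Longrightarrow> dQ s (sgn_Q i q) = sgn_Q i (dQ s q)"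
  by (simp add: sgn_Q_def linear_map_uminus[OF Q.module Q.module dQ_linear])

lemma psi_cobar_diff:
  assumes X: "X \<in> tensor_deg R s d"
  shows "psi tsum (cobar_diff R s X) = dQ s (psi tsum X)"
proof -
  note Xc = tensor_deg_closed[OF X]
  have "psi (\<lambda>j. tsum (skip i j)) X = cf i (psi tsum X)" for i
    using psi_Theta[of "\<lambda>j. tsum (skip i j)", OF _ E_Qpart[OF psi_tsum_deg[OF X]]] Theta_psi[OF Xc]
    by (simp add: cf_def)
  then show ?thesis by (simp only: cobar_diff_psi(2)[OF Xc] dQ_def)
qed

lemma E_cf:
  assumes q: "q \<in> E d s" shows "cf i q \<in> E d (Suc s)"
proof -
  have "psi (\<lambda>j. tsum (skip i j)) (Theta s q) \<in> E d (Suc s)"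
    by (rule psi_deg[OF _ _ Theta_deg[OF q]]) (simp_all add: E_tsum skip_def del: tsum.simps)
  then show ?thesis
    using psi_Theta[of "\<lambda>j. tsum (skip i j)", OF _ E_Qpart[OF q]] by (simp add: cf_def)
qed

lemma E_sgn: "q \<in> E d s \<Longrightarrow> sgn_Q i q \<in> E d s"
  by (simp add: sgn_Q_def E_rules)

lemma E_dQ: "q \<in> E d s \<Longrightarrow> dQ s q \<in> E d (Suc s)"
  unfolding dQ_def by (rule Q.finsum_mem_submodule[OF E_submodule]) (simp add: E_sgn E_cf)

text \<open>Enlarging \<open>n\<close> adds a column \<open>j = Suc n\<close> and a row
  \<open>i = Suc (Suc n)\<close>. The cosimplicial identity turns the column, entry by entry, into
  the row, and the outer signs are opposite, so the additions cancel.\<close>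

lemma alternating_double_sum:
  assumes F: "\<And>i j. F i j \<in> carrier Q" and sw: "\<And>i j. i \<le> j \<Longrightarrow> F i j = F (Suc j) i"
  shows "(\<Oplus>\<^bsub>Q\<^esub>i\<in>{..Suc n}. sgn_Q i (\<Oplus>\<^bsub>Q\<^esub>j\<in>{..n}. sgn_Q j (F i j))) = \<zero>\<^bsub>Q\<^esub>"
proof (induction n)
  case 0
  have "F (Suc 0) 0 = F 0 0" using sw[of 0 0] by simp
  then show ?case using F by (simp add: sgn_Q_def Q.l_neg)
next
  case (Suc n)
  note add = linear_mapsD(2)[OF sgn_Q_linear]
  let ?A = "\<Oplus>\<^bsub>Q\<^esub>j\<in>{..Suc n}. sgn_Q j (F (Suc (Suc n)) j)"
  have A: "?A \<in> carrier Q" using F by (intro Q.finsum_closed) auto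
  have inner: "(\<Oplus>\<^bsub>Q\<^esub>j\<in>{..n}. sgn_Q j (F i j)) \<in> carrier Q" for i using F by (intro Q.finsum_closed) auto
  have "(\<Oplus>\<^bsub>Q\<^esub>i\<in>{..Suc n}. sgn_Q i (\<Oplus>\<^bsub>Q\<^esub>j\<in>{..Suc n}. sgn_Q j (F i j)))
      = (\<Oplus>\<^bsub>Q\<^esub>i\<in>{..Suc n}. sgn_Q i (sgn_Q (Suc n) (F i (Suc n))) \<oplus>\<^bsub>Q\<^esub> sgn_Q i (\<Oplus>\<^bsub>Q\<^esub>j\<in>{..n}. sgn_Q j (F i j)))"
    by (rule Q.finsum_cong') (use F inner add in \<open>auto simp: Pi_def\<close>)
  also have "\<dots> = (\<Oplus>\<^bsub>Q\<^esub>i\<in>{..Suc n}. sgn_Q i (sgn_Q (Suc n) (F i (Suc n))))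
      \<oplus>\<^bsub>Q\<^esub> (\<Oplus>\<^bsub>Q\<^esub>i\<in>{..Suc n}. sgn_Q i (\<Oplus>\<^bsub>Q\<^esub>j\<in>{..n}. sgn_Q j (F i j)))"
    using F inner by (intro Q.finsum_addf) auto
  also have "\<dots> = (\<Oplus>\<^bsub>Q\<^esub>i\<in>{..Suc n}. sgn_Q i (sgn_Q (Suc n) (F i (Suc n))))"
    unfolding Suc.IH using F by (intro Q.r_zero Q.finsum_closed) auto
  also have "\<dots> = (\<Oplus>\<^bsub>Q\<^esub>i\<in>{..Suc n}. sgn_Q (Suc n) (sgn_Q i (F (Suc (Suc n)) i)))"
  proof (rule Q.finsum_cong')
    fix i assume "i \<in> {..Suc n}"
    then have "F i (Suc n) = F (Suc (Suc n)) i" using sw[of i "Suc n"] by simp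
    then show "sgn_Q i (sgn_Q (Suc n) (F i (Suc n))) = sgn_Q (Suc n) (sgn_Q i (F (Suc (Suc n)) i))"
      using sgn_Q_comm F by simp
  qed (use F in auto)
  also have "\<dots> = sgn_Q (Suc n) ?A"
    by (rule linear_map_finsum[OF Q.module Q.module sgn_Q_linear, symmetric]) (use F in auto)
  finally have B: "(\<Oplus>\<^bsub>Q\<^esub>i\<in>{..Suc n}. sgn_Q i (\<Oplus>\<^bsub>Q\<^esub>j\<in>{..Suc n}. sgn_Q j (F i j))) = sgn_Q (Suc n) ?A" .
  have "(\<Oplus>\<^bsub>Q\<^esub>i\<in>{..Suc (Suc n)}. sgn_Q i (\<Oplus>\<^bsub>Q\<^esub>j\<in>{..Suc n}. sgn_Q j (F i j)))
      = sgn_Q (Suc (Suc n)) ?A \<oplus>\<^bsub>Q\<^esub> (\<Oplus>\<^bsub>Q\<^esub>i\<in>{..Suc n}. sgn_Q i (\<Oplus>\<^bsub>Q\<^esub>j\<in>{..Suc n}. sgn_Q j (F i j)))"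
    by (rule Q.finsum_Suc) (use F in \<open>auto intro!: sgn_Q_closed Q.finsum_closed\<close>)
  also have "\<dots> = \<zero>\<^bsub>Q\<^esub>" unfolding B by (rule sgn_Q_Suc[OF A])
  finally show ?case .
qed

lemma dQ_dQ:
  assumes q: "q \<in> carrier Q" shows "dQ (Suc s) (dQ s q) = \<zero>\<^bsub>Q\<^esub>"
proof -
  have "cf i (dQ s q) = (\<Oplus>\<^bsub>Q\<^esub>j\<in>{..Suc s}. sgn_Q j (cf i (cf j q)))" for i
  proof -
    have "cf i (sgn_Q j (cf j q)) = sgn_Q j (cf i (cf j q))" for j
      using q by (simp add: sgn_Q_def linear_map_uminus[OF Q.module Q.module cf_simps(1)])
    then show ?thesis
      unfolding dQ_def
      using linear_map_finsum[OF Q.module Q.module cf_simps(1), of "\<lambda>j. sgn_Q j (cf j q)" "{..Suc s}" i] q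
      by (simp del: Q.finsum_Suc)
  qed
  then have "dQ (Suc s) (dQ s q) = (\<Oplus>\<^bsub>Q\<^esub>i\<in>{..Suc (Suc s)}. sgn_Q i (\<Oplus>\<^bsub>Q\<^esub>j\<in>{..Suc s}. sgn_Q j (cf i (cf j q))))"
    by (simp only: dQ_def[of "Suc s"])
  also have "\<dots> = \<zero>\<^bsub>Q\<^esub>"
    by (rule alternating_double_sum) (use q cf_cf in auto)
  finally show ?thesis .
qed

text \<open>The alternating sum without the last coface of \<open>dQ s\<close>. On polynomials in
  \<open>s\<close> variables that last coface is the identity, so the remaining sum carries all the
  information.\<close>

definition "pd s q = (\<Oplus>\<^bsub>Q\<^esub>i\<in>{..s}. sgn_Q i (cf i q))"

lemma pd_closed [simp]: "q \<in> carrier Q \<Longrightarrow> pd s q \<in> carrier Q"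
  unfolding pd_def by (rule Q.finsum_closed) auto

lemma dQ_pd: "q \<in> carrier Q \<Longrightarrow> dQ s q = sgn_Q (Suc s) (cf (Suc s) q) \<oplus>\<^bsub>Q\<^esub> pd s q"
  unfolding dQ_def pd_def by (rule Q.finsum_Suc) auto

lemma dQ_pd_id:
  assumes "q \<in> Qpart {..<s}" shows "dQ s q = sgn_Q (Suc s) q \<oplus>\<^bsub>Q\<^esub> pd s q"
  using dQ_pd[OF Qpart_closed[OF assms]] cf_id[OF assms, of "Suc s"] by simp

lemma dQ_pd2:
  assumes "q \<in> carrier Q"
  shows "dQ (Suc s) q = sgn_Q (Suc (Suc s)) (cf (Suc (Suc s)) q) \<oplus>\<^bsub>Q\<^esub> (sgn_Q (Suc s) (cf (Suc s) q) \<oplus>\<^bsub>Q\<^esub> pd s q)"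
  using dQ_pd[OF assms, of "Suc s"] dQ_pd[OF assms, of s] by (simp add: pd_def dQ_def del: Q.finsum_Suc)

text \<open>The cofaces up to \<open>s\<close> send \<open>qt s\<close> to
  \<open>qt (Suc s)\<close>, the next one sends it to \<open>qt s \<oplus> qt (Suc s)\<close>, and
  the last one fixes it. The last two contribute \<open>qt s\<close> times \<open>r\<close> with
  opposite signs; what survives is \<open>qt (Suc s)\<close> times the differential of
  \<open>r\<close>.\<close>

lemma dQ_var_mult:
  assumes r: "r \<in> Qpart {..<s}"
  shows "dQ (Suc s) (qt s \<otimes>\<^bsub>Q\<^esub> r) = qt (Suc s) \<otimes>\<^bsub>Q\<^esub> dQ s r"
proof -
  note rQ = Qpart_closed[OF r]
  let ?x = "qt s \<otimes>\<^bsub>Q\<^esub> r"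
  have x: "?x \<in> carrier Q" using rQ by simp
  have c2: "cf (Suc (Suc s)) ?x = ?x"
    using rQ cf_id[OF r, of "Suc (Suc s)"] by (simp add: cf_simps cf_qt)
  have c1: "cf (Suc s) ?x = ?x \<oplus>\<^bsub>Q\<^esub> qt (Suc s) \<otimes>\<^bsub>Q\<^esub> r"
    using rQ cf_id[OF r, of "Suc s"] by (simp add: cf_simps cf_qt Q.l_distr)
  have "pd s ?x = (\<Oplus>\<^bsub>Q\<^esub>i\<in>{..s}. qt (Suc s) \<otimes>\<^bsub>Q\<^esub> sgn_Q i (cf i r))"
    unfolding pd_def
    by (rule Q.finsum_cong') (use rQ in \<open>auto simp: cf_simps cf_qt sgn_Q_mult\<close>)
  also have "\<dots> = qt (Suc s) \<otimes>\<^bsub>Q\<^esub> pd s r"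
    unfolding pd_def by (rule Q.finsum_rdistr[symmetric]) (use rQ in auto)
  finally have p: "pd s ?x = qt (Suc s) \<otimes>\<^bsub>Q\<^esub> pd s r" .
  note add = linear_mapsD(2)[OF sgn_Q_linear]
  have "dQ (Suc s) ?x = sgn_Q (Suc (Suc s)) ?x \<oplus>\<^bsub>Q\<^esub> (sgn_Q (Suc s) ?x \<oplus>\<^bsub>Q\<^esub> sgn_Q (Suc s) (qt (Suc s) \<otimes>\<^bsub>Q\<^esub> r) \<oplus>\<^bsub>Q\<^esub> pd s ?x)"
    using dQ_pd2[OF x, of s] x rQ by (simp add: c1 c2 add)
  also have "\<dots> = (sgn_Q (Suc (Suc s)) ?x \<oplus>\<^bsub>Q\<^esub> sgn_Q (Suc s) ?x) \<oplus>\<^bsub>Q\<^esub> (sgn_Q (Suc s) (qt (Suc s) \<otimes>\<^bsub>Q\<^esub> r) \<oplus>\<^bsub>Q\<^esub> pd s ?x)"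
    using x rQ by (simp add: Q.a_assoc)
  also have "\<dots> = sgn_Q (Suc s) (qt (Suc s) \<otimes>\<^bsub>Q\<^esub> r) \<oplus>\<^bsub>Q\<^esub> pd s ?x"
    unfolding sgn_Q_Suc[OF x] using x rQ by (intro Q.l_zero) simp
  also have "\<dots> = qt (Suc s) \<otimes>\<^bsub>Q\<^esub> (sgn_Q (Suc s) r \<oplus>\<^bsub>Q\<^esub> pd s r)"
    using rQ by (simp add: p sgn_Q_mult Q.r_distr)
  finally show ?thesis using dQ_pd_id[OF r] by simp
qed

text \<open>Setting the last variable to zero is an extra codegeneracy.\<close>

definition "zv s = Qlift Q qc (\<lambda>j. if j = s then \<zero>\<^bsub>Q\<^esub> else qt j)"

lemma zv:
  shows zv_map: "zv s \<in> algebra_maps R Q Q"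
    and zv_qc: "l \<in> carrier (LA R) \<Longrightarrow> zv s (qc l) = qc l"
    and zv_qt: "zv s (qt i) = (if i = s then \<zero>\<^bsub>Q\<^esub> else qt i)"
proof -
  have u: "(if j = s then \<zero>\<^bsub>Q\<^esub> else qt j) \<in> carrier Q" for j by simp
  note q = Qlift[OF Q_algebra qc_map u]
  show "zv s \<in> algebra_maps R Q Q" unfolding zv_def by (rule q(1))
  show "l \<in> carrier (LA R) \<Longrightarrow> zv s (qc l) = qc l" unfolding zv_def by (rule q(2))
  show "zv s (qt i) = (if i = s then \<zero>\<^bsub>Q\<^esub> else qt i)" unfolding zv_def by (rule q(3))
qed

lemmas zv_simps = algebra_mapsD[OF zv_map]

lemma zv_id:
  assumes q: "q \<in> Qpart {..<s}" shows "zv s q = q"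
  by (rule Qpart_maps_eq[OF algebra_maps_ring_hom[OF zv_map] _ _ _ q])
    (auto simp: zv_qc zv_qt intro: ring_hom_memI)

lemma zv_tau: "l \<in> carrier (LA R) \<Longrightarrow> zv (Suc s) (tau (qt 0) l) = tau (qt 0) l"
  by (rule LA_maps_eq[OF Q_algebra algebra_maps_comp[OF tau_map zv_map] tau_map])
    (simp_all add: tau_iota zv_simps zv_qc zv_qt)

text \<open>When \<open>qt (Suc s)\<close> is zero the last two points coincide, so omitting either
  of them returns \<open>q\<close>. Omitting an earlier point leaves the coincidence alone, so the
  substitution can be made before or after, with the index of the last variable adjusted.\<close>

lemma zv_cf:
  assumes q: "q \<in> Qpart {..<Suc s}"
  shows "i \<le> s \<Longrightarrow> zv (Suc s) (cf i q) = cf i (zv s q)"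
    and "zv (Suc s) (cf (Suc s) q) = q"
    and "zv (Suc s) (cf (Suc (Suc s)) q) = q"
proof -
  note zero = linear_map_zero[OF Q.module Q.module cf_simps(1)]
  have hom: "(\<lambda>q. zv a (cf b q)) \<in> ring_hom Q Q" for a b
    by (rule algebra_maps_ring_hom[OF algebra_maps_comp[OF cf_map zv_map]])
  have hom': "(\<lambda>q. cf b (zv a q)) \<in> ring_hom Q Q" for a b
    by (rule algebra_maps_ring_hom[OF algebra_maps_comp[OF zv_map cf_map]])
  have id: "(\<lambda>q. q) \<in> ring_hom Q Q" by (rule ring_hom_memI) simp_all
  show "zv (Suc s) (cf i q) = cf i (zv s q)" if i: "i \<le> s"
  proof (rule Qpart_maps_eq[OF hom hom' _ _ q])
    fix l assume l: "l \<in> carrier (LA R)"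
    show "zv (Suc s) (cf i (qc l)) = cf i (zv s (qc l))"
    proof (cases i)
      case 0 with l show ?thesis by (simp add: cf_qc zv_qc skip_def zv_tau)
    next
      case (Suc k) with l show ?thesis by (simp add: cf_qc_Suc zv_qc)
    qed
  next
    fix j assume "j \<in> {..<Suc s}"
    then consider "j = s" | "j < s" "i \<le> j" | "j < s" "i = Suc j" | "j < s" "Suc j < i" by fastforce
    then show "zv (Suc s) (cf i (qt j)) = cf i (zv s (qt j))"
      using i by cases (simp_all add: cf_qt zv_qt zv_simps zero)
  qed
  show "zv (Suc s) (cf (Suc s) q) = q"
  proof (rule Qpart_maps_eq[OF hom id _ _ q])
    fix j assume "j \<in> {..<Suc s}"
    then consider "j = s" | "Suc j < Suc s" by fastforce
    then show "zv (Suc s) (cf (Suc s) (qt j)) = qt j" by cases (simp_all add: cf_qt zv_qt zv_simps)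
  qed (simp add: cf_qc_Suc zv_qc)
  show "zv (Suc s) (cf (Suc (Suc s)) q) = q"
    using cf_id[OF q, of "Suc (Suc s)"] zv_id[OF q] by simp
qed

text \<open>Apply the substitution to the cocycle equation: the last two cofaces give
  \<open>q\<close> with opposite signs, which leaves \<open>pd s\<close> of \<open>zv s q\<close>
  equal to zero. The differential of \<open>zv s q\<close> is then just its last coface, plus or
  minus \<open>zv s q\<close> itself.\<close>

lemma zv_cocycle:
  assumes q: "q \<in> Qpart {..<Suc s}" and z: "zv s q \<in> Qpart {..<s}" and d: "dQ (Suc s) q = \<zero>\<^bsub>Q\<^esub>"
  shows "zv s q = dQ s (sgn_Q (Suc s) (zv s q))"
proof -
  note qQ = Qpart_closed[OF q] and zQ = Qpart_closed[OF z]
  have sz: "zv a (sgn_Q i x) = sgn_Q i (zv a x)" if "x \<in> carrier Q" for a i x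
    using that by (simp add: sgn_Q_def linear_map_uminus[OF Q.module Q.module zv_simps(1)])
  have "zv (Suc s) (pd s q) = (\<Oplus>\<^bsub>Q\<^esub>i\<in>{..s}. zv (Suc s) (sgn_Q i (cf i q)))"
    unfolding pd_def by (rule linear_map_finsum[OF Q.module Q.module zv_simps(1)]) (use qQ in auto)
  also have "\<dots> = pd s (zv s q)"
    unfolding pd_def by (rule Q.finsum_cong') (use qQ zQ zv_cf(1)[OF q] in \<open>auto simp: sz\<close>)
  finally have p: "zv (Suc s) (pd s q) = pd s (zv s q)" .
  have "\<zero>\<^bsub>Q\<^esub> = zv (Suc s) (dQ (Suc s) q)"
    using d linear_map_zero[OF Q.module Q.module zv_simps(1)] by simp
  also have "\<dots> = sgn_Q (Suc (Suc s)) q \<oplus>\<^bsub>Q\<^esub> (sgn_Q (Suc s) q \<oplus>\<^bsub>Q\<^esub> pd s (zv s q))"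
    using dQ_pd2[OF qQ, of s] qQ by (simp add: zv_simps sz zv_cf(2,3)[OF q] p)
  also have "\<dots> = (sgn_Q (Suc (Suc s)) q \<oplus>\<^bsub>Q\<^esub> sgn_Q (Suc s) q) \<oplus>\<^bsub>Q\<^esub> pd s (zv s q)"
    using qQ zQ by (simp add: Q.a_assoc)
  also have "\<dots> = pd s (zv s q)" using qQ zQ by (simp add: sgn_Q_Suc)
  finally have "dQ s (zv s q) = sgn_Q (Suc s) (zv s q)" using dQ_pd_id[OF z] zQ by simp
  then show ?thesis using zQ by (simp add: dQ_sgn sgn_Q_sgn_Q)
qed

text \<open>Whatever the coefficient ring, a variable is not a zero divisor, since multiplication by
  it only shifts coefficients.\<close>

lemma var_mult_inj:
  assumes q: "q \<in> carrier Q" and "qt s \<otimes>\<^bsub>Q\<^esub> q = \<zero>\<^bsub>Q\<^esub>" shows "q = \<zero>\<^bsub>Q\<^esub>"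
proof (rule ext)
  fix u
  have "(qt s \<otimes>\<^bsub>Q\<^esub> q) (add_mset s u) = q u"
    using cring.variable_mult_apply[OF L.M_cring, of q s "add_mset s u"] q
    by (simp add: Q_sel QM_def qt_def)
  with assms(2) show "q u = \<zero>\<^bsub>Q\<^esub> u" by (simp add: Q_zero_apply)
qed

text \<open>Monomials are sorted by whether \<open>qt s\<close> divides them; the quotient
  \<open>r\<close> may still contain \<open>qt s\<close>. In degree below 2 there is no room for a
  variable, which is why that case is separated from the one where \<open>d - 2\<close> is a genuine
  difference.\<close>

lemma E_decompose:
  assumes q: "q \<in> E d (Suc s)"
  obtains e r where "e \<in> E d s" "r \<in> carrier Q" "q = e \<oplus>\<^bsub>Q\<^esub> qt s \<otimes>\<^bsub>Q\<^esub> r"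
    "d < 2 \<Longrightarrow> r = \<zero>\<^bsub>Q\<^esub>" "2 \<le> d \<Longrightarrow> r \<in> E (d - 2) (Suc s)"
proof -
  define e where "e u = (if s \<in># u then \<zero>\<^bsub>LA R\<^esub> else q u)" for u
  define r where "r u = q (add_mset s u)" for u
  note qQ = E_closed[OF q]
  have carr: "p \<in> carrier Q \<longleftrightarrow> range p \<subseteq> carrier (LA R) \<and> finite {u. p u \<noteq> \<zero>\<^bsub>LA R\<^esub>}" for p
    by (simp add: Q_sel QM_def cring.monoid_algebra_sel[OF L.M_cring] cring.free_module_sel[OF L.M_cring] free_comm_monoid_def)
  have "{u. e u \<noteq> \<zero>\<^bsub>LA R\<^esub>} \<subseteq> {u. q u \<noteq> \<zero>\<^bsub>LA R\<^esub>}" by (simp add: e_def Collect_mono_iff)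
  then have "finite {u. e u \<noteq> \<zero>\<^bsub>LA R\<^esub>}" by (rule finite_subset) (use qQ in \<open>simp add: carr\<close>)
  then have eQ: "e \<in> carrier Q" using Q_apply_closed[OF qQ] by (simp add: carr e_def image_subset_iff)
  have "add_mset s ` {u. r u \<noteq> \<zero>\<^bsub>LA R\<^esub>} \<subseteq> {u. q u \<noteq> \<zero>\<^bsub>LA R\<^esub>}" by (simp add: r_def image_subset_iff)
  then have "finite (add_mset s ` {u. r u \<noteq> \<zero>\<^bsub>LA R\<^esub>})"
    by (rule finite_subset) (use qQ in \<open>simp add: carr\<close>)
  then have "finite {u. r u \<noteq> \<zero>\<^bsub>LA R\<^esub>}" by (rule finite_imageD) (simp add: inj_on_def)
  then have rQ: "r \<in> carrier Q" using Q_apply_closed[OF qQ] by (simp add: carr r_def image_subset_iff)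
  have "e \<in> E d s"
  proof -
    have "set_mset u \<subseteq> {..<s}" if "e u \<noteq> \<zero>\<^bsub>LA R\<^esub>" for u
    proof -
      have "s \<notin># u" "q u \<noteq> \<zero>\<^bsub>LA R\<^esub>" using that by (simp_all add: e_def split: if_splits)
      then show ?thesis using E_supp[OF q, of u] by (auto simp: less_Suc_eq subset_iff)
    qed
    moreover have "2 * size u \<le> d \<and> e u \<in> L_deg R (d - 2 * size u)" if "e u \<noteq> \<zero>\<^bsub>LA R\<^esub>" for u
    proof -
      have "e u = q u" using that by (simp add: e_def split: if_splits)
      with that show ?thesis using E_supp[OF q, of u] E_coeff[OF q, of u] by simp
    qed
    ultimately show ?thesis using eQ by (simp add: E_def)
  qed
  moreover have "q = e \<oplus>\<^bsub>Q\<^esub> qt s \<otimes>\<^bsub>Q\<^esub> r"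
  proof (rule ext)
    fix u
    have "(qt s \<otimes>\<^bsub>Q\<^esub> r) u = (if s \<in># u then r (u - {#s#}) else \<zero>\<^bsub>LA R\<^esub>)"
      using cring.variable_mult_apply[OF L.M_cring, of r s u] rQ by (simp add: Q_sel QM_def qt_def)
    then show "q u = (e \<oplus>\<^bsub>Q\<^esub> qt s \<otimes>\<^bsub>Q\<^esub> r) u"
      using Q_apply_closed[OF qQ, of u] by (simp add: Q_add_apply e_def r_def)
  qed
  moreover have "r = \<zero>\<^bsub>Q\<^esub>" if "d < 2"
  proof (rule ext)
    fix u
    show "r u = \<zero>\<^bsub>Q\<^esub> u" using E_supp[OF q, of "add_mset s u"] that unfolding Q_zero_apply r_def by fastforce
  qed
  moreover have "r \<in> E (d - 2) (Suc s)" if "2 \<le> d"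
  proof -
    have "set_mset u \<subseteq> {..<Suc s} \<and> 2 * size u \<le> d - 2 \<and> r u \<in> L_deg R (d - 2 - 2 * size u)"
      if "r u \<noteq> \<zero>\<^bsub>LA R\<^esub>" for u
      using E_supp[OF q, of "add_mset s u"] E_coeff[OF q, of "add_mset s u"] that
      by (simp add: r_def diff_diff_add) arith
    with rQ show ?thesis by (simp add: E_def)
  qed
  ultimately show thesis using rQ that by blast
qed

lemma E_zero_vars:
  assumes "q \<in> E d 0" obtains l where "l \<in> L_deg R d" "q = qc l"
proof
  show "q {#} \<in> L_deg R d" using E_coeff[OF assms, of "{#}"] by simp
  then show "q = qc (q {#})"
    using E_supp[OF assms] by (auto simp: fun_eq_iff qc_apply L_deg_closed)
qed

section \<open>Cohomology in low degrees\<close>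

definition "mu = sym_lift R (regular_module R) phi"

lemma mu_map: "mu \<in> algebra_maps R (LA R) (regular_module R)"
  unfolding mu_def by (rule LA_lift_map[OF regular_module_algebra[OF is_cring] phi_linear])

lemma mu_simps:
  "l \<in> carrier (LA R) \<Longrightarrow> mu l \<in> carrier R"
  "l \<in> carrier (LA R) \<Longrightarrow> m \<in> carrier (LA R) \<Longrightarrow> mu (l \<oplus>\<^bsub>LA R\<^esub> m) = mu l \<oplus> mu m"
  "l \<in> carrier (LA R) \<Longrightarrow> m \<in> carrier (LA R) \<Longrightarrow> mu (l \<otimes>\<^bsub>LA R\<^esub> m) = mu l \<otimes> mu m"
  "a \<in> carrier R \<Longrightarrow> l \<in> carrier (LA R) \<Longrightarrow> mu (a \<odot>\<^bsub>LA R\<^esub> l) = a \<otimes> mu l"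
  "mu \<one>\<^bsub>LA R\<^esub> = \<one>"
  "mu \<zero>\<^bsub>LA R\<^esub> = \<zero>"
  "x \<in> carrier (Dr R) \<Longrightarrow> mu (iota x) = phi x"
  using algebra_mapsD[OF mu_map] linear_map_zero[OF L.module regular_module algebra_mapsD(1)[OF mu_map]]
    LA_lift_incl[OF regular_module_algebra[OF is_cring] phi_linear]
  by (simp_all add: mu_def)

lemma LA_lift_id: "X \<in> carrier (LA R) \<Longrightarrow> sym_lift R (LA R) iota X = X"
proof (rule LA_maps_eq[OF LA_algebra LA_lift_map[OF LA_algebra iota_linear]])
  show "(\<lambda>X. X) \<in> algebra_maps R (LA R) (LA R)" by (intro algebra_mapsI linear_mapsI) simp_all
qed (simp_all add: LA_lift_incl[OF LA_algebra iota_linear])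

text \<open>The identity of \<open>LA\<close> is the lift of \<open>iota\<close>, so
  \<open>sym_power_lift_mem\<close> applied to it places each degree in a prescribed submodule. With
  \<open>U\<close> free, the last clause is an induction principle: a linear statement about degree
  4 need only be checked on products of two generators.\<close>

lemma L_deg_cases:
  assumes U: "submodule U R (LA R)"
    and prod: "\<And>x y. x \<in> carrier (Dr R) \<Longrightarrow> y \<in> carrier (Dr R) \<Longrightarrow> iota x \<otimes>\<^bsub>LA R\<^esub> iota y \<in> U"
  shows "l \<in> L_deg R 0 \<Longrightarrow> \<exists>a\<in>carrier R. l = a \<odot>\<^bsub>LA R\<^esub> \<one>\<^bsub>LA R\<^esub>"
    and "l \<in> L_deg R 2 \<Longrightarrow> \<exists>x\<in>carrier (Dr R). l = iota x"
    and "l \<in> L_deg R 4 \<Longrightarrow> l \<in> U"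
proof -
  \<comment> \<open>Above degree 2 nothing is claimed, so multiplicativity of the family is a
    question only in total degree at most 2.\<close>
  define F where "F k = (if k = 0 then (\<lambda>a. a \<odot>\<^bsub>LA R\<^esub> \<one>\<^bsub>LA R\<^esub>) ` carrier R
    else if k = 1 then iota ` carrier (Dr R) else if k = 2 then U else carrier (LA R))" for k :: nat
  note u = L.submoduleE[OF U]
  note il = linear_mapsD[OF iota_linear]
  have F0: "submodule ((\<lambda>a. a \<odot>\<^bsub>LA R\<^esub> \<one>\<^bsub>LA R\<^esub>) ` carrier R) R (LA R)"
  proof -
    have "(\<lambda>a. a \<odot>\<^bsub>LA R\<^esub> \<one>\<^bsub>LA R\<^esub>) \<in> linear_maps R (regular_module R) (LA R)"
      by (rule linear_mapsI) (simp_all add: L.smult_l_distr L.smult_assoc1)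
    from linear_image_submodule[OF regular_module L.module this] show ?thesis by simp
  qed
  have F1: "submodule (iota ` carrier (Dr R)) R (LA R)"
    by (rule linear_image_submodule[OF Dr_module L.module iota_linear])
  have F: "submodule (F k) R (LA R)" for k
    unfolding F_def using F0 F1 U L.carrier_is_submodule by simp
  have Fc: "l \<in> F k \<Longrightarrow> l \<in> carrier (LA R)" for l k
    using L.submoduleE(1)[OF F, of k] by blast
  have scal: "x \<otimes>\<^bsub>LA R\<^esub> y \<in> F m \<and> y \<otimes>\<^bsub>LA R\<^esub> x \<in> F m" if x: "x \<in> F 0" and y: "y \<in> F m" for x y m
  proof -
    obtain a where a: "a \<in> carrier R" "x = a \<odot>\<^bsub>LA R\<^esub> \<one>\<^bsub>LA R\<^esub>"
      using x unfolding F_def by (simp add: image_iff) blast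
    have "x \<otimes>\<^bsub>LA R\<^esub> y = a \<odot>\<^bsub>LA R\<^esub> y" using a Fc[OF y] by (simp add: L.unit_hom_smult)
    then show ?thesis using L.submoduleE(4)[OF F a(1) y] L.m_comm Fc[OF x] Fc[OF y] by simp
  qed
  have mult: "x \<otimes>\<^bsub>LA R\<^esub> y \<in> F (k + m)" if x: "x \<in> F k" and y: "y \<in> F m" for x y k m
  proof -
    consider "k = 0" | "m = 0" | "k = 1" "m = 1" | "k \<ge> 1" "m \<ge> 1" "k + m \<ge> 3" by linarith
    then show ?thesis
    proof cases
      case 1 then show ?thesis using scal x y by simp
    next
      case 2 then show ?thesis using scal x y by simp
    next
      case 3
      then obtain u v where "u \<in> carrier (Dr R)" "x = iota u" "v \<in> carrier (Dr R)" "y = iota v"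
        using x y unfolding F_def by (simp add: image_iff) blast
      then show ?thesis using 3 prod by (simp add: F_def)
    next
      case 4 then show ?thesis using Fc[OF x] Fc[OF y] by (simp add: F_def)
    qed
  qed
  have one: "\<one>\<^bsub>LA R\<^esub> \<in> F 0" unfolding F_def by (simp add: image_iff) (rule bexI[of _ \<one>], simp_all)
  have incl: "iota x \<in> F (Suc 0)" if "x \<in> carrier (Dr R)" for x using that by (simp add: F_def)
  have main: "l \<in> F k" if "l \<in> L_deg R (2 * k)" for l k
  proof -
    have l: "l \<in> sym_power R (Dr R) k" using that by (simp add: L_deg_def)
    have "sym_lift R (LA R) iota l \<in> F k"
      by (rule sym_power_lift_mem[OF Dr_module LA_algebra iota_linear, where F = F]) (fact F one incl mult l)+
    then show ?thesis using LA_lift_id[OF L_deg_closed[OF that]] by simp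
  qed
  show "l \<in> L_deg R 0 \<Longrightarrow> \<exists>a\<in>carrier R. l = a \<odot>\<^bsub>LA R\<^esub> \<one>\<^bsub>LA R\<^esub>" using main[of l 0] by (simp add: F_def image_iff)
  show "l \<in> L_deg R 2 \<Longrightarrow> \<exists>x\<in>carrier (Dr R). l = iota x" using main[of l 1] by (simp add: F_def image_iff)
  show "l \<in> L_deg R 4 \<Longrightarrow> l \<in> U" using main[of l 2] by (simp add: F_def)
qed

lemmas L_deg_0 = L_deg_cases(1)[OF L.carrier_is_submodule L.m_closed[OF iota_closed iota_closed]]
lemmas L_deg_2 = L_deg_cases(2)[OF L.carrier_is_submodule L.m_closed[OF iota_closed iota_closed]]

text \<open>In coordinates \<open>eta_R z - z = mu z (\<gamma> t + t\<^sup>2)\<close> for \<open>z\<close> of degree 4.\<close>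

definition "boundary_class = qt 0 \<otimes>\<^bsub>Q\<^esub> (qc (iota gam) \<oplus>\<^bsub>Q\<^esub> qt 0)"

lemma boundary_class_closed [simp]: "boundary_class \<in> carrier Q"
  by (simp add: boundary_class_def)

lemma qc_smult: "a \<in> carrier R \<Longrightarrow> l \<in> carrier (LA R) \<Longrightarrow> qc (a \<odot>\<^bsub>LA R\<^esub> l) = a \<odot>\<^bsub>Q\<^esub> qc l"
  by (rule algebra_mapsD(4)[OF qc_map])

text \<open>In (x + phi(x)t)(y + phi(y)t) the cross terms are equal by \<open>phi_swap\<close>, and
  twice one of them is a multiple of \<open>gam\<close>, because phi(x) \<open>gam\<close> = 2x.
  Both the linear and the quadratic term in t then carry the coefficient phi(x)phi(y).\<close>

lemma tau_product:
  assumes x: "x \<in> carrier (Dr R)" and y: "y \<in> carrier (Dr R)"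
  shows "tau (qt 0) (iota x \<otimes>\<^bsub>LA R\<^esub> iota y) = qc (iota x \<otimes>\<^bsub>LA R\<^esub> iota y)
    \<oplus>\<^bsub>Q\<^esub> mu (iota x \<otimes>\<^bsub>LA R\<^esub> iota y) \<odot>\<^bsub>Q\<^esub> boundary_class"
proof -
  let ?X = "qc (iota x)" and ?Y = "qc (iota y)" and ?T = "qt 0" and ?G = "qc (iota gam)"
  let ?a = "phi x" and ?b = "phi y"
  note il = linear_mapsD[OF iota_linear]
  have c: "?X \<in> carrier Q" "?Y \<in> carrier Q" "?T \<in> carrier Q" "?G \<in> carrier Q" "?a \<in> carrier R" "?b \<in> carrier R"
    using x y by simp_all
  have s1: "?a \<odot>\<^bsub>Q\<^esub> ?Y = ?b \<odot>\<^bsub>Q\<^esub> ?X"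
    using phi_swap[OF x y] x y by (simp add: qc_smult[symmetric] il(3)[symmetric])
  have s2: "?a \<odot>\<^bsub>Q\<^esub> ?G = ?X \<oplus>\<^bsub>Q\<^esub> ?X"
  proof -
    have "?a \<odot>\<^bsub>Dr R\<^esub> gam = x \<oplus>\<^bsub>Dr R\<^esub> x" using phi_swap[OF x, of gam] x by (simp add: two_smult)
    then show ?thesis
      using x by (simp add: qc_smult[symmetric] il(3)[symmetric]) (simp add: il algebra_mapsD[OF qc_map])
  qed
  have "tau ?T (iota x \<otimes>\<^bsub>LA R\<^esub> iota y) = (?X \<oplus>\<^bsub>Q\<^esub> ?a \<odot>\<^bsub>Q\<^esub> ?T) \<otimes>\<^bsub>Q\<^esub> (?Y \<oplus>\<^bsub>Q\<^esub> ?b \<odot>\<^bsub>Q\<^esub> ?T)"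
    using x y by (simp add: algebra_mapsD(6)[OF tau_map] tau_iota)
  also have "\<dots> = ?X \<otimes>\<^bsub>Q\<^esub> ?Y \<oplus>\<^bsub>Q\<^esub> (?T \<otimes>\<^bsub>Q\<^esub> (?b \<odot>\<^bsub>Q\<^esub> ?X) \<oplus>\<^bsub>Q\<^esub> ?T \<otimes>\<^bsub>Q\<^esub> (?a \<odot>\<^bsub>Q\<^esub> ?Y)
      \<oplus>\<^bsub>Q\<^esub> (?a \<otimes> ?b) \<odot>\<^bsub>Q\<^esub> (?T \<otimes>\<^bsub>Q\<^esub> ?T))"
    using c by (simp add: Q.l_distr Q.r_distr Q.smult_assoc2 Q.smult_mult_right Q.smult_r_distr
        Q.smult_assoc1[symmetric] m_comm[of ?b ?a] Q.a_ac Q.m_comm[of ?X ?T])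
  also have "?T \<otimes>\<^bsub>Q\<^esub> (?b \<odot>\<^bsub>Q\<^esub> ?X) \<oplus>\<^bsub>Q\<^esub> ?T \<otimes>\<^bsub>Q\<^esub> (?a \<odot>\<^bsub>Q\<^esub> ?Y) = (?a \<otimes> ?b) \<odot>\<^bsub>Q\<^esub> (?T \<otimes>\<^bsub>Q\<^esub> ?G)"
  proof -
    have "(?a \<otimes> ?b) \<odot>\<^bsub>Q\<^esub> (?T \<otimes>\<^bsub>Q\<^esub> ?G) = ?T \<otimes>\<^bsub>Q\<^esub> (?b \<odot>\<^bsub>Q\<^esub> (?a \<odot>\<^bsub>Q\<^esub> ?G))"
      using c by (simp add: Q.smult_mult_right Q.smult_assoc1[symmetric] m_comm)
    then show ?thesis using c by (simp only: s1 s2) (simp add: Q.smult_r_distr Q.r_distr)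
  qed
  also have "(?a \<otimes> ?b) \<odot>\<^bsub>Q\<^esub> (?T \<otimes>\<^bsub>Q\<^esub> ?G) \<oplus>\<^bsub>Q\<^esub> (?a \<otimes> ?b) \<odot>\<^bsub>Q\<^esub> (?T \<otimes>\<^bsub>Q\<^esub> ?T) = (?a \<otimes> ?b) \<odot>\<^bsub>Q\<^esub> boundary_class"
    using c by (simp add: boundary_class_def Q.smult_r_distr Q.r_distr)
  finally show ?thesis using x y by (simp add: mu_simps algebra_mapsD(6)[OF qc_map])
qed

text \<open>The difference of the two sides is linear in \<open>z\<close> and vanishes on products
  of two generators, which is enough in degree 4.\<close>

lemma tau_deg4:
  assumes z: "z \<in> L_deg R 4"
  shows "tau (qt 0) z = qc z \<oplus>\<^bsub>Q\<^esub> mu z \<odot>\<^bsub>Q\<^esub> boundary_class"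
proof -
  note t = algebra_mapsD[OF tau_map[OF qt_closed[of 0]]] and c = algebra_mapsD[OF qc_map]
  let ?h = "\<lambda>z. tau (qt 0) z \<ominus>\<^bsub>Q\<^esub> (qc z \<oplus>\<^bsub>Q\<^esub> mu z \<odot>\<^bsub>Q\<^esub> boundary_class)"
  have sw: "(a \<oplus>\<^bsub>Q\<^esub> b) \<ominus>\<^bsub>Q\<^esub> (c \<oplus>\<^bsub>Q\<^esub> d \<oplus>\<^bsub>Q\<^esub> (e \<oplus>\<^bsub>Q\<^esub> f)) = (a \<ominus>\<^bsub>Q\<^esub> (c \<oplus>\<^bsub>Q\<^esub> e)) \<oplus>\<^bsub>Q\<^esub> (b \<ominus>\<^bsub>Q\<^esub> (d \<oplus>\<^bsub>Q\<^esub> f))"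
    if "a \<in> carrier Q" "b \<in> carrier Q" "c \<in> carrier Q" "d \<in> carrier Q" "e \<in> carrier Q" "f \<in> carrier Q" for a b c d e f
    using that by (simp add: a_minus_def Q.minus_add Q.a_ac)
  have sm: "a \<odot>\<^bsub>Q\<^esub> (x \<ominus>\<^bsub>Q\<^esub> y) = a \<odot>\<^bsub>Q\<^esub> x \<ominus>\<^bsub>Q\<^esub> a \<odot>\<^bsub>Q\<^esub> y" if "a \<in> carrier R" "x \<in> carrier Q" "y \<in> carrier Q" for a x y
    using that by (simp add: a_minus_def Q.smult_r_distr Q.smult_r_minus)
  have h: "?h \<in> linear_maps R (LA R) Q"
    by (rule linear_mapsI)
      (simp_all add: t c mu_simps Q.minus_closed Q.smult_l_distr sw sm Q.smult_r_distr Q.smult_assoc1)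
  have "z \<in> {z \<in> carrier (LA R). ?h z = \<zero>\<^bsub>Q\<^esub>}"
    by (rule L_deg_cases(3)[OF L.kernel_submodule[OF Q.module h] _ z])
      (simp add: tau_product Q.minus_eq_zero_iff mu_simps)
  then have "?h z = \<zero>\<^bsub>Q\<^esub>" by simp
  then show ?thesis using L_deg_closed[OF z] by (simp add: Q.minus_eq_zero_iff mu_simps)
qed

section \<open>Scalars and low degrees in coordinates\<close>

abbreviation "un a \<equiv> a \<odot>\<^bsub>Q\<^esub> \<one>\<^bsub>Q\<^esub>"

text \<open>\<open>mu\<close> is an algebra map back to the ground ring and hence a retraction of
  the unit map, so scalars embed in \<open>LA\<close>.\<close>

lemma un_inj:
  assumes "a \<in> carrier R" "un a = \<zero>\<^bsub>Q\<^esub>" shows "a = \<zero>"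
proof -
  have "qc (a \<odot>\<^bsub>LA R\<^esub> \<one>\<^bsub>LA R\<^esub>) = \<zero>\<^bsub>Q\<^esub>"
    using assms by (simp add: qc_smult algebra_mapsD(5)[OF qc_map])
  then have "qc (a \<odot>\<^bsub>LA R\<^esub> \<one>\<^bsub>LA R\<^esub>) {#} = \<zero>\<^bsub>LA R\<^esub>" by (simp only: Q_zero_apply)
  then have "a \<odot>\<^bsub>LA R\<^esub> \<one>\<^bsub>LA R\<^esub> = \<zero>\<^bsub>LA R\<^esub>" using assms(1) by (simp add: qc_apply)
  then have "mu (a \<odot>\<^bsub>LA R\<^esub> \<one>\<^bsub>LA R\<^esub>) = \<zero>" by (simp add: mu_simps)
  then show ?thesis using assms(1) by (simp add: mu_simps)
qed

lemma qt_un: "a \<in> carrier R \<Longrightarrow> qt i \<otimes>\<^bsub>Q\<^esub> un a = a \<odot>\<^bsub>Q\<^esub> qt i"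
  by (simp add: Q.smult_mult_right)

lemma smult_qt_inj: "a \<in> carrier R \<Longrightarrow> a \<odot>\<^bsub>Q\<^esub> qt i = \<zero>\<^bsub>Q\<^esub> \<Longrightarrow> a = \<zero>"
  using var_mult_inj[of "un a" i] by (simp add: qt_un un_inj)

lemma smult_eqD:
  assumes inj: "\<And>a. a \<in> carrier R \<Longrightarrow> a \<odot>\<^bsub>Q\<^esub> v = \<zero>\<^bsub>Q\<^esub> \<Longrightarrow> a = \<zero>" and v: "v \<in> carrier Q"
    and ab: "a \<in> carrier R" "b \<in> carrier R" "a \<odot>\<^bsub>Q\<^esub> v = b \<odot>\<^bsub>Q\<^esub> v"
  shows "a = b"
proof -
  have "(a \<ominus> b) \<odot>\<^bsub>Q\<^esub> v = \<zero>\<^bsub>Q\<^esub>"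
    using ab v by (simp add: a_minus_def Q.smult_l_distr Q.smult_l_minus Q.r_neg)
  then have "a \<ominus> b = \<zero>" using inj[of "a \<ominus> b"] ab by (simp add: minus_closed)
  then show ?thesis using ab minus_eq_zero_iff by blast
qed

text \<open>Cancel \<open>qt 0\<close>, then set it to zero: this separates the multiple of
  \<open>gam\<close> from the multiple of \<open>qt 0\<close>, and the latter detects
  \<open>a\<close>. A degree 4 constant is therefore a cocycle only if \<open>mu\<close> kills
  it.\<close>

lemma smult_boundary_inj:
  assumes a: "a \<in> carrier R" and z: "a \<odot>\<^bsub>Q\<^esub> boundary_class = \<zero>\<^bsub>Q\<^esub>" shows "a = \<zero>"
proof -
  let ?G = "qc (iota gam)"
  have "qt 0 \<otimes>\<^bsub>Q\<^esub> (a \<odot>\<^bsub>Q\<^esub> ?G \<oplus>\<^bsub>Q\<^esub> a \<odot>\<^bsub>Q\<^esub> qt 0) = \<zero>\<^bsub>Q\<^esub>"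
    using a z by (simp add: boundary_class_def Q.smult_mult_right Q.smult_r_distr[symmetric])
  then have 1: "a \<odot>\<^bsub>Q\<^esub> ?G \<oplus>\<^bsub>Q\<^esub> a \<odot>\<^bsub>Q\<^esub> qt 0 = \<zero>\<^bsub>Q\<^esub>" by (rule var_mult_inj[rotated]) (simp add: a)
  have "zv 0 (a \<odot>\<^bsub>Q\<^esub> ?G \<oplus>\<^bsub>Q\<^esub> a \<odot>\<^bsub>Q\<^esub> qt 0) = \<zero>\<^bsub>Q\<^esub>"
    unfolding 1 by (rule linear_map_zero[OF Q.module Q.module zv_simps(1)])
  then have "a \<odot>\<^bsub>Q\<^esub> ?G = \<zero>\<^bsub>Q\<^esub>" using a by (simp add: zv_simps zv_qc zv_qt)
  with 1 have "a \<odot>\<^bsub>Q\<^esub> qt 0 = \<zero>\<^bsub>Q\<^esub>" using a by simp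
  then show ?thesis using smult_qt_inj a by blast
qed

lemma E_smult: "a \<in> carrier R \<Longrightarrow> q \<in> E d s \<Longrightarrow> a \<odot>\<^bsub>Q\<^esub> q \<in> E d s"
  by (rule E_rules(2))

lemma E_un: "a \<in> carrier R \<Longrightarrow> un a \<in> E 0 s"
  by (rule E_smult[OF _ E_one])

lemma E0_cases:
  assumes "q \<in> E 0 s" obtains a where "a \<in> carrier R" "q = un a"
proof -
  have "\<exists>a\<in>carrier R. q = un a" using assms
  proof (induction s)
    case 0
    then obtain l where l: "l \<in> L_deg R 0" "q = qc l" by (rule E_zero_vars)
    obtain a where "a \<in> carrier R" "l = a \<odot>\<^bsub>LA R\<^esub> \<one>\<^bsub>LA R\<^esub>" using L_deg_0[OF _ _ l(1)] by auto
    then show ?case using l(2) by (auto simp: qc_smult algebra_mapsD(5)[OF qc_map] intro!: bexI[of _ a])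
  next
    case (Suc s)
    obtain e r where "e \<in> E 0 s" "q = e \<oplus>\<^bsub>Q\<^esub> qt s \<otimes>\<^bsub>Q\<^esub> r" "r = \<zero>\<^bsub>Q\<^esub>"
      by (rule E_decompose[OF Suc.prems]) simp
    then have "q = e" using E_closed by simp
    with Suc.IH \<open>e \<in> E 0 s\<close> show ?case by simp
  qed
  then show thesis using that by blast
qed

lemma E2_cases:
  assumes "q \<in> E 2 (Suc s)" obtains e a where "e \<in> E 2 s" "a \<in> carrier R" "q = e \<oplus>\<^bsub>Q\<^esub> a \<odot>\<^bsub>Q\<^esub> qt s"
proof -
  obtain e r where er: "e \<in> E 2 s" "q = e \<oplus>\<^bsub>Q\<^esub> qt s \<otimes>\<^bsub>Q\<^esub> r" "r \<in> E 0 (Suc s)"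
    by (rule E_decompose[OF assms]) simp
  obtain a where a: "a \<in> carrier R" "r = un a" using er(3) by (rule E0_cases)
  show thesis using that[OF er(1) a(1)] er(2) a by (simp add: qt_un)
qed

lemma E2_zero_cases:
  assumes "q \<in> E 2 0" obtains x where "x \<in> carrier (Dr R)" "q = qc (iota x)"
proof -
  obtain l where l: "l \<in> L_deg R 2" "q = qc l" using assms by (rule E_zero_vars)
  then show thesis using L_deg_2[OF _ _ l(1)] that by auto
qed

lemma dQ0_qc:
  assumes "l \<in> carrier (LA R)" shows "dQ 0 (qc l) = tau (qt 0) l \<ominus>\<^bsub>Q\<^esub> qc l"
  using assms dQ_pd[of "qc l" 0]
  by (simp add: pd_def sgn_Q_def cf_qc_Suc cf_qc skip_def tau_zero a_minus_def Q.a_comm)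

lemma dQ0_iota: "x \<in> carrier (Dr R) \<Longrightarrow> dQ 0 (qc (iota x)) = phi x \<odot>\<^bsub>Q\<^esub> qt 0"
proof -
  assume x: "x \<in> carrier (Dr R)"
  have "(a \<oplus>\<^bsub>Q\<^esub> b) \<ominus>\<^bsub>Q\<^esub> a = b" if "a \<in> carrier Q" "b \<in> carrier Q" for a b
    using that by (simp add: a_minus_def Q.a_comm[of a] Q.a_assoc Q.r_neg)
  then show ?thesis using x by (simp add: dQ0_qc tau_iota)
qed

lemma dQ0_deg4: "z \<in> L_deg R 4 \<Longrightarrow> dQ 0 (qc z) = mu z \<odot>\<^bsub>Q\<^esub> boundary_class"
proof -
  assume z: "z \<in> L_deg R 4"
  have "(a \<oplus>\<^bsub>Q\<^esub> b) \<ominus>\<^bsub>Q\<^esub> a = b" if "a \<in> carrier Q" "b \<in> carrier Q" for a b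
    using that by (simp add: a_minus_def Q.a_comm[of a] Q.a_assoc Q.r_neg)
  then show ?thesis using L_deg_closed[OF z] by (simp add: dQ0_qc tau_deg4[OF z] mu_simps)
qed

lemma pd_one: "pd s \<one>\<^bsub>Q\<^esub> = (if even s then \<one>\<^bsub>Q\<^esub> else \<zero>\<^bsub>Q\<^esub>)"
proof (induction s)
  case (Suc s)
  have "pd (Suc s) \<one>\<^bsub>Q\<^esub> = sgn_Q (Suc s) \<one>\<^bsub>Q\<^esub> \<oplus>\<^bsub>Q\<^esub> pd s \<one>\<^bsub>Q\<^esub>"
    using Q.finsum_Suc[of "\<lambda>i. sgn_Q i (cf i \<one>\<^bsub>Q\<^esub>)" s] by (simp add: pd_def cf_simps)
  then show ?case unfolding Suc by (simp add: sgn_Q_def Q.l_neg)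
qed (simp add: pd_def cf_simps sgn_Q_def)

lemma dQ_one: "dQ s \<one>\<^bsub>Q\<^esub> = (if even s then \<zero>\<^bsub>Q\<^esub> else \<one>\<^bsub>Q\<^esub>)"
  using dQ_pd[of "\<one>\<^bsub>Q\<^esub>" s] by (simp add: cf_simps pd_one sgn_Q_def Q.l_neg)

lemma dQ_un: "a \<in> carrier R \<Longrightarrow> dQ s (un a) = (if even s then \<zero>\<^bsub>Q\<^esub> else un a)"
  by (simp add: dQ_simps dQ_one)

text \<open>In internal degree 0 every term of the complex is the ground ring, and the differentials
  are zero at even and the identity at odd places. Hence everything after place 0 is exact.\<close>

lemma exact_deg0:
  assumes q: "q \<in> E 0 (Suc s)" and d: "dQ (Suc s) q = \<zero>\<^bsub>Q\<^esub>"
  shows "\<exists>y\<in>E 0 s. q = dQ s y"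
proof -
  obtain a where a: "a \<in> carrier R" "q = un a" using q by (rule E0_cases)
  show ?thesis
  proof (cases "even s")
    case True
    then have "q = \<zero>\<^bsub>Q\<^esub>" using d a by (simp add: dQ_un)
    then show ?thesis by (intro bexI[of _ "\<zero>\<^bsub>Q\<^esub>"]) (simp_all add: dQ_zero E_zero)
  next
    case False
    then show ?thesis using a by (intro bexI[of _ "un a"]) (simp_all add: dQ_un E_un)
  qed
qed

text \<open>The part of \<open>q\<close> free of the last variable is \<open>zv s q\<close>, which
  bounds by \<open>zv_cocycle\<close>. The remaining multiple of \<open>qt s\<close> is then again a
  cocycle, since the differential squares to zero.\<close>

lemma normalize_cocycle:
  assumes q: "q \<in> E d (Suc s)" and d: "dQ (Suc s) q = \<zero>\<^bsub>Q\<^esub>" and "2 \<le> d"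
  obtains y r where "y \<in> E d s" "r \<in> E (d - 2) (Suc s)" "q = dQ s y \<oplus>\<^bsub>Q\<^esub> qt s \<otimes>\<^bsub>Q\<^esub> r"
    "dQ (Suc s) (qt s \<otimes>\<^bsub>Q\<^esub> r) = \<zero>\<^bsub>Q\<^esub>"
proof -
  obtain e r where er: "e \<in> E d s" "q = e \<oplus>\<^bsub>Q\<^esub> qt s \<otimes>\<^bsub>Q\<^esub> r" "r \<in> E (d - 2) (Suc s)"
    by (rule E_decompose[OF q]) (use assms(3) in auto)
  note eQ = E_closed[OF er(1)] and rQ = E_closed[OF er(3)]
  have z: "zv s q = e"
    using eQ rQ by (simp add: er(2) zv_simps zv_qt zv_id[OF E_Qpart[OF er(1)]])
  have e: "e = dQ s (sgn_Q (Suc s) e)"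
    using zv_cocycle[OF E_Qpart[OF q] _ d] E_Qpart[OF er(1)] by (simp add: z)
  have "dQ (Suc s) e = \<zero>\<^bsub>Q\<^esub>" by (subst e) (rule dQ_dQ, simp add: eQ)
  then have "dQ (Suc s) (qt s \<otimes>\<^bsub>Q\<^esub> r) = \<zero>\<^bsub>Q\<^esub>"
    using d eQ rQ by (simp add: er(2) dQ_simps)
  then show thesis using that[OF E_sgn[OF er(1)] er(3), of "Suc s"] er(2) e by metis
qed

text \<open>After normalising, only a scalar multiple of \<open>qt s\<close> is left. Its
  differential is \<open>qt (Suc s)\<close> times that of the scalar, and cancelling the variable
  makes the scalar a cocycle one place lower.\<close>

lemma exact_deg2_one:
  assumes q: "q \<in> E 2 (Suc s)" and d: "dQ (Suc s) q = \<zero>\<^bsub>Q\<^esub>"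
  obtains y a where "y \<in> E 2 s" "a \<in> carrier R" "q = dQ s y \<oplus>\<^bsub>Q\<^esub> a \<odot>\<^bsub>Q\<^esub> qt s" "dQ s (un a) = \<zero>\<^bsub>Q\<^esub>"
proof -
  obtain y r where yr: "y \<in> E 2 s" "r \<in> E 0 (Suc s)" "q = dQ s y \<oplus>\<^bsub>Q\<^esub> qt s \<otimes>\<^bsub>Q\<^esub> r"
    "dQ (Suc s) (qt s \<otimes>\<^bsub>Q\<^esub> r) = \<zero>\<^bsub>Q\<^esub>" by (rule normalize_cocycle[OF q d]) simp_all
  obtain a where a: "a \<in> carrier R" "r = un a" using yr(2) by (rule E0_cases)
  have "qt (Suc s) \<otimes>\<^bsub>Q\<^esub> dQ s (un a) = \<zero>\<^bsub>Q\<^esub>"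
    using yr(4) dQ_var_mult[OF E_Qpart[OF E_un[OF a(1)]]] a(2) by simp
  then have "dQ s (un a) = \<zero>\<^bsub>Q\<^esub>" by (rule var_mult_inj[rotated]) (simp add: dQ_simps a)
  then show thesis using that[OF yr(1) a(1)] yr(3) a by (simp add: qt_un)
qed

lemma exact_shift:
  assumes "r \<in> E d s" shows "qt (Suc s) \<otimes>\<^bsub>Q\<^esub> dQ s r = dQ (Suc s) (qt s \<otimes>\<^bsub>Q\<^esub> r)" "qt s \<otimes>\<^bsub>Q\<^esub> r \<in> E (2 + d) (Suc s)"
  using dQ_var_mult[OF E_Qpart[OF assms]] E_mult[OF E_qt[of s "Suc s"] E_mono[OF _ assms, of "Suc s"]] by simp_all

text \<open>With at least two variables the remaining scalar sits in a positive place of the degree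
  0 complex and bounds there; multiplying the bounding element by a variable bounds the original
  class.\<close>

lemma exact_deg2:
  assumes q: "q \<in> E 2 (Suc (Suc s))" and d: "dQ (Suc (Suc s)) q = \<zero>\<^bsub>Q\<^esub>"
  shows "\<exists>y\<in>E 2 (Suc s). q = dQ (Suc s) y"
proof -
  obtain y a where ya: "y \<in> E 2 (Suc s)" "a \<in> carrier R" "q = dQ (Suc s) y \<oplus>\<^bsub>Q\<^esub> a \<odot>\<^bsub>Q\<^esub> qt (Suc s)"
    "dQ (Suc s) (un a) = \<zero>\<^bsub>Q\<^esub>" using q d by (rule exact_deg2_one)
  obtain z where z: "z \<in> E 0 s" "un a = dQ s z" using exact_deg0[OF E_un[OF ya(2)] ya(4)] by blast
  have "a \<odot>\<^bsub>Q\<^esub> qt (Suc s) = dQ (Suc s) (qt s \<otimes>\<^bsub>Q\<^esub> z)"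
    using exact_shift(1)[OF z(1)] z(2) qt_un[OF ya(2)] by metis
  moreover have zE: "qt s \<otimes>\<^bsub>Q\<^esub> z \<in> E 2 (Suc s)" using exact_shift(2)[OF z(1)] by simp
  ultimately have "q = dQ (Suc s) (y \<oplus>\<^bsub>Q\<^esub> qt s \<otimes>\<^bsub>Q\<^esub> z)"
    using ya(3) E_closed[OF ya(1)] E_closed[OF zE] by (simp add: dQ_simps)
  then show ?thesis using E_rules(3)[OF ya(1) zE] by blast
qed

text \<open>The differential of a constant \<open>x\<close> of degree 2 is phi(x)
  \<open>qt 0\<close>, so this is the injectivity of \<open>phi\<close>.\<close>

lemma deg2_zero:
  assumes q: "q \<in> E 2 0" and d: "dQ 0 q = \<zero>\<^bsub>Q\<^esub>" shows "q = \<zero>\<^bsub>Q\<^esub>"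
proof -
  obtain x where x: "x \<in> carrier (Dr R)" "q = qc (iota x)" using q by (rule E2_zero_cases)
  then have "phi x = \<zero>" using d smult_qt_inj[of "phi x" 0] by (simp add: dQ0_iota)
  then have "x = \<zero>\<^bsub>Dr R\<^esub>" using phi_injective x by simp
  then show ?thesis
    using x linear_map_zero[OF Dr_module L.module iota_linear]
      linear_map_zero[OF L.module Q.module algebra_mapsD(1)[OF qc_map]] by simp
qed

text \<open>The middle coface contributes the square of \<open>qt t \<oplus> qt (Suc t)\<close>. The
  cofaces up to \<open>t\<close> all give the square of \<open>qt (Suc t)\<close>, and their signs
  add up to one or zero copies according to the parity of \<open>t\<close>; the leftover copy
  cancels exactly in the even case.\<close>

lemma dQ_square:
  "dQ (Suc t) (qt t \<otimes>\<^bsub>Q\<^esub> qt t) = qt (Suc t) \<otimes>\<^bsub>Q\<^esub>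
    (if even t then \<ominus>\<^bsub>Q\<^esub> (qt t \<oplus>\<^bsub>Q\<^esub> qt t) else (qt t \<oplus>\<^bsub>Q\<^esub> qt t) \<oplus>\<^bsub>Q\<^esub> qt (Suc t))"
proof -
  let ?T = "qt t" and ?U = "qt (Suc t)"
  let ?w = "?T \<otimes>\<^bsub>Q\<^esub> ?U"
  have "pd t (?T \<otimes>\<^bsub>Q\<^esub> ?T) = (\<Oplus>\<^bsub>Q\<^esub>i\<in>{..t}. (?U \<otimes>\<^bsub>Q\<^esub> ?U) \<otimes>\<^bsub>Q\<^esub> sgn_Q i (cf i \<one>\<^bsub>Q\<^esub>))"
    unfolding pd_def
  proof (rule Q.finsum_cong')
    fix i assume i: "i \<in> {..t}"
    have "sgn_Q i (?U \<otimes>\<^bsub>Q\<^esub> ?U) = (?U \<otimes>\<^bsub>Q\<^esub> ?U) \<otimes>\<^bsub>Q\<^esub> sgn_Q i \<one>\<^bsub>Q\<^esub>"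
      using sgn_Q_mult[of "?U \<otimes>\<^bsub>Q\<^esub> ?U" "\<one>\<^bsub>Q\<^esub>" i] by simp
    then show "sgn_Q i (cf i (?T \<otimes>\<^bsub>Q\<^esub> ?T)) = (?U \<otimes>\<^bsub>Q\<^esub> ?U) \<otimes>\<^bsub>Q\<^esub> sgn_Q i (cf i \<one>\<^bsub>Q\<^esub>)"
      using i by (simp add: cf_simps cf_qt)
  qed auto
  also have "\<dots> = (?U \<otimes>\<^bsub>Q\<^esub> ?U) \<otimes>\<^bsub>Q\<^esub> pd t \<one>\<^bsub>Q\<^esub>"
    unfolding pd_def by (rule Q.finsum_rdistr[symmetric]) auto
  finally have p: "pd t (?T \<otimes>\<^bsub>Q\<^esub> ?T) = (?U \<otimes>\<^bsub>Q\<^esub> ?U) \<otimes>\<^bsub>Q\<^esub> (if even t then \<one>\<^bsub>Q\<^esub> else \<zero>\<^bsub>Q\<^esub>)"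
    by (simp only: pd_one)
  have c2: "cf (Suc (Suc t)) (?T \<otimes>\<^bsub>Q\<^esub> ?T) = ?T \<otimes>\<^bsub>Q\<^esub> ?T" by (simp add: cf_simps cf_qt)
  have c1: "cf (Suc t) (?T \<otimes>\<^bsub>Q\<^esub> ?T) = ?T \<otimes>\<^bsub>Q\<^esub> ?T \<oplus>\<^bsub>Q\<^esub> ((?w \<oplus>\<^bsub>Q\<^esub> ?w) \<oplus>\<^bsub>Q\<^esub> ?U \<otimes>\<^bsub>Q\<^esub> ?U)"
    by (simp add: cf_simps cf_qt Q.l_distr Q.r_distr Q.a_assoc Q.m_comm[of ?U ?T])
  have s: "dQ (Suc t) (?T \<otimes>\<^bsub>Q\<^esub> ?T) = sgn_Q (Suc (Suc t)) (?T \<otimes>\<^bsub>Q\<^esub> ?T) \<oplus>\<^bsub>Q\<^esub>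
      (sgn_Q (Suc t) (?T \<otimes>\<^bsub>Q\<^esub> ?T \<oplus>\<^bsub>Q\<^esub> ((?w \<oplus>\<^bsub>Q\<^esub> ?w) \<oplus>\<^bsub>Q\<^esub> ?U \<otimes>\<^bsub>Q\<^esub> ?U)) \<oplus>\<^bsub>Q\<^esub> pd t (?T \<otimes>\<^bsub>Q\<^esub> ?T))"
    by (subst dQ_pd2) (simp_all add: c1 c2)
  have e1: "a \<oplus>\<^bsub>Q\<^esub> (\<ominus>\<^bsub>Q\<^esub> (a \<oplus>\<^bsub>Q\<^esub> (b \<oplus>\<^bsub>Q\<^esub> c)) \<oplus>\<^bsub>Q\<^esub> c) = \<ominus>\<^bsub>Q\<^esub> b"
    if "a \<in> carrier Q" "b \<in> carrier Q" "c \<in> carrier Q" for a b c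
    using that by (simp add: Q.minus_add Q.a_assoc Q.r_neg2 Q.l_neg)
  show ?thesis
  proof (cases "even t")
    case True
    then have "dQ (Suc t) (?T \<otimes>\<^bsub>Q\<^esub> ?T) = \<ominus>\<^bsub>Q\<^esub> (?w \<oplus>\<^bsub>Q\<^esub> ?w)"
      unfolding s p by (simp add: sgn_Q_def e1)
    also have "?w \<oplus>\<^bsub>Q\<^esub> ?w = ?U \<otimes>\<^bsub>Q\<^esub> (?T \<oplus>\<^bsub>Q\<^esub> ?T)" by (simp add: Q.r_distr Q.m_comm[of ?U ?T])
    finally show ?thesis using True by (simp add: Q.r_minus)
  next
    case False
    then have "dQ (Suc t) (?T \<otimes>\<^bsub>Q\<^esub> ?T) = (?w \<oplus>\<^bsub>Q\<^esub> ?w) \<oplus>\<^bsub>Q\<^esub> ?U \<otimes>\<^bsub>Q\<^esub> ?U"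
      unfolding s p by (simp add: sgn_Q_def Q.r_neg1)
    also have "\<dots> = ?U \<otimes>\<^bsub>Q\<^esub> ((?T \<oplus>\<^bsub>Q\<^esub> ?T) \<oplus>\<^bsub>Q\<^esub> ?U)" by (simp add: Q.r_distr Q.m_comm[of ?U ?T])
    finally show ?thesis using False by simp
  qed
qed

text \<open>After normalising, the quotient by \<open>qt t\<close> has degree 2 and is
  \<open>e\<close> free of the last variable plus a multiple of \<open>qt t\<close>. The
  differentials of both resulting terms are divisible by \<open>qt (Suc t)\<close>, and cancelling
  it gives the condition.\<close>

lemma deg4_cocycle:
  assumes q: "q \<in> E 4 (Suc t)" and d: "dQ (Suc t) q = \<zero>\<^bsub>Q\<^esub>"
  obtains y r a where "y \<in> E 4 t" "r \<in> E 2 t" "a \<in> carrier R"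
    "q = dQ t y \<oplus>\<^bsub>Q\<^esub> qt t \<otimes>\<^bsub>Q\<^esub> (r \<oplus>\<^bsub>Q\<^esub> a \<odot>\<^bsub>Q\<^esub> qt t)"
    "dQ t r \<oplus>\<^bsub>Q\<^esub> a \<odot>\<^bsub>Q\<^esub> (if even t then \<ominus>\<^bsub>Q\<^esub> (qt t \<oplus>\<^bsub>Q\<^esub> qt t) else (qt t \<oplus>\<^bsub>Q\<^esub> qt t) \<oplus>\<^bsub>Q\<^esub> qt (Suc t)) = \<zero>\<^bsub>Q\<^esub>"
proof -
  let ?S = "if even t then \<ominus>\<^bsub>Q\<^esub> (qt t \<oplus>\<^bsub>Q\<^esub> qt t) else (qt t \<oplus>\<^bsub>Q\<^esub> qt t) \<oplus>\<^bsub>Q\<^esub> qt (Suc t)"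
  obtain y r where yr: "y \<in> E 4 t" "r \<in> E (4 - 2) (Suc t)" "q = dQ t y \<oplus>\<^bsub>Q\<^esub> qt t \<otimes>\<^bsub>Q\<^esub> r"
    "dQ (Suc t) (qt t \<otimes>\<^bsub>Q\<^esub> r) = \<zero>\<^bsub>Q\<^esub>" by (rule normalize_cocycle[OF q d]) simp_all
  have "r \<in> E 2 (Suc t)" using yr(2) by simp
  then obtain e a where ea: "e \<in> E 2 t" "a \<in> carrier R" "r = e \<oplus>\<^bsub>Q\<^esub> a \<odot>\<^bsub>Q\<^esub> qt t" by (rule E2_cases)
  note eQ = E_closed[OF ea(1)]
  define S where "S = ?S"
  have S: "S \<in> carrier Q" unfolding S_def by simp
  have sq: "dQ (Suc t) (qt t \<otimes>\<^bsub>Q\<^esub> qt t) = qt (Suc t) \<otimes>\<^bsub>Q\<^esub> S" unfolding S_def by (rule dQ_square)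
  have "qt t \<otimes>\<^bsub>Q\<^esub> r = qt t \<otimes>\<^bsub>Q\<^esub> e \<oplus>\<^bsub>Q\<^esub> a \<odot>\<^bsub>Q\<^esub> (qt t \<otimes>\<^bsub>Q\<^esub> qt t)"
    using eQ ea(2) by (simp add: ea(3) Q.r_distr Q.smult_mult_right)
  then have "dQ (Suc t) (qt t \<otimes>\<^bsub>Q\<^esub> r) = qt (Suc t) \<otimes>\<^bsub>Q\<^esub> dQ t e \<oplus>\<^bsub>Q\<^esub> a \<odot>\<^bsub>Q\<^esub> (qt (Suc t) \<otimes>\<^bsub>Q\<^esub> S)"
    using eQ ea(2) dQ_var_mult[OF E_Qpart[OF ea(1)]] sq by (simp add: dQ_simps)
  also have "\<dots> = qt (Suc t) \<otimes>\<^bsub>Q\<^esub> (dQ t e \<oplus>\<^bsub>Q\<^esub> a \<odot>\<^bsub>Q\<^esub> S)"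
    using eQ ea(2) S by (simp only: Q.r_distr Q.smult_mult_right qt_closed dQ_simps(1) Q.smult_closed)
  finally have 0: "qt (Suc t) \<otimes>\<^bsub>Q\<^esub> (dQ t e \<oplus>\<^bsub>Q\<^esub> a \<odot>\<^bsub>Q\<^esub> S) = \<zero>\<^bsub>Q\<^esub>" unfolding yr(4) by (rule sym)
  have c: "dQ t e \<oplus>\<^bsub>Q\<^esub> a \<odot>\<^bsub>Q\<^esub> S \<in> carrier Q" using eQ ea(2) S by (simp add: dQ_simps)
  have "dQ t e \<oplus>\<^bsub>Q\<^esub> a \<odot>\<^bsub>Q\<^esub> S = \<zero>\<^bsub>Q\<^esub>" by (rule var_mult_inj[OF c 0])
  then have "dQ t e \<oplus>\<^bsub>Q\<^esub> a \<odot>\<^bsub>Q\<^esub> ?S = \<zero>\<^bsub>Q\<^esub>" unfolding S_def .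
  from that[OF yr(1) ea(1,2) yr(3)[unfolded ea(3)] this] show thesis .
qed

text \<open>\<open>dQ t r\<close> involves only variables up to \<open>qt t\<close>. Setting
  \<open>qt (Suc t)\<close> to zero therefore splits off its coefficient, which is
  \<open>a\<close>.\<close>

lemma deg4_odd:
  assumes t: "odd t" and r: "r \<in> E 2 t" and a: "a \<in> carrier R"
    and eq: "dQ t r \<oplus>\<^bsub>Q\<^esub> a \<odot>\<^bsub>Q\<^esub> ((qt t \<oplus>\<^bsub>Q\<^esub> qt t) \<oplus>\<^bsub>Q\<^esub> qt (Suc t)) = \<zero>\<^bsub>Q\<^esub>"
  shows "a = \<zero>" "dQ t r = \<zero>\<^bsub>Q\<^esub>"
proof -
  note dE = E_dQ[OF r]
  note dc = E_closed[OF dE]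
  have "zv (Suc t) (dQ t r \<oplus>\<^bsub>Q\<^esub> a \<odot>\<^bsub>Q\<^esub> ((qt t \<oplus>\<^bsub>Q\<^esub> qt t) \<oplus>\<^bsub>Q\<^esub> qt (Suc t))) = \<zero>\<^bsub>Q\<^esub>"
    unfolding eq by (rule linear_map_zero[OF Q.module Q.module zv_simps(1)])
  then have 1: "dQ t r \<oplus>\<^bsub>Q\<^esub> a \<odot>\<^bsub>Q\<^esub> (qt t \<oplus>\<^bsub>Q\<^esub> qt t) = \<zero>\<^bsub>Q\<^esub>"
    using dc a by (simp add: zv_simps zv_qt zv_id[OF E_Qpart[OF dE]])
  have "(dQ t r \<oplus>\<^bsub>Q\<^esub> a \<odot>\<^bsub>Q\<^esub> (qt t \<oplus>\<^bsub>Q\<^esub> qt t)) \<oplus>\<^bsub>Q\<^esub> a \<odot>\<^bsub>Q\<^esub> qt (Suc t) = \<zero>\<^bsub>Q\<^esub>"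
    using eq dc a by (simp add: Q.smult_r_distr Q.a_assoc)
  then have "a \<odot>\<^bsub>Q\<^esub> qt (Suc t) = \<zero>\<^bsub>Q\<^esub>" unfolding 1 using a by simp
  then show "a = \<zero>" using smult_qt_inj a by blast
  with 1 show "dQ t r = \<zero>\<^bsub>Q\<^esub>" using dc by simp
qed

text \<open>For an odd index the square term drops out and exactness in degree 2 is shifted up. For
  an even index the square of the preceding variable, whose index is odd, has a differential of the
  shape needed to absorb the square term.\<close>

lemma exact_deg4:
  assumes q: "q \<in> E 4 (Suc (Suc (Suc k)))" and d: "dQ (Suc (Suc (Suc k))) q = \<zero>\<^bsub>Q\<^esub>"
  shows "\<exists>y\<in>E 4 (Suc (Suc k)). q = dQ (Suc (Suc k)) y"
proof -
  let ?t = "Suc (Suc k)" and ?m = "Suc k"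
  let ?T = "qt ?t" and ?V = "qt ?m"
  obtain y r a where yr: "y \<in> E 4 ?t" "r \<in> E 2 ?t" "a \<in> carrier R"
    "q = dQ ?t y \<oplus>\<^bsub>Q\<^esub> ?T \<otimes>\<^bsub>Q\<^esub> (r \<oplus>\<^bsub>Q\<^esub> a \<odot>\<^bsub>Q\<^esub> ?T)"
    "dQ ?t r \<oplus>\<^bsub>Q\<^esub> a \<odot>\<^bsub>Q\<^esub> (if even ?t then \<ominus>\<^bsub>Q\<^esub> (?T \<oplus>\<^bsub>Q\<^esub> ?T) else (?T \<oplus>\<^bsub>Q\<^esub> ?T) \<oplus>\<^bsub>Q\<^esub> qt (Suc ?t)) = \<zero>\<^bsub>Q\<^esub>"
    using q d by (rule deg4_cocycle)
  note yQ = E_closed[OF yr(1)] and rQ = E_closed[OF yr(2)]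
  have "\<exists>w\<in>E 4 ?t. ?T \<otimes>\<^bsub>Q\<^esub> (r \<oplus>\<^bsub>Q\<^esub> a \<odot>\<^bsub>Q\<^esub> ?T) = dQ ?t w"
  proof (cases "even ?t")
    case False
    then have o: "odd ?t" by simp
    have "dQ ?t r \<oplus>\<^bsub>Q\<^esub> a \<odot>\<^bsub>Q\<^esub> ((?T \<oplus>\<^bsub>Q\<^esub> ?T) \<oplus>\<^bsub>Q\<^esub> qt (Suc ?t)) = \<zero>\<^bsub>Q\<^esub>"
      using yr(5) unfolding if_not_P[OF False] .
    note az = deg4_odd[OF o yr(2,3) this]
    obtain z where z: "z \<in> E 2 ?m" "r = dQ ?m z" using exact_deg2[OF yr(2) az(2)] by blast
    have "?T \<otimes>\<^bsub>Q\<^esub> (r \<oplus>\<^bsub>Q\<^esub> a \<odot>\<^bsub>Q\<^esub> ?T) = ?T \<otimes>\<^bsub>Q\<^esub> dQ ?m z" using rQ by (simp add: az(1) z(2))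
    then show ?thesis using exact_shift[OF z(1)] by (intro bexI[of _ "?V \<otimes>\<^bsub>Q\<^esub> z"]) simp_all
  next
    case True
    \<comment> \<open>The cocycle condition says that the differential of \<open>r\<close> is 2a
      \<open>?T\<close>. As \<open>?m\<close> is odd, \<open>?V\<close> has differential
      \<open>?T\<close>, so \<open>?v\<close> solves the same equation and
      \<open>r \<ominus> ?v\<close> is a cocycle of degree 2.\<close>
    let ?v = "a \<odot>\<^bsub>Q\<^esub> (?V \<oplus>\<^bsub>Q\<^esub> ?V)"
    have vE: "?v \<in> E 2 ?t" by (intro E_smult E_rules yr(3) E_qt) simp_all
    have dV: "dQ ?t ?V = ?T"
      using dQ_var_mult[OF E_Qpart[OF E_one], of ?m] True by (simp add: dQ_one)
    have eq: "dQ ?t r \<oplus>\<^bsub>Q\<^esub> a \<odot>\<^bsub>Q\<^esub> (\<ominus>\<^bsub>Q\<^esub> (?T \<oplus>\<^bsub>Q\<^esub> ?T)) = \<zero>\<^bsub>Q\<^esub>"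
      using yr(5) unfolding if_P[OF True] .
    have "dQ ?t (r \<ominus>\<^bsub>Q\<^esub> ?v) = dQ ?t r \<ominus>\<^bsub>Q\<^esub> a \<odot>\<^bsub>Q\<^esub> (?T \<oplus>\<^bsub>Q\<^esub> ?T)"
      using rQ yr(3) by (simp add: linear_map_minus[OF Q.module Q.module dQ_linear] dQ_simps dV)
    also have "\<dots> = \<zero>\<^bsub>Q\<^esub>" using eq yr(3) by (simp add: a_minus_def Q.smult_r_minus)
    finally obtain z where z: "z \<in> E 2 ?m" "r \<ominus>\<^bsub>Q\<^esub> ?v = dQ ?m z"
      using exact_deg2[OF E_minus[OF yr(2) vE]] by blast
    have vQ: "?v \<in> carrier Q" using yr(3) by simp
    have "r = (r \<ominus>\<^bsub>Q\<^esub> ?v) \<oplus>\<^bsub>Q\<^esub> ?v" using rQ vQ by (simp add: a_minus_def Q.a_assoc Q.l_neg)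
    then have r: "r = dQ ?m z \<oplus>\<^bsub>Q\<^esub> ?v" unfolding z(2) .
    \<comment> \<open>For the odd index \<open>?m\<close> the differential of the square of
      \<open>?V\<close> is \<open>?T\<close> times 2 \<open>?V\<close> + \<open>?T\<close>. This
      accounts both for \<open>?v\<close> in \<open>r\<close> and for the term a
      \<open>?T\<close>.\<close>
    have sq: "dQ ?t (a \<odot>\<^bsub>Q\<^esub> (?V \<otimes>\<^bsub>Q\<^esub> ?V)) = a \<odot>\<^bsub>Q\<^esub> (?T \<otimes>\<^bsub>Q\<^esub> ((?V \<oplus>\<^bsub>Q\<^esub> ?V) \<oplus>\<^bsub>Q\<^esub> ?T))"
      using dQ_square[of ?m] True yr(3) by (simp add: dQ_simps)
    have wE: "?V \<otimes>\<^bsub>Q\<^esub> z \<in> E 4 ?t" "a \<odot>\<^bsub>Q\<^esub> (?V \<otimes>\<^bsub>Q\<^esub> ?V) \<in> E 4 ?t"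
      using exact_shift(2)[OF z(1)] E_mult[OF E_qt[of ?m ?t] E_qt[of ?m ?t]] by (simp_all add: E_smult[OF yr(3)])
    have "dQ ?t (?V \<otimes>\<^bsub>Q\<^esub> z \<oplus>\<^bsub>Q\<^esub> a \<odot>\<^bsub>Q\<^esub> (?V \<otimes>\<^bsub>Q\<^esub> ?V))
        = ?T \<otimes>\<^bsub>Q\<^esub> dQ ?m z \<oplus>\<^bsub>Q\<^esub> a \<odot>\<^bsub>Q\<^esub> (?T \<otimes>\<^bsub>Q\<^esub> ((?V \<oplus>\<^bsub>Q\<^esub> ?V) \<oplus>\<^bsub>Q\<^esub> ?T))"
      unfolding dQ_simps(2)[OF E_closed[OF wE(1)] E_closed[OF wE(2)]] sq exact_shift(1)[OF z(1)] ..
    also have "\<dots> = ?T \<otimes>\<^bsub>Q\<^esub> (r \<oplus>\<^bsub>Q\<^esub> a \<odot>\<^bsub>Q\<^esub> ?T)"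
      unfolding r using E_closed[OF E_dQ[OF z(1)]] yr(3)
      by (simp add: Q.r_distr Q.smult_r_distr Q.smult_mult_right Q.a_assoc)
    finally show ?thesis using E_rules(3)[OF wE] by metis
  qed
  then obtain w where w: "w \<in> E 4 ?t" "?T \<otimes>\<^bsub>Q\<^esub> (r \<oplus>\<^bsub>Q\<^esub> a \<odot>\<^bsub>Q\<^esub> ?T) = dQ ?t w" by blast
  have "q = dQ ?t (y \<oplus>\<^bsub>Q\<^esub> w)" using yr(4) w(2) yQ E_closed[OF w(1)] by (simp add: dQ_simps)
  then show ?thesis using E_rules(3)[OF yr(1) w(1)] by blast
qed

lemma dQ_qt: "dQ (Suc t) (qt t) = (if even t then \<zero>\<^bsub>Q\<^esub> else qt (Suc t))"
  using dQ_var_mult[OF E_Qpart[OF E_one], of t] by (simp add: dQ_one)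

text \<open>The index is the odd number 1, so the square term is absent and the quotient is a degree
  2 cocycle in one variable. Up to coboundaries that is a multiple of \<open>qt 0\<close>, and
  multiplication by \<open>qt 1\<close> shifts it up.\<close>

lemma deg4_two:
  assumes q: "q \<in> E 4 2" and d: "dQ 2 q = \<zero>\<^bsub>Q\<^esub>"
  shows "\<exists>b\<in>carrier R. \<exists>y\<in>E 4 1. q = b \<odot>\<^bsub>Q\<^esub> (qt 1 \<otimes>\<^bsub>Q\<^esub> qt 0) \<oplus>\<^bsub>Q\<^esub> dQ 1 y"
proof -
  have q': "q \<in> E 4 (Suc 1)" "dQ (Suc 1) q = \<zero>\<^bsub>Q\<^esub>" using q d by (simp_all add: numeral_2_eq_2)
  obtain y r a where yr: "y \<in> E 4 1" "r \<in> E 2 1" "a \<in> carrier R"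
    "q = dQ 1 y \<oplus>\<^bsub>Q\<^esub> qt 1 \<otimes>\<^bsub>Q\<^esub> (r \<oplus>\<^bsub>Q\<^esub> a \<odot>\<^bsub>Q\<^esub> qt 1)"
    "dQ 1 r \<oplus>\<^bsub>Q\<^esub> a \<odot>\<^bsub>Q\<^esub> (if even (1::nat) then \<ominus>\<^bsub>Q\<^esub> (qt 1 \<oplus>\<^bsub>Q\<^esub> qt 1) else (qt 1 \<oplus>\<^bsub>Q\<^esub> qt 1) \<oplus>\<^bsub>Q\<^esub> qt (Suc 1)) = \<zero>\<^bsub>Q\<^esub>"
    using q' by (rule deg4_cocycle)
  note yQ = E_closed[OF yr(1)] and rQ = E_closed[OF yr(2)]
  have az: "a = \<zero>" "dQ 1 r = \<zero>\<^bsub>Q\<^esub>" using deg4_odd[OF _ yr(2,3)] yr(5) by simp_all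
  obtain z b where zb: "z \<in> E 2 0" "b \<in> carrier R" "r = dQ 0 z \<oplus>\<^bsub>Q\<^esub> b \<odot>\<^bsub>Q\<^esub> qt 0"
    using yr(2) az(2) unfolding One_nat_def by (rule exact_deg2_one)
  have wE: "qt 0 \<otimes>\<^bsub>Q\<^esub> z \<in> E 4 1" using exact_shift(2)[OF zb(1)] by simp
  have "qt 1 \<otimes>\<^bsub>Q\<^esub> (r \<oplus>\<^bsub>Q\<^esub> a \<odot>\<^bsub>Q\<^esub> qt 1) = qt 1 \<otimes>\<^bsub>Q\<^esub> dQ 0 z \<oplus>\<^bsub>Q\<^esub> b \<odot>\<^bsub>Q\<^esub> (qt 1 \<otimes>\<^bsub>Q\<^esub> qt 0)"
    using rQ zb(2) E_closed[OF E_dQ[OF zb(1)]] by (simp add: az(1) zb(3) Q.r_distr Q.smult_mult_right)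
  also have "qt 1 \<otimes>\<^bsub>Q\<^esub> dQ 0 z = dQ 1 (qt 0 \<otimes>\<^bsub>Q\<^esub> z)" using exact_shift(1)[OF zb(1)] by simp
  finally have "q = b \<odot>\<^bsub>Q\<^esub> (qt 1 \<otimes>\<^bsub>Q\<^esub> qt 0) \<oplus>\<^bsub>Q\<^esub> dQ 1 (y \<oplus>\<^bsub>Q\<^esub> qt 0 \<otimes>\<^bsub>Q\<^esub> z)"
    using yr(4) yQ E_closed[OF wE] zb(2) by (simp add: dQ_simps Q.a_ac)
  then show ?thesis using E_rules(3)[OF yr(1) wE] zb(2) by blast
qed

lemma qt10_cocycle: "dQ 2 (qt 1 \<otimes>\<^bsub>Q\<^esub> qt 0) = \<zero>\<^bsub>Q\<^esub>"
  using dQ_var_mult[OF E_Qpart[OF E_qt[of 0 1]]] dQ_qt[of 0] by (simp add: numeral_2_eq_2)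

lemma E_qt10: "qt 1 \<otimes>\<^bsub>Q\<^esub> qt 0 \<in> E 4 2"
  using E_mult[OF E_qt[of 1 2] E_qt[of 0 2]] by simp

lemma smult_qt10_inj: "b \<in> carrier R \<Longrightarrow> b \<odot>\<^bsub>Q\<^esub> (qt 1 \<otimes>\<^bsub>Q\<^esub> qt 0) = \<zero>\<^bsub>Q\<^esub> \<Longrightarrow> b = \<zero>"
  using var_mult_inj[of "b \<odot>\<^bsub>Q\<^esub> qt 0" 1] by (simp add: Q.smult_mult_right smult_qt_inj)

text \<open>A cochain of degree 4 in one variable is z + x t + a t^2 with z of degree 4, x in
  \<open>Dr\<close> and a scalar; if it bounds a multiple of the class then z contributes nothing.
  The other terms reach the coefficients phi(x) - 2a, which run through the image of
  \<open>phi\<close> because 2 = phi(\<open>gam\<close>).\<close>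

lemma qt10_boundary:
  assumes b: "b \<in> carrier R"
  shows "b \<odot>\<^bsub>Q\<^esub> (qt 1 \<otimes>\<^bsub>Q\<^esub> qt 0) \<in> dQ 1 ` E 4 1 \<longleftrightarrow> b \<in> I2 R"
proof
  assume "b \<in> I2 R"
  then obtain x where x: "x \<in> carrier (Dr R)" "b = phi x" unfolding phi_image[symmetric] by (rule imageE) simp
  have xE: "qc (iota x) \<in> E 2 0" by (rule E_qc[OF L_deg_iota[OF x(1)]])
  have "dQ 1 (qt 0 \<otimes>\<^bsub>Q\<^esub> qc (iota x)) = b \<odot>\<^bsub>Q\<^esub> (qt 1 \<otimes>\<^bsub>Q\<^esub> qt 0)"
    using exact_shift(1)[OF xE] x b by (simp add: dQ0_iota Q.smult_mult_right)
  then show "b \<odot>\<^bsub>Q\<^esub> (qt 1 \<otimes>\<^bsub>Q\<^esub> qt 0) \<in> dQ 1 ` E 4 1"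
    using exact_shift(2)[OF xE] by (intro image_eqI[of _ _ "qt 0 \<otimes>\<^bsub>Q\<^esub> qc (iota x)"]) simp_all
next
  assume "b \<odot>\<^bsub>Q\<^esub> (qt 1 \<otimes>\<^bsub>Q\<^esub> qt 0) \<in> dQ 1 ` E 4 1"
  then obtain y where y: "y \<in> E 4 1" "b \<odot>\<^bsub>Q\<^esub> (qt 1 \<otimes>\<^bsub>Q\<^esub> qt 0) = dQ 1 y" by (rule imageE) simp
  obtain e r where er: "e \<in> E 4 0" "y = e \<oplus>\<^bsub>Q\<^esub> qt 0 \<otimes>\<^bsub>Q\<^esub> r" "r \<in> E 2 (Suc 0)"
    by (rule E_decompose[OF y(1)[unfolded One_nat_def]]) simp
  obtain e' a where ea: "e' \<in> E 2 0" "a \<in> carrier R" "r = e' \<oplus>\<^bsub>Q\<^esub> a \<odot>\<^bsub>Q\<^esub> qt 0" using er(3) by (rule E2_cases)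
  obtain x where x: "x \<in> carrier (Dr R)" "e' = qc (iota x)" using ea(1) by (rule E2_zero_cases)
  obtain z where z: "z \<in> L_deg R 4" "e = qc z" using er(1) by (rule E_zero_vars)
  note zc = L_deg_closed[OF z(1)]
  let ?w = "qt 0 \<otimes>\<^bsub>Q\<^esub> qt 0" and ?xq = "qc (iota x)"
  have y': "y = qc z \<oplus>\<^bsub>Q\<^esub> (qt 0 \<otimes>\<^bsub>Q\<^esub> ?xq \<oplus>\<^bsub>Q\<^esub> a \<odot>\<^bsub>Q\<^esub> ?w)"
    using x ea(2) by (simp add: er(2) z(2) ea(3) Q.r_distr Q.smult_mult_right)
  have dz: "dQ (Suc 0) (qc z) = tau (qt 0) z"
    using dQ_pd2[of "qc z" 0] zc
    by (simp add: pd_def cf_qc_Suc sgn_Q_def cf_qc skip_def tau_zero Q.r_neg2)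
  have dx: "dQ (Suc 0) (qt 0 \<otimes>\<^bsub>Q\<^esub> ?xq) = phi x \<odot>\<^bsub>Q\<^esub> (qt 1 \<otimes>\<^bsub>Q\<^esub> qt 0)"
    using exact_shift(1)[OF ea(1)] x by (simp add: dQ0_iota Q.smult_mult_right)
  have dw: "dQ (Suc 0) (a \<odot>\<^bsub>Q\<^esub> ?w) = (\<ominus> (a \<otimes> (\<one> \<oplus> \<one>))) \<odot>\<^bsub>Q\<^esub> (qt 1 \<otimes>\<^bsub>Q\<^esub> qt 0)"
    using dQ_square[of 0] ea(2)
    by (simp add: dQ_simps Q.smult_l_minus Q.smult_assoc1 Q.smult_l_distr Q.smult_r_minus Q.r_minus Q.r_distr)
  let ?c = "phi x \<oplus> \<ominus> (a \<otimes> (\<one> \<oplus> \<one>))"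
  have cR: "?c \<in> carrier R" using x ea(2) by simp
  have "dQ (Suc 0) y = tau (qt 0) z \<oplus>\<^bsub>Q\<^esub> ?c \<odot>\<^bsub>Q\<^esub> (qt 1 \<otimes>\<^bsub>Q\<^esub> qt 0)"
    unfolding y' using x zc ea(2) dz dx dw by (simp add: dQ_simps Q.smult_l_distr)
  then have y1: "b \<odot>\<^bsub>Q\<^esub> (qt 1 \<otimes>\<^bsub>Q\<^esub> qt 0) = tau (qt 0) z \<oplus>\<^bsub>Q\<^esub> ?c \<odot>\<^bsub>Q\<^esub> (qt 1 \<otimes>\<^bsub>Q\<^esub> qt 0)"
    \<comment> \<open>This only replaces the index \<open>1\<close> of the differential by
      \<open>Suc 0\<close>.\<close>
    by (rule trans[OF y(2)[THEN trans[OF _ arg_cong2[of 1 "Suc 0" y y dQ, OF One_nat_def refl]]]])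
  \<comment> \<open>Setting \<open>qt 1\<close> to zero kills both multiples of the class and keeps
    \<open>tau (qt 0) z\<close>, which does not involve that variable; hence this term
    vanishes.\<close>
  have "zv 1 (b \<odot>\<^bsub>Q\<^esub> (qt 1 \<otimes>\<^bsub>Q\<^esub> qt 0)) = zv 1 (tau (qt 0) z \<oplus>\<^bsub>Q\<^esub> ?c \<odot>\<^bsub>Q\<^esub> (qt 1 \<otimes>\<^bsub>Q\<^esub> qt 0))"
    unfolding y1 ..
  then have "tau (qt 0) z = \<zero>\<^bsub>Q\<^esub>" using b cR zc by (simp add: zv_simps zv_qt zv_tau)
  then have "b \<odot>\<^bsub>Q\<^esub> (qt 1 \<otimes>\<^bsub>Q\<^esub> qt 0) = ?c \<odot>\<^bsub>Q\<^esub> (qt 1 \<otimes>\<^bsub>Q\<^esub> qt 0)" using y1 cR by simp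
  then have "b = ?c" using smult_eqD[OF smult_qt10_inj _ b cR] by simp
  also have "\<dots> = phi (x \<oplus>\<^bsub>Dr R\<^esub> (\<ominus> a) \<odot>\<^bsub>Dr R\<^esub> gam)" using x ea(2) by (simp add: l_minus)
  finally have "b = phi (x \<oplus>\<^bsub>Dr R\<^esub> (\<ominus> a) \<odot>\<^bsub>Dr R\<^esub> gam)" .
  then show "b \<in> I2 R" unfolding phi_image[symmetric]
    by (rule image_eqI) (use x ea(2) in simp)
qed

lemma E_boundary_class: "boundary_class \<in> E 4 1"
  unfolding boundary_class_def
  using E_mult[OF E_qt[of 0 1] E_rules(3)[OF E_qc[OF L_deg_iota[of gam]] E_qt[of 0 1]]] by simp

text \<open>The term with \<open>gam\<close> contributes 2 because phi(\<open>gam\<close>) = 2, and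
  the square of \<open>qt 0\<close> contributes -2; this is what fixes the coefficient of
  \<open>gam\<close> in the class.\<close>

lemma boundary_class_cocycle: "dQ 1 boundary_class = \<zero>\<^bsub>Q\<^esub>"
proof -
  have gE: "qc (iota gam) \<in> E 2 0" by (rule E_qc[OF L_deg_iota]) simp
  have "dQ (Suc 0) boundary_class = qt 1 \<otimes>\<^bsub>Q\<^esub> (qt 0 \<oplus>\<^bsub>Q\<^esub> qt 0) \<oplus>\<^bsub>Q\<^esub> qt 1 \<otimes>\<^bsub>Q\<^esub> (\<ominus>\<^bsub>Q\<^esub> (qt 0 \<oplus>\<^bsub>Q\<^esub> qt 0))"
    using exact_shift(1)[OF gE] dQ_square[of 0]
    by (simp add: boundary_class_def Q.r_distr dQ_simps dQ0_iota Q.smult_l_distr)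
  then show ?thesis by (simp add: Q.r_minus Q.r_neg)
qed

text \<open>For index 0 the cocycle condition reads phi(x) = 2a, that is phi(x) = phi(a
  \<open>gam\<close>). Injectivity of \<open>phi\<close> gives x = a \<open>gam\<close>, so the
  cocycle is a multiple of \<open>boundary_class\<close>.\<close>

lemma deg4_one:
  assumes q: "q \<in> E 4 1" and d: "dQ 1 q = \<zero>\<^bsub>Q\<^esub>"
  shows "\<exists>a\<in>carrier R. \<exists>y\<in>E 4 0. q = a \<odot>\<^bsub>Q\<^esub> boundary_class \<oplus>\<^bsub>Q\<^esub> dQ 0 y"
proof -
  obtain y r a where yr: "y \<in> E 4 0" "r \<in> E 2 0" "a \<in> carrier R"
    "q = dQ 0 y \<oplus>\<^bsub>Q\<^esub> qt 0 \<otimes>\<^bsub>Q\<^esub> (r \<oplus>\<^bsub>Q\<^esub> a \<odot>\<^bsub>Q\<^esub> qt 0)"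
    "dQ 0 r \<oplus>\<^bsub>Q\<^esub> a \<odot>\<^bsub>Q\<^esub> (if even (0::nat) then \<ominus>\<^bsub>Q\<^esub> (qt 0 \<oplus>\<^bsub>Q\<^esub> qt 0) else (qt 0 \<oplus>\<^bsub>Q\<^esub> qt 0) \<oplus>\<^bsub>Q\<^esub> qt (Suc 0)) = \<zero>\<^bsub>Q\<^esub>"
    using q d unfolding One_nat_def by (rule deg4_cocycle)
  obtain x where x: "x \<in> carrier (Dr R)" "r = qc (iota x)" using yr(2) by (rule E2_zero_cases)
  have "phi x \<odot>\<^bsub>Q\<^esub> qt 0 \<ominus>\<^bsub>Q\<^esub> (a \<otimes> (\<one> \<oplus> \<one>)) \<odot>\<^bsub>Q\<^esub> qt 0 = \<zero>\<^bsub>Q\<^esub>"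
    using yr(5) x yr(3)
    by (simp add: dQ0_iota a_minus_def Q.smult_r_minus Q.smult_assoc1 Q.smult_l_distr)
  then have "phi x \<odot>\<^bsub>Q\<^esub> qt 0 = (a \<otimes> (\<one> \<oplus> \<one>)) \<odot>\<^bsub>Q\<^esub> qt 0"
    using x yr(3) by (simp add: Q.minus_eq_zero_iff)
  then have "phi x = a \<otimes> (\<one> \<oplus> \<one>)"
    by (rule smult_eqD[OF smult_qt_inj, rotated -1]) (use x yr(3) in simp_all)
  then have "x = a \<odot>\<^bsub>Dr R\<^esub> gam" using x yr(3) by (intro phi_eqD) simp_all
  then have "r = a \<odot>\<^bsub>Q\<^esub> qc (iota gam)"
    using yr(3) x(2) by (simp add: linear_mapsD(3)[OF iota_linear] qc_smult)
  then have "qt 0 \<otimes>\<^bsub>Q\<^esub> (r \<oplus>\<^bsub>Q\<^esub> a \<odot>\<^bsub>Q\<^esub> qt 0) = a \<odot>\<^bsub>Q\<^esub> boundary_class"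
    using yr(3) by (simp add: boundary_class_def Q.smult_r_distr[symmetric] Q.smult_mult_right)
  then have "q = a \<odot>\<^bsub>Q\<^esub> boundary_class \<oplus>\<^bsub>Q\<^esub> dQ 0 y"
    using yr(4) E_closed[OF E_dQ[OF yr(1)]] yr(3) by (simp add: Q.a_comm)
  then show ?thesis using yr(1,3) by blast
qed

text \<open>In degree 4, \<open>LA\<close> is spanned by products of two generators, and
  \<open>mu\<close> sends such a product to a product of two values of \<open>phi\<close>, whose
  image is \<open>I2 R\<close>.\<close>

lemma mu_deg4:
  "mu ` L_deg R 4 = ideal_prod R (I2 R) (I2 R)"
proof
  interpret I: ideal "I2 R" R by (rule I2_ideal)
  have pid: "ideal (ideal_prod R (I2 R) (I2 R)) R"
    by (rule ideal_prod_is_ideal[OF I2_ideal I2_ideal])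
  have sub: "submodule (ideal_prod R (I2 R) (I2 R)) R (regular_module R)"
  proof -
    interpret J: ideal "ideal_prod R (I2 R) (I2 R)" R by (rule pid)
    have minus: "\<ominus>\<^bsub>regular_module R\<^esub> x = \<ominus> x" for x by (simp add: a_inv_def m_inv_def)
    show ?thesis by (rule module.submoduleI[OF regular_module]) (auto simp: minus J.I_l_closed)
  qed
  have phi_I: "phi x \<in> I2 R" if "x \<in> carrier (Dr R)" for x using that phi_image by blast
  have "mu z \<in> ideal_prod R (I2 R) (I2 R)" if z: "z \<in> L_deg R 4" for z
  proof -
    have "z \<in> {z \<in> carrier (LA R). mu z \<in> ideal_prod R (I2 R) (I2 R)}"
    proof (rule L_deg_cases(3)[OF preimage_submodule[OF L.module regular_module algebra_mapsD(1)[OF mu_map] sub] _ z])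
      fix x y assume "x \<in> carrier (Dr R)" "y \<in> carrier (Dr R)"
      then show "iota x \<otimes>\<^bsub>LA R\<^esub> iota y \<in> {z \<in> carrier (LA R). mu z \<in> ideal_prod R (I2 R) (I2 R)}"
        by (simp add: mu_simps ideal_prod.prod phi_I)
    qed
    then show ?thesis by simp
  qed
  then show "mu ` L_deg R 4 \<subseteq> ideal_prod R (I2 R) (I2 R)" by blast
  show "ideal_prod R (I2 R) (I2 R) \<subseteq> mu ` L_deg R 4"
  proof
    fix a assume "a \<in> ideal_prod R (I2 R) (I2 R)"
    then show "a \<in> mu ` L_deg R 4"
    proof (induction rule: ideal_prod.induct)
      case (prod i j)
      obtain x where x: "x \<in> carrier (Dr R)" "i = phi x" using prod(1) unfolding phi_image[symmetric] by (rule imageE) simp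
      obtain y where y: "y \<in> carrier (Dr R)" "j = phi y" using prod(2) unfolding phi_image[symmetric] by (rule imageE) simp
      have "iota x \<otimes>\<^bsub>LA R\<^esub> iota y \<in> L_deg R 4" using L_deg_mult[OF L_deg_iota[OF x(1)] L_deg_iota[OF y(1)]] by simp
      then show ?case using x y by (intro image_eqI[of _ _ "iota x \<otimes>\<^bsub>LA R\<^esub> iota y"]) (simp_all add: mu_simps)
    next
      case (sum a b)
      obtain z where z: "z \<in> L_deg R 4" "a = mu z" using sum(3) by (rule imageE) simp
      obtain w where w: "w \<in> L_deg R 4" "b = mu w" using sum(4) by (rule imageE) simp
      show ?case
        using z w L.submoduleE(5)[OF L_deg_submodule z(1) w(1)]
        by (intro image_eqI[of _ _ "z \<oplus>\<^bsub>LA R\<^esub> w"]) (simp_all add: mu_simps L_deg_closed)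
    qed
  qed
qed

text \<open>Coboundaries in place 1 come from constants of degree 4, with differential
  \<open>mu z\<close> times the class; scalars can be cancelled against the class.\<close>

lemma boundary_class_boundary:
  assumes a: "a \<in> carrier R"
  shows "a \<odot>\<^bsub>Q\<^esub> boundary_class \<in> dQ 0 ` E 4 0 \<longleftrightarrow> a \<in> ideal_prod R (I2 R) (I2 R)"
proof
  assume "a \<in> ideal_prod R (I2 R) (I2 R)"
  then obtain z where z: "z \<in> L_deg R 4" "a = mu z" unfolding mu_deg4[symmetric] by (rule imageE) simp
  then show "a \<odot>\<^bsub>Q\<^esub> boundary_class \<in> dQ 0 ` E 4 0"
    by (intro image_eqI[of _ _ "qc z"]) (simp_all add: dQ0_deg4 E_qc)
next
  assume "a \<odot>\<^bsub>Q\<^esub> boundary_class \<in> dQ 0 ` E 4 0"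
  then obtain y where y: "y \<in> E 4 0" "a \<odot>\<^bsub>Q\<^esub> boundary_class = dQ 0 y" by (rule imageE) simp
  obtain z where z: "z \<in> L_deg R 4" "y = qc z" using y(1) by (rule E_zero_vars)
  have "a = mu z"
    by (rule smult_eqD[OF smult_boundary_inj boundary_class_closed a])
      (use y z in \<open>simp_all add: dQ0_deg4 mu_simps L_deg_closed\<close>)
  then show "a \<in> ideal_prod R (I2 R) (I2 R)" using z(1) unfolding mu_deg4[symmetric] by simp
qed

text \<open>The degree 2 constants are the elements of \<open>Dr\<close>, and their differentials
  are the multiples of \<open>qt 0\<close> by values of \<open>phi\<close>.\<close>

lemma qt0_boundary:
  assumes a: "a \<in> carrier R" shows "a \<odot>\<^bsub>Q\<^esub> qt 0 \<in> dQ 0 ` E 2 0 \<longleftrightarrow> a \<in> I2 R"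
proof
  assume "a \<in> I2 R"
  then obtain x where x: "x \<in> carrier (Dr R)" "a = phi x" unfolding phi_image[symmetric] by (rule imageE) simp
  then show "a \<odot>\<^bsub>Q\<^esub> qt 0 \<in> dQ 0 ` E 2 0"
    by (intro image_eqI[of _ _ "qc (iota x)"]) (simp_all add: dQ0_iota E_qc L_deg_iota)
next
  assume "a \<odot>\<^bsub>Q\<^esub> qt 0 \<in> dQ 0 ` E 2 0"
  then obtain y where y: "y \<in> E 2 0" "a \<odot>\<^bsub>Q\<^esub> qt 0 = dQ 0 y" by (rule imageE) simp
  obtain x where x: "x \<in> carrier (Dr R)" "y = qc (iota x)" using y(1) by (rule E2_zero_cases)
  have "a = phi x"
    by (rule smult_eqD[OF smult_qt_inj qt_closed a]) (use y x in \<open>simp_all add: dQ0_iota\<close>)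
  then show "a \<in> I2 R" using x(1) unfolding phi_image[symmetric] by simp
qed

section \<open>Transfer from polynomials to \<open>cotor\<close>\<close>

definition "BE d s = (case s of 0 \<Rightarrow> {\<zero>\<^bsub>Q\<^esub>} | Suc t \<Rightarrow> dQ t ` E d t)"

lemma BE_simps: "BE d 0 = {\<zero>\<^bsub>Q\<^esub>}" "BE d (Suc t) = dQ t ` E d t"
  by (simp_all add: BE_def)

lemma BE_submodule: "submodule (BE d s) R Q"
proof (cases s)
  case 0
  show ?thesis unfolding 0 BE_simps by (rule Q.submoduleI) simp_all
next
  case (Suc t)
  have "submodule (dQ t ` carrier (Q\<lparr>carrier := E d t\<rparr>)) R Q"
    by (rule linear_image_submodule[OF submodule.submodule_is_module[OF E_submodule Q.module] Q.module], rule linear_mapsI)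
      (simp_all add: dQ_simps E_closed)
  then show ?thesis by (simp add: Suc BE_simps)
qed

lemmas BE_rules = Q.submoduleE(3-5)[OF BE_submodule]

lemma BE_cocycle:
  assumes "q \<in> BE d s" shows "dQ s q = \<zero>\<^bsub>Q\<^esub>"
proof (cases s)
  case 0
  show ?thesis using assms dQ_zero unfolding 0 BE_simps by simp
next
  case (Suc t)
  obtain y where y: "q = dQ t y" "y \<in> E d t" using assms unfolding Suc BE_simps by (rule imageE)
  show ?thesis unfolding y(1) Suc by (rule dQ_dQ[OF E_closed[OF y(2)]])
qed

abbreviation "psi0 \<equiv> psi tsum"

lemma psi0_map: "psi0 \<in> algebra_maps R (tensor R s) Q"
  by (rule psi_map) simp

lemmas psi0_linear = algebra_mapsD(1)[OF psi0_map]

lemma psi0_inj: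
  assumes "X \<in> carrier (tensor R s)" "Y \<in> carrier (tensor R s)" "psi0 X = psi0 Y" shows "X = Y"
  using arg_cong[OF assms(3), of "Theta s"] unfolding Theta_psi[OF assms(1)] Theta_psi[OF assms(2)] .

text \<open>The coordinate map is injective on the next tensor power, so vanishing of the cobar
  differential can be tested on polynomials.\<close>

lemma cocycles_eq: "cocycles R s d = {X \<in> tensor_deg R s d. dQ s (psi0 X) = \<zero>\<^bsub>Q\<^esub>}"
proof -
  interpret T: algebra R "tensor R (Suc s)" by (rule tensor_algebra)
  have "cobar_diff R s X = \<zero>\<^bsub>tensor R (Suc s)\<^esub> \<longleftrightarrow> dQ s (psi0 X) = \<zero>\<^bsub>Q\<^esub>" if X: "X \<in> tensor_deg R s d" for X
    unfolding psi_cobar_diff[OF X, symmetric]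
  proof
    assume "cobar_diff R s X = \<zero>\<^bsub>tensor R (Suc s)\<^esub>"
    then show "psi0 (cobar_diff R s X) = \<zero>\<^bsub>Q\<^esub>" by (simp add: linear_map_zero[OF T.module Q.module psi0_linear])
  next
    assume "psi0 (cobar_diff R s X) = \<zero>\<^bsub>Q\<^esub>"
    then show "cobar_diff R s X = \<zero>\<^bsub>tensor R (Suc s)\<^esub>"
      by (rule psi_zeroD[OF cobar_diff_psi(1)[OF tensor_deg_closed[OF X]]])
  qed
  then show ?thesis unfolding cocycles_def by (simp cong: conj_cong)
qed

text \<open>A polynomial bounding \<open>psi0 X\<close> is carried back by \<open>Theta\<close>, and
  injectivity of coordinates makes the result bound \<open>X\<close>. In place 0 the statement is
  injectivity alone.\<close>

lemma coboundaries_eq: "coboundaries R s d = {X \<in> tensor_deg R s d. psi0 X \<in> BE d s}"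
proof (cases s)
  case 0
  interpret T: algebra R "tensor R 0" by (rule tensor_algebra)
  have z: "\<zero>\<^bsub>tensor R 0\<^esub> \<in> tensor_deg R 0 d"
    by (rule submodule_zero[OF tensor_deg_submodule])
  show ?thesis unfolding 0 coboundaries_def BE_simps nat.case
  proof (intro equalityI subsetI)
    fix X assume "X \<in> {\<zero>\<^bsub>tensor R 0\<^esub>}"
    then show "X \<in> {X \<in> tensor_deg R 0 d. psi0 X \<in> {\<zero>\<^bsub>Q\<^esub>}}"
      using z linear_map_zero[OF T.module Q.module psi0_linear] by simp
  next
    fix X assume "X \<in> {X \<in> tensor_deg R 0 d. psi0 X \<in> {\<zero>\<^bsub>Q\<^esub>}}"
    then have "X \<in> tensor_deg R 0 d" "psi0 X = \<zero>\<^bsub>Q\<^esub>" by simp_all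
    then show "X \<in> {\<zero>\<^bsub>tensor R 0\<^esub>}" using psi_zeroD[OF tensor_deg_closed] by simp
  qed
next
  case (Suc t)
  show ?thesis unfolding Suc coboundaries_def BE_simps nat.case
  proof (intro equalityI subsetI)
    fix X assume "X \<in> cobar_diff R t ` tensor_deg R t d"
    then obtain Y where Y: "X = cobar_diff R t Y" "Y \<in> tensor_deg R t d" by (rule imageE)
    note p = psi_cobar_diff[OF Y(2)] and e = psi_tsum_deg[OF Y(2)]
    have "Theta (Suc t) (dQ t (psi0 Y)) = X"
      unfolding p[symmetric] Y(1) by (rule Theta_psi[OF cobar_diff_psi(1)[OF tensor_deg_closed[OF Y(2)]]])
    then have "X \<in> tensor_deg R (Suc t) d" using Theta_deg[OF E_dQ[OF e]] by simp
    then show "X \<in> {X \<in> tensor_deg R (Suc t) d. psi0 X \<in> dQ t ` E d t}"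
      using p e unfolding Y(1) by simp
  next
    fix X assume "X \<in> {X \<in> tensor_deg R (Suc t) d. psi0 X \<in> dQ t ` E d t}"
    then have X: "X \<in> tensor_deg R (Suc t) d" "psi0 X \<in> dQ t ` E d t" by simp_all
    obtain y where y: "psi0 X = dQ t y" "y \<in> E d t" using X(2) by (rule imageE)
    note Y = Theta_deg[OF y(2)]
    have "psi0 X = psi0 (cobar_diff R t (Theta t y))"
      unfolding psi_cobar_diff[OF Y] psi_Theta_id[OF E_Qpart[OF y(2)]] by (rule y(1))
    then have "X = cobar_diff R t (Theta t y)"
      by (rule psi0_inj[OF tensor_deg_closed[OF X(1)] cobar_diff_psi(1)[OF tensor_deg_closed[OF Y]]])
    then show "X \<in> cobar_diff R t ` tensor_deg R t d" using Y by (rule image_eqI)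
  qed
qed

abbreviation (input) "ZT s d \<equiv> (tensor R s)\<lparr>carrier := cocycles R s d\<rparr>"

lemma restricted_kernel_module:
  assumes M: "module R M" and N: "module R N" and U: "submodule U R M"
    and f: "f \<in> linear_maps R (M\<lparr>carrier := U\<rparr>) N"
  shows "module R (M\<lparr>carrier := {x \<in> U. f x = \<zero>\<^bsub>N\<^esub>}\<rparr>)"
proof -
  have U': "module R (M\<lparr>carrier := U\<rparr>)" by (rule submodule.submodule_is_module[OF U M])
  show ?thesis
    using submodule.submodule_is_module[OF module.kernel_submodule[OF U' N f] U'] by simp
qed

lemma ZT_module: "module R (ZT s d)"
proof -
  interpret T: algebra R "tensor R s" by (rule tensor_algebra)
  show ?thesis unfolding cocycles_eq
  proof (rule restricted_kernel_module[OF T.module Q.module tensor_deg_submodule], rule linear_mapsI)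
    fix X assume "X \<in> carrier (tensor R s\<lparr>carrier := tensor_deg R s d\<rparr>)"
    then have "X \<in> carrier (tensor R s)" by (simp add: tensor_deg_closed)
    then show "dQ s (psi0 X) \<in> carrier Q" by (simp add: dQ_simps linear_mapsD(1)[OF psi0_linear])
  next
    fix X Y
    assume "X \<in> carrier (tensor R s\<lparr>carrier := tensor_deg R s d\<rparr>)" "Y \<in> carrier (tensor R s\<lparr>carrier := tensor_deg R s d\<rparr>)"
    then have "X \<in> carrier (tensor R s)" "Y \<in> carrier (tensor R s)" by (simp_all add: tensor_deg_closed)
    then show "dQ s (psi0 (X \<oplus>\<^bsub>tensor R s\<lparr>carrier := tensor_deg R s d\<rparr>\<^esub> Y)) = dQ s (psi0 X) \<oplus>\<^bsub>Q\<^esub> dQ s (psi0 Y)"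
      by (simp add: dQ_simps linear_mapsD[OF psi0_linear])
  next
    fix a X
    assume "a \<in> carrier R" "X \<in> carrier (tensor R s\<lparr>carrier := tensor_deg R s d\<rparr>)"
    then have "a \<in> carrier R" "X \<in> carrier (tensor R s)" by (simp_all add: tensor_deg_closed)
    then show "dQ s (psi0 (a \<odot>\<^bsub>tensor R s\<lparr>carrier := tensor_deg R s d\<rparr>\<^esub> X)) = a \<odot>\<^bsub>Q\<^esub> dQ s (psi0 X)"
      by (simp add: dQ_simps linear_mapsD[OF psi0_linear])
  qed
qed

lemma ZT_carrier: "X \<in> carrier (ZT s d) \<longleftrightarrow> X \<in> tensor_deg R s d \<and> dQ s (psi0 X) = \<zero>\<^bsub>Q\<^esub>"
  by (simp add: cocycles_eq)

lemma ZT_closed: "X \<in> carrier (ZT s d) \<Longrightarrow> X \<in> carrier (tensor R s)"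
  unfolding ZT_carrier by (erule conjE, erule tensor_deg_closed)

lemma ZT_psi_linear: "psi0 \<in> linear_maps R (ZT s d) Q"
proof (rule linear_mapsI)
  fix X assume "X \<in> carrier (ZT s d)"
  then show "psi0 X \<in> carrier Q" by (rule linear_mapsD(1)[OF psi0_linear ZT_closed])
next
  fix X Y assume "X \<in> carrier (ZT s d)" "Y \<in> carrier (ZT s d)"
  from this[THEN ZT_closed] show "psi0 (X \<oplus>\<^bsub>ZT s d\<^esub> Y) = psi0 X \<oplus>\<^bsub>Q\<^esub> psi0 Y"
    by (simp add: linear_mapsD(2)[OF psi0_linear])
next
  fix a X assume a: "a \<in> carrier R" and X: "X \<in> carrier (ZT s d)"
  from a X[THEN ZT_closed] show "psi0 (a \<odot>\<^bsub>ZT s d\<^esub> X) = a \<odot>\<^bsub>Q\<^esub> psi0 X"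
    by (simp add: linear_mapsD(3)[OF psi0_linear])
qed

lemma ZT_boundary: "X \<in> carrier (ZT s d) \<Longrightarrow> X \<in> coboundaries R s d \<longleftrightarrow> psi0 X \<in> BE d s"
  unfolding ZT_carrier coboundaries_eq by simp

text \<open>Coboundaries are cocycles because the polynomial differential squares to zero; the
  submodule property is pulled back along coordinates.\<close>

lemma coboundaries_submodule: "submodule (coboundaries R s d) R (ZT s d)"
proof -
  have "coboundaries R s d = {X \<in> carrier (ZT s d). psi0 X \<in> BE d s}"
    unfolding ZT_carrier coboundaries_eq using BE_cocycle by blast
  then show ?thesis using preimage_submodule[OF ZT_module Q.module ZT_psi_linear BE_submodule] by (rule ssubst)
qed

lemmas cotor_coset =
  module.coset_linear[OF ZT_module coboundaries_submodule, folded cotor_def]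
  module.coset_eq_zero_iff[OF ZT_module coboundaries_submodule]
  module.coset_eq_iff[OF ZT_module coboundaries_submodule]

lemma cotor_module: "module R (cotor R s d)"
  unfolding cotor_def by (rule module.quotient_module_module[OF ZT_module coboundaries_submodule])

lemma cotor_zero_closed: "\<zero>\<^bsub>cotor R s d\<^esub> = coboundaries R s d"
  by (simp add: cotor_def quotient_module_sel)

lemma cotorE:
  assumes "X \<in> carrier (cotor R s d)"
  obtains x where "x \<in> carrier (ZT s d)" "X = coboundaries R s d +>\<^bsub>ZT s d\<^esub> x"
  using assms unfolding cotor_def by (rule quotient_carrierE)

lemma cotor_zero:
  assumes all: "\<And>q. q \<in> E d s \<Longrightarrow> dQ s q = \<zero>\<^bsub>Q\<^esub> \<Longrightarrow> q \<in> BE d s"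
  shows "zero_module R (cotor R s d)"
proof -
  interpret C: module R "cotor R s d" by (rule cotor_module)
  have "X = \<zero>\<^bsub>cotor R s d\<^esub>" if X: "X \<in> carrier (cotor R s d)" for X
  proof -
    obtain x where x: "x \<in> carrier (ZT s d)" "X = coboundaries R s d +>\<^bsub>ZT s d\<^esub> x" using X by (rule cotorE)
    have "psi0 x \<in> BE d s" using x(1) all psi_tsum_deg unfolding ZT_carrier by simp
    then show ?thesis unfolding x(2) cotor_zero_closed cotor_coset(2)[OF x(1)] ZT_boundary[OF x(1)] .
  qed
  then have "carrier (cotor R s d) = {\<zero>\<^bsub>cotor R s d\<^esub>}" using C.zero_closed by (intro equalityI subsetI) simp_all
  then show ?thesis unfolding zero_module_def by (intro conjI cotor_module)
qed

text \<open>The common route to all nonzero groups: a linear family \<open>g\<close> of cocycles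
  that meets every class gives a surjection from \<open>M\<close> onto cohomology by way of
  \<open>Theta\<close>, with kernel the parameters whose cocycle bounds. The first isomorphism
  theorem and symmetry conclude.\<close>

lemma cotor_iso:
  assumes M: "module R M" and g: "g \<in> linear_maps R M Q"
    and gE: "\<And>x. x \<in> carrier M \<Longrightarrow> g x \<in> E d s" and gd: "\<And>x. x \<in> carrier M \<Longrightarrow> dQ s (g x) = \<zero>\<^bsub>Q\<^esub>"
    and surj: "\<And>q. q \<in> E d s \<Longrightarrow> dQ s q = \<zero>\<^bsub>Q\<^esub> \<Longrightarrow> \<exists>x\<in>carrier M. \<exists>b\<in>BE d s. q = g x \<oplus>\<^bsub>Q\<^esub> b"
    and N: "N = {x \<in> carrier M. g x \<in> BE d s}"
  shows "module_iso R (cotor R s d) (quotient_module M N)"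
proof -
  interpret T: algebra R "tensor R s" by (rule tensor_algebra)
  note th = algebra_mapsD[OF Theta_map[of s]]
  let ?h = "\<lambda>x. Theta s (g x)"
  have hc: "?h x \<in> carrier (ZT s d)" and hp: "psi0 (?h x) = g x" if x: "x \<in> carrier M" for x
  proof -
    show "psi0 (?h x) = g x" by (rule psi_Theta_id[OF E_Qpart[OF gE[OF x]]])
    then show "?h x \<in> carrier (ZT s d)" unfolding ZT_carrier using Theta_deg[OF gE[OF x]] gd[OF x] by simp
  qed
  have h: "?h \<in> linear_maps R M (ZT s d)"
  proof (rule linear_mapsI[OF hc])
    fix x y assume "x \<in> carrier M" "y \<in> carrier M"
    then show "?h (x \<oplus>\<^bsub>M\<^esub> y) = ?h x \<oplus>\<^bsub>ZT s d\<^esub> ?h y" by (simp add: linear_mapsD[OF g] th)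
  next
    fix a x assume "a \<in> carrier R" "x \<in> carrier M"
    then show "?h (a \<odot>\<^bsub>M\<^esub> x) = a \<odot>\<^bsub>ZT s d\<^esub> ?h x" by (simp add: linear_mapsD[OF g] th)
  qed
  let ?f = "\<lambda>x. coboundaries R s d +>\<^bsub>ZT s d\<^esub> ?h x"
  have f: "?f \<in> linear_maps R M (cotor R s d)" by (rule linear_maps_comp[OF h cotor_coset(1)])
  have "carrier (cotor R s d) \<subseteq> ?f ` carrier M"
  proof
    fix X assume "X \<in> carrier (cotor R s d)"
    then obtain x where x: "x \<in> carrier (ZT s d)" "X = coboundaries R s d +>\<^bsub>ZT s d\<^esub> x" by (rule cotorE)
    have xE: "psi0 x \<in> E d s" "dQ s (psi0 x) = \<zero>\<^bsub>Q\<^esub>" using x(1) psi_tsum_deg unfolding ZT_carrier by simp_all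
    obtain m where m: "m \<in> carrier M" "\<exists>b\<in>BE d s. psi0 x = g m \<oplus>\<^bsub>Q\<^esub> b" using surj[OF xE] by (rule bexE)
    obtain b where b: "b \<in> BE d s" "psi0 x = g m \<oplus>\<^bsub>Q\<^esub> b" using m(2) by (rule bexE)
    have bQ: "b \<in> carrier Q" using b(1) Q.submoduleE(1)[OF BE_submodule] by (rule subsetD[rotated])
    note gQ = linear_mapsD(1)[OF g m(1)]
    have mc: "?h m \<ominus>\<^bsub>ZT s d\<^esub> x \<in> carrier (ZT s d)"
      by (rule abelian_group.minus_closed[OF module.axioms(2)[OF ZT_module] hc[OF m(1)] x(1)])
    have "psi0 (?h m \<ominus>\<^bsub>ZT s d\<^esub> x) = g m \<ominus>\<^bsub>Q\<^esub> (g m \<oplus>\<^bsub>Q\<^esub> b)"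
      unfolding linear_map_minus[OF ZT_module Q.module ZT_psi_linear hc[OF m(1)] x(1)] hp[OF m(1)] b(2) ..
    also have "\<dots> = \<ominus>\<^bsub>Q\<^esub> b" using gQ bQ by (simp add: a_minus_def Q.minus_add Q.a_assoc[symmetric] Q.r_neg)
    finally have "psi0 (?h m \<ominus>\<^bsub>ZT s d\<^esub> x) \<in> BE d s" using BE_rules(1)[OF b(1)] by simp
    then have "?f m = X" unfolding x(2) cotor_coset(3)[OF hc[OF m(1)] x(1)] ZT_boundary[OF mc] .
    then show "X \<in> ?f ` carrier M" using m(1) by (rule image_eqI[OF sym])
  qed
  then have im: "?f ` carrier M = carrier (cotor R s d)"
    using linear_mapsD(1)[OF f] by (intro equalityI image_subsetI)
  have K: "N = {x \<in> carrier M. ?f x = \<zero>\<^bsub>cotor R s d\<^esub>}"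
    unfolding N
  proof (rule Collect_cong, rule conj_cong[OF refl])
    fix x assume x: "x \<in> carrier M"
    show "g x \<in> BE d s \<longleftrightarrow> ?f x = \<zero>\<^bsub>cotor R s d\<^esub>"
      unfolding cotor_zero_closed cotor_coset(2)[OF hc[OF x]] ZT_boundary[OF hc[OF x]] hp[OF x] ..
  qed
  show ?thesis by (rule module_iso_sym[OF first_isomorphism[OF M cotor_module f im K]])
qed

text \<open>The case of a single generating class \<open>v\<close>; \<open>N\<close> is the set of
  scalars that make it bound.\<close>

lemma cotor_cyclic:
  assumes v: "v \<in> E d s" "dQ s v = \<zero>\<^bsub>Q\<^esub>"
    and surj: "\<And>q. q \<in> E d s \<Longrightarrow> dQ s q = \<zero>\<^bsub>Q\<^esub> \<Longrightarrow> \<exists>a\<in>carrier R. \<exists>b\<in>BE d s. q = a \<odot>\<^bsub>Q\<^esub> v \<oplus>\<^bsub>Q\<^esub> b"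
    and N: "N \<subseteq> carrier R" "\<And>a. a \<in> carrier R \<Longrightarrow> a \<odot>\<^bsub>Q\<^esub> v \<in> BE d s \<longleftrightarrow> a \<in> N"
  shows "module_iso R (cotor R s d) (quotient_module (regular_module R) N)"
proof (rule cotor_iso[OF regular_module])
  note vQ = E_closed[OF v(1)]
  show "(\<lambda>a. a \<odot>\<^bsub>Q\<^esub> v) \<in> linear_maps R (regular_module R) Q"
    by (rule linear_mapsI) (use vQ in \<open>simp_all add: Q.smult_l_distr Q.smult_assoc1\<close>)
  show "a \<odot>\<^bsub>Q\<^esub> v \<in> E d s" if "a \<in> carrier (regular_module R)" for a
    using that v(1) by (simp add: E_smult)
  show "dQ s (a \<odot>\<^bsub>Q\<^esub> v) = \<zero>\<^bsub>Q\<^esub>" if "a \<in> carrier (regular_module R)" for a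
    using that vQ by (simp add: dQ_simps v(2))
  show "\<exists>a\<in>carrier (regular_module R). \<exists>b\<in>BE d s. q = a \<odot>\<^bsub>Q\<^esub> v \<oplus>\<^bsub>Q\<^esub> b"
    if "q \<in> E d s" "dQ s q = \<zero>\<^bsub>Q\<^esub>" for q using surj[OF that] by simp
  show "N = {a \<in> carrier (regular_module R). a \<odot>\<^bsub>Q\<^esub> v \<in> BE d s}" using N by auto
qed

section \<open>The individual cohomology groups\<close>

lemma cotor_0_0: "module_iso R (cotor R 0 0) (regular_module R)"
proof (rule module_iso_trans[OF cotor_cyclic module_iso_quotient_zero[OF regular_module]])
  show "\<one>\<^bsub>Q\<^esub> \<in> E 0 0" by (rule E_one)
  show "dQ 0 \<one>\<^bsub>Q\<^esub> = \<zero>\<^bsub>Q\<^esub>" by (simp add: dQ_one)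
  show "\<exists>a\<in>carrier R. \<exists>b\<in>BE 0 0. q = a \<odot>\<^bsub>Q\<^esub> \<one>\<^bsub>Q\<^esub> \<oplus>\<^bsub>Q\<^esub> b" if q: "q \<in> E 0 0" for q
  proof -
    obtain a where "a \<in> carrier R" "q = un a" using q by (rule E0_cases)
    then show ?thesis by (intro bexI[of _ a] bexI[of _ "\<zero>\<^bsub>Q\<^esub>"]) (simp_all add: BE_simps)
  qed
  show "{\<zero>\<^bsub>regular_module R\<^esub>} \<subseteq> carrier R" by simp
  show "un a \<in> BE 0 0 \<longleftrightarrow> a \<in> {\<zero>\<^bsub>regular_module R\<^esub>}" if "a \<in> carrier R" for a
    using un_inj[OF that] by (auto simp: BE_simps)
qed

lemma cotor_0: "zero_module R (cotor R (Suc s) 0)"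
proof (rule cotor_zero)
  fix q assume "q \<in> E 0 (Suc s)" "dQ (Suc s) q = \<zero>\<^bsub>Q\<^esub>"
  then obtain y where "y \<in> E 0 s" "q = dQ s y" using exact_deg0 by blast
  then show "q \<in> BE 0 (Suc s)" by (simp add: BE_simps)
qed

lemma I2_closed: "I2 R \<subseteq> carrier R"
  by (rule additive_subgroup.a_subset[OF ideal.axioms(1)[OF I2_ideal]])

lemma cotor_1_2: "module_iso R (cotor R 1 2) (quotient_module (regular_module R) (I2 R))"
proof (rule cotor_cyclic)
  show "qt 0 \<in> E 2 1" by (rule E_qt) simp
  show "dQ 1 (qt 0) = \<zero>\<^bsub>Q\<^esub>" using dQ_qt[of 0] by simp
  show "\<exists>a\<in>carrier R. \<exists>b\<in>BE 2 1. q = a \<odot>\<^bsub>Q\<^esub> qt 0 \<oplus>\<^bsub>Q\<^esub> b" if q: "q \<in> E 2 1" "dQ 1 q = \<zero>\<^bsub>Q\<^esub>" for q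
  proof -
    obtain y a where ya: "y \<in> E 2 0" "a \<in> carrier R" "q = dQ 0 y \<oplus>\<^bsub>Q\<^esub> a \<odot>\<^bsub>Q\<^esub> qt 0"
      using q unfolding One_nat_def by (rule exact_deg2_one)
    have "q = a \<odot>\<^bsub>Q\<^esub> qt 0 \<oplus>\<^bsub>Q\<^esub> dQ 0 y"
      using ya E_closed[OF E_dQ[OF ya(1)]] by (simp add: Q.a_comm)
    moreover have "dQ 0 y \<in> BE 2 1" using ya(1) by (simp add: BE_simps)
    ultimately show ?thesis using ya(2) by (intro bexI)
  qed
  show "a \<odot>\<^bsub>Q\<^esub> qt 0 \<in> BE 2 1 \<longleftrightarrow> a \<in> I2 R" if "a \<in> carrier R" for a
    using qt0_boundary[OF that] by (simp add: BE_simps)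
qed (rule I2_closed)

lemma cotor_2:
  assumes "s \<noteq> 1" shows "zero_module R (cotor R s 2)"
proof (rule cotor_zero)
  fix q assume q: "q \<in> E 2 s" "dQ s q = \<zero>\<^bsub>Q\<^esub>"
  consider "s = 0" | k where "s = Suc (Suc k)" using assms by (metis One_nat_def not0_implies_Suc)
  then show "q \<in> BE 2 s"
  proof cases
    case 1
    show ?thesis using deg2_zero q unfolding 1 BE_simps by simp
  next
    case (2 k)
    obtain y where "y \<in> E 2 (Suc k)" "q = dQ (Suc k) y" using exact_deg2[of q k] q unfolding 2 by blast
    then show ?thesis unfolding 2 BE_simps by simp
  qed
qed

lemma cotor_1_4:
  "module_iso R (cotor R 1 4) (quotient_module (regular_module R) (ideal_prod R (I2 R) (I2 R)))"
proof (rule cotor_cyclic[OF E_boundary_class boundary_class_cocycle])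
  show "\<exists>a\<in>carrier R. \<exists>b\<in>BE 4 1. q = a \<odot>\<^bsub>Q\<^esub> boundary_class \<oplus>\<^bsub>Q\<^esub> b"
    if q: "q \<in> E 4 1" "dQ 1 q = \<zero>\<^bsub>Q\<^esub>" for q
  proof -
    obtain a where a: "a \<in> carrier R" "\<exists>y\<in>E 4 0. q = a \<odot>\<^bsub>Q\<^esub> boundary_class \<oplus>\<^bsub>Q\<^esub> dQ 0 y"
      using deg4_one[OF q] by (rule bexE)
    obtain y where y: "y \<in> E 4 0" "q = a \<odot>\<^bsub>Q\<^esub> boundary_class \<oplus>\<^bsub>Q\<^esub> dQ 0 y" using a(2) by (rule bexE)
    have "dQ 0 y \<in> BE 4 1" using y(1) by (simp add: BE_simps)
    with y(2) a(1) show ?thesis by (intro bexI)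
  qed
  show "ideal_prod R (I2 R) (I2 R) \<subseteq> carrier R"
    by (rule additive_subgroup.a_subset[OF ideal.axioms(1)[OF ideal_prod_is_ideal[OF I2_ideal I2_ideal]]])
  show "a \<odot>\<^bsub>Q\<^esub> boundary_class \<in> BE 4 1 \<longleftrightarrow> a \<in> ideal_prod R (I2 R) (I2 R)" if "a \<in> carrier R" for a
    using boundary_class_boundary[OF that] by (simp add: BE_simps)
qed

lemma cotor_2_4: "module_iso R (cotor R 2 4) (quotient_module (regular_module R) (I2 R))"
proof (rule cotor_cyclic[OF E_qt10 qt10_cocycle])
  have BE: "BE 4 2 = dQ 1 ` E 4 1" using BE_simps(2)[of 4 1] by (simp add: numeral_2_eq_2)
  show "\<exists>a\<in>carrier R. \<exists>b\<in>BE 4 2. q = a \<odot>\<^bsub>Q\<^esub> (qt 1 \<otimes>\<^bsub>Q\<^esub> qt 0) \<oplus>\<^bsub>Q\<^esub> b"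
    if q: "q \<in> E 4 2" "dQ 2 q = \<zero>\<^bsub>Q\<^esub>" for q
  proof -
    obtain a where a: "a \<in> carrier R" "\<exists>y\<in>E 4 1. q = a \<odot>\<^bsub>Q\<^esub> (qt 1 \<otimes>\<^bsub>Q\<^esub> qt 0) \<oplus>\<^bsub>Q\<^esub> dQ 1 y"
      using deg4_two[OF q] by (rule bexE)
    obtain y where y: "y \<in> E 4 1" "q = a \<odot>\<^bsub>Q\<^esub> (qt 1 \<otimes>\<^bsub>Q\<^esub> qt 0) \<oplus>\<^bsub>Q\<^esub> dQ 1 y" using a(2) by (rule bexE)
    have "dQ 1 y \<in> BE 4 2" using y(1) unfolding BE by (rule imageI)
    with y(2) a(1) show ?thesis by (intro bexI)
  qed
  show "a \<odot>\<^bsub>Q\<^esub> (qt 1 \<otimes>\<^bsub>Q\<^esub> qt 0) \<in> BE 4 2 \<longleftrightarrow> a \<in> I2 R" if "a \<in> carrier R" for a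
    unfolding BE by (rule qt10_boundary[OF that])
qed (rule I2_closed)

lemma cotor_4: "zero_module R (cotor R (Suc (Suc (Suc k))) 4)"
proof (rule cotor_zero)
  fix q assume q: "q \<in> E 4 (Suc (Suc (Suc k)))" "dQ (Suc (Suc (Suc k))) q = \<zero>\<^bsub>Q\<^esub>"
  obtain y where y: "y \<in> E 4 (Suc (Suc k))" "q = dQ (Suc (Suc k)) y" using exact_deg4[OF q] by (rule bexE)
  show "q \<in> BE 4 (Suc (Suc (Suc k)))" unfolding BE_simps using y(2,1) by (rule image_eqI)
qed

section \<open>The delta-invariant inside \<open>LA\<close>\<close>

abbreviation (input) "IM \<equiv> (regular_module R)\<lparr>carrier := I2 R\<rparr>"
abbreviation (input) "SI \<equiv> sym_algebra R IM"

lemma IM_module: "module R IM"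
proof (rule submodule.submodule_is_module[OF _ regular_module])
  show "submodule (I2 R) R (regular_module R)"
    unfolding phi_image[symmetric] by (rule linear_image_submodule[OF Dr_module regular_module phi_linear])
qed

definition "phinv = inv_into (carrier (Dr R)) phi"

lemma phinv:
  assumes "a \<in> I2 R" shows "phinv a \<in> carrier (Dr R)" "phi (phinv a) = a"
proof -
  have "a \<in> phi ` carrier (Dr R)" unfolding phi_image by fact
  then show "phinv a \<in> carrier (Dr R)" "phi (phinv a) = a"
    unfolding phinv_def by (rule inv_into_into, rule f_inv_into_f)
qed

lemma phinv_phi: "x \<in> carrier (Dr R) \<Longrightarrow> phinv (phi x) = x"
proof (rule phi_eqD)
  assume x: "x \<in> carrier (Dr R)"
  then have "phi x \<in> I2 R" unfolding phi_image[symmetric] by (rule imageI)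
  from phinv[OF this] show "phinv (phi x) \<in> carrier (Dr R)" "phi (phinv (phi x)) = phi x" .
qed

lemma phi_mem_I2: "x \<in> carrier (Dr R) \<Longrightarrow> phi x \<in> I2 R"
  unfolding phi_image[symmetric] by (rule imageI)

lemma phi_IM_linear: "phi \<in> linear_maps R (Dr R) IM"
  by (rule linear_mapsI) (simp_all add: phi_mem_I2)

lemma phinv_linear: "phinv \<in> linear_maps R IM (Dr R)"
proof (rule linear_mapsI)
  fix a b assume "a \<in> carrier IM" "b \<in> carrier IM"
  then have ab: "a \<in> I2 R" "b \<in> I2 R" by simp_all
  have "phinv (a \<oplus> b) = phinv (phi (phinv a \<oplus>\<^bsub>Dr R\<^esub> phinv b))" using phinv[OF ab(1)] phinv[OF ab(2)] by simp
  also have "\<dots> = phinv a \<oplus>\<^bsub>Dr R\<^esub> phinv b"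
    by (rule phinv_phi[OF D.a_closed[OF phinv(1)[OF ab(1)] phinv(1)[OF ab(2)]]])
  finally show "phinv (a \<oplus>\<^bsub>IM\<^esub> b) = phinv a \<oplus>\<^bsub>Dr R\<^esub> phinv b" by simp
next
  fix c a assume "c \<in> carrier R" "a \<in> carrier IM"
  then have c: "c \<in> carrier R" and a: "a \<in> I2 R" by simp_all
  have "phinv (c \<otimes> a) = phinv (phi (c \<odot>\<^bsub>Dr R\<^esub> phinv a))" using phinv[OF a] c by simp
  also have "\<dots> = c \<odot>\<^bsub>Dr R\<^esub> phinv a" by (rule phinv_phi[OF D.smult_closed[OF c phinv(1)[OF a]]])
  finally show "phinv (c \<odot>\<^bsub>IM\<^esub> a) = c \<odot>\<^bsub>Dr R\<^esub> phinv a" by simp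
qed (simp add: phinv)

lemmas SI_algebra = sym_algebra_algebra[OF IM_module]

text \<open>The delta-invariant lives in the symmetric algebra of \<open>I2 R\<close>, the
  cohomology in that of \<open>Dr\<close>. Since \<open>phi\<close> is an isomorphism between the
  two modules, \<open>sigma\<close> and \<open>rho\<close> are mutually inverse graded algebra maps
  between the two rings.\<close>

definition "sigma = sym_lift R (LA R) (\<lambda>a. iota (phinv a))"
definition "rho = sym_lift R SI (\<lambda>x. sym_incl R IM (phi x))"

lemmas sigma_lin = linear_maps_comp[OF phinv_linear iota_linear]
lemmas rho_lin = linear_maps_comp[OF phi_IM_linear sym_incl_linear[OF IM_module]]

lemma sigma_map: "sigma \<in> algebra_maps R SI (LA R)"
  unfolding sigma_def by (rule sym_lift_map[OF IM_module LA_algebra sigma_lin])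

lemma sigma_incl: "a \<in> I2 R \<Longrightarrow> sigma (sym_incl R IM a) = iota (phinv a)"
  unfolding sigma_def by (rule sym_lift_incl[OF IM_module LA_algebra sigma_lin]) simp

lemma rho_map: "rho \<in> algebra_maps R (LA R) SI"
  unfolding rho_def by (rule LA_lift_map[OF SI_algebra rho_lin])

lemma rho_iota: "x \<in> carrier (Dr R) \<Longrightarrow> rho (iota x) = sym_incl R IM (phi x)"
  unfolding rho_def by (rule LA_lift_incl[OF SI_algebra rho_lin])

lemma id_algebra_map: "(\<lambda>X. X) \<in> algebra_maps R M M"
  by (intro algebra_mapsI linear_mapsI) simp_all

lemma rho_sigma:
  assumes "X \<in> carrier SI" shows "rho (sigma X) = X"
proof (rule sym_maps_eq[OF IM_module SI_algebra algebra_maps_comp[OF sigma_map rho_map] id_algebra_map _ assms])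
  fix a assume "a \<in> carrier IM"
  then have "a \<in> I2 R" by simp
  then show "rho (sigma (sym_incl R IM a)) = sym_incl R IM a" by (simp add: sigma_incl rho_iota phinv)
qed

lemma sigma_rho:
  assumes "l \<in> carrier (LA R)" shows "sigma (rho l) = l"
proof (rule LA_maps_eq[OF LA_algebra algebra_maps_comp[OF rho_map sigma_map] id_algebra_map _ assms])
  fix x assume "x \<in> carrier (Dr R)"
  then show "sigma (rho (iota x)) = iota x" by (simp add: sigma_incl rho_iota phi_mem_I2 phinv_phi)
qed

lemma sigma_deg: "X \<in> sym_power R IM k \<Longrightarrow> sigma X \<in> sym_power R (Dr R) k"
  unfolding sigma_def
proof (rule sym_power_lift_mem[OF IM_module LA_algebra sigma_lin])
  show "submodule (sym_power R (Dr R) k) R (LA R)" for k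
    unfolding LA_def by (rule sym_power_submodule[OF Dr_module])
  show "\<one>\<^bsub>LA R\<^esub> \<in> sym_power R (Dr R) 0" unfolding LA_def by (rule sym_power_one[OF Dr_module])
  show "iota (phinv a) \<in> sym_power R (Dr R) (Suc 0)" if "a \<in> carrier IM" for a
    using sym_power_incl[OF Dr_module phinv(1)] that by simp
  show "x \<otimes>\<^bsub>LA R\<^esub> y \<in> sym_power R (Dr R) (k + m)"
    if "x \<in> sym_power R (Dr R) k" "y \<in> sym_power R (Dr R) m" for k m x y
    unfolding LA_def using that by (rule sym_power_mult[OF Dr_module])
qed

lemma rho_deg: "l \<in> sym_power R (Dr R) k \<Longrightarrow> rho l \<in> sym_power R IM k"
  unfolding rho_def
proof (rule sym_power_lift_mem[OF Dr_module SI_algebra rho_lin])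
  show "submodule (sym_power R IM k) R SI" for k by (rule sym_power_submodule[OF IM_module])
  show "\<one>\<^bsub>SI\<^esub> \<in> sym_power R IM 0" by (rule sym_power_one[OF IM_module])
  show "sym_incl R IM (phi x) \<in> sym_power R IM (Suc 0)" if "x \<in> carrier (Dr R)" for x
    using sym_power_incl[OF IM_module] phi_mem_I2[OF that] by simp
  show "x \<otimes>\<^bsub>SI\<^esub> y \<in> sym_power R IM (k + m)"
    if "x \<in> sym_power R IM k" "y \<in> sym_power R IM m" for k m x y
    using that by (rule sym_power_mult[OF IM_module])
qed

abbreviation (input) "mult_I \<equiv> sym_lift R (regular_module R) (\<lambda>x. x)"

lemma incl_IM_linear: "(\<lambda>x. x) \<in> linear_maps R IM (regular_module R)"
  by (rule linear_mapsI) (simp_all add: I2_closed[THEN subsetD])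

lemmas mult_I_map = sym_lift_map[OF IM_module regular_module_algebra[OF is_cring] incl_IM_linear]

text \<open>Both are algebra maps that send the generator of an element of \<open>I2 R\<close> to
  that element. So \<open>sigma\<close> matches the kernel defining the delta-invariant with the
  kernel of \<open>mu\<close> in degree 4.\<close>

lemma mu_sigma:
  assumes X: "X \<in> carrier SI" shows "mu (sigma X) = mult_I X"
proof (rule sym_maps_eq[OF IM_module regular_module_algebra[OF is_cring]
      algebra_maps_comp[OF sigma_map mu_map] mult_I_map _ X])
  fix a assume "a \<in> carrier IM"
  then have a: "a \<in> I2 R" by simp
  have "mult_I (sym_incl R IM a) = a"
    by (rule sym_lift_incl[OF IM_module regular_module_algebra[OF is_cring] incl_IM_linear]) (simp add: a)
  then show "mu (sigma (sym_incl R IM a)) = mult_I (sym_incl R IM a)"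
    by (simp add: sigma_incl a mu_simps phinv)
qed

lemma sym_power_closed: "X \<in> sym_power R IM k \<Longrightarrow> X \<in> carrier SI"
  by (rule subsetD[OF module.submoduleE(1)[OF algebra.axioms(1)[OF SI_algebra] sym_power_submodule[OF IM_module]]])

lemma delta_eq: "delta_invariant R (I2 R) = SI\<lparr>carrier := {X \<in> sym_power R IM 2. mult_I X = \<zero>}\<rparr>"
  by (simp only: delta_invariant_def Let_def)

lemma delta_module: "module R (delta_invariant R (I2 R))"
proof -
  have "module R (SI\<lparr>carrier := {X \<in> sym_power R IM 2. mult_I X = \<zero>\<^bsub>regular_module R\<^esub>}\<rparr>)"
  proof (rule restricted_kernel_module[OF algebra.axioms(1)[OF SI_algebra] regular_module sym_power_submodule[OF IM_module]])
    show "mult_I \<in> linear_maps R (SI\<lparr>carrier := sym_power R IM 2\<rparr>) (regular_module R)"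
      using algebra_mapsD(2)[OF mult_I_map]
      by (intro linear_mapsI) (simp_all add: sym_power_closed algebra_mapsD(3,4)[OF mult_I_map])
  qed
  then show ?thesis unfolding delta_eq by simp
qed

lemma qc_inj: "l \<in> carrier (LA R) \<Longrightarrow> qc l = \<zero>\<^bsub>Q\<^esub> \<Longrightarrow> l = \<zero>\<^bsub>LA R\<^esub>"
  using qc_apply[of l "{#}"] Q_zero_apply[of "{#}"] by simp

lemma delta_carrier:
  "X \<in> carrier (delta_invariant R (I2 R)) \<longleftrightarrow> X \<in> sym_power R IM 2 \<and> mult_I X = \<zero>"
  unfolding delta_eq by simp

lemma sigma_delta:
  assumes "X \<in> carrier (delta_invariant R (I2 R))"
  shows "X \<in> carrier SI" "sigma X \<in> L_deg R 4" "mu (sigma X) = \<zero>"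
proof -
  have X: "X \<in> sym_power R IM 2" "mult_I X = \<zero>" using assms unfolding delta_carrier by simp_all
  show Xc: "X \<in> carrier SI" by (rule sym_power_closed[OF X(1)])
  show "sigma X \<in> L_deg R 4" using sigma_deg[OF X(1)] by (simp add: L_deg_def)
  show "mu (sigma X) = \<zero>" unfolding mu_sigma[OF Xc] by (rule X(2))
qed

text \<open>A constant \<open>z\<close> of degree 4 has differential \<open>mu z\<close> times
  \<open>boundary_class\<close>, and no nonzero scalar kills that class, so the cocycles are the
  kernel of \<open>mu\<close>. In place 0 only zero is a coboundary, and \<open>sigma\<close>
  supplies the representatives.\<close>

lemma cotor_0_4: "module_iso R (cotor R 0 4) (delta_invariant R (I2 R))"
proof -
  let ?D = "delta_invariant R (I2 R)"
  interpret D': module R ?D by (rule delta_module)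
  interpret S: algebra R SI by (rule SI_algebra)
  note sc = algebra_mapsD[OF sigma_map] and cc = algebra_mapsD[OF qc_map]
  have "module_iso R (cotor R 0 4) (quotient_module ?D {\<zero>\<^bsub>?D\<^esub>})"
  proof (rule cotor_iso[OF delta_module])
    show "(\<lambda>X. qc (sigma X)) \<in> linear_maps R ?D Q"
    proof (rule linear_mapsI)
      fix X assume "X \<in> carrier ?D"
      note Xc = sigma_delta(1)[OF this]
      show "qc (sigma X) \<in> carrier Q" by (rule cc(2)[OF sc(2)[OF Xc]])
    next
      fix X Y assume X: "X \<in> carrier ?D" and Y: "Y \<in> carrier ?D"
      note Xc = sigma_delta(1)[OF X] sigma_delta(1)[OF Y]
      have "qc (sigma (X \<oplus>\<^bsub>SI\<^esub> Y)) = qc (sigma X) \<oplus>\<^bsub>Q\<^esub> qc (sigma Y)"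
        unfolding sc(3)[OF Xc] by (rule cc(3)[OF sc(2)[OF Xc(1)] sc(2)[OF Xc(2)]])
      then show "qc (sigma (X \<oplus>\<^bsub>?D\<^esub> Y)) = qc (sigma X) \<oplus>\<^bsub>Q\<^esub> qc (sigma Y)" unfolding delta_eq by simp
    next
      fix a X assume a: "a \<in> carrier R" and X: "X \<in> carrier ?D"
      note Xc = sigma_delta(1)[OF X]
      have "qc (sigma (a \<odot>\<^bsub>SI\<^esub> X)) = a \<odot>\<^bsub>Q\<^esub> qc (sigma X)"
        unfolding sc(4)[OF a Xc] by (rule cc(4)[OF a sc(2)[OF Xc]])
      then show "qc (sigma (a \<odot>\<^bsub>?D\<^esub> X)) = a \<odot>\<^bsub>Q\<^esub> qc (sigma X)" unfolding delta_eq by simp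
    qed
    show "qc (sigma X) \<in> E 4 0" if "X \<in> carrier ?D" for X by (rule E_qc[OF sigma_delta(2)[OF that]])
    show "dQ 0 (qc (sigma X)) = \<zero>\<^bsub>Q\<^esub>" if "X \<in> carrier ?D" for X
      unfolding dQ0_deg4[OF sigma_delta(2)[OF that]] sigma_delta(3)[OF that] by simp
    show "\<exists>X\<in>carrier ?D. \<exists>b\<in>BE 4 0. q = qc (sigma X) \<oplus>\<^bsub>Q\<^esub> b" if q: "q \<in> E 4 0" "dQ 0 q = \<zero>\<^bsub>Q\<^esub>" for q
    proof -
      obtain z where z: "z \<in> L_deg R 4" "q = qc z" using q(1) by (rule E_zero_vars)
      note zc = L_deg_closed[OF z(1)]
      have m0: "mu z = \<zero>"
        by (rule smult_boundary_inj[OF mu_simps(1)[OF zc]]) (use q(2) in \<open>simp add: z(2) dQ0_deg4[OF z(1)]\<close>)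
      have "z \<in> sym_power R (Dr R) 2" using z(1) by (simp add: L_deg_def)
      note r = rho_deg[OF this]
      have "rho z \<in> carrier ?D"
        unfolding delta_carrier mu_sigma[OF sym_power_closed[OF r], symmetric] sigma_rho[OF zc] by (intro conjI r m0)
      moreover have "q = qc (sigma (rho z)) \<oplus>\<^bsub>Q\<^esub> \<zero>\<^bsub>Q\<^esub>"
        unfolding sigma_rho[OF zc] z(2) using cc(2)[OF zc] by simp
      ultimately show ?thesis unfolding BE_simps by (intro bexI[of _ "rho z"] bexI[of _ "\<zero>\<^bsub>Q\<^esub>"] singletonI)
    qed
    show "{\<zero>\<^bsub>?D\<^esub>} = {X \<in> carrier ?D. qc (sigma X) \<in> BE 4 0}"
    proof (intro equalityI subsetI)
      fix X assume "X \<in> {\<zero>\<^bsub>?D\<^esub>}"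
      then have X: "X = \<zero>\<^bsub>?D\<^esub>" by simp
      have "qc (sigma \<zero>\<^bsub>SI\<^esub>) = \<zero>\<^bsub>Q\<^esub>"
        unfolding linear_map_zero[OF S.module L.module sc(1)] linear_map_zero[OF L.module Q.module cc(1)] ..
      then have "qc (sigma \<zero>\<^bsub>?D\<^esub>) = \<zero>\<^bsub>Q\<^esub>" unfolding delta_eq by simp
      then show "X \<in> {X \<in> carrier ?D. qc (sigma X) \<in> BE 4 0}" unfolding X BE_simps by simp
    next
      fix X assume "X \<in> {X \<in> carrier ?D. qc (sigma X) \<in> BE 4 0}"
      then have X: "X \<in> carrier ?D" "qc (sigma X) = \<zero>\<^bsub>Q\<^esub>" unfolding BE_simps by simp_all
      have "sigma X = \<zero>\<^bsub>LA R\<^esub>" by (rule qc_inj[OF L_deg_closed[OF sigma_delta(2)[OF X(1)]] X(2)])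
      then have "rho (sigma X) = \<zero>\<^bsub>SI\<^esub>"
        using linear_map_zero[OF L.module S.module algebra_mapsD(1)[OF rho_map]] by simp
      then have "X = \<zero>\<^bsub>SI\<^esub>" unfolding rho_sigma[OF sigma_delta(1)[OF X(1)]] .
      then show "X \<in> {\<zero>\<^bsub>?D\<^esub>}" unfolding delta_eq by simp
    qed
  qed
  then show ?thesis by (rule module_iso_trans[OF _ module_iso_quotient_zero[OF delta_module]])
qed

end

theorem theorem5p7:
  fixes A :: "('a, 'm) ring_scheme"
  assumes "cring A" and "noetherian_ring A" and "torsion_free_ring A"
  shows
    "module_iso A (flat_cohomology A 0 0) (regular_module A)
   \<and> (\<forall>s. s \<noteq> 0 \<longrightarrow> zero_module A (flat_cohomology A s 0))
   \<and> module_iso A (flat_cohomology A 1 1) (quotient_module (regular_module A) (I2 A))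
   \<and> (\<forall>s. s \<noteq> 1 \<longrightarrow> zero_module A (flat_cohomology A s 1))
   \<and> module_iso A (flat_cohomology A 0 2) (delta_invariant A (I2 A))
   \<and> module_iso A (flat_cohomology A 1 2)
        (quotient_module (regular_module A) (ideal_prod A (I2 A) (I2 A)))
   \<and> module_iso A (flat_cohomology A 2 2) (quotient_module (regular_module A) (I2 A))
   \<and> (\<forall>s. s \<notin> {0, 1, 2} \<longrightarrow> zero_module A (flat_cohomology A s 2))"
proof -
  interpret cring A by (rule assms(1))
  have n: "flat_cohomology A s 0 = cotor A s 0" "flat_cohomology A s 1 = cotor A s 2"
    "flat_cohomology A s 2 = cotor A s 4" for s by (simp_all add: flat_cohomology_def)
  have z0: "zero_module A (cotor A s 0)" if "s \<noteq> 0" for s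
    using cotor_0[of "s - 1"] that by simp
  have "s = Suc (Suc (Suc (s - 3)))" if "s \<notin> {0, 1, 2}" for s :: nat using that by auto
  then have z4: "zero_module A (cotor A s 4)" if "s \<notin> {0, 1, 2}" for s
    using cotor_4[of "s - 3"] that by metis
  show ?thesis
    unfolding n using z0 z4 by (intro conjI allI impI cotor_0_0 cotor_1_2 cotor_2 cotor_0_4 cotor_1_4 cotor_2_4)
qed

end
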